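(* For all $\nu\in\mathbb{R}^3$ and all $\zeta=(\zeta_1,\zeta_2,\zeta_3)\in\mathbb{R}^3$, $$\varphi_{\mathrm{HCP}}(\nu)=\sqrt2\left(|\langle e_1,\nu\rangle|+|\langle e_2,\nu\rangle|+|\langle e_1-e_2,\nu\rangle|\right)+\frac1{\sqrt2}|\langle e_3,\nu\rangle|+\sqrt2\max\left\{|\langle e_1,\nu\rangle|,|\langle e_2,\nu\rangle|,|\langle e_3,\nu\rangle|,|\langle e_1-e_2,\nu\rangle|\right\}$$ and $$\varphi_{\mathrm{HCP}}^\circ(\zeta)=\max\Big\{\frac2{7\sqrt2}\Big(|\zeta_1|+\frac1{\sqrt3}|\zeta_2|+\frac3{2\sqrt6}|\zeta_3|\Big),\ \frac1{2\sqrt3}|\zeta_3|,\ \frac2{3\sqrt6}|\zeta_2|,\ \frac4{7\sqrt6}|\zeta_2|+\frac3{14\sqrt3}|\zeta_3|,\ \frac1{3\sqrt2}\Big(|\zeta_1|+\frac1{\sqrt3}|\zeta_2|\Big)\Big\}.$$ In particular, $W_{\mathrm{HCP}}$ is a truncated elongated hexagonal bipyramid and its surface energy per unit volume is $$|W_{\mathrm{HCP}}|^{-2/3}\int_{\partial^*W_{\mathrm{HCP}}}\varphi_{\mathrm{HCP}}(\nu)\,d\mathcal{H}^2=3\cdot2^{2/3}\cdot65^{1/3}.$$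
   Context: $e_1=(1,0,0)$, $e_2=\frac12(1,\sqrt3,0)$, $e_3=\frac23\sqrt6(0,0,1)$, $v_1=\frac13(e_1+e_2)+\frac12e_3$, and $\mathcal{L}=\mathcal{L}_{\mathrm{HCP}}=\mathrm{span}_{\mathbb{Z}}\{e_1,e_2,e_3\}\cup(v_1+\mathrm{span}_{\mathbb{Z}}\{e_1,e_2,e_3\})$. For $x\in\mathcal{L}$, $\mathcal{N}(x)=\{y\in\mathcal{L}\colon|x-y|=1\}$ (it always has 12 elements). For $X\subset\mathcal{L}$, $A\subset\mathbb{R}^3$, let $E_{\mathcal{L}}(X,A)=\sum_{x\in X\cap A}(12-\#(\mathcal{N}(x)\cap X))$. For $\nu\in\mathbb{S}^2$ let $Q^\nu_T$ be an open cube of side $T$ centered at the origin with faces parallel and orthogonal to $\nu$, and $u_\nu(x)=1$ if $\langle x,\nu\rangle\ge0$, $u_\nu(x)=0$ otherwise. $\varphi_{\mathrm{HCP}}\colon\mathbb{R}^3\to[0,+\infty)$ is the convex, positively 1-homogeneous function such that for $\nu\in\mathbb{S}^2$ $$\varphi_{\mathrm{HCP}}(\nu)=\lim_{T\to+\infty}\frac1{T^2}\inf\{E_{\mathcal{L}}(X,Q^\nu_T)\colon X\subset\mathcal{L},\ \chi_X(i)=u_\nu(i)\text{ for }i\in\mathcal{L}\setminus Q^\nu_{T-3}\}.$$ The polar function is $\varphi^\circ(\xi)=\sup_{\nu\in\mathbb{S}^2}\langle\nu,\xi\rangle/\varphi(\nu)$ and the Wulff set is $W_{\mathrm{HCP}}=\{\zeta\in\mathbb{R}^3\colon\langle\zeta,\nu\rangle\le\varphi_{\mathrm{HCP}}(\nu)\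 \forall\nu\in\mathbb{S}^2\}=\{\varphi_{\mathrm{HCP}}^\circ\le1\}$. $\partial^*W$ is the reduced boundary and $\nu$ its outer unit normal. An elongated hexagonal bipyramid is a hexagonal prism with a hexagonal pyramid attached to each of its two bases; truncated means that the two apexes are cut off by planes parallel to the bases. *)

theory Defs
  imports "HOL-Analysis.Analysis"
begin

section \<open>The hexagonal close-packed lattice and its edge energy\<close>

definition e1 :: "real^3" where "e1 = vector [1, 0, 0]"
definition e2 :: "real^3" where "e2 = (1/2) *\<^sub>R vector [1, sqrt 3, 0]"
definition e3 :: "real^3" where "e3 = (2/3 * sqrt 6) *\<^sub>R vector [0, 0, 1]"
definition v1 :: "real^3" where "v1 = (1/3) *\<^sub>R (e1 + e2) + (1/2) *\<^sub>R e3"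

definition span_Z :: "(real^3) set" where
  "span_Z = {of_int a *\<^sub>R e1 + of_int b *\<^sub>R e2 + of_int c *\<^sub>R e3 | a b c :: int. True}"

definition HCP :: "(real^3) set" where
  "HCP = span_Z \<union> (+) v1 ` span_Z"

definition neighbours :: "real^3 \<Rightarrow> (real^3) set" where
  "neighbours x = {y \<in> HCP. dist x y = 1}"

text \<open>Used only for bounded \<open>A\<close>; then \<open>X \<inter> A\<close> is finite for every \<open>X \<subseteq> HCP\<close>.\<close>

definition edge_energy :: "(real^3) set \<Rightarrow> (real^3) set \<Rightarrow> real" where
  "edge_energy X A = (\<Sum>x\<in>X \<inter> A. 12 - real (card (neighbours x \<inter> X)))"


section \<open>The surface tension\<close>

definition half_space_fun :: "real^3 \<Rightarrow> real^3 \<Rightarrow> real" where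
  "half_space_fun \<nu> x = (if x \<bullet> \<nu> \<ge> 0 then 1 else 0)"

text \<open>
  The open cube of side \<open>T\<close> centred at the origin whose axes are the columns of the orthogonal
  matrix \<open>R\<close>. The cubes with faces parallel and orthogonal to a unit vector \<open>\<nu>\<close> are those for
  which the third column of \<open>R\<close> is \<open>\<nu>\<close> (neither the order nor the sign of the columns matters).
\<close>

definition cube :: "real^3^3 \<Rightarrow> real \<Rightarrow> (real^3) set" where
  "cube R T = (*v) R ` {y. \<forall>i. \<bar>y $ i\<bar> < T / 2}"

definition cube_frame :: "real^3 \<Rightarrow> real^3^3 \<Rightarrow> bool" where
  "cube_frame \<nu> R \<longleftrightarrow> orthogonal_matrix R \<and> R *v axis 3 1 = \<nu>"

definition admissible :: "real^3 \<Rightarrow> real^3^3 \<Rightarrow> real \<Rightarrow> (real^3) set set" where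
  "admissible \<nu> R T =
     {X. X \<subseteq> HCP \<and> (\<forall>i \<in> HCP - cube R (T - 3). indicator X i = half_space_fun \<nu> i)}"

definition cell_energy :: "real^3 \<Rightarrow> real^3^3 \<Rightarrow> real \<Rightarrow> real" where
  "cell_energy \<nu> R T = (INF X \<in> admissible \<nu> R T. edge_energy X (cube R T))"

text \<open>
  The cube attached to \<open>\<nu>\<close> is only determined up to a rotation about \<open>\<nu>\<close>;
  the limit is required for every choice of it.
\<close>

definition is_surface_tension :: "(real^3 \<Rightarrow> real) \<Rightarrow> bool" where
  "is_surface_tension \<phi> \<longleftrightarrow>
     (\<forall>\<nu>. 0 \<le> \<phi> \<nu>) \<and>
     convex_on UNIV \<phi> \<and>
     (\<forall>c>0. \<forall>\<nu>. \<phi> (c *\<^sub>R \<nu>) = c * \<phi> \<nu>) \<and>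
     (\<forall>\<nu> \<in> sphere 0 1. \<forall>R. cube_frame \<nu> R \<longrightarrow>
        ((\<lambda>T. 1 / T\<^sup>2 * cell_energy \<nu> R T) \<longlongrightarrow> \<phi> \<nu>) at_top)"

definition phi_HCP :: "real^3 \<Rightarrow> real" where
  "phi_HCP = (THE \<phi>. is_surface_tension \<phi>)"

definition polar :: "(real^3 \<Rightarrow> real) \<Rightarrow> real^3 \<Rightarrow> real" where
  "polar \<phi> \<xi> = (SUP \<nu> \<in> sphere 0 1. (\<nu> \<bullet> \<xi>) / \<phi> \<nu>)"

definition wulff_set :: "(real^3 \<Rightarrow> real) \<Rightarrow> (real^3) set" where
  "wulff_set \<phi> = {\<zeta>. \<forall>\<nu> \<in> sphere 0 1. \<zeta> \<bullet> \<nu> \<le> \<phi> \<nu>}"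

definition W_HCP :: "(real^3) set" where
  "W_HCP = wulff_set phi_HCP"


section \<open>Truncated elongated hexagonal bipyramids\<close>

definition regular_hexagon :: "real^3 \<Rightarrow> real^3 \<Rightarrow> real^3 \<Rightarrow> real \<Rightarrow> (real^3) set" where
  "regular_hexagon c a b r =
     convex hull {c + r *\<^sub>R (cos (real k * pi / 3) *\<^sub>R a + sin (real k * pi / 3) *\<^sub>R b) | k::nat. k < 6}"

definition hexagonal_prism ::
  "real^3 \<Rightarrow> real^3 \<Rightarrow> real^3 \<Rightarrow> real^3 \<Rightarrow> real \<Rightarrow> real \<Rightarrow> (real^3) set" where
  "hexagonal_prism c a b n r h = {x + t *\<^sub>R n | x t. x \<in> regular_hexagon c a b r \<and> \<bar>t\<bar> \<le> h}"

text \<open>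
  Right prism of height \<open>2 * h\<close> over a regular hexagon of circumradius \<open>r\<close>, with a right pyramid
  of height \<open>k\<close> on each base.
\<close>

definition elongated_hexagonal_bipyramid ::
  "real^3 \<Rightarrow> real^3 \<Rightarrow> real^3 \<Rightarrow> real^3 \<Rightarrow> real \<Rightarrow> real \<Rightarrow> real \<Rightarrow> (real^3) set" where
  "elongated_hexagonal_bipyramid c a b n r h k =
     hexagonal_prism c a b n r h
     \<union> convex hull (insert (c + (h + k) *\<^sub>R n) (regular_hexagon (c + h *\<^sub>R n) a b r))
     \<union> convex hull (insert (c - (h + k) *\<^sub>R n) (regular_hexagon (c - h *\<^sub>R n) a b r))"

definition truncated_elongated_hexagonal_bipyramid :: "(real^3) set \<Rightarrow> bool" where
  "truncated_elongated_hexagonal_bipyramid S \<longleftrightarrow>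
     (\<exists>c a b n r h k t.
        norm a = 1 \<and> norm b = 1 \<and> norm n = 1 \<and> a \<bullet> b = 0 \<and> a \<bullet> n = 0 \<and> b \<bullet> n = 0 \<and>
        0 < r \<and> 0 < h \<and> 0 < t \<and> t < k \<and>
        S = elongated_hexagonal_bipyramid c a b n r h k \<inter> {x. \<bar>(x - c) \<bullet> n\<bar> \<le> h + t})"


section \<open>Two-dimensional Hausdorff measure\<close>

text \<open>
  Normalised by \<open>pi / 4\<close>, so that it is the area on planes. Boundedness of the covering sets is
  required because \<^const>\<open>diameter\<close> is a supremum of reals.
\<close>

definition hausdorff2_pre :: "real \<Rightarrow> 'a::metric_space set \<Rightarrow> ennreal" where
  "hausdorff2_pre \<delta> A =
     (INF C \<in> {C :: nat \<Rightarrow> 'a set. A \<subseteq> (\<Union>i. C i) \<and> (\<forall>i. bounded (C i) \<and> diameter (C i) \<le> \<delta>)}.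
        \<Sum>i. ennreal (pi / 4 * (diameter (C i))\<^sup>2))"

definition hausdorff2 :: "'a::metric_space measure" where
  "hausdorff2 = measure_of UNIV (sets borel) (\<lambda>A. SUP \<delta> \<in> {0<..}. hausdorff2_pre \<delta> A)"


section \<open>Reduced boundary and outer unit normal\<close>

definition C1_compact_support :: "('a::euclidean_space \<Rightarrow> 'a) \<Rightarrow> bool" where
  "C1_compact_support F \<longleftrightarrow>
     (\<forall>x. F differentiable (at x)) \<and>
     (\<forall>v. continuous_on UNIV (\<lambda>x. frechet_derivative F (at x) v)) \<and>
     (\<exists>K. compact K \<and> (\<forall>x. x \<notin> K \<longrightarrow> F x = 0))"

definition divergence :: "('a::euclidean_space \<Rightarrow> 'a) \<Rightarrow> 'a \<Rightarrow> real" where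
  "divergence F x = (\<Sum>b\<in>Basis. frechet_derivative F (at x) b \<bullet> b)"

text \<open>
  The Gauss--Green measure of \<open>E\<close> (minus the distributional gradient of its indicator function),
  given by its polar decomposition: the perimeter measure \<open>\<mu>\<close> and a density \<open>\<sigma>\<close> of norm 1.
\<close>

definition gauss_green_measure ::
  "'a::euclidean_space set \<Rightarrow> 'a measure \<Rightarrow> ('a \<Rightarrow> 'a) \<Rightarrow> bool" where
  "gauss_green_measure E \<mu> \<sigma> \<longleftrightarrow>
     sets \<mu> = sets borel \<and>
     (\<forall>K. compact K \<longrightarrow> emeasure \<mu> K < \<infinity>) \<and>
     \<sigma> \<in> borel_measurable borel \<and>
     (AE x in \<mu>. norm (\<sigma> x) = 1) \<and>
     (\<forall>F. C1_compact_support F \<longrightarrow>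
        (LINT x:E|lebesgue. divergence F x) = (LINT x|\<mu>. F x \<bullet> \<sigma> x))"

text \<open>De Giorgi's definition; \<open>\<mu>\<close> and, up to null sets, \<open>\<sigma>\<close> are determined by \<open>E\<close>.\<close>

definition has_outer_normal ::
  "'a::euclidean_space set \<Rightarrow> 'a \<Rightarrow> 'a \<Rightarrow> bool" where
  "has_outer_normal E x n \<longleftrightarrow>
     (\<exists>\<mu> \<sigma>. gauss_green_measure E \<mu> \<sigma> \<and>
        (\<forall>r>0. 0 < measure \<mu> (ball x r)) \<and>
        ((\<lambda>r. (LINT y:ball x r|\<mu>. \<sigma> y) /\<^sub>R measure \<mu> (ball x r)) \<longlongrightarrow> n) (at_right 0) \<and>
        norm n = 1)"

definition reduced_boundary :: "'a::euclidean_space set \<Rightarrow> 'a set" where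
  "reduced_boundary E = {x. \<exists>n. has_outer_normal E x n}"

definition outer_normal :: "'a::euclidean_space set \<Rightarrow> 'a \<Rightarrow> 'a" where
  "outer_normal E x = (THE n. has_outer_normal E x n)"

definition surface_energy :: "('a::euclidean_space \<Rightarrow> real) \<Rightarrow> 'a set \<Rightarrow> real" where
  "surface_energy \<phi> E = (LINT x:reduced_boundary E|hausdorff2. \<phi> (outer_normal E x))"

end

(*
  The missing bonds of a configuration are counted one bond direction at a time.  Every line of lattice sites in a
  direction w with w . nu > 0 leads from outside X into X, hence contributes a missing bond; the number of such lines is
  the number of lattice points in a slab of thickness w . nu, about T^2 (w . nu) / sqrt 2.  The bonds inside the
  triangular layers give straight lines.  The six interlayer bond directions v1 + d of a site are paired up, each pair d, d'
  giving zigzag lines of period d - d'; the best of four pairings of the six directions yields the lower bound.  It is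
  attained by cutting the two sublattices by half spaces shifted relative to each other, the shift being a median of the
  six numbers d . nu.

  The polar is found by linear programming duality: every nu is an explicit combination of facet normals of the Wulff set
  along which the tension is additive.
  For the surface energy, the Gauss-Green measure of a polytope is computed facet by facet, which needs that the Hausdorff
  measure of Defs is the area on planes (isodiametric inequality); since phi(n) is the distance of the facet with normal n
  from the origin, the divergence theorem for the identity field gives surface energy = 3 * volume, and the volume is 260.
*)
theory Submission
  imports Defs
begin

section \<open>Two-dimensional Hausdorff measure\<close>

text \<open>Where the maximum in the tension comes from: the six interlayer differences can be split
  into three pairs such that two pairs differ by the same vector, one of \<open>e1\<close>,
  \<open>e2\<close>, \<open>e1 - e2\<close>, \<open>e3\<close>, and the third pair differs by
  \<open>e3\<close>. Such a pairing bounds the interlayer energy below by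
  \<open>(|e3 . nu| + 2 m) / sqrt 2\<close>, with \<open>m\<close> the height of that vector. The
  least sum of absolute deviations of the six heights is exactly the largest value of
  \<open>|e3 . nu| + 2 m\<close>, so the two bounds meet. The factor \<open>1 / sqrt 2\<close> is
  the density of one sublattice, whose cell has volume \<open>sqrt 2\<close>; in-plane lines count
  twice because there are two sublattices. Two definitions shape the rest. \<open>phi_HCP\<close> is
  a definite description, so the closed formula must have all defining properties and these must
  determine it. The outer normal refers to some Gauss-Green pair, so uniqueness of such pairs is
  established before an explicit pair is used to find the reduced boundary. Dual coordinates scaled
  by square roots make tension and gauge rational, which reduces the polyhedral facts to linear
  arithmetic.\<close>

definition hausdorff2_outer :: "'a::metric_space set \<Rightarrow> ennreal" where
  "hausdorff2_outer A = (SUP \<delta> \<in> {0<..}. hausdorff2_pre \<delta> A)"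

definition bounded_covers :: "real \<Rightarrow> 'a::metric_space set \<Rightarrow> (nat \<Rightarrow> 'a set) set" where
  "bounded_covers \<delta> A = {C. A \<subseteq> (\<Union>i. C i) \<and> (\<forall>i. bounded (C i) \<and> diameter (C i) \<le> \<delta>)}"

definition disc_sum :: "(nat \<Rightarrow> 'a::metric_space set) \<Rightarrow> ennreal" where
  "disc_sum C = (\<Sum>i. ennreal (pi / 4 * (diameter (C i))\<^sup>2))"

lemma hausdorff2_pre_eq: "hausdorff2_pre \<delta> A = (INF C \<in> bounded_covers \<delta> A. disc_sum C)"
  by (simp add: hausdorff2_pre_def bounded_covers_def disc_sum_def)

lemma hausdorff2_pre_le: "C \<in> bounded_covers \<delta> A \<Longrightarrow> hausdorff2_pre \<delta> A \<le> disc_sum C"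
  by (simp add: hausdorff2_pre_eq INF_lower)

lemma hausdorff2_pre_mono: "A \<subseteq> B \<Longrightarrow> hausdorff2_pre \<delta> A \<le> hausdorff2_pre \<delta> B"
  unfolding hausdorff2_pre_eq by (rule INF_superset_mono) (auto simp: bounded_covers_def)

lemma hausdorff2_pre_antimono: "\<delta> \<le> \<delta>' \<Longrightarrow> hausdorff2_pre \<delta>' A \<le> hausdorff2_pre \<delta> A"
  unfolding hausdorff2_pre_eq
  by (rule INF_superset_mono) (auto simp: bounded_covers_def intro: order_trans)

lemma hausdorff2_pre_le_outer: "0 < \<delta> \<Longrightarrow> hausdorff2_pre \<delta> A \<le> hausdorff2_outer A"
  unfolding hausdorff2_outer_def by (rule SUP_upper) auto

lemma hausdorff2_outer_mono: "A \<subseteq> B \<Longrightarrow> hausdorff2_outer A \<le> hausdorff2_outer B"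
  unfolding hausdorff2_outer_def by (rule SUP_mono) (auto intro!: hausdorff2_pre_mono exI)

lemma hausdorff2_outer_empty [simp]: "hausdorff2_outer {} = 0"
proof -
  have "hausdorff2_pre \<delta> ({}::'a set) \<le> 0" if "0 < \<delta>" for \<delta>
    using hausdorff2_pre_le[of "\<lambda>i. {}" \<delta> "{}::'a set"] that
    by (auto simp: bounded_covers_def disc_sum_def)
  then show ?thesis
    unfolding hausdorff2_outer_def by (simp add: SUP_eq_const)
qed

text \<open>Near-optimal covers of the \<open>A i\<close>, with excess \<open>e / 2^(i + 1)\<close>,
  are merged into one sequence by the pairing function of the naturals.\<close>

lemma hausdorff2_pre_countably_subadditive:
  "hausdorff2_pre \<delta> (\<Union>i. A i) \<le> (\<Sum>i. hausdorff2_pre \<delta> (A i))"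
proof (rule ennreal_le_epsilon)
  fix e :: real assume fin: "(\<Sum>i. hausdorff2_pre \<delta> (A i)) < top" and e: "0 < e"
  have "\<exists>C. C \<in> bounded_covers \<delta> (A i) \<and> disc_sum C \<le> hausdorff2_pre \<delta> (A i) + ennreal (e * (1/2)^Suc i)" for i
  proof -
    have "hausdorff2_pre \<delta> (A i) < top"
      using ennreal_suminf_lessD[OF fin] .
    moreover have "0 < ennreal (e * (1/2)^Suc i)" using e by simp
    ultimately have "hausdorff2_pre \<delta> (A i) < hausdorff2_pre \<delta> (A i) + ennreal (e * (1/2)^Suc i)"
      by (simp add: ennreal_add_left_cancel_less)
    then have "(INF C \<in> bounded_covers \<delta> (A i). disc_sum C) < hausdorff2_pre \<delta> (A i) + ennreal (e * (1/2)^Suc i)"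
      by (subst (asm) (1) hausdorff2_pre_eq)
    then show ?thesis unfolding INF_less_iff by (meson less_imp_le)
  qed
  then obtain C where C: "\<And>i. C i \<in> bounded_covers \<delta> (A i)"
    "\<And>i. disc_sum (C i) \<le> hausdorff2_pre \<delta> (A i) + ennreal (e * (1/2)^Suc i)"
    by metis
  define D where "D n = (case prod_decode n of (i, j) \<Rightarrow> C i j)" for n
  have "D \<in> bounded_covers \<delta> (\<Union>i. A i)"
  proof -
    have "A i \<subseteq> (\<Union>n. D n)" for i
    proof
      fix x assume "x \<in> A i"
      then obtain j where "x \<in> C i j" using C(1)[of i] by (auto simp: bounded_covers_def)
      then have "x \<in> D (prod_encode (i, j))" by (simp add: D_def)
      then show "x \<in> (\<Union>n. D n)" by blast
    qed
    then show ?thesis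
      using C(1) by (auto simp: bounded_covers_def D_def split: prod.split)
  qed
  then have "hausdorff2_pre \<delta> (\<Union>i. A i) \<le> disc_sum D" by (rule hausdorff2_pre_le)
  also have "disc_sum D = (\<Sum>i. (\<lambda>(i,j). ennreal (pi / 4 * (diameter (C i j))\<^sup>2)) (prod_decode i))"
    unfolding disc_sum_def D_def by (rule arg_cong[where f=suminf]) (auto split: prod.split)
  also have "\<dots> = (\<Sum>i. disc_sum (C i))"
    by (rule suminf_ennreal_2dimen) (simp add: disc_sum_def)
  also have "\<dots> \<le> (\<Sum>i. hausdorff2_pre \<delta> (A i) + ennreal (e * (1/2)^Suc i))"
    by (intro suminf_le C) auto
  also have "\<dots> = (\<Sum>i. hausdorff2_pre \<delta> (A i)) + (\<Sum>i. ennreal (e * (1/2)^Suc i))"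
    by (subst suminf_add[symmetric]) auto
  also have "(\<Sum>i. ennreal (e * (1/2)^Suc i)) = ennreal e"
    using sums_mult[OF power_half_series, of e] e
    by (intro sums_unique[symmetric]) simp
  finally show "hausdorff2_pre \<delta> (\<Union>i. A i) \<le> (\<Sum>i. hausdorff2_pre \<delta> (A i)) + ennreal e" .
qed

lemma hausdorff2_outer_countably_subadditive:
  "hausdorff2_outer (\<Union>i. A i) \<le> (\<Sum>i. hausdorff2_outer (A i))"
  unfolding hausdorff2_outer_def[of "\<Union>i. A i"]
proof (rule SUP_least)
  fix \<delta> :: real assume "\<delta> \<in> {0<..}"
  then show "hausdorff2_pre \<delta> (\<Union>i. A i) \<le> (\<Sum>i. hausdorff2_outer (A i))"
    by (intro order_trans[OF hausdorff2_pre_countably_subadditive] suminf_le hausdorff2_pre_le_outer) auto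
qed

lemma hausdorff2_outer_Un_le: "hausdorff2_outer (A \<union> B) \<le> hausdorff2_outer A + hausdorff2_outer B"
proof -
  have "hausdorff2_outer (\<Union>i. case i of 0 \<Rightarrow> A | Suc 0 \<Rightarrow> B | _ \<Rightarrow> {}) \<le>
      (\<Sum>i. hausdorff2_outer (case i of 0 \<Rightarrow> A | Suc 0 \<Rightarrow> B | _ \<Rightarrow> {}))"
    by (rule hausdorff2_outer_countably_subadditive)
  also have "(\<Union>i. case i of 0 \<Rightarrow> A | Suc 0 \<Rightarrow> B | _ \<Rightarrow> {}) = A \<union> B"
    by (auto split: nat.splits)
  also have "(\<Sum>i. hausdorff2_outer (case i of 0 \<Rightarrow> A | Suc 0 \<Rightarrow> B | _ \<Rightarrow> {})) =
     (\<Sum>i\<in>{0,1}. hausdorff2_outer (case i of 0 \<Rightarrow> A | Suc 0 \<Rightarrow> B | _ \<Rightarrow> {}))"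
    by (rule suminf_finite) (auto split: nat.splits)
  finally show ?thesis by simp
qed

text \<open>A set of diameter at most \<delta> cannot meet both parts, so every cover of the union
  splits into a cover of \<open>A\<close> and one of \<open>B\<close>; discarded members are
  replaced by the empty set, which costs nothing.\<close>

lemma hausdorff2_pre_Un_separated:
  assumes "0 < \<delta>" "\<And>a b. a \<in> A \<Longrightarrow> b \<in> B \<Longrightarrow> \<delta> < dist a b"
  shows "hausdorff2_pre \<delta> A + hausdorff2_pre \<delta> B \<le> hausdorff2_pre \<delta> (A \<union> B)"
  unfolding hausdorff2_pre_eq[of \<delta> "A \<union> B"]
proof (rule INF_greatest)
  fix C assume C: "C \<in> bounded_covers \<delta> (A \<union> B)"
  define C1 where "C1 i = (if C i \<inter> A \<noteq> {} then C i else {})" for i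
  define C2 where "C2 i = (if C i \<inter> A \<noteq> {} then {} else C i)" for i
  have 1: "C1 \<in> bounded_covers \<delta> A"
    using C assms(1) by (fastforce simp: bounded_covers_def C1_def)
  have "B \<subseteq> (\<Union>i. C2 i)"
  proof
    fix b assume b: "b \<in> B"
    then obtain i where i: "b \<in> C i" using C by (auto simp: bounded_covers_def)
    have "C i \<inter> A = {}"
    proof (rule ccontr)
      assume "C i \<inter> A \<noteq> {}"
      then obtain a where a: "a \<in> C i" "a \<in> A" by auto
      then have "dist a b \<le> diameter (C i)"
        using C i by (intro diameter_bounded_bound) (auto simp: bounded_covers_def)
      moreover have "diameter (C i) \<le> \<delta>" using C by (auto simp: bounded_covers_def)
      ultimately show False using assms(2)[OF a(2) b] by simp
    qed
    then have "b \<in> C2 i" using i by (simp add: C2_def)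
    then show "b \<in> (\<Union>i. C2 i)" by blast
  qed
  then have 2: "C2 \<in> bounded_covers \<delta> B"
    using C assms(1) by (auto simp: bounded_covers_def C2_def)
  have "hausdorff2_pre \<delta> A + hausdorff2_pre \<delta> B \<le> disc_sum C1 + disc_sum C2"
    using 1 2 by (intro add_mono hausdorff2_pre_le)
  also have "\<dots> = disc_sum C"
    unfolding disc_sum_def
    by (subst suminf_add) (auto simp: C1_def C2_def intro!: arg_cong[where f=suminf])
  finally show "hausdorff2_pre \<delta> A + hausdorff2_pre \<delta> B \<le> disc_sum C" .
qed

text \<open>The pre-measures grow as the scale shrinks, so separate scales for \<open>A\<close> and
  \<open>B\<close> are dominated by a common one below the gap \<eta>, where covers split.\<close>

lemma hausdorff2_outer_Un_separated:
  assumes "0 < \<eta>" and sep: "\<And>a b. a \<in> A \<Longrightarrow> b \<in> B \<Longrightarrow> \<eta> \<le> dist a b"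
  shows "hausdorff2_outer A + hausdorff2_outer B \<le> hausdorff2_outer (A \<union> B)"
proof -
  have key: "\<exists>k\<in>{0<..}. hausdorff2_pre i A + hausdorff2_pre j B \<le> hausdorff2_pre k A + hausdorff2_pre k B
      \<and> hausdorff2_pre k A + hausdorff2_pre k B \<le> hausdorff2_outer (A \<union> B)"
    if "i \<in> {0<..}" "j \<in> {0<..}" for i j :: real
  proof (intro bexI conjI)
    let ?k = "min (min i j) (\<eta> / 2)"
    show k: "?k \<in> {0<..}" using that assms(1) by auto
    show "hausdorff2_pre i A + hausdorff2_pre j B \<le> hausdorff2_pre ?k A + hausdorff2_pre ?k B"
      by (intro add_mono hausdorff2_pre_antimono) auto
    have "hausdorff2_pre ?k A + hausdorff2_pre ?k B \<le> hausdorff2_pre ?k (A \<union> B)"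
      using k assms(1) by (intro hausdorff2_pre_Un_separated) (auto dest!: sep)
    also have "\<dots> \<le> hausdorff2_outer (A \<union> B)"
      using k by (intro hausdorff2_pre_le_outer) auto
    finally show "hausdorff2_pre ?k A + hausdorff2_pre ?k B \<le> hausdorff2_outer (A \<union> B)" .
  qed
  have "hausdorff2_outer A + hausdorff2_outer B = (SUP \<delta>\<in>{0<..}. hausdorff2_pre \<delta> A + hausdorff2_pre \<delta> B)"
    unfolding hausdorff2_outer_def using key by (intro SUP_add_directed_ennreal[symmetric]) blast
  also have "\<dots> \<le> hausdorff2_outer (A \<union> B)"
  proof (rule SUP_least)
    fix i :: real assume "i \<in> {0<..}"
    then show "hausdorff2_pre i A + hausdorff2_pre i B \<le> hausdorff2_outer (A \<union> B)"
      using key[of i i] by (meson order_trans)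
  qed
  finally show ?thesis .
qed

text \<open>Caratheodory's criterion: the shells at distance about \<open>1/n\<close> from \<open>F\<close> are pairwise
  separated when two indices of equal parity are compared, so their measures are summable.\<close>

lemma hausdorff2_outer_closed_split:
  fixes F T :: "'a::metric_space set"
  assumes F: "closed F" and ne: "F \<noteq> {}"
  shows "hausdorff2_outer (T \<inter> F) + hausdorff2_outer (T - F) \<le> hausdorff2_outer T"
proof (cases "hausdorff2_outer T = top")
  case False
  let ?H = "hausdorff2_outer :: 'a set \<Rightarrow> ennreal"
  define S where "S n = {x \<in> T. 1 / real (Suc n) \<le> infdist x F}" for n
  define R where "R n = S (Suc n) - S n" for n
  have HT: "?H A \<le> ?H T" if "A \<subseteq> T" for A using that by (rule hausdorff2_outer_mono)
  have R_sep: "1 / real (Suc n) - 1 / real (Suc m) \<le> dist x y"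
    if "x \<in> S n" "y \<in> T" "y \<notin> S m" for n m x y
  proof -
    have "infdist x F \<le> infdist y F + dist x y" by (rule infdist_triangle)
    then show ?thesis using that by (auto simp: S_def)
  qed
  have S_mono: "S n \<subseteq> S m" if "n \<le> m" for n m
  proof -
    have "1 / real (Suc m) \<le> 1 / real (Suc n)" using that by (intro divide_left_mono) auto
    then show ?thesis by (auto simp: S_def)
  qed
  have R_sub: "R n \<subseteq> S (Suc n)" "R n \<subseteq> T" for n by (auto simp: R_def S_def)
  have gap: "0 < 1 / real (Suc n) - 1 / real (Suc (Suc n))" for n by (intro diff_gt_0_iff_gt[THEN iffD2] divide_strict_left_mono) auto
  have parity: "(\<Sum>k<n. ?H (R (2 * k + c))) \<le> ?H (\<Union>k<n. R (2 * k + c))" for n c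
  proof (induction n)
    case (Suc n)
    have "(\<Sum>k<Suc n. ?H (R (2 * k + c))) \<le> ?H (\<Union>k<n. R (2 * k + c)) + ?H (R (2 * n + c))"
      using Suc by (simp add: add_right_mono)
    also have "\<dots> \<le> ?H ((\<Union>k<n. R (2 * k + c)) \<union> R (2 * n + c))"
    proof (cases n)
      case 0 then show ?thesis by simp
    next
      case (Suc m)
      show ?thesis
      proof (rule hausdorff2_outer_Un_separated[OF gap[of "2 * m + c + 1"]])
        fix a b assume a: "a \<in> (\<Union>k<n. R (2 * k + c))" and b: "b \<in> R (2 * n + c)"
        obtain k where k: "k \<le> m" "a \<in> R (2 * k + c)" using a Suc by (auto simp: less_Suc_eq_le)
        have "a \<in> S (2 * m + c + 1)"
          using k R_sub(1)[of "2*k+c"] S_mono[of "Suc (2*k+c)" "2 * m + c + 1"] by auto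
        moreover have "b \<notin> S (2 * m + c + 2)" "b \<in> T"
          using b Suc by (auto simp: R_def S_def)
        ultimately show "1 / real (Suc (2 * m + c + 1)) - 1 / real (Suc (Suc (2 * m + c + 1))) \<le> dist a b"
          using R_sep[of a "2*m+c+1" b "2*m+c+2"] by simp
      qed
    qed
    also have "(\<Union>k<n. R (2 * k + c)) \<union> R (2 * n + c) = (\<Union>k<Suc n. R (2 * k + c))"
      by (auto simp: less_Suc_eq)
    finally show ?case .
  qed simp
  have "(\<Sum>k. ?H (R k)) \<le> 2 * ?H T"
  proof (rule suminf_le_const)
    fix n
    have "(\<Sum>k<n. ?H (R k)) \<le> (\<Sum>k<2*n. ?H (R k))"
      by (intro sum_mono2) auto
    also have "\<dots> = (\<Sum>k<n. ?H (R (2 * k + 0))) + (\<Sum>k<n. ?H (R (2 * k + 1)))"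
      by (induction n) (auto simp: algebra_simps)
    also have "\<dots> \<le> ?H T + ?H T"
      using R_sub(2) by (intro add_mono order_trans[OF parity] HT) auto
    finally show "(\<Sum>k<n. ?H (R k)) \<le> 2 * ?H T" by (simp add: mult_2)
  qed auto
  also have "\<dots> < top" using False by (simp add: ennreal_mult_less_top less_top)
  finally have fin: "(\<Sum>k. ?H (R k)) \<noteq> top" by simp
  \<comment> \<open>The shells have finite total measure, so the part closer to \<open>F\<close>
    than the first \<open>n\<close> shells is negligible for large \<open>n\<close>.\<close>
  have tail: "(\<lambda>n. \<Sum>k. ?H (R (k + n))) \<longlonglongrightarrow> 0"
  proof -
    obtain r where r: "\<And>k. ?H (R k) = ennreal (r k)" "\<And>k. 0 \<le> r k"
    proof -
      have "?H (R k) \<noteq> top" for k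
        using HT[OF R_sub(2)[of k]] False by (auto simp: top_unique)
      then show ?thesis using that[of "\<lambda>k. enn2real (?H (R k))"] by (simp add: less_top)
    qed
    have sm: "summable r" using fin r by (intro summable_suminf_not_top) auto
    have "(\<Sum>k. ?H (R (k + n))) = ennreal (\<Sum>k. r (k + n))" for n
      using sm r summable_ignore_initial_segment[OF sm, of n] by (simp add: suminf_ennreal2)
    moreover have "(\<lambda>n. ennreal (\<Sum>k. r (k + n))) \<longlonglongrightarrow> ennreal 0"
      by (intro tendsto_ennrealI suminf_exist_split2 sm)
    ultimately show ?thesis by simp
  qed
  have cover: "T - F \<subseteq> S n \<union> (\<Union>k. R (k + n))" for n
  proof
    fix x assume x: "x \<in> T - F"
    then have "infdist x F > 0"
      using F ne in_closed_iff_infdist_zero infdist_nonneg[of x F] by (metis DiffD2 less_eq_real_def)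
    then obtain N where N: "1 / real (Suc N) < infdist x F"
      using nat_approx_posE by blast
    define m where "m = (LEAST m. x \<in> S m)"
    have "x \<in> S N" using x N by (simp add: S_def)
    then have m: "x \<in> S m" and min: "\<And>j. j < m \<Longrightarrow> x \<notin> S j"
      unfolding m_def by (auto intro: LeastI dest: not_less_Least)
    show "x \<in> S n \<union> (\<Union>k. R (k + n))"
    proof (cases "m \<le> n")
      case True then show ?thesis using m S_mono[of m n] by auto
    next
      case False
      then have "x \<in> R ((m - 1 - n) + n)" using m min[of "m - 1"] by (cases m) (auto simp: R_def)
      then show ?thesis by blast
    qed
  qed
  \<comment> \<open>\<open>S n\<close> keeps the distance \<open>1 / (n + 1)\<close> from
    \<open>F\<close>, so additivity on separated sets applies to it; the error is the tail of the
    shells.\<close>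
  have "?H (T \<inter> F) + ?H (T - F) \<le> ?H T + (\<Sum>k. ?H (R (k + n)))" for n
  proof -
    have "?H (T - F) \<le> ?H (S n) + (\<Sum>k. ?H (R (k + n)))"
      using hausdorff2_outer_mono[OF cover[of n]] hausdorff2_outer_Un_le[of "S n" "\<Union>k. R (k + n)"]
        add_left_mono[OF hausdorff2_outer_countably_subadditive[of "\<lambda>k. R (k + n)"], of "?H (S n)"]
      by (meson order_trans)
    then have "?H (T \<inter> F) + ?H (T - F) \<le> (?H (T \<inter> F) + ?H (S n)) + (\<Sum>k. ?H (R (k + n)))"
      by (simp add: add.assoc add_left_mono)
    also have "?H (T \<inter> F) + ?H (S n) \<le> ?H ((T \<inter> F) \<union> S n)"
    proof (rule hausdorff2_outer_Un_separated)
      show "0 < 1 / real (Suc n)" by simp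
      fix a b assume "a \<in> T \<inter> F" "b \<in> S n"
      then show "1 / real (Suc n) \<le> dist a b"
        using infdist_le[of a F b] by (auto simp: S_def dist_commute)
    qed
    also have "\<dots> \<le> ?H T" by (rule HT) (auto simp: S_def)
    finally show ?thesis by (simp add: add_right_mono)
  qed
  moreover have "(\<lambda>n. ?H T + (\<Sum>k. ?H (R (k + n)))) \<longlonglongrightarrow> ?H T + 0"
    by (intro tendsto_add tendsto_const tail)
  ultimately show ?thesis
    using LIMSEQ_le_const by fastforce
qed simp

text \<open>Closed sets satisfy Caratheodory's criterion, hence so do all Borel sets. Thus the set
  function behind \<open>hausdorff2\<close> is a measure on the Borel sets; for a set function that
  is not one, \<open>measure_of\<close> returns the zero measure.\<close>

lemma measure_space_hausdorff2_outer:
  "measure_space UNIV (sets borel) (hausdorff2_outer :: 'a::metric_space set \<Rightarrow> ennreal)"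
proof -
  let ?H = "hausdorff2_outer :: 'a set \<Rightarrow> ennreal"
  have oms: "outer_measure_space (Pow UNIV) ?H"
    by (auto simp: outer_measure_space_def positive_def increasing_def countably_subadditive_def
        intro: hausdorff2_outer_mono hausdorff2_outer_countably_subadditive)
  have ms: "measure_space UNIV (lambda_system UNIV (Pow UNIV) ?H) ?H"
    using sigma_algebra.caratheodory_lemma[OF sigma_algebra_Pow oms] .
  have "F \<in> lambda_system UNIV (Pow UNIV) ?H" if "closed F" for F
  proof -
    have "?H (F \<inter> x) + ?H ((UNIV - F) \<inter> x) = ?H x" for x
    proof (cases "F = {}")
      case False
      have "?H x \<le> ?H (F \<inter> x) + ?H ((UNIV - F) \<inter> x)"
        by (rule order_trans[OF hausdorff2_outer_mono hausdorff2_outer_Un_le]) auto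
      moreover have "?H (x \<inter> F) + ?H (x - F) \<le> ?H x"
        using that False by (rule hausdorff2_outer_closed_split)
      moreover have "(UNIV - F) \<inter> x = x - F" "F \<inter> x = x \<inter> F" by auto
      ultimately show ?thesis by (intro order_antisym) (simp_all only:)
    qed simp
    then show ?thesis by (auto simp: lambda_system_def)
  qed
  then have "sigma_sets UNIV (Collect closed) \<subseteq> lambda_system UNIV (Pow UNIV) ?H"
    using ms by (intro sigma_algebra.sigma_sets_subset) (auto simp: measure_space_def)
  then have "(sets borel :: 'a set set) \<subseteq> lambda_system UNIV (Pow UNIV) ?H"
    by (simp add: borel_eq_closed)
  then show ?thesis
    using measure_down[OF ms] sets.sigma_algebra_axioms[of "borel :: 'a measure"] by auto
qed

lemma sets_hausdorff2 [simp, measurable_cong]: "sets hausdorff2 = sets borel"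
  by (simp add: hausdorff2_def sets.sigma_sets_eq[of borel, simplified])

lemma space_hausdorff2 [simp]: "space hausdorff2 = UNIV"
  by (simp add: hausdorff2_def)

lemma emeasure_hausdorff2: "A \<in> sets borel \<Longrightarrow> emeasure hausdorff2 A = hausdorff2_outer A"
  using measure_space_hausdorff2_outer
  unfolding hausdorff2_def hausdorff2_outer_def[abs_def]
  by (intro emeasure_measure_of_sigma) (auto simp: measure_space_def)

section \<open>The isodiametric inequality\<close>

text \<open>Steiner symmetrisation in the second coordinate: each vertical fibre becomes a centred
  closed interval of the same length. Fibres of measure zero are removed, so every remaining one
  lies over a nonempty fibre of \<open>A\<close>.\<close>

definition steiner :: "(real \<times> real) set \<Rightarrow> (real \<times> real) set" where
  "steiner A = {(x, y). 0 < measure lborel (Pair x -` A) \<and> 2 * \<bar>y\<bar> \<le> measure lborel (Pair x -` A)}"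

lemma sets_lborel_pair: "sets (lborel \<Otimes>\<^sub>M lborel) = sets (borel :: (real \<times> real) measure)"
  by (subst lborel_prod) (rule sets_lborel)

lemma sets_Pair_vimage: 
  assumes "A \<in> sets (borel :: (real \<times> real) measure)" shows "Pair x -` A \<in> sets borel"
proof -
  have "A \<in> sets (lborel \<Otimes>\<^sub>M lborel)" using assms unfolding sets_lborel_pair .
  from sets_Pair1[OF this] show ?thesis by simp
qed

lemma bounded_Pair_vimage:
  fixes A :: "(real \<times> real) set"
  assumes d: "\<And>p q. p \<in> A \<Longrightarrow> q \<in> A \<Longrightarrow> dist p q \<le> d"
  shows "bounded (Pair t -` A)"
proof -
  have "dist y z \<le> d" if "(t, y) \<in> A" "(t, z) \<in> A" for y z
    using d[OF that] by (simp add: dist_Pair_Pair)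
  then show ?thesis unfolding bounded_two_points by auto
qed

text \<open>A bounded set lies between its infimum and its supremum, which are therefore at least
  its measure apart. They need not be attained, hence the margin \<open>e\<close>.\<close>

lemma spread_of_measure:
  fixes E :: "real set"
  assumes E: "E \<in> sets borel" "bounded E" "0 < measure lborel E" and e: "0 < e"
  obtains p q where "p \<in> E" "q \<in> E" "measure lborel E - e < q - p"
proof (rule ccontr)
  assume "\<not> thesis"
  then have le: "q - p \<le> measure lborel E - e" if "p \<in> E" "q \<in> E" for p q
    using that \<open>\<And>p q. p \<in> E \<Longrightarrow> q \<in> E \<Longrightarrow> measure lborel E - e < q - p \<Longrightarrow> thesis\<close>
    by (meson linorder_not_less)
  have ne: "E \<noteq> {}" using E(3) by auto
  have "q - (measure lborel E - e) \<le> Inf E" if "q \<in> E" for q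
    using le[OF _ that] by (intro cInf_greatest[OF ne]) (auto simp: algebra_simps)
  then have "Sup E \<le> Inf E + (measure lborel E - e)"
    by (intro cSup_least[OF ne]) (auto simp: algebra_simps)
  moreover have "measure lborel E \<le> measure lborel (cbox (Inf E) (Sup E))"
  proof (rule measure_mono_fmeasurable)
    show "E \<subseteq> cbox (Inf E) (Sup E)"
      using E(2) by (auto intro!: cInf_lower cSup_upper bounded_imp_bdd_above bounded_imp_bdd_below)
    show "cbox (Inf E) (Sup E) \<in> fmeasurable lborel" by (rule fmeasurable_cbox)
  qed (use E(1) in simp)
  moreover have "Inf E \<le> Sup E"
    using E(2) ne by (simp add: cInf_le_cSup bounded_imp_bdd_above bounded_imp_bdd_below)
  ultimately show False using e by (simp add: cbox_interval)
qed

text \<open>Let two fibres of \<open>A\<close> have lengths m and m'. The top of one and the bottom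
  of the other are, for one of the two choices, vertically at least about (m + m') / 2 apart, and
  this is compatible with the bound \<open>d\<close>. Points of the two centred intervals are
  vertically at most (m + m') / 2 apart.\<close>

lemma steiner_dist_le:
  assumes A: "A \<in> sets borel" and d: "\<And>p q. p \<in> A \<Longrightarrow> q \<in> A \<Longrightarrow> dist p q \<le> d"
    and pq: "p \<in> steiner A" "q \<in> steiner A"
  shows "dist p q \<le> d"
proof -
  obtain x y x' y' where [simp]: "p = (x, y)" "q = (x', y')" by (cases p, cases q)
  have bd: "bounded (Pair t -` A)" for t
    by (rule bounded_Pair_vimage[OF d])
  define m m' where "m = measure lborel (Pair x -` A)" and "m' = measure lborel (Pair x' -` A)"
  have m: "0 < m" "2 * \<bar>y\<bar> \<le> m" "0 < m'" "2 * \<bar>y'\<bar> \<le> m'"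
    using pq by (auto simp: steiner_def m_def m'_def)
  have sq: "(x - x')\<^sup>2 + (v - w)\<^sup>2 \<le> d\<^sup>2" "0 \<le> d" if "(x, v) \<in> A" "(x', w) \<in> A" for v w
  proof -
    have "sqrt ((x - x')\<^sup>2 + (v - w)\<^sup>2) \<le> d"
      using d[OF that] by (simp add: dist_Pair_Pair dist_real_def)
    then show "(x - x')\<^sup>2 + (v - w)\<^sup>2 \<le> d\<^sup>2" by (simp add: sqrt_le_D)
    show "0 \<le> d" using d[OF that] zero_le_dist order_trans by blast
  qed
  have "(m + m') / 2 \<le> sqrt (d\<^sup>2 - (x - x')\<^sup>2) + e" if e: "0 < e" for e
  proof -
    obtain v1 v2 where v: "(x, v1) \<in> A" "(x, v2) \<in> A" "m - e < v2 - v1"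
      using spread_of_measure[OF sets_Pair_vimage[OF A] bd _ e, of x] m(1) unfolding m_def by auto
    obtain w1 w2 where w: "(x', w1) \<in> A" "(x', w2) \<in> A" "m' - e < w2 - w1"
      using spread_of_measure[OF sets_Pair_vimage[OF A] bd _ e, of x'] m(3) unfolding m'_def by auto
    have "\<bar>v2 - w1\<bar> \<le> sqrt (d\<^sup>2 - (x - x')\<^sup>2)" "\<bar>v1 - w2\<bar> \<le> sqrt (d\<^sup>2 - (x - x')\<^sup>2)"
      using sq[OF v(2) w(1)] sq[OF v(1) w(2)] by (auto intro!: real_le_rsqrt)
    moreover have "(m + m') / 2 \<le> g + e"
      if "\<bar>v2 - w1\<bar> \<le> g" "\<bar>v1 - w2\<bar> \<le> g" for g
      using that v(3) w(3) unfolding abs_le_iff by (simp add: field_simps)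
    ultimately show ?thesis by blast
  qed
  then have half: "(m + m') / 2 \<le> sqrt (d\<^sup>2 - (x - x')\<^sup>2)" by (rule field_le_epsilon)
  have le: "\<bar>y - y'\<bar> \<le> sqrt (d\<^sup>2 - (x - x')\<^sup>2)"
  proof (rule order_trans)
    show "\<bar>y - y'\<bar> \<le> (m + m') / 2"
      using m abs_triangle_ineq4[of y y'] by (simp add: field_simps)
  qed (rule half)
  obtain v w where vw: "(x, v) \<in> A" "(x', w) \<in> A"
    using m unfolding m_def m'_def by (metis ex_in_conv less_irrefl measure_empty vimage_eq)
  have "d\<^sup>2 - (x - x')\<^sup>2 \<ge> 0" using sq(1)[OF vw] zero_le_power2[of "v - w"] by linarith
  then have "(y - y')\<^sup>2 \<le> d\<^sup>2 - (x - x')\<^sup>2"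
    using power_mono[OF le, of 2] by simp
  then show ?thesis using sq(2)[OF vw]
    by (auto simp: dist_Pair_Pair dist_real_def intro!: real_le_lsqrt)
qed

text \<open>Cavalieri's principle: all fibres keep their lengths.\<close>

lemma
  assumes A: "A \<in> sets borel" and d: "\<And>p q. p \<in> A \<Longrightarrow> q \<in> A \<Longrightarrow> dist p q \<le> d"
  shows sets_steiner: "steiner A \<in> sets borel"
    and emeasure_steiner: "emeasure lborel (steiner A) = emeasure lborel A"
proof -
  have bd: "bounded (Pair t -` A)" for t
    by (rule bounded_Pair_vimage[OF d])
  have A': "A \<in> sets (lborel \<Otimes>\<^sub>M lborel)" using A unfolding sets_lborel_pair .
  have [measurable]: "(\<lambda>x. measure lborel (Pair x -` A)) \<in> borel_measurable borel"
    unfolding measure_def using lborel.measurable_emeasure_Pair[OF A'] by simp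
  have "steiner A = {p \<in> space borel. 0 < measure lborel (Pair (fst p) -` A) \<and> 2 * \<bar>snd p\<bar> \<le> measure lborel (Pair (fst p) -` A)}"
    by (auto simp: steiner_def)
  also have "\<dots> \<in> sets (borel \<Otimes>\<^sub>M borel)" unfolding borel_prod[symmetric] by measurable
  finally show S: "steiner A \<in> sets borel" unfolding borel_prod .
  then have S': "steiner A \<in> sets (lborel \<Otimes>\<^sub>M lborel)" unfolding sets_lborel_pair .
  have fin: "emeasure lborel (Pair x -` A) = ennreal (measure lborel (Pair x -` A))" for x
    using emeasure_bounded_finite[OF bd, of x] by (intro emeasure_eq_ennreal_measure) simp
  have "emeasure lborel (Pair x -` steiner A) = emeasure lborel (Pair x -` A)" for x
  proof (cases "0 < measure lborel (Pair x -` A)")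
    case True
    then have "Pair x -` steiner A = {- (measure lborel (Pair x -` A) / 2)..measure lborel (Pair x -` A) / 2}"
      by (auto simp: steiner_def)
    then show ?thesis using True by (simp add: fin)
  next
    case False
    then have "measure lborel (Pair x -` A) = 0" using measure_nonneg[of lborel "Pair x -` A"] by linarith
    then show ?thesis by (simp add: fin) (simp add: steiner_def)
  qed
  then have "emeasure (lborel \<Otimes>\<^sub>M lborel) (steiner A) = emeasure (lborel \<Otimes>\<^sub>M lborel) A"
    unfolding lborel.emeasure_pair_measure_alt[OF A'] lborel.emeasure_pair_measure_alt[OF S'] by simp
  then show "emeasure lborel (steiner A) = emeasure lborel A" by (simp add: lborel_prod)
qed

lemma emeasure_swap:
  assumes A: "A \<in> sets (borel :: (real \<times> real) measure)"
  shows "prod.swap -` A \<in> sets borel" "emeasure lborel (prod.swap -` A) = emeasure lborel A"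
proof -
  have [measurable]: "prod.swap \<in> measurable (lborel \<Otimes>\<^sub>M lborel) (lborel \<Otimes>\<^sub>M (lborel::real measure))"
    unfolding prod.swap_def by measurable
  have A': "A \<in> sets (lborel \<Otimes>\<^sub>M lborel)" using A unfolding sets_lborel_pair .
  have "prod.swap -` A \<inter> space (lborel \<Otimes>\<^sub>M lborel) \<in> sets (lborel \<Otimes>\<^sub>M (lborel::real measure))"
    using A' by measurable
  then show "prod.swap -` A \<in> sets borel" unfolding sets_lborel_pair by (simp add: space_pair_measure)
  have "emeasure (lborel \<Otimes>\<^sub>M lborel) A = emeasure (distr (lborel \<Otimes>\<^sub>M lborel) (lborel \<Otimes>\<^sub>M (lborel::real measure)) (\<lambda>(x, y). (y, x))) A"
    by (subst lborel_pair.distr_pair_swap) simp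
  also have "\<dots> = emeasure (lborel \<Otimes>\<^sub>M lborel) (prod.swap -` A)"
    using A' by (subst emeasure_distr) (auto simp: space_pair_measure intro!: arg_cong[where f="emeasure _"])
  finally show "emeasure lborel (prod.swap -` A) = emeasure lborel A" by (simp add: lborel_prod)
qed

text \<open>Symmetrising in both coordinates gives a centrally symmetric set of the same area and no
  larger diameter, which therefore lies in a disc of that diameter.\<close>

lemma isodiametric_borel:
  fixes A :: "(real \<times> real) set"
  assumes A: "A \<in> sets borel" and d: "\<And>p q. p \<in> A \<Longrightarrow> q \<in> A \<Longrightarrow> dist p q \<le> d" and "0 \<le> d"
  shows "emeasure lborel A \<le> ennreal (pi / 4 * d\<^sup>2)"
proof -
  define B where "B = prod.swap -` steiner A"
  have B: "B \<in> sets borel" "emeasure lborel B = emeasure lborel A"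
    using emeasure_swap[OF sets_steiner[OF A d]] emeasure_steiner[OF A d] by (simp_all add: B_def)
  have Bd: "dist p q \<le> d" if "p \<in> B" "q \<in> B" for p q
    using that steiner_dist_le[OF A, of d "prod.swap p" "prod.swap q"] d
    by (cases p; cases q) (auto simp: B_def dist_Pair_Pair add.commute)
  \<comment> \<open>This symmetry survives the second symmetrisation, since equal fibres give equal
    intervals; with the reflection of the intervals it yields central symmetry.\<close>
  have Bsym: "(- x, y) \<in> B \<longleftrightarrow> (x, y) \<in> B" for x y by (auto simp: B_def steiner_def)
  have "steiner B \<subseteq> cball 0 (d / 2)"
  proof
    fix p assume p: "p \<in> steiner B"
    have "- p \<in> steiner B"
    proof -
      have "Pair (- fst p) -` B = Pair (fst p) -` B" using Bsym by auto
      then show ?thesis using p by (cases p) (auto simp: steiner_def)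
    qed
    then have "dist p (- p) \<le> d" using steiner_dist_le[OF B(1) _ p] Bd by blast
    moreover have "dist p (- p) = 2 * norm p"
    proof -
      have "dist p (- p) = norm (2 *\<^sub>R p)" by (simp add: dist_norm scaleR_2)
      then show ?thesis by simp
    qed
    ultimately show "p \<in> cball 0 (d / 2)" by simp
  qed
  then have "emeasure lborel (steiner B) \<le> emeasure lborel (cball (0::real\<times>real) (d / 2))"
    by (intro emeasure_mono) auto
  also have "\<dots> = ennreal (pi / 4 * d\<^sup>2)"
    using \<open>0 \<le> d\<close> by (simp add: emeasure_cball unit_ball_vol_2 power_divide power2_eq_square)
  finally show ?thesis using emeasure_steiner[OF B(1) Bd] B(2) by simp
qed

section \<open>Hausdorff measure on planes\<close>

text \<open>The common pattern of the two upper bounds below: the disc area of each covering set is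
  paid for, up to the factor \<open>c\<close>, by its own member of a disjoint family inside
  \<open>U\<close>. It is applied to dyadic squares with \<open>c = 2\<close> and to Vitali balls
  with \<open>c = 1\<close>.\<close>

lemma hausdorff2_pre_le_packing:
  assumes D: "countable D" and cov: "A \<subseteq> (\<Union>d\<in>D. K d)" and "0 \<le> \<delta>"
    and K: "\<And>d. d \<in> D \<Longrightarrow> bounded (K d) \<and> diameter (K d) \<le> \<delta>"
    and P: "\<And>d. d \<in> D \<Longrightarrow> P d \<in> sets M" "disjoint_family_on P D" "\<And>d. d \<in> D \<Longrightarrow> P d \<subseteq> U" "U \<in> sets M"
    and le: "\<And>d. d \<in> D \<Longrightarrow> ennreal (pi / 4 * (diameter (K d))\<^sup>2) \<le> c * emeasure M (P d)"
  shows "hausdorff2_pre \<delta> A \<le> c * emeasure M U"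
proof -
  define h where "h = to_nat_on D"
  have inj: "inj_on h D" using D by (simp add: h_def inj_on_to_nat_on)
  define pick where "pick i = the_inv_into D h i" for i
  have pick: "pick (h d) = d" if "d \<in> D" for d
    using that inj by (simp add: pick_def the_inv_into_f_f)
  define C where "C i = (if i \<in> h ` D then K (pick i) else {})" for i
  define Q where "Q i = (if i \<in> h ` D then P (pick i) else {})" for i
  have "C \<in> bounded_covers \<delta> A"
    unfolding bounded_covers_def
  proof (intro CollectI conjI allI)
    show "A \<subseteq> (\<Union>i. C i)"
    proof
      fix x assume "x \<in> A"
      then obtain d where "d \<in> D" "x \<in> K d" using cov by auto
      then have "x \<in> C (h d)" by (simp add: C_def pick)
      then show "x \<in> (\<Union>i. C i)" by blast
    qed
    show "bounded (C i)" "diameter (C i) \<le> \<delta>" for i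
      using K \<open>0 \<le> \<delta>\<close> by (auto simp: C_def pick)
  qed
  then have "hausdorff2_pre \<delta> A \<le> disc_sum C" by (rule hausdorff2_pre_le)
  also have "disc_sum C \<le> (\<Sum>i. c * emeasure M (Q i))"
    unfolding disc_sum_def using le by (intro suminf_le) (auto simp: C_def Q_def pick)
  also have "\<dots> = c * (\<Sum>i. emeasure M (Q i))" by simp
  also have "(\<Sum>i. emeasure M (Q i)) = emeasure M (\<Union>i. Q i)"
  proof (rule suminf_emeasure)
    show "range Q \<subseteq> sets M" using P(1) by (auto simp: Q_def pick)
    show "disjoint_family Q"
      using P(2) by (fastforce simp: disjoint_family_on_def Q_def pick)
  qed
  also have "c * \<dots> \<le> c * emeasure M U"
    using P(3,4) by (intro mult_left_mono emeasure_mono) (auto simp: Q_def pick split: if_splits)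
  finally show ?thesis .
qed

lemma hausdorff2_pre_Un_le:
  assumes "0 \<le> \<delta>"
  shows "hausdorff2_pre \<delta> (A \<union> B) \<le> hausdorff2_pre \<delta> A + hausdorff2_pre \<delta> B"
proof -
  define C where "C i = (if i = 0 then A else if i = Suc 0 then B else {})" for i :: nat
  have empty: "hausdorff2_pre \<delta> ({} :: 'a set) = 0"
    using hausdorff2_pre_le[of "\<lambda>i. {}" \<delta> "{}::'a set"] assms
    by (simp add: bounded_covers_def disc_sum_def)
  have "A \<union> B = (\<Union>i. C i)" by (auto simp: C_def split: if_splits)
  then have "hausdorff2_pre \<delta> (A \<union> B) \<le> (\<Sum>i. hausdorff2_pre \<delta> (C i))"
    by (simp add: hausdorff2_pre_countably_subadditive)
  also have "\<dots> = (\<Sum>i\<in>{0, Suc 0}. hausdorff2_pre \<delta> (C i))"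
    by (rule suminf_finite) (auto simp: C_def empty)
  finally show ?thesis by (simp add: C_def)
qed

lemma borel_outer_open:
  assumes B: "B \<in> sets borel" and e: "0 < (e::real)"
  obtains U where "open U" "B \<subseteq> U" "emeasure lborel U \<le> emeasure lborel B + ennreal e"
proof -
  obtain U where U: "open U" "B \<subseteq> U" "emeasure lborel (U - B) < ennreal e"
    using outer_regular_lborel[OF B e] .
  have "emeasure lborel U = emeasure lborel B + emeasure lborel (U - B)"
    using U(1,2) B by (subst plus_emeasure) (auto intro!: arg_cong[where f="emeasure lborel"])
  then show thesis using U by (intro that[of U]) (auto intro: add_left_mono)
qed

locale isometric_plane =
  fixes \<psi> :: "real \<times> real \<Rightarrow> 'a::euclidean_space"
  assumes dist_psi [simp]: "dist (\<psi> p) (\<psi> q) = dist p q"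
begin

lemma diameter_image_le:
  assumes "0 \<le> d" "\<And>p q. p \<in> S \<Longrightarrow> q \<in> S \<Longrightarrow> dist p q \<le> d"
  shows "bounded (\<psi> ` S) \<and> diameter (\<psi> ` S) \<le> d"
proof
  show "bounded (\<psi> ` S)" using assms unfolding bounded_two_points by (auto intro!: exI[of _ d])
  show "diameter (\<psi> ` S) \<le> d"
    using assms by (intro diameter_le) (auto simp: dist_psi simp flip: dist_norm)
qed

text \<open>The isodiametric inequality bounds the area of the preimage of each covering set.
  Passing to closures makes the preimages Borel and leaves their diameters unchanged.\<close>

lemma emeasure_le_hausdorff2_pre:
  assumes S: "S \<in> sets borel"
  shows "emeasure lborel S \<le> hausdorff2_pre \<delta> (\<psi> ` S)"
  unfolding hausdorff2_pre_eq
proof (rule INF_greatest)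
  fix C assume C: "C \<in> bounded_covers \<delta> (\<psi> ` S)"
  define D where "D i = closure (\<psi> -` C i)" for i
  have D: "emeasure lborel (D i) \<le> ennreal (pi / 4 * (diameter (C i))\<^sup>2)" for i
  proof (rule isodiametric_borel)
    have b: "bounded (C i)" using C by (auto simp: bounded_covers_def)
    then show "0 \<le> diameter (C i)" by (rule diameter_ge_0)
    have "dist p q \<le> diameter (C i)" if "p \<in> \<psi> -` C i" "q \<in> \<psi> -` C i" for p q
      using diameter_bounded_bound[OF b, of "\<psi> p" "\<psi> q"] that by simp
    then have bd: "bounded (\<psi> -` C i)" "diameter (\<psi> -` C i) \<le> diameter (C i)"
      using \<open>0 \<le> diameter (C i)\<close> 
      by (auto simp: bounded_two_points dist_norm intro!: exI[of _ "diameter (C i)"] diameter_le)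
    fix p q assume "p \<in> D i" "q \<in> D i"
    then show "dist p q \<le> diameter (C i)"
      using diameter_bounded_bound[of "D i" p q] bd by (simp add: D_def bounded_closure diameter_closure)
  qed (simp add: D_def)
  have "S \<subseteq> (\<Union>i. D i)"
  proof
    fix x assume "x \<in> S"
    then have "\<psi> x \<in> (\<Union>i. C i)" using C unfolding bounded_covers_def by blast
    then obtain i where "\<psi> x \<in> C i" by blast
    then have "x \<in> D i" unfolding D_def by (intro subsetD[OF closure_subset]) simp
    then show "x \<in> (\<Union>i. D i)" by blast
  qed
  then have "emeasure lborel S \<le> emeasure lborel (\<Union>i. D i)"
    by (intro emeasure_mono) (auto simp: D_def)
  also have "\<dots> \<le> (\<Sum>i. emeasure lborel (D i))"
    by (intro emeasure_subadditive_countably) (auto simp: D_def)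
  also have "\<dots> \<le> disc_sum C" unfolding disc_sum_def by (intro suminf_le D) auto
  finally show "emeasure lborel S \<le> disc_sum C" .
qed

text \<open>Dyadic squares inside an open set of small measure cover \<open>N\<close>. A square of
  side s has diameter at most s sqrt 2, so its disc area is at most twice its area; a constant
  factor is harmless for a null set.\<close>

lemma hausdorff2_pre_null_cbox:
  assumes N: "N \<in> sets borel" "emeasure lborel N = 0" and "0 < \<delta>" and m: "0 < m"
    and sub: "N \<subseteq> cbox (- m, - m) (m, m)"
  shows "hausdorff2_pre \<delta> (\<psi> ` N) = 0"
proof -
  have "hausdorff2_pre \<delta> (\<psi> ` N) \<le> 0"
  proof (rule ennreal_le_epsilon)
    fix e :: real assume e: "0 < e"
    obtain U where U: "open U" "N \<subseteq> U" "emeasure lborel U \<le> emeasure lborel N + ennreal (e / 2)"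
      using borel_outer_open[OF N(1), of "e / 2"] e by auto
    \<comment> \<open>The gauge forces each square chosen at a point of \<open>N\<close> into
      \<open>U\<close> and below the scale \<delta>; outside \<open>U\<close> it has a default
      value.\<close>
    define g where "g x = (if x \<in> U then U \<inter> ball x (\<delta> / 2) else ball x 1)" for x
    have gauge: "gauge g" using U(1) \<open>0 < \<delta>\<close> by (auto simp: gauge_def g_def)
    have ne: "box (- m, - m) (m, m) \<noteq> {}" using m by (auto simp: box_ne_empty Basis_prod_def)
    obtain D where D: "countable D" "\<Union>D \<subseteq> cbox (- m, - m) (m, m)"
      "\<And>K. K \<in> D \<Longrightarrow> interior K \<noteq> {} \<and> (\<exists>c d. K = cbox c d)"
      "pairwise (\<lambda>A B. interior A \<inter> interior B = {}) D"
      "\<And>K. K \<in> D \<Longrightarrow> \<exists>x\<in>N \<inter> K. K \<subseteq> g x"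
      "\<And>u v. cbox u v \<in> D \<Longrightarrow> \<exists>n. \<forall>i\<in>Basis. v \<bullet> i - u \<bullet> i = ((m, m) \<bullet> i - (- m, - m) \<bullet> i) / 2 ^ n"
      "N \<subseteq> \<Union> D"
      by (rule covering_lemma[OF sub ne gauge]) (rule that; assumption)
    have "hausdorff2_pre \<delta> (\<psi> ` N) \<le> ennreal 2 * emeasure lborel U"
    proof (rule hausdorff2_pre_le_packing[where K = "\<lambda>K. \<psi> ` K" and P = interior])
      show "countable D" by fact
      show "\<psi> ` N \<subseteq> (\<Union>K\<in>D. \<psi> ` K)" using D(7) by auto
      show "disjoint_family_on interior D" using D(4) by (auto simp: disjoint_family_on_def pairwise_def)
    next
      fix K assume K: "K \<in> D"
      obtain x where x: "x \<in> N" "K \<subseteq> g x" using D(5)[OF K] by auto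
      then have sub: "K \<subseteq> U" "K \<subseteq> ball x (\<delta> / 2)" using U(2) by (auto simp: g_def split: if_splits)
      show "interior K \<subseteq> U" using sub interior_subset by blast
      have "dist p q \<le> \<delta>" if "p \<in> K" "q \<in> K" for p q
      proof -
        have "dist x p < \<delta> / 2" "dist x q < \<delta> / 2" using sub that by auto
        then show ?thesis using dist_triangle3[of p q x] by simp
      qed
      then show "bounded (\<psi> ` K) \<and> diameter (\<psi> ` K) \<le> \<delta>"
        using \<open>0 < \<delta>\<close> by (intro diameter_image_le) auto
      obtain u v where uv: "K = cbox u v" "interior K \<noteq> {}" using D(3)[OF K] by blast
      obtain n where n: "\<And>i. i \<in> Basis \<Longrightarrow> v \<bullet> i - u \<bullet> i = ((m, m) \<bullet> i - (- m, - m) \<bullet> i) / 2 ^ n"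
        using D(6) K uv(1) by blast
      define s where "s = 2 * m / 2 ^ n"
      have s: "0 < s" "fst v = fst u + s" "snd v = snd u + s"
        using n[of "(1, 0)"] n[of "(0, 1)"] m by (auto simp: Basis_prod_def s_def inner_prod_def)
      have "dist p q \<le> sqrt (2 * s\<^sup>2)" if "p \<in> K" "q \<in> K" for p q
      proof -
        have "\<bar>fst p - fst q\<bar> \<le> s" "\<bar>snd p - snd q\<bar> \<le> s"
          using that uv(1) s by (cases p; cases q; cases u; cases v; force simp: cbox_Pair_eq)+
        then have "(fst p - fst q)\<^sup>2 \<le> s\<^sup>2" "(snd p - snd q)\<^sup>2 \<le> s\<^sup>2"
          using abs_le_square_iff s(1) by fastforce+
        then show ?thesis by (simp add: dist_prod_def dist_real_def)
      qed
      then have "bounded (\<psi> ` K) \<and> diameter (\<psi> ` K) \<le> sqrt (2 * s\<^sup>2)"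
        by (intro diameter_image_le) auto
      then have "(diameter (\<psi> ` K))\<^sup>2 \<le> 2 * s\<^sup>2"
        using diameter_ge_0 by (metis sqrt_le_D sqrt_ge_absD abs_of_nonneg)
      then have "pi / 4 * (diameter (\<psi> ` K))\<^sup>2 \<le> 1 * (2 * s\<^sup>2)"
        using pi_less_4 by (intro mult_mono) auto
      also have "ennreal (1 * (2 * s\<^sup>2)) = ennreal 2 * emeasure lborel (interior K)"
        using s by (cases u; cases v)
          (auto simp: uv(1) interior_cbox emeasure_lborel_box_eq Basis_prod_def inner_prod_def
            prod.union_disjoint ennreal_mult' power2_eq_square)
      finally show "ennreal (pi / 4 * (diameter (\<psi> ` K))\<^sup>2) \<le> ennreal 2 * emeasure lborel (interior K)"
        by (simp add: ennreal_leI)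
    qed (use U \<open>0 < \<delta>\<close> in auto)
    also have "\<dots> \<le> ennreal 2 * ennreal (e / 2)" using U(3) N(2) by (intro mult_left_mono) auto
    also have "\<dots> = ennreal e" using e by (subst ennreal_mult'[symmetric]) auto
    finally show "hausdorff2_pre \<delta> (\<psi> ` N) \<le> 0 + ennreal e" by simp
  qed
  then show ?thesis by simp
qed

lemma hausdorff2_pre_null:
  assumes N: "N \<in> sets borel" "emeasure lborel N = 0" and "0 < \<delta>"
  shows "hausdorff2_pre \<delta> (\<psi> ` N) = 0"
proof -
  define Q where "Q k = cbox (- real (Suc k), - real (Suc k)) (real (Suc k), real (Suc k))" for k
  have null: "hausdorff2_pre \<delta> (\<psi> ` (N \<inter> Q k)) = 0" for k
  proof (rule hausdorff2_pre_null_cbox)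
    show "N \<inter> Q k \<in> sets borel" using N(1) by (auto simp: Q_def)
    show "emeasure lborel (N \<inter> Q k) = 0"
      using N emeasure_mono[of "N \<inter> Q k" N lborel] by auto
    show "N \<inter> Q k \<subseteq> cbox (- real (Suc k), - real (Suc k)) (real (Suc k), real (Suc k))"
      by (auto simp: Q_def)
  qed (use \<open>0 < \<delta>\<close> in auto)
  have "\<psi> ` N \<subseteq> (\<Union>k. \<psi> ` (N \<inter> Q k))"
  proof
    fix y assume "y \<in> \<psi> ` N"
    then obtain a b where ab: "(a, b) \<in> N" "y = \<psi> (a, b)" by auto
    obtain k where "max \<bar>a\<bar> \<bar>b\<bar> < real k" using reals_Archimedean2 by blast
    then have "(a, b) \<in> Q k" by (auto simp: Q_def cbox_Pair_eq)
    then show "y \<in> (\<Union>k. \<psi> ` (N \<inter> Q k))" using ab by blast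
  qed
  then have "hausdorff2_pre \<delta> (\<psi> ` N) \<le> (\<Sum>k. hausdorff2_pre \<delta> (\<psi> ` (N \<inter> Q k)))"
    by (rule order_trans[OF hausdorff2_pre_mono hausdorff2_pre_countably_subadditive])
  then show ?thesis by (simp add: null)
qed

text \<open>By Vitali's theorem disjoint closed balls of radius at most \<delta>/2 fill
  \<open>U\<close> up to a null set. The disc area attached to a ball of radius r is at most the
  area of the ball, so nothing is lost, and the null remainder has pre-measure zero.\<close>

lemma hausdorff2_pre_le_open:
  assumes U: "open U" and "0 < \<delta>"
  shows "hausdorff2_pre \<delta> (\<psi> ` U) \<le> emeasure lborel U"
proof -
  define I where "I = {(x, r). 0 < r \<and> r \<le> \<delta> / 2 \<and> cball x r \<subseteq> U}"
  obtain C where C: "countable C" "C \<subseteq> I"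
    "pairwise (\<lambda>i j. disjnt (cball (fst i) (snd i)) (cball (fst j) (snd j))) C"
    "negligible (U - (\<Union>i\<in>C. cball (fst i) (snd i)))"
  proof (rule Vitali_covering_theorem_cballs[of I snd U fst])
    show "0 < snd i" if "i \<in> I" for i using that by (auto simp: I_def)
    fix x :: "real \<times> real" and d :: real
    assume x: "x \<in> U" and d: "0 < d"
    obtain e where e: "0 < e" "cball x e \<subseteq> U" using U x open_contains_cball by blast
    define r where "r = min (min e (d / 2)) (\<delta> / 2)"
    have "(x, r) \<in> I" using e d \<open>0 < \<delta>\<close> by (auto simp: I_def r_def)
    moreover have "r < d" using d by (auto simp: r_def)
    ultimately show "\<exists>i. i \<in> I \<and> x \<in> cball (fst i) (snd i) \<and> snd i < d"
      using e d \<open>0 < \<delta>\<close> by (intro exI[of _ "(x, r)"]) (auto simp: r_def)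
  qed blast
  define B where "B = (\<Union>i\<in>C. cball (fst i) (snd i))"
  have B: "B \<in> sets borel" unfolding B_def by (intro sets.countable_UN'' C) auto
  have UB: "U - B \<in> sets borel" using B U by auto
  have "U - B \<in> null_sets lebesgue" using C(4) by (simp add: B_def negligible_iff_null_sets)
  then have "emeasure lborel (U - B) = 0" using UB by (auto simp: null_sets_def)
  then have null: "hausdorff2_pre \<delta> (\<psi> ` (U - B)) = 0"
    using UB \<open>0 < \<delta>\<close> by (intro hausdorff2_pre_null)
  have le: "hausdorff2_pre \<delta> (\<psi> ` B) \<le> 1 * emeasure lborel U"
  proof (rule hausdorff2_pre_le_packing[where K = "\<lambda>i. \<psi> ` cball (fst i) (snd i)" and P = "\<lambda>i. cball (fst i) (snd i)"])
    show "disjoint_family_on (\<lambda>i. cball (fst i) (snd i)) C"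
      using C(3) by (auto simp: disjoint_family_on_def pairwise_def disjnt_def)
    fix i assume "i \<in> C"
    then have "i \<in> I" using C(2) by auto
    then have i: "0 < snd i" "snd i \<le> \<delta> / 2" "cball (fst i) (snd i) \<subseteq> U" by (simp_all add: I_def case_prod_beta)
    then show "cball (fst i) (snd i) \<subseteq> U" by simp
    have "dist p q \<le> 2 * snd i" if "p \<in> cball (fst i) (snd i)" "q \<in> cball (fst i) (snd i)" for p q
      using that dist_triangle3[of p q "fst i"] by (simp add: mem_cball)
    then have d: "bounded (\<psi> ` cball (fst i) (snd i)) \<and> diameter (\<psi> ` cball (fst i) (snd i)) \<le> 2 * snd i"
      using i by (intro diameter_image_le) auto
    then show "bounded (\<psi> ` cball (fst i) (snd i)) \<and> diameter (\<psi> ` cball (fst i) (snd i)) \<le> \<delta>"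
      using i by auto
    have "pi / 4 * (diameter (\<psi> ` cball (fst i) (snd i)))\<^sup>2 \<le> pi / 4 * (2 * snd i)\<^sup>2"
      using d diameter_ge_0 by (intro mult_left_mono power_mono) auto
    then have "ennreal (pi / 4 * (diameter (\<psi> ` cball (fst i) (snd i)))\<^sup>2) \<le> ennreal (pi * (snd i)\<^sup>2)"
      by (intro ennreal_leI) (simp add: power_mult_distrib)
    also have "\<dots> = emeasure lborel (cball (fst i) (snd i))"
      using i by (simp add: emeasure_cball unit_ball_vol_2 power2_eq_square)
    finally show "ennreal (pi / 4 * (diameter (\<psi> ` cball (fst i) (snd i)))\<^sup>2) \<le> 1 * emeasure lborel (cball (fst i) (snd i))"
      by simp
  qed (use C(1) U \<open>0 < \<delta>\<close> in \<open>auto simp: B_def\<close>)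
  have "hausdorff2_pre \<delta> (\<psi> ` U) \<le> hausdorff2_pre \<delta> (\<psi> ` B \<union> \<psi> ` (U - B))"
    by (rule hausdorff2_pre_mono) auto
  also have "\<dots> \<le> hausdorff2_pre \<delta> (\<psi> ` B) + hausdorff2_pre \<delta> (\<psi> ` (U - B))"
    using \<open>0 < \<delta>\<close> by (intro hausdorff2_pre_Un_le) simp
  also have "\<dots> \<le> emeasure lborel U" using le null by simp
  finally show ?thesis .
qed

theorem hausdorff2_outer_image:
  assumes S: "S \<in> sets borel"
  shows "hausdorff2_outer (\<psi> ` S) = emeasure lborel S"
proof (rule order_antisym)
  show "emeasure lborel S \<le> hausdorff2_outer (\<psi> ` S)"
    by (rule order_trans[OF emeasure_le_hausdorff2_pre[OF S] hausdorff2_pre_le_outer[of 1]]) simp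
  show "hausdorff2_outer (\<psi> ` S) \<le> emeasure lborel S"
    unfolding hausdorff2_outer_def
  proof (rule SUP_least, rule ennreal_le_epsilon)
    fix \<delta> e :: real assume "\<delta> \<in> {0<..}" "emeasure lborel S < top" "0 < e"
    obtain U where U: "open U" "S \<subseteq> U" "emeasure lborel U \<le> emeasure lborel S + ennreal e"
      using borel_outer_open[OF S \<open>0 < e\<close>] .
    have "hausdorff2_pre \<delta> (\<psi> ` S) \<le> hausdorff2_pre \<delta> (\<psi> ` U)"
      using U(2) by (intro hausdorff2_pre_mono) auto
    also have "\<dots> \<le> emeasure lborel U"
      using U(1) \<open>\<delta> \<in> {0<..}\<close> by (intro hausdorff2_pre_le_open) auto
    finally show "hausdorff2_pre \<delta> (\<psi> ` S) \<le> emeasure lborel S + ennreal e" using U(3) by simp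
  qed
qed

lemma continuous_psi: "continuous_on UNIV \<psi>"
  by (auto simp: continuous_on_iff)

lemma measurable_psi [measurable]: "\<psi> \<in> borel_measurable borel"
  using continuous_psi by (rule borel_measurable_continuous_onI)

lemma emeasure_hausdorff2_plane:
  assumes A: "A \<in> sets borel" "A \<subseteq> range \<psi>"
  shows "emeasure hausdorff2 A = emeasure lborel (\<psi> -` A)"
proof -
  have "\<psi> -` A \<in> sets borel" using measurable_sets_borel[OF measurable_psi A(1)] by simp
  moreover have "\<psi> ` (\<psi> -` A) = A" using A(2) by auto
  ultimately show ?thesis
    using hausdorff2_outer_image[of "\<psi> -` A"] emeasure_hausdorff2[OF A(1)] by simp
qed

text \<open>On a subset of the plane \<open>hausdorff2\<close> is the image of Lebesgue measure
  under the chart, which turns surface integrals into planar ones.\<close>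

lemma density_hausdorff2_plane:
  assumes F: "F \<in> sets borel" "F \<subseteq> range \<psi>"
  shows "density hausdorff2 (indicator F) = density (distr lborel borel \<psi>) (indicator F)"
proof (rule measure_eqI)
  fix A :: "'a set" assume "A \<in> sets (density hausdorff2 (indicator F))"
  then have A: "A \<in> sets borel" by simp
  have "emeasure (density hausdorff2 (indicator F)) A = emeasure hausdorff2 (F \<inter> A)"
    using A F by (intro emeasure_restricted) auto
  also have "\<dots> = emeasure lborel (\<psi> -` (F \<inter> A))" using A F by (intro emeasure_hausdorff2_plane) auto
  also have "\<dots> = emeasure (density (distr lborel borel \<psi>) (indicator F)) A"
    using A F by (subst emeasure_restricted) (auto simp: emeasure_distr)
  finally show "emeasure (density hausdorff2 (indicator F)) A = emeasure (density (distr lborel borel \<psi>) (indicator F)) A" .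
qed simp

lemma set_integral_hausdorff2_plane:
  fixes f :: "'a \<Rightarrow> 'c::{banach, second_countable_topology}"
  assumes F: "F \<in> sets borel" "F \<subseteq> range \<psi>" and f: "f \<in> borel_measurable borel"
  shows "(LINT x:F|hausdorff2. f x) = (LINT p|lborel. indicator F (\<psi> p) *\<^sub>R f (\<psi> p))"
proof -
  have eq: "density hausdorff2 (\<lambda>x. ennreal (indicator F x)) = density (distr lborel borel \<psi>) (\<lambda>x. ennreal (indicator F x))"
    using density_hausdorff2_plane[OF F] by (simp add: ennreal_indicator)
  have [measurable]: "f \<in> borel_measurable hausdorff2"
    using f by (simp cong: measurable_cong_sets)
  note [measurable] = f F(1)
  have [measurable]: "F \<in> sets hausdorff2" using F(1) by simp
  have "(LINT x:F|hausdorff2. f x) = integral\<^sup>L (density hausdorff2 (\<lambda>x. ennreal (indicator F x))) f"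
    unfolding set_lebesgue_integral_def by (subst integral_density) auto
  also have "\<dots> = (LINT p|lborel. indicator F (\<psi> p) *\<^sub>R f (\<psi> p))"
    unfolding eq by (subst integral_density) (auto simp: integral_distr)
  finally show ?thesis .
qed

end

section \<open>The Gauss-Green formula for polytopes\<close>

text \<open>Boxes suffice: the preimage of a box under \<open>g\<close> is its image under the
  inverse, and the two determinants cancel.\<close>

lemma lborel_distr_linear:
  fixes g :: "real^'n::{finite,wellorder} \<Rightarrow> real^'n::_"
  assumes g: "linear g" and d: "det (matrix g) \<noteq> 0"
  shows "lborel = distr (density lborel (\<lambda>_. ennreal \<bar>det (matrix g)\<bar>)) borel g"
proof (rule lborel_eqI)
  have "inj g" using d det_nz_iff_inj[OF g] by blast
  then obtain g' where g': "linear g'" and g'g: "\<forall>x. g' (g x) = x" and gg': "\<forall>x. g (g' x) = x"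
    using linear_injective_isomorphism[OF g] by metis
  have det: "\<bar>det (matrix g)\<bar> * \<bar>det (matrix g')\<bar> = 1"
  proof -
    have "matrix g ** matrix g' = mat 1"
      using matrix_compose[OF g' g] gg' by (simp add: matrix_id_mat_1 comp_def flip: id_def)
    then have "det (matrix g) * det (matrix g') = 1" by (metis det_mul det_I)
    then show ?thesis by (simp flip: abs_mult)
  qed
  have [measurable]: "g \<in> borel_measurable borel"
    using g by (intro borel_measurable_continuous_onI linear_continuous_on) (simp add: linear_conv_bounded_linear)
  fix l u :: "real^'n::_" assume lu: "\<And>b. b \<in> Basis \<Longrightarrow> l \<bullet> b \<le> u \<bullet> b"
  have img: "g -` box l u = g' ` box l u"
    using g'g gg' by (auto simp: image_iff) metis
  have gm: "g -` box l u \<in> sets borel" using measurable_sets[of g borel borel "box l u"] by simp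
  have m: "box l u \<in> lmeasurable" by (rule lmeasurable_box)
  have "emeasure lborel (g -` box l u) = emeasure lebesgue (g' ` box l u)"
    using gm by (simp add: img)
  also have "\<dots> = ennreal (measure lebesgue (g' ` box l u))"
    using measurable_linear_image[OF g' m] by (simp add: emeasure_eq_measure2)
  also have "measure lebesgue (g' ` box l u) = \<bar>det (matrix g')\<bar> * (\<Prod>b\<in>Basis. (u - l) \<bullet> b)"
    using lu by (simp add: measure_linear_image[OF g' m])
  finally have e: "emeasure lborel (g -` box l u) = ennreal (\<bar>det (matrix g')\<bar> * (\<Prod>b\<in>Basis. (u - l) \<bullet> b))" .
  have "emeasure (distr (density lborel (\<lambda>_. ennreal \<bar>det (matrix g)\<bar>)) borel g) (box l u) =
      ennreal \<bar>det (matrix g)\<bar> * emeasure lborel (g -` box l u)"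
    using gm by (simp add: emeasure_distr emeasure_density nn_integral_cmult)
  also have "\<dots> = ennreal (\<bar>det (matrix g)\<bar> * \<bar>det (matrix g')\<bar> * (\<Prod>b\<in>Basis. (u - l) \<bullet> b))"
    unfolding e by (subst ennreal_mult'[symmetric]) (auto simp: mult.assoc)
  finally show "emeasure (distr (density lborel (\<lambda>_. ennreal \<bar>det (matrix g)\<bar>)) borel g) (box l u) =
     ennreal (\<Prod>b\<in>Basis. (u - l) \<bullet> b)" using det by simp
qed simp

section \<open>Product coordinates on space and charts of planes\<close>

definition tri :: "(real \<times> real) \<times> real \<Rightarrow> real^3" where
  "tri p = vector [fst (fst p), snd (fst p), snd p]"

lemma tri_nth [simp]: "tri p $ 1 = fst (fst p)" "tri p $ 2 = snd (fst p)" "tri p $ 3 = snd p"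
  by (simp_all add: tri_def)

lemma linear_tri: "linear tri"
  by (auto simp: linear_iff vec_eq_iff forall_3)

lemma measurable_tri [measurable]: "tri \<in> borel_measurable borel"
  using linear_tri by (intro borel_measurable_continuous_onI linear_continuous_on) (simp add: linear_conv_bounded_linear)

lemma Basis_real3: "(Basis :: (real^3) set) = {axis 1 1, axis 2 1, axis 3 (1::real)} "
  by (auto simp: Basis_vec_def UNIV_3)

lemma lborel_tri: "(lborel :: (real^3) measure) = distr lborel borel tri"
proof (rule lborel_eqI)
  fix l u :: "real^3" assume lu: "\<And>b. b \<in> Basis \<Longrightarrow> l \<bullet> b \<le> u \<bullet> b"
  have le: "l $ 1 \<le> u $ 1" "l $ 2 \<le> u $ 2" "l $ 3 \<le> u $ 3"
    using lu[of "axis 1 1"] lu[of "axis 2 1"] lu[of "axis 3 1"] by (auto simp: Basis_real3 inner_axis)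
  have "tri -` box l u = box ((l $ 1, l $ 2), l $ 3) ((u $ 1, u $ 2), u $ 3)"
    by (auto simp: box_def Basis_real3 inner_axis Basis_prod_def inner_prod_def)
  then have "emeasure (distr lborel borel tri) (box l u) = emeasure lborel (box ((l $ 1, l $ 2), l $ 3) ((u $ 1, u $ 2), u $ 3))"
    by (simp add: emeasure_distr)
  also have "\<dots> = (u $ 1 - l $ 1) * (u $ 2 - l $ 2) * (u $ 3 - l $ 3)"
    using le by (auto simp: emeasure_lborel_box_eq Basis_prod_def inner_prod_def ennreal_mult'[symmetric] algebra_simps
        prod.union_disjoint mult.assoc)
  also have "\<dots> = (\<Prod>b\<in>Basis. (u - l) \<bullet> b)"
    by (simp add: Basis_real3 inner_axis axis_eq_axis inner_diff_left mult.assoc)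
  finally show "emeasure (distr lborel borel tri) (box l u) = (\<Prod>b\<in>Basis. (u - l) \<bullet> b)" .
qed simp

definition plane_chart :: "real^3^3 \<Rightarrow> real \<Rightarrow> real \<times> real \<Rightarrow> real^3" where
  "plane_chart R h y = R *v vector [fst y, snd y, h]"

lemma orthogonal_transformation_mult_vec:
  "orthogonal_matrix (R :: real^'n^'n) \<Longrightarrow> orthogonal_transformation ((*v) R)"
  by (simp add: orthogonal_transformation_matrix)

lemma plane_chart_isometric:
  assumes R: "orthogonal_matrix R"
  shows "isometric_plane (plane_chart R h)"
proof
  fix p q :: "real \<times> real"
  have "dist (plane_chart R h p) (plane_chart R h q) = norm (R *v (vector [fst p, snd p, h] - vector [fst q, snd q, h]))"
    by (simp add: plane_chart_def dist_norm matrix_vector_mult_diff_distrib)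
  also have "\<dots> = norm (vector [fst p, snd p, h] - vector [fst q, snd q, h] :: real^3)"
    by (rule orthogonal_transformation_norm[OF orthogonal_transformation_mult_vec[OF R]])
  also have "\<dots> = dist p q"
    by (simp add: norm_eq_sqrt_inner inner_vec_def sum_3 dist_prod_def dist_real_def power2_eq_square)
  finally show "dist (plane_chart R h p) (plane_chart R h q) = dist p q" .
qed

lemma orthogonal_inner_third:
  assumes R: "orthogonal_matrix R" and n: "R *v axis 3 1 = n"
  shows "n \<bullet> (R *v x) = x $ 3"
proof -
  have "n \<bullet> (R *v x) = axis 3 1 \<bullet> x"
    unfolding n[symmetric] using R
    by (metis orthogonal_transformation_mult_vec orthogonal_transformation_def)
  then show ?thesis by (simp add: inner_axis')
qed

lemma range_plane_chart:
  assumes R: "orthogonal_matrix R" and n: "R *v axis 3 1 = n"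
  shows "range (plane_chart R h) = {x. n \<bullet> x = h}"
proof (intro set_eqI iffI)
  fix x assume "x \<in> {x. n \<bullet> x = h}"
  then have h: "n \<bullet> x = h" by simp
  define y where "y = transpose R *v x"
  have x: "x = R *v y"
    using R unfolding y_def orthogonal_matrix_def
    by (simp add: matrix_vector_mul_assoc del: transpose_matrix_vector)
  then have "y $ 3 = h" using orthogonal_inner_third[OF R n, of y] h by simp
  then have "vector [y $ 1, y $ 2, h] = y" by (simp add: vec_eq_iff forall_3)
  then have "plane_chart R h (y $ 1, y $ 2) = x" by (simp add: plane_chart_def x)
  then show "x \<in> range (plane_chart R h)" by (metis rangeI)
qed (auto simp: plane_chart_def orthogonal_inner_third[OF R n])

text \<open>Oblique coordinates: a point of the plane and the distance travelled along
  \<open>v\<close>. Up to the rotation \<open>R\<close> and a translation the map is a triangular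
  matrix with diagonal 1, 1, \<open>n \<bullet> v\<close>, whence the Jacobian.\<close>

lemma lborel_plane_chart:
  assumes R: "orthogonal_matrix R" and n: "R *v axis 3 1 = n" and nv: "n \<bullet> v \<noteq> 0"
  shows "(lborel :: (real^3) measure) =
    distr (density lborel (\<lambda>_. ennreal \<bar>n \<bullet> v\<bar>)) borel (\<lambda>p. plane_chart R h (fst p) + snd p *\<^sub>R v)"
proof -
  define w where "w = transpose R *v v"
  have Rw: "R *v w = v"
    using R unfolding w_def orthogonal_matrix_def
    by (simp add: matrix_vector_mul_assoc del: transpose_matrix_vector)
  have w3: "w $ 3 = n \<bullet> v" using orthogonal_inner_third[OF R n, of w] Rw by simp
  define M :: "real^3^3" where "M = vector [vector [1, 0, w $ 1], vector [0, 1, w $ 2], vector [0, 0, w $ 3]]"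
  have detM: "det M = n \<bullet> v" by (simp add: M_def det_3 w3)
  define g where "g = (*v) (R ** M)"
  have g: "linear g" by (simp add: g_def)
  have "\<bar>det (matrix g)\<bar> = \<bar>n \<bullet> v\<bar>"
    using det_orthogonal_matrix[OF R] by (auto simp: g_def det_mul detM matrix_of_matrix_vector_mul)
  then have L: "(lborel :: (real^3) measure) = distr (density lborel (\<lambda>_. ennreal \<bar>n \<bullet> v\<bar>)) borel g"
    using lborel_distr_linear[OF g] nv by auto
  have Mt: "M *v tri p = vector [fst (fst p), snd (fst p), 0] + snd p *\<^sub>R w" for p
    by (simp add: vec_eq_iff forall_3 M_def matrix_vector_mult_def sum_3 mult.commute)
  have shift: "R *v vector [0, 0, h] + g (tri p) = plane_chart R h (fst p) + snd p *\<^sub>R v" for p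
  proof -
    have "R *v vector [0, 0, h] + g (tri p) = R *v (vector [0, 0, h] + (vector [fst (fst p), snd (fst p), 0] + snd p *\<^sub>R w))"
      by (simp add: g_def Mt matrix_vector_right_distrib flip: matrix_vector_mul_assoc)
    also have "vector [0, 0, h] + (vector [fst (fst p), snd (fst p), 0] + snd p *\<^sub>R w) =
        vector [fst (fst p), snd (fst p), h] + snd p *\<^sub>R w"
      by (simp add: vec_eq_iff forall_3)
    finally show ?thesis
      by (simp add: plane_chart_def matrix_vector_right_distrib Rw matrix_vector_mult_scaleR)
  qed
  have [measurable]: "g \<in> borel_measurable borel"
    using g by (intro borel_measurable_continuous_onI linear_continuous_on) (simp add: linear_conv_bounded_linear)
  have "(lborel :: (real^3) measure) = distr lborel borel (\<lambda>x. R *v vector [0, 0, h] + x)"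
    by (rule lborel_distr_plus[symmetric])
  also have "\<dots> = distr (distr (density lborel (\<lambda>_. ennreal \<bar>n \<bullet> v\<bar>)) borel g) borel (\<lambda>x. R *v vector [0, 0, h] + x)"
    using L by simp
  also have "density (lborel :: (real^3) measure) (\<lambda>_. ennreal \<bar>n \<bullet> v\<bar>) =
      distr (density lborel (\<lambda>_. ennreal \<bar>n \<bullet> v\<bar>)) borel tri"
    by (subst lborel_tri) (simp add: density_distr)
  also have "distr (distr (distr (density lborel (\<lambda>_. ennreal \<bar>n \<bullet> v\<bar>)) borel tri) borel g) borel (\<lambda>x. R *v vector [0, 0, h] + x) =
      distr (density lborel (\<lambda>_. ennreal \<bar>n \<bullet> v\<bar>)) borel (\<lambda>p. plane_chart R h (fst p) + snd p *\<^sub>R v)"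
    by (simp add: distr_distr o_def shift)
  finally show ?thesis .
qed

section \<open>Integrals of directional derivatives over half-infinite prisms\<close>

definition shadow :: "'a::real_vector set \<Rightarrow> 'a \<Rightarrow> 'a set" where
  "shadow F v = {x. \<exists>s\<ge>0. x - s *\<^sub>R v \<in> F}"

lemma derivative_zero_off_support:
  fixes u :: "'a::euclidean_space \<Rightarrow> real"
  assumes der: "(u has_derivative D) (at x)" and K: "closed K" "\<And>y. y \<notin> K \<Longrightarrow> u y = 0" "x \<notin> K"
  shows "D v = 0"
proof -
  have "(u has_derivative (\<lambda>_. 0)) (at x)"
    by (rule has_derivative_transform_within_open[of "\<lambda>_. 0" _ _ _ "- K"]) (use K in auto)
  then have "D = (\<lambda>_. 0)" using der has_derivative_unique by blast
  then show ?thesis by simp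
qed

lemma ray_integral:
  fixes u :: "'a::euclidean_space \<Rightarrow> real"
  assumes der: "\<And>x. (u has_derivative D x) (at x)" and cont: "continuous_on UNIV (\<lambda>x. D x v)"
    and K: "compact K" "\<And>x. x \<notin> K \<Longrightarrow> u x = 0" and v: "v \<noteq> 0"
  shows "(LINT s|lborel. indicator {0..} s * D (p + s *\<^sub>R v) v) = - u p"
proof -
  obtain B where B: "\<And>x. x \<in> K \<Longrightarrow> norm x \<le> B" "0 < B"
    using compact_imp_bounded[OF K(1)] bounded_pos by blast
  \<comment> \<open>Beyond the parameter \<open>M\<close> the ray has left the ball of radius
    \<open>B\<close> that contains the support.\<close>
  define M where "M = (B + norm p + 1) / norm v"
  have "0 < M" unfolding M_def using B(2) v norm_ge_zero[of p]
    by (intro divide_pos_pos) (simp_all del: norm_ge_zero)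
  have out: "p + s *\<^sub>R v \<notin> K" if "M \<le> s" for s
  proof
    assume "p + s *\<^sub>R v \<in> K"
    then have "norm (p + s *\<^sub>R v) \<le> B" by (rule B)
    moreover have "norm (s *\<^sub>R v) \<le> norm (p + s *\<^sub>R v) + norm p"
      using norm_triangle_ineq4[of "p + s *\<^sub>R v" p] by simp
    moreover have "B + norm p + 1 \<le> s * norm v"
      using that v by (simp add: M_def field_simps)
    moreover have "norm (s *\<^sub>R v) = s * norm v" using that \<open>0 < M\<close> by simp
    ultimately show False by linarith
  qed
  have D0: "D x v = 0" if "x \<notin> K" for x
    using derivative_zero_off_support[OF der compact_imp_closed[OF K(1)] K(2) that] .
  have "(LINT s|lborel. indicator {0..} s * D (p + s *\<^sub>R v) v) = (LINT s|lborel. indicator {0..M} s *\<^sub>R D (p + s *\<^sub>R v) v)"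
    using D0[OF out] by (intro Bochner_Integration.integral_cong refl) (auto simp: indicator_def)
  also have "\<dots> = u (p + M *\<^sub>R v) - u (p + 0 *\<^sub>R v)"
  proof (rule integral_FTC_atLeastAtMost)
    show "0 \<le> M" using \<open>0 < M\<close> by simp
    fix s
    have "((\<lambda>s. u (p + s *\<^sub>R v)) has_derivative (\<lambda>t. D (p + s *\<^sub>R v) (t *\<^sub>R v))) (at s within {0..M})"
      by (rule has_derivative_compose[of "\<lambda>s. p + s *\<^sub>R v" _ _ _ u]) (auto intro!: derivative_eq_intros der)
    moreover have "D (p + s *\<^sub>R v) (t *\<^sub>R v) = t *\<^sub>R D (p + s *\<^sub>R v) v" for t
      using has_derivative_linear[OF der] by (simp add: linear_cmul)
    ultimately show "((\<lambda>s. u (p + s *\<^sub>R v)) has_vector_derivative D (p + s *\<^sub>R v) v) (at s within {0..M})"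
      by (simp add: has_vector_derivative_def)
  next
    show "continuous_on {0..M} (\<lambda>s. D (p + s *\<^sub>R v) v)"
      by (rule continuous_on_compose2[OF cont]) (auto intro!: continuous_intros)
  qed
  also have "\<dots> = - u p" using K(2)[OF out[of M]] by simp
  finally show ?thesis .
qed

lemma
  fixes g :: "real^3 \<Rightarrow> real"
  assumes R: "orthogonal_matrix R" "R *v axis 3 1 = n" and nv: "n \<bullet> v \<noteq> 0" and g: "g \<in> borel_measurable borel"
  shows integral_plane_chart: "integral\<^sup>L lborel g =
      \<bar>n \<bullet> v\<bar> * (LINT p|lborel. g (plane_chart R h (fst p) + snd p *\<^sub>R v))"
    and integrable_plane_chart: "integrable lborel g \<Longrightarrow>
      integrable lborel (\<lambda>p. g (plane_chart R h (fst p) + snd p *\<^sub>R v))"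
proof -
  interpret isometric_plane "plane_chart R h" by (rule plane_chart_isometric[OF R(1)])
  have [measurable]: "(\<lambda>p. plane_chart R h (fst p) + snd p *\<^sub>R v) \<in> borel_measurable borel"
    by (intro borel_measurable_continuous_onI continuous_intros continuous_on_compose2[OF continuous_psi]) auto
  note [measurable] = g
  note L = lborel_plane_chart[OF R nv, of h]
  show "integral\<^sup>L lborel g = \<bar>n \<bullet> v\<bar> * (LINT p|lborel. g (plane_chart R h (fst p) + snd p *\<^sub>R v))"
    by (subst L) (simp add: integral_distr integral_density)
  show "integrable lborel (\<lambda>p. g (plane_chart R h (fst p) + snd p *\<^sub>R v))" if "integrable lborel g"
    using that nv by (subst (asm) L) (simp add: integrable_distr_eq integrable_density)
qed

context
  fixes u :: "real^3 \<Rightarrow> real" and D :: "real^3 \<Rightarrow> real^3 \<Rightarrow> real" and K :: "(real^3) set" and n v :: "real^3"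
    and F :: "(real^3) set" and h :: real
  assumes der: "\<And>x. (u has_derivative D x) (at x)" and cont: "continuous_on UNIV (\<lambda>x. D x v)"
    and K: "compact K" "\<And>x. x \<notin> K \<Longrightarrow> u x = 0"
    and n: "norm n = 1" and nv: "n \<bullet> v \<noteq> 0" and F: "F \<in> sets borel" "F \<subseteq> {x. n \<bullet> x = h}"
begin

text \<open>The equation of the plane determines the parameter as a function of the point, so
  membership is a Borel condition without a quantifier.\<close>

lemma sets_shadow: "shadow F v \<in> sets borel"
proof -
  define s where "s x = (n \<bullet> x - h) / (n \<bullet> v)" for x
  have "shadow F v = {x \<in> space borel. 0 \<le> s x \<and> x - s x *\<^sub>R v \<in> F}"
  proof (intro set_eqI iffI)
    fix x assume "x \<in> shadow F v"
    then obtain t where t: "0 \<le> t" "x - t *\<^sub>R v \<in> F" by (auto simp: shadow_def)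
    then have "n \<bullet> x - t * (n \<bullet> v) = h" using F(2) by (auto simp: inner_diff_right)
    then have "t = s x" using nv by (auto simp: s_def field_simps)
    then show "x \<in> {x \<in> space borel. 0 \<le> s x \<and> x - s x *\<^sub>R v \<in> F}" using t by simp
  qed (auto simp: shadow_def)
  also have "\<dots> \<in> sets borel" using F(1) unfolding s_def by measurable
  finally show ?thesis .
qed

lemma integrable_shadow: "integrable lborel (\<lambda>x. indicator (shadow F v) x * D x v)"
proof (rule Bochner_Integration.integrable_bound)
  show "integrable lborel (\<lambda>x. indicator K x *\<^sub>R D x v)"
    using K(1) cont by (intro borel_integrable_compact) (auto intro: continuous_on_subset)
  show "(\<lambda>x. indicator (shadow F v) x * D x v) \<in> borel_measurable lborel"
    using sets_shadow borel_measurable_continuous_onI[OF cont] by simp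
  have "D x v = 0" if "x \<notin> K" for x
    using derivative_zero_off_support[OF der compact_imp_closed[OF K(1)] K(2) that] .
  then show "AE x in lborel. norm (indicator (shadow F v) x * D x v) \<le> norm (indicator K x *\<^sub>R D x v)"
    by (auto simp: indicator_def)
qed

text \<open>Fubini in the oblique coordinates: a ray starting at a point \<open>p\<close> of
  \<open>F\<close> contributes \<open>- u p\<close> by the fundamental theorem of calculus, and the
  Jacobian contributes the factor in front.\<close>

lemma integral_shadow:
  "(LINT x|lborel. indicator (shadow F v) x * D x v) = - \<bar>n \<bullet> v\<bar> * (LINT x:F|hausdorff2. u x)"
proof -
  obtain R where R: "orthogonal_matrix R" "R *v axis 3 1 = n"
    using orthogonal_matrix_exists_basis[OF n] by blast
  interpret isometric_plane "plane_chart R h" by (rule plane_chart_isometric[OF R(1)])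
  have Fr: "F \<subseteq> range (plane_chart R h)" using F(2) range_plane_chart[OF R] by simp
  have nc: "n \<bullet> plane_chart R h y = h" for y using range_plane_chart[OF R, of h] by auto
  define g where "g x = indicator (shadow F v) x * D x v" for x
  have g: "integrable lborel g" unfolding g_def by (rule integrable_shadow)
  have g_chart: "g (plane_chart R h y + s *\<^sub>R v) =
      indicator F (plane_chart R h y) * (indicator {0..} s * D (plane_chart R h y + s *\<^sub>R v) v)" for y s
  proof -
    have "plane_chart R h y + s *\<^sub>R v \<in> shadow F v \<longleftrightarrow> 0 \<le> s \<and> plane_chart R h y \<in> F"
    proof
      assume "plane_chart R h y + s *\<^sub>R v \<in> shadow F v"
      then obtain t where t: "0 \<le> t" "plane_chart R h y + s *\<^sub>R v - t *\<^sub>R v \<in> F" by (auto simp: shadow_def)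
      then have "n \<bullet> (plane_chart R h y + s *\<^sub>R v - t *\<^sub>R v) = h" using F(2) by auto
      then have "s = t" using nc[of y] nv by (simp add: inner_simps)
      then show "0 \<le> s \<and> plane_chart R h y \<in> F" using t by simp
    qed (auto simp: shadow_def)
    then show ?thesis by (auto simp: g_def indicator_def)
  qed
  have "integrable (lborel \<Otimes>\<^sub>M lborel) (\<lambda>p. g (plane_chart R h (fst p) + snd p *\<^sub>R v))"
    unfolding lborel_prod by (rule integrable_plane_chart[OF R nv _ g]) (use g in simp)
  from lborel_pair.integral_fst'[OF this]
  have "(LINT p|lborel. g (plane_chart R h (fst p) + snd p *\<^sub>R v)) =
      (LINT y|lborel. LINT s|lborel. g (plane_chart R h y + s *\<^sub>R v))"
    by (simp add: lborel_prod)
  also have "\<dots> = (LINT y|lborel. indicator F (plane_chart R h y) * (- u (plane_chart R h y)))"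
  proof -
    have "v \<noteq> 0" using nv by auto
    then show ?thesis unfolding g_chart by (simp add: ray_integral[OF der cont K])
  qed
  also have "\<dots> = - (LINT y|lborel. indicator F (plane_chart R h y) *\<^sub>R u (plane_chart R h y))"
    by (simp flip: Bochner_Integration.integral_minus)
  also have "(LINT y|lborel. indicator F (plane_chart R h y) *\<^sub>R u (plane_chart R h y)) = (LINT x:F|hausdorff2. u x)"
  proof (rule set_integral_hausdorff2_plane[OF F(1) Fr, symmetric])
    have "continuous_on UNIV u" using der has_derivative_continuous_on by (meson has_derivative_at_withinI)
    then show "u \<in> borel_measurable borel" by (rule borel_measurable_continuous_onI)
  qed
  finally have "integral\<^sup>L lborel g = - \<bar>n \<bullet> v\<bar> * (LINT x:F|hausdorff2. u x)"
    using integral_plane_chart[OF R nv borel_measurable_integrable[OF g, simplified], of h] by simp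
  then show ?thesis unfolding g_def .
qed

end

text \<open>Along the line through a generic point \<open>x\<close>, the polytope is a parameter interval whose ends lie on
  exactly one face each, so \<open>x\<close> is in the shadow of exactly one face of either kind.\<close>

locale polytope =
  fixes I :: "'i set" and n :: "'i \<Rightarrow> real^3" and h :: "'i \<Rightarrow> real" and E :: "(real^3) set"
  assumes finite_I: "finite I" and norm_n: "\<And>i. i \<in> I \<Longrightarrow> norm (n i) = 1" and inj_n: "inj_on n I"
    and E_def: "E = {x. \<forall>i\<in>I. n i \<bullet> x \<le> h i}" and bounded_E: "bounded E"
begin

definition face :: "'i \<Rightarrow> (real^3) set" where "face i = {x \<in> E. n i \<bullet> x = h i}"

lemma closed_E: "closed E"
proof -
  have "E = (\<Inter>i\<in>I. {x. n i \<bullet> x \<le> h i})" by (auto simp: E_def)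
  then show ?thesis using closed_halfspace_le by (auto intro!: closed_INT)
qed

lemma compact_face: "compact (face i)"
proof -
  have "face i = E \<inter> {x. n i \<bullet> x = h i}" by (auto simp: face_def)
  then show ?thesis
    using closed_E bounded_E closed_hyperplane by (metis bounded_Int closed_Int compact_eq_bounded_closed)
qed

lemma sets_face [measurable]: "face i \<in> sets borel"
  using compact_face compact_imp_closed borel_closed by blast

lemma face_sub_plane: "face i \<subseteq> {x. n i \<bullet> x = h i}" by (auto simp: face_def)

text \<open>The parameter s at which \<open>x - s *\<^sub>R v\<close> lies on the plane of
  \<open>i\<close>. It is a lower bound for the parameters inside the half space when
  \<open>n i \<bullet> v\<close> is positive and an upper bound when it is negative.\<close>

definition exit_time :: "real^3 \<Rightarrow> real^3 \<Rightarrow> 'i \<Rightarrow> real" where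
  "exit_time v x i = (n i \<bullet> x - h i) / (n i \<bullet> v)"

lemma shadow_face_iff:
  assumes "i \<in> I" "n i \<bullet> v \<noteq> 0"
  shows "x \<in> shadow (face i) v \<longleftrightarrow> 0 \<le> exit_time v x i \<and> x - exit_time v x i *\<^sub>R v \<in> E"
proof
  assume "x \<in> shadow (face i) v"
  then obtain s where s: "0 \<le> s" "x - s *\<^sub>R v \<in> face i" by (auto simp: shadow_def)
  then have "s = exit_time v x i" using assms by (auto simp: face_def exit_time_def inner_simps field_simps)
  then show "0 \<le> exit_time v x i \<and> x - exit_time v x i *\<^sub>R v \<in> E" using s by (auto simp: face_def)
next
  assume *: "0 \<le> exit_time v x i \<and> x - exit_time v x i *\<^sub>R v \<in> E"
  then have "x - exit_time v x i *\<^sub>R v \<in> face i"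
    using assms by (auto simp: face_def exit_time_def inner_simps field_simps)
  then show "x \<in> shadow (face i) v" using * by (auto simp: shadow_def)
qed

text \<open>If the line meets \<open>E\<close>, its parameters in \<open>E\<close> run from \<tau>
  a, the largest lower bound, to \<tau> b, the least upper bound. Then \<open>x\<close> is in the
  shadow of face b iff 0 \<le> \<tau> b and in that of face a iff 0 \<le> \<tau> a, and the
  difference detects whether 0 lies in the interval.\<close>

lemma indicator_eq_shadows:
  assumes v: "v \<noteq> 0" and nonzero: "\<And>i. i \<in> I \<Longrightarrow> n i \<bullet> v \<noteq> 0 \<Longrightarrow> n i \<bullet> x \<noteq> h i"
    and generic: "\<And>i j. i \<in> I \<Longrightarrow> j \<in> I \<Longrightarrow> 0 < (n i \<bullet> v) * (n j \<bullet> v) \<Longrightarrow> exit_time v x i = exit_time v x j \<Longrightarrow> i = j"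
  shows "(indicator E x :: real) = (\<Sum>i | i \<in> I \<and> n i \<bullet> v < 0. indicator (shadow (face i) v) x)
       - (\<Sum>i | i \<in> I \<and> 0 < n i \<bullet> v. indicator (shadow (face i) v) x)"
proof -
  let ?\<tau> = "exit_time v x"
  define P N where "P = {i \<in> I. 0 < n i \<bullet> v}" and "N = {i \<in> I. n i \<bullet> v < 0}"
  have fin: "finite P" "finite N" using finite_I by (auto simp: P_def N_def)
  define Z where "Z \<longleftrightarrow> (\<forall>i\<in>I. n i \<bullet> v = 0 \<longrightarrow> n i \<bullet> x \<le> h i)"
  have L: "x - s *\<^sub>R v \<in> E \<longleftrightarrow> Z \<and> (\<forall>i\<in>P. ?\<tau> i \<le> s) \<and> (\<forall>i\<in>N. s \<le> ?\<tau> i)" for s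
  proof -
    have c: "n i \<bullet> (x - s *\<^sub>R v) \<le> h i \<longleftrightarrow>
        (n i \<bullet> v = 0 \<longrightarrow> n i \<bullet> x \<le> h i) \<and> (0 < n i \<bullet> v \<longrightarrow> ?\<tau> i \<le> s) \<and> (n i \<bullet> v < 0 \<longrightarrow> s \<le> ?\<tau> i)" for i
      by (cases "n i \<bullet> v" "0::real" rule: linorder_cases)
        (auto simp: exit_time_def inner_simps field_simps)
    show ?thesis unfolding E_def P_def N_def Z_def by (auto simp: c)
  qed
  show ?thesis
  proof (cases "\<exists>s. x - s *\<^sub>R v \<in> E")
    case False
    then have "x \<notin> E" by (metis diff_zero scaleR_zero_left)
    moreover have "x \<notin> shadow (face i) v" if "i \<in> I" for i
      using False by (auto simp: shadow_def face_def)
    ultimately show ?thesis by (simp add: indicator_def)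
  next
    case True
    then obtain s0 where s0: "x - s0 *\<^sub>R v \<in> E" by auto
    then have Z using L by auto
    obtain B where B: "\<And>y. y \<in> E \<Longrightarrow> norm y \<le> B" using bounded_E bounded_iff by blast
    have bd: "\<bar>s\<bar> * norm v \<le> B + norm x" if "x - s *\<^sub>R v \<in> E" for s
      using B[OF that] norm_triangle_ineq4[of x "x - s *\<^sub>R v"] by simp
    define C where "C = (B + norm x) / norm v + 1"
    have bd': "\<bar>s\<bar> < C" if "x - s *\<^sub>R v \<in> E" for s
    proof -
      have "0 < norm v" using v by simp
      then have "\<bar>s\<bar> \<le> (B + norm x) / norm v" using bd[OF that] by (simp add: pos_le_divide_eq)
      then show ?thesis by (simp add: C_def)
    qed
    \<comment> \<open>Without a bound on one side a whole ray of the line would lie in the bounded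
      set \<open>E\<close>.\<close>
    have "P \<noteq> {}"
    proof
      assume "P = {}"
      then have "x - (min s0 (- C)) *\<^sub>R v \<in> E" using s0 L by auto
      then show False using bd' by fastforce
    qed
    moreover have "N \<noteq> {}"
    proof
      assume "N = {}"
      then have "x - (max s0 C) *\<^sub>R v \<in> E" using s0 L by auto
      then show False using bd' by fastforce
    qed
    ultimately have "Max (?\<tau> ` P) \<in> ?\<tau> ` P" "Min (?\<tau> ` N) \<in> ?\<tau> ` N"
      using fin by (intro Max_in Min_in; simp)+
    then obtain a b where "a \<in> P" "?\<tau> a = Max (?\<tau> ` P)" "b \<in> N" "?\<tau> b = Min (?\<tau> ` N)" by force
    then have a: "a \<in> P" "\<And>i. i \<in> P \<Longrightarrow> ?\<tau> i \<le> ?\<tau> a" and b: "b \<in> N" "\<And>i. i \<in> N \<Longrightarrow> ?\<tau> b \<le> ?\<tau> i"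
      using fin by auto
    have L': "x - s *\<^sub>R v \<in> E \<longleftrightarrow> ?\<tau> a \<le> s \<and> s \<le> ?\<tau> b" for s
      using L \<open>Z\<close> a b by (meson order_trans)
    have ab: "?\<tau> a \<le> ?\<tau> b" using s0 L' by force
    have P: "x \<in> shadow (face i) v \<longleftrightarrow> i = a \<and> 0 \<le> ?\<tau> a" if "i \<in> P" for i
    proof -
      have "i \<in> I" "n i \<bullet> v \<noteq> 0" using that by (auto simp: P_def)
      from shadow_face_iff[OF this, of x]
      have iff: "x \<in> shadow (face i) v \<longleftrightarrow> 0 \<le> ?\<tau> i \<and> ?\<tau> a \<le> ?\<tau> i \<and> ?\<tau> i \<le> ?\<tau> b"
        unfolding L' .
      have eq: "i = a" if "?\<tau> i = ?\<tau> a"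
        using generic[of i a] \<open>i \<in> P\<close> that a(1) by (auto simp: P_def)
      show ?thesis
      proof (cases "i = a")
        case True then show ?thesis using iff ab by auto
      next
        case False
        then have "?\<tau> i \<noteq> ?\<tau> a" using eq by blast
        then show ?thesis using iff False a(2)[OF \<open>i \<in> P\<close>] by auto
      qed
    qed
    have N: "x \<in> shadow (face i) v \<longleftrightarrow> i = b \<and> 0 \<le> ?\<tau> b" if "i \<in> N" for i
    proof -
      have "i \<in> I" "n i \<bullet> v \<noteq> 0" using that by (auto simp: N_def)
      from shadow_face_iff[OF this, of x]
      have iff: "x \<in> shadow (face i) v \<longleftrightarrow> 0 \<le> ?\<tau> i \<and> ?\<tau> a \<le> ?\<tau> i \<and> ?\<tau> i \<le> ?\<tau> b"
        unfolding L' .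
      have eq: "i = b" if "?\<tau> i = ?\<tau> b"
        using generic[of i b] \<open>i \<in> N\<close> that b(1) by (auto simp: N_def mult_neg_neg)
      show ?thesis
      proof (cases "i = b")
        case True then show ?thesis using iff ab by auto
      next
        case False
        then have "?\<tau> i \<noteq> ?\<tau> b" using eq by blast
        then show ?thesis using iff False b(2)[OF \<open>i \<in> N\<close>] by auto
      qed
    qed
    have "(\<Sum>i\<in>P. indicator (shadow (face i) v) x) = (\<Sum>i\<in>P. if i = a then (if 0 \<le> ?\<tau> a then 1 else 0) else (0::real))"
      using P by (intro sum.cong) (auto simp: indicator_def)
    also have "\<dots> = (if 0 \<le> ?\<tau> a then 1 else 0)" using fin a(1) by simp
    finally have sP: "(\<Sum>i\<in>P. indicator (shadow (face i) v) x) = (if 0 \<le> ?\<tau> a then 1 else (0::real))" .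
    have "(\<Sum>i\<in>N. indicator (shadow (face i) v) x) = (\<Sum>i\<in>N. if i = b then (if 0 \<le> ?\<tau> b then 1 else 0) else (0::real))"
      using N by (intro sum.cong) (auto simp: indicator_def)
    also have "\<dots> = (if 0 \<le> ?\<tau> b then 1 else 0)" using fin b(1) by simp
    finally have sN: "(\<Sum>i\<in>N. indicator (shadow (face i) v) x) = (if 0 \<le> ?\<tau> b then 1 else (0::real))" .
    \<comment> \<open>If \<tau> a vanished, \<open>x\<close> would lie in both shadows and in
      \<open>E\<close>, and the identity would fail.\<close>
    have "?\<tau> a \<noteq> 0" using nonzero[of a] a(1) by (auto simp: P_def exit_time_def)
    moreover have "x \<in> E \<longleftrightarrow> ?\<tau> a \<le> 0 \<and> 0 \<le> ?\<tau> b" using L'[of 0] by simp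
    ultimately have "(indicator E x :: real) = (\<Sum>i\<in>N. indicator (shadow (face i) v) x) - (\<Sum>i\<in>P. indicator (shadow (face i) v) x)"
      unfolding sP sN using ab by (auto simp: indicator_def)
    then show ?thesis by (simp add: P_def N_def)
  qed
qed

text \<open>Exceptional points lie in finitely many planes: those of the faces, and those where two
  exit times of the same kind agree. The latter are planes because distinct unit normals are not
  positive multiples of each other.\<close>

lemma AE_indicator_eq_shadows:
  assumes v: "v \<noteq> 0"
  shows "AE x in lborel. (indicator E x :: real) = (\<Sum>i | i \<in> I \<and> n i \<bullet> v < 0. indicator (shadow (face i) v) x)
       - (\<Sum>i | i \<in> I \<and> 0 < n i \<bullet> v. indicator (shadow (face i) v) x)"
proof -
  have hyper: "AE x in lborel. a \<bullet> x \<noteq> c" if "a \<noteq> 0" for a :: "real^3" and c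
  proof -
    have "{x. a \<bullet> x = c} \<in> null_sets lebesgue"
      using negligible_hyperplane[of a c] that by (simp add: negligible_iff_null_sets)
    moreover have "{x. a \<bullet> x = c} \<in> sets borel" by (intro borel_closed closed_hyperplane)
    ultimately have "{x. a \<bullet> x = c} \<in> null_sets lborel" by (auto simp: null_sets_def)
    then show ?thesis by (rule AE_I') auto
  qed
  have 1: "AE x in lborel. \<forall>i\<in>I. n i \<bullet> v \<noteq> 0 \<longrightarrow> n i \<bullet> x \<noteq> h i"
    using finite_I norm_n by (intro AE_finite_allI) (auto intro!: hyper)
  have 2: "AE x in lborel. \<forall>i\<in>I. \<forall>j\<in>I. 0 < (n i \<bullet> v) * (n j \<bullet> v) \<longrightarrow> exit_time v x i = exit_time v x j \<longrightarrow> i = j"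
  proof (intro AE_finite_allI[OF finite_I])
    fix i j assume ij: "i \<in> I" "j \<in> I"
    show "AE x in lborel. 0 < (n i \<bullet> v) * (n j \<bullet> v) \<longrightarrow> exit_time v x i = exit_time v x j \<longrightarrow> i = j"
    proof (cases "0 < (n i \<bullet> v) * (n j \<bullet> v) \<and> i \<noteq> j")
      case True
      define a where "a = (n j \<bullet> v) *\<^sub>R n i - (n i \<bullet> v) *\<^sub>R n j"
      have "a \<noteq> 0"
      proof
        assume "a = 0"
        then have eq: "(n j \<bullet> v) *\<^sub>R n i = (n i \<bullet> v) *\<^sub>R n j" by (simp add: a_def)
        then have "\<bar>n j \<bullet> v\<bar> = \<bar>n i \<bullet> v\<bar>" using norm_n ij by (metis norm_scaleR mult.right_neutral)
        then have "n j \<bullet> v = n i \<bullet> v" using True by (auto simp: abs_if zero_less_mult_iff split: if_splits)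
        then have "n i = n j" using eq True by auto
        then show False using inj_n ij True by (auto dest: inj_onD)
      qed
      then have "AE x in lborel. a \<bullet> x \<noteq> (n j \<bullet> v) * h i - (n i \<bullet> v) * h j" by (rule hyper)
      then show ?thesis
      proof eventually_elim
        case (elim x)
        have "n i \<bullet> v \<noteq> 0" "n j \<bullet> v \<noteq> 0" using True by auto
        then have "exit_time v x i \<noteq> exit_time v x j"
          using elim by (auto simp: exit_time_def a_def inner_simps field_simps)
        then show ?case by simp
      qed
    qed auto
  qed
  show ?thesis using 1 2
  proof eventually_elim
    case (elim x)
    then show ?case by (intro indicator_eq_shadows[OF v]) auto
  qed
qed

text \<open>Both the sign with which a shadow enters and the factor
  \<open>- \<bar>n i \<bullet> v\<bar>\<close> depend on the sign of \<open>n i \<bullet> v\<close>;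
  their product is \<open>n i \<bullet> v\<close> in either case, and faces parallel to
  \<open>v\<close> contribute zero.\<close>

lemma integral_directional:
  assumes der: "\<And>x. (u has_derivative D x) (at x)" and cont: "continuous_on UNIV (\<lambda>x. D x v)"
    and K: "compact K" "\<And>x. x \<notin> K \<Longrightarrow> u x = 0" and v: "v \<noteq> 0"
  shows "(LINT x|lborel. indicator E x * D x v) = (\<Sum>i\<in>I. (n i \<bullet> v) * (LINT x:face i|hausdorff2. u x))"
proof -
  note f = der cont K norm_n _ sets_face face_sub_plane
  define P N where "P = {i \<in> I. 0 < n i \<bullet> v}" and "N = {i \<in> I. n i \<bullet> v < 0}"
  have fin: "finite P" "finite N" using finite_I by (auto simp: P_def N_def)
  let ?S = "\<lambda>i x. indicator (shadow (face i) v) x * D x v"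
  have int: "integrable lborel (?S i)" "(LINT x|lborel. ?S i x) = - \<bar>n i \<bullet> v\<bar> * (LINT x:face i|hausdorff2. u x)"
    if "i \<in> P \<union> N" for i
  proof -
    have i: "i \<in> I" "n i \<bullet> v \<noteq> 0" using that by (auto simp: P_def N_def)
    show "integrable lborel (?S i)" by (rule integrable_shadow[OF f]) (use i in auto)
    show "(LINT x|lborel. ?S i x) = - \<bar>n i \<bullet> v\<bar> * (LINT x:face i|hausdorff2. u x)"
      by (rule integral_shadow[OF f]) (use i in auto)
  qed
  have "(LINT x|lborel. indicator E x * D x v) = (LINT x|lborel. (\<Sum>i\<in>N. ?S i x) - (\<Sum>i\<in>P. ?S i x))"
  proof (rule integral_cong_AE)
    have [measurable]: "(\<lambda>x. D x v) \<in> borel_measurable borel" using cont by (rule borel_measurable_continuous_onI)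
    have [measurable]: "E \<in> sets borel" using closed_E by simp
    show "(\<lambda>x. indicator E x * D x v) \<in> borel_measurable lborel" by simp
    show "(\<lambda>x. (\<Sum>i\<in>N. ?S i x) - (\<Sum>i\<in>P. ?S i x)) \<in> borel_measurable lborel"
      using int(1) by (intro borel_measurable_diff borel_measurable_sum) auto
    show "AE x in lborel. indicator E x * D x v = (\<Sum>i\<in>N. ?S i x) - (\<Sum>i\<in>P. ?S i x)"
      using AE_indicator_eq_shadows[OF v]
      by eventually_elim (simp add: P_def N_def sum_distrib_right left_diff_distrib)
  qed
  also have "\<dots> = (\<Sum>i\<in>N. LINT x|lborel. ?S i x) - (\<Sum>i\<in>P. LINT x|lborel. ?S i x)"
    using int(1) by (subst Bochner_Integration.integral_diff) (auto intro!: Bochner_Integration.integrable_sum)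
  also have "\<dots> = (\<Sum>i\<in>N. (n i \<bullet> v) * (LINT x:face i|hausdorff2. u x)) + (\<Sum>i\<in>P. (n i \<bullet> v) * (LINT x:face i|hausdorff2. u x))"
    using int(2) by (simp add: sum_negf[symmetric] P_def N_def)
  also have "\<dots> = (\<Sum>i\<in>N \<union> P. (n i \<bullet> v) * (LINT x:face i|hausdorff2. u x))"
    using fin by (intro sum.union_disjoint[symmetric]) (auto simp: P_def N_def)
  also have "\<dots> = (\<Sum>i\<in>I. (n i \<bullet> v) * (LINT x:face i|hausdorff2. u x))"
    using finite_I by (intro sum.mono_neutral_left) (auto simp: P_def N_def)
  finally show ?thesis .
qed

end

section \<open>The reduced boundary of a polytope\<close>

text \<open>A continuously differentiable function vanishing on the nonpositive half line: the
  building block of the test fields, and later an antiderivative of twice the positive part.\<close>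

definition ramp2 :: "real \<Rightarrow> real" where "ramp2 t = (max 0 t)\<^sup>2"

lemma DERIV_ramp2: "(ramp2 has_real_derivative 2 * max 0 t) (at t)"
proof (cases t "0::real" rule: linorder_cases)
  case less
  have "(ramp2 has_real_derivative 0) (at t)"
    by (rule has_field_derivative_transform_within_open[of "\<lambda>_. 0" _ _ "{..<0}"])
      (use less in \<open>auto simp: ramp2_def\<close>)
  then show ?thesis using less by simp
next
  case greater
  have "((\<lambda>t. t\<^sup>2) has_real_derivative 2 * t) (at t)" by (auto intro!: derivative_eq_intros)
  then have "(ramp2 has_real_derivative 2 * t) (at t)"
    by (rule has_field_derivative_transform_within_open[of _ _ _ "{0<..}"])
      (use greater in \<open>auto simp: ramp2_def\<close>)
  then show ?thesis using greater by simp
next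
  case equal
  have "((\<lambda>s. (ramp2 (0 + s) - ramp2 0) / s) \<longlongrightarrow> 0) (at 0)"
  proof (rule Lim_null_comparison)
    show "\<forall>\<^sub>F s in at 0. norm ((ramp2 (0 + s) - ramp2 0) / s) \<le> \<bar>s\<bar>"
    proof (rule always_eventually, rule allI)
      fix s :: real
      have "(max 0 s)\<^sup>2 \<le> \<bar>s\<bar> * \<bar>s\<bar>" by (auto simp: max_def power2_eq_square)
      then show "norm ((ramp2 (0 + s) - ramp2 0) / s) \<le> \<bar>s\<bar>"
        by (cases "s = 0") (auto simp: ramp2_def pos_divide_le_eq)
    qed
    show "((\<lambda>s::real. \<bar>s\<bar>) \<longlongrightarrow> 0) (at 0)" by (rule tendsto_eq_intros | simp)+
  qed
  then show ?thesis using equal by (simp add: DERIV_def)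
qed

text \<open>A continuously differentiable approximation from below to the indicator of the positive
  half line.\<close>

definition soft_step :: "nat \<Rightarrow> real \<Rightarrow> real" where "soft_step k t = 1 - exp (- (real k * ramp2 t))"

lemma DERIV_soft_step: "(soft_step k has_real_derivative (2 * real k * max 0 t * exp (- (real k * ramp2 t)))) (at t)"
  unfolding soft_step_def[abs_def] by (auto intro!: derivative_eq_intros DERIV_ramp2)

lemma continuous_ramp2: "continuous_on S ramp2"
  by (rule DERIV_continuous_on) (rule DERIV_subset[OF DERIV_ramp2], simp)

lemma continuous_soft_step: "continuous_on S (soft_step k)"
  by (rule DERIV_continuous_on) (rule DERIV_subset[OF DERIV_soft_step], simp)

lemma soft_step_bounds: "0 \<le> soft_step k t" "soft_step k t \<le> 1"
  by (auto simp: soft_step_def ramp2_def)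

lemma soft_step_nonpos: "t \<le> 0 \<Longrightarrow> soft_step k t = 0"
  by (simp add: soft_step_def ramp2_def)

lemma soft_step_tendsto: "(\<lambda>k. soft_step k t) \<longlonglongrightarrow> (if 0 < t then 1 else 0)"
proof (cases "0 < t")
  case True
  then have "0 < ramp2 t" by (simp add: ramp2_def)
  then have "(\<lambda>k. exp (- (real k * ramp2 t))) \<longlonglongrightarrow> 0"
    by (intro filterlim_compose[OF exp_at_bot] filterlim_compose[OF filterlim_uminus_at_bot_at_top]
       filterlim_at_top_mult_tendsto_pos[OF tendsto_const _ filterlim_real_sequentially, THEN filterlim_cong[THEN iffD1, rotated -1]])
      (auto simp: mult.commute)
  from tendsto_diff[OF tendsto_const[of 1] this] show ?thesis using True by (simp add: soft_step_def)
qed (simp add: soft_step_nonpos)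

text \<open>Test functions that stay below the indicator of the open box and converge to it
  pointwise.\<close>

definition box_bump :: "nat \<Rightarrow> 'a \<Rightarrow> 'a \<Rightarrow> 'a::euclidean_space \<Rightarrow> real" where
  "box_bump k a b x = (\<Prod>i\<in>Basis. soft_step k (x \<bullet> i - a \<bullet> i) * soft_step k (b \<bullet> i - x \<bullet> i))"

lemma box_bump_bounds: "0 \<le> box_bump k a b x" "box_bump k a b x \<le> 1"
  unfolding box_bump_def by (auto intro!: prod_nonneg prod_le_1 mult_le_one simp: soft_step_bounds)

lemma box_bump_outside: "x \<notin> box a b \<Longrightarrow> box_bump k a b x = 0"
  unfolding box_bump_def
proof -
  assume "x \<notin> box a b"
  then obtain i where "i \<in> Basis" "x \<bullet> i - a \<bullet> i \<le> 0 \<or> b \<bullet> i - x \<bullet> i \<le> 0"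
    by (auto simp: mem_box not_less)
  then have "\<exists>i\<in>Basis. soft_step k (x \<bullet> i - a \<bullet> i) * soft_step k (b \<bullet> i - x \<bullet> i) = 0"
    using soft_step_nonpos[of _ k] by (metis mult_eq_0_iff)
  then show "(\<Prod>i\<in>Basis. soft_step k (x \<bullet> i - a \<bullet> i) * soft_step k (b \<bullet> i - x \<bullet> i)) = 0"
    by simp
qed

lemma box_bump_tendsto: "(\<lambda>k. box_bump k a b x) \<longlonglongrightarrow> indicator (box a b) x"
proof (cases "x \<in> box a b")
  case True
  have "(\<lambda>k. box_bump k a b x) \<longlonglongrightarrow> (\<Prod>i\<in>Basis. (if 0 < x \<bullet> i - a \<bullet> i then 1 else 0) * (if 0 < b \<bullet> i - x \<bullet> i then 1 else 0))"
    unfolding box_bump_def by (intro tendsto_prod tendsto_mult soft_step_tendsto)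
  then show ?thesis using True by (simp add: mem_box)
qed (simp add: box_bump_outside)

lemma C1_box_bump: "C1_compact_support (\<lambda>x::'a::euclidean_space. box_bump k a b x *\<^sub>R c)"
proof -
  define s' where "s' t = 2 * real k * max 0 t * exp (- (real k * ramp2 t))" for t
  define D where "D x v = (\<Sum>i\<in>Basis. (soft_step k (x \<bullet> i - a \<bullet> i) * (s' (b \<bullet> i - x \<bullet> i) * (- (v \<bullet> i)))
       + s' (x \<bullet> i - a \<bullet> i) * (v \<bullet> i) * soft_step k (b \<bullet> i - x \<bullet> i))
     * (\<Prod>j\<in>Basis - {i}. soft_step k (x \<bullet> j - a \<bullet> j) * soft_step k (b \<bullet> j - x \<bullet> j)))" for x v :: 'a
  have st: "(soft_step k has_derivative (*) (s' t)) (at t)" for t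
    using DERIV_soft_step[of k t] by (simp add: has_field_derivative_def s'_def)
  have "((\<lambda>x. box_bump k a b x) has_derivative D x) (at x)" for x
    unfolding box_bump_def D_def
    by (rule has_derivative_prod)
      (auto intro!: derivative_eq_intros has_derivative_compose[OF _ st])
  then have der: "((\<lambda>x. box_bump k a b x *\<^sub>R c) has_derivative (\<lambda>v. D x v *\<^sub>R c)) (at x)" for x
    by (rule has_derivative_scaleR_left)
  have fd: "frechet_derivative (\<lambda>x. box_bump k a b x *\<^sub>R c) (at x) = (\<lambda>v. D x v *\<^sub>R c)" for x
    using frechet_derivative_at[OF der] by simp
  have s'c: "continuous_on UNIV s'"
    unfolding s'_def by (intro continuous_intros continuous_ramp2)
  have "continuous_on UNIV (\<lambda>x. D x v *\<^sub>R c)" for v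
    unfolding D_def
    by (intro continuous_intros continuous_on_compose2[OF continuous_soft_step[of UNIV]] continuous_on_compose2[OF s'c]) auto
  moreover have "box_bump k a b x *\<^sub>R c = 0" if "x \<notin> cbox a b" for x
    using that box_bump_outside[of x a b k] box_subset_cbox[of a b] by auto
  ultimately show ?thesis
    unfolding C1_compact_support_def fd
    using der by (auto simp: differentiable_def intro!: exI[of _ "cbox a b"])
qed

section \<open>Uniqueness of Gauss-Green pairs on bounded Borel sets\<close>

lemma gauss_green_bounded:
  assumes G: "gauss_green_measure E \<mu> \<sigma>" and A: "A \<in> sets borel" "bounded A"
  shows "emeasure \<mu> A < \<infinity>" "set_integrable \<mu> A \<sigma>" "A \<in> sets \<mu>" "\<sigma> \<in> borel_measurable \<mu>"
proof -
  have s: "sets \<mu> = sets borel" using G by (simp add: gauss_green_measure_def)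
  show As: "A \<in> sets \<mu>" using s A by simp
  have "compact (closure A)" using A(2) by (simp add: compact_closure)
  then have "emeasure \<mu> (closure A) < \<infinity>" using G by (simp add: gauss_green_measure_def)
  moreover have "emeasure \<mu> A \<le> emeasure \<mu> (closure A)"
    by (intro emeasure_mono closure_subset) (simp add: s)
  ultimately show fin: "emeasure \<mu> A < \<infinity>" by (rule le_less_trans[rotated])
  show m: "\<sigma> \<in> borel_measurable \<mu>"
    using G s by (simp add: gauss_green_measure_def cong: measurable_cong_sets)
  have "AE x in \<mu>. norm (\<sigma> x) = 1" using G by (simp add: gauss_green_measure_def)
  then have "AE x in \<mu>. x \<in> A \<longrightarrow> norm (\<sigma> x) \<le> 1" by eventually_elim simp
  then show "set_integrable \<mu> A \<sigma>"
    unfolding set_integrable_def by (rule integrableI_bounded_set_indicator[OF As m fin])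
qed

text \<open>Dominated convergence with the indicator of the box as majorant, since a coordinate of a
  unit vector is at most 1 in absolute value.\<close>

lemma gauss_green_box_tendsto:
  assumes G: "gauss_green_measure E \<mu> \<sigma>" and c: "c \<in> Basis"
  shows "(\<lambda>k. LINT x|\<mu>. (box_bump k a b x *\<^sub>R c) \<bullet> \<sigma> x) \<longlonglongrightarrow> (LINT x:box a b|\<mu>. \<sigma> x) \<bullet> c"
proof -
  have s [measurable_cong]: "sets \<mu> = sets borel" using G by (simp add: gauss_green_measure_def)
  note [measurable] = gauss_green_bounded(4)[OF G borel_open[OF open_box] bounded_box]
  have [measurable]: "box_bump k a b \<in> borel_measurable borel" for k
    unfolding box_bump_def[abs_def]
    by (intro borel_measurable_continuous_onI continuous_intros continuous_on_compose2[OF continuous_soft_step[of UNIV]]) auto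
  have AE: "AE x in \<mu>. norm (\<sigma> x) = 1" using G by (simp add: gauss_green_measure_def)
  have "(\<lambda>k. LINT x|\<mu>. (box_bump k a b x *\<^sub>R c) \<bullet> \<sigma> x) \<longlonglongrightarrow> (LINT x|\<mu>. (indicator (box a b) x *\<^sub>R \<sigma> x) \<bullet> c)"
  proof (rule integral_dominated_convergence)
    show "integrable \<mu> (\<lambda>x. indicator (box a b) x :: real)"
      using gauss_green_bounded(1,3)[OF G borel_open[OF open_box] bounded_box, of a b] by simp
    show "AE x in \<mu>. (\<lambda>k. (box_bump k a b x *\<^sub>R c) \<bullet> \<sigma> x) \<longlonglongrightarrow> (indicator (box a b) x *\<^sub>R \<sigma> x) \<bullet> c"
      by (rule AE_I2) (auto intro!: tendsto_eq_intros box_bump_tendsto simp: inner_commute)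
    show "AE x in \<mu>. norm ((box_bump k a b x *\<^sub>R c) \<bullet> \<sigma> x) \<le> indicator (box a b) x" for k
      using AE
    proof eventually_elim
      case (elim x)
      have "norm ((box_bump k a b x *\<^sub>R c) \<bullet> \<sigma> x) \<le> box_bump k a b x * \<bar>c \<bullet> \<sigma> x\<bar>"
        using box_bump_bounds(1)[of k a b x] by (simp add: abs_mult)
      also have "\<dots> \<le> box_bump k a b x * 1"
        using Basis_le_norm[OF c, of "\<sigma> x"] elim box_bump_bounds(1)[of k a b x]
        by (intro mult_left_mono) (auto simp: inner_commute)
      also have "\<dots> \<le> indicator (box a b) x"
        using box_bump_bounds(2)[of k a b x] box_bump_outside[of x a b k] by (auto simp: indicator_def)
      finally show ?case .
    qed
  qed simp_all
  also have "(LINT x|\<mu>. (indicator (box a b) x *\<^sub>R \<sigma> x) \<bullet> c) = (LINT x:box a b|\<mu>. \<sigma> x) \<bullet> c"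
    unfolding set_lebesgue_integral_def
    using gauss_green_bounded(2)[OF G borel_open[OF open_box] bounded_box, of a b]
    by (intro integral_inner_left) (simp add: set_integrable_def)
  finally show ?thesis .
qed

lemma gauss_green_box_eq:
  assumes G: "gauss_green_measure E \<mu> \<sigma>" and G': "gauss_green_measure E \<mu>' \<sigma>'"
  shows "(LINT x:box a b|\<mu>. \<sigma> x) = (LINT x:box a b|\<mu>'. \<sigma>' x)"
proof (rule euclidean_eqI)
  fix c :: 'a assume c: "c \<in> Basis"
  have "(LINT x|\<mu>. (box_bump k a b x *\<^sub>R c) \<bullet> \<sigma> x) = (LINT x|\<mu>'. (box_bump k a b x *\<^sub>R c) \<bullet> \<sigma>' x)" for k
    using G G' C1_box_bump[of k a b c] unfolding gauss_green_measure_def by metis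
  then show "(LINT x:box a b|\<mu>. \<sigma> x) \<bullet> c = (LINT x:box a b|\<mu>'. \<sigma>' x) \<bullet> c"
    using gauss_green_box_tendsto[OF G c, of a b] gauss_green_box_tendsto[OF G' c, of a b]
    by (simp add: LIMSEQ_unique)
qed

text \<open>Dynkin's argument from boxes, which are stable under intersection and generate the Borel
  sets. Everything is intersected with one box around \<open>A\<close>, so that the vector measures
  are finite.\<close>

lemma gauss_green_set_eq:
  assumes G: "gauss_green_measure E \<mu> \<sigma>" and G': "gauss_green_measure E \<mu>' \<sigma>'"
    and A: "A \<in> sets borel" "bounded A"
  shows "(LINT x:A|\<mu>. \<sigma> x) = (LINT x:A|\<mu>'. \<sigma>' x)"
proof -
  obtain a b where ab: "A \<subseteq> box a b"
    using A(2) bounded_subset_box_symmetric by metis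
  have int: "set_integrable \<mu> (S \<inter> box a b) \<sigma>" "set_integrable \<mu>' (S \<inter> box a b) \<sigma>'" if "S \<in> sets borel" for S
    using that gauss_green_bounded(2)[OF G, of "S \<inter> box a b"] gauss_green_bounded(2)[OF G', of "S \<inter> box a b"]
    by (auto intro: bounded_subset[OF bounded_box])
  have sets: "sets \<mu> = sets borel" "sets \<mu>' = sets borel"
    using G G' by (auto simp: gauss_green_measure_def)
  have "Int_stable (range (\<lambda>(a, b). box a b :: 'a set))"
    by (auto simp: Int_stable_def box_Int_box)
  moreover have "range (\<lambda>(a, b). box a b :: 'a set) \<subseteq> Pow UNIV" by simp
  moreover have "A \<in> sigma_sets UNIV (range (\<lambda>(a, b). box a b))"
    using A(1) by (simp add: borel_eq_box)
  ultimately have "(LINT x:A \<inter> box a b|\<mu>. \<sigma> x) = (LINT x:A \<inter> box a b|\<mu>'. \<sigma>' x)"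
  proof (induction rule: sigma_sets_induct_disjoint)
    case (basic S)
    then obtain c d where "S = box c d" by auto
    then show ?case using gauss_green_box_eq[OF G G'] by (simp add: box_Int_box)
  next
    case empty
    then show ?case by (simp add: set_lebesgue_integral_def)
  next
    case (compl S)
    then have S: "S \<in> sets borel" by (simp add: borel_eq_box)
    have "box a b = (S \<inter> box a b) \<union> ((UNIV - S) \<inter> box a b)" by auto
    moreover have "(LINT x:(S \<inter> box a b) \<union> ((UNIV - S) \<inter> box a b)|\<mu>. \<sigma> x) =
        (LINT x:S \<inter> box a b|\<mu>. \<sigma> x) + (LINT x:(UNIV - S) \<inter> box a b|\<mu>. \<sigma> x)"
      using S by (intro set_integral_Un int) auto
    moreover have "(LINT x:(S \<inter> box a b) \<union> ((UNIV - S) \<inter> box a b)|\<mu>'. \<sigma>' x) =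
        (LINT x:S \<inter> box a b|\<mu>'. \<sigma>' x) + (LINT x:(UNIV - S) \<inter> box a b|\<mu>'. \<sigma>' x)"
      using S by (intro set_integral_Un int) auto
    ultimately show ?case using compl.IH gauss_green_box_eq[OF G G', of a b] by (metis add_left_cancel)
  next
    case (union S)
    have S: "S i \<in> sets borel" for i using union.hyps(2) by (auto simp: borel_eq_box)
    have "(LINT x:(\<Union>i. S i \<inter> box a b)|\<mu>. \<sigma> x) = (\<Sum>i. LINT x:S i \<inter> box a b|\<mu>. \<sigma> x)"
      using S union.hyps(1) int[of "\<Union>i. S i"]
      by (intro lebesgue_integral_countable_add) (auto simp: sets disjoint_family_on_def)
    moreover have "(LINT x:(\<Union>i. S i \<inter> box a b)|\<mu>'. \<sigma>' x) = (\<Sum>i. LINT x:S i \<inter> box a b|\<mu>'. \<sigma>' x)"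
      using S union.hyps(1) int[of "\<Union>i. S i"]
      by (intro lebesgue_integral_countable_add) (auto simp: sets disjoint_family_on_def)
    ultimately show ?case using union.IH by simp
  qed
  moreover have "A \<inter> box a b = A" using ab by auto
  ultimately show ?thesis by simp
qed

text \<open>On a piece where \<open>\<sigma>\<close> is almost constant, \<open>\<mu>\<close> is almost the norm of the vector measure.\<close>

lemma gauss_green_emeasure_le:
  assumes G: "gauss_green_measure E \<mu> \<sigma>" and G': "gauss_green_measure E \<mu>' \<sigma>'"
    and A: "A \<in> sets borel" "bounded A"
  shows "emeasure \<mu> A \<le> emeasure \<mu>' A"
proof -
  have sets [measurable_cong]: "sets \<mu> = sets borel" "sets \<mu>' = sets borel"
    using G G' by (auto simp: gauss_green_measure_def)
  have \<sigma>b [measurable]: "\<sigma> \<in> borel_measurable borel" using G by (simp add: gauss_green_measure_def)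
  have AE: "AE x in \<mu>. norm (\<sigma> x) = 1" "AE x in \<mu>'. norm (\<sigma>' x) = 1"
    using G G' by (auto simp: gauss_green_measure_def)
  have main: "ennreal (1 - 2 * e) * emeasure \<mu> A \<le> emeasure \<mu>' A" if e: "0 < e" "e < 1/2" for e
  proof -
    \<comment> \<open>A dense sequence of values, so that the countably many sets where \<sigma> is
      close to some \<open>w k\<close> cover \<open>A\<close>.\<close>
    obtain w :: "nat \<Rightarrow> 'a" where w: "\<And>S. open S \<Longrightarrow> S \<noteq> {} \<Longrightarrow> \<exists>k. w k \<in> S"
    proof -
      obtain D :: "'a set" where D: "countable D" "\<And>S. open S \<Longrightarrow> S \<noteq> {} \<Longrightarrow> \<exists>d\<in>D. d \<in> S"
        using countable_dense_exists by blast
      then have "D \<noteq> {}" using D(2)[of UNIV] by auto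
      then show thesis using that[of "from_nat_into D"] D by (metis from_nat_into_surj)
    qed
    define B where "B k = A \<inter> {x. dist (\<sigma> x) (w k) < e}" for k
    define C where "C = disjointed B"
    have B: "B k \<in> sets borel" for k
    proof -
      have "{x \<in> space borel. dist (\<sigma> x) (w k) < e} \<in> sets borel" by measurable
      then show ?thesis unfolding B_def using A(1) by auto
    qed
    have C: "C k \<in> sets borel" for k
      using B sets.range_disjointed_sets[of B borel] unfolding C_def by auto
    have CB: "C k \<subseteq> B k" for k unfolding C_def by (rule disjointed_subset)
    then have CA: "C k \<subseteq> A" for k by (auto simp: B_def)
    then have bd: "bounded (C k)" for k using A(2) bounded_subset by blast
    have "(\<Union>k. C k) = A"
    proof -
      have "A \<subseteq> (\<Union>k. B k)"
      proof
        fix x assume "x \<in> A"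
        moreover obtain k where "w k \<in> ball (\<sigma> x) e" using w[of "ball (\<sigma> x) e"] e by auto
        ultimately have "x \<in> B k" by (simp add: B_def)
        then show "x \<in> (\<Union>k. B k)" by blast
      qed
      then show ?thesis unfolding C_def UN_disjointed_eq by (auto simp: B_def)
    qed
    have piece: "ennreal (1 - 2 * e) * emeasure \<mu> (C k) \<le> emeasure \<mu>' (C k)" for k
    proof (cases "emeasure \<mu> (C k) = 0")
      case False
      note fin = gauss_green_bounded[OF G C[of k] bd[of k]] and fin' = gauss_green_bounded[OF G' C[of k] bd[of k]]
      define m m' where "m = measure \<mu> (C k)" and "m' = measure \<mu>' (C k)"
      have m: "emeasure \<mu> (C k) = ennreal m" "emeasure \<mu>' (C k) = ennreal m'" "0 \<le> m" "0 \<le> m'"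
        using fin(1) fin'(1) by (auto simp: m_def m'_def emeasure_eq_ennreal_measure)
      have one: "(LINT x:C k|\<mu>. c) = m * c" "(LINT x:C k|\<mu>'. c) = m' * c"
        "set_integrable \<mu> (C k) (\<lambda>_. c)" "set_integrable \<mu>' (C k) (\<lambda>_. c)" for c :: real
        using fin(1,3) fin'(1,3) by (simp_all add: m_def m'_def set_lebesgue_integral_def set_integrable_def)
      have const: "(LINT x:C k|\<mu>. c) = m *\<^sub>R c" "set_integrable \<mu> (C k) (\<lambda>_. c)" for c :: 'a
        using fin(1,3) by (simp_all add: m_def set_lebesgue_integral_def set_integrable_def)
      have "1 - e \<le> norm (w k)"
      proof -
        have "\<not> (AE x in \<mu>. x \<notin> C k)"
          using False sets.sets_into_space[OF fin(3)] by (subst AE_iff_measurable[OF fin(3)]) auto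
        then obtain x where "x \<in> C k" "norm (\<sigma> x) = 1"
          using AE(1) by (metis (mono_tags, lifting) AE_mp AE_I2)
        then have "dist (\<sigma> x) (w k) < e" "norm (\<sigma> x) = 1" using CB by (auto simp: B_def)
        then show ?thesis using norm_triangle_ineq2[of "\<sigma> x" "w k"] by (simp add: dist_norm)
      qed
      have "norm ((LINT x:C k|\<mu>. \<sigma> x) - m *\<^sub>R w k) \<le> e * m"
      proof -
        have "(LINT x:C k|\<mu>. \<sigma> x) - m *\<^sub>R w k = (LINT x:C k|\<mu>. \<sigma> x - w k)"
          using fin(2) const by (subst set_integral_diff(2)) auto
        also have "norm \<dots> \<le> (LINT x:C k|\<mu>. norm (\<sigma> x - w k))"
          using fin(2) const by (intro set_integral_norm_bound) auto
        also have "\<dots> \<le> (LINT x:C k|\<mu>. e)"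
        proof (rule set_integral_mono)
          show "set_integrable \<mu> (C k) (\<lambda>x. norm (\<sigma> x - w k))"
            using fin(2) const by (intro set_integrable_norm set_integral_diff(1)) auto
          show "norm (\<sigma> x - w k) \<le> e" if "x \<in> C k" for x
            using that CB[of k] by (auto simp: B_def dist_norm)
        qed (rule one)
        finally show ?thesis by (simp only: one mult.commute)
      qed
      then have "m * norm (w k) - norm (LINT x:C k|\<mu>. \<sigma> x) \<le> e * m"
        using norm_triangle_ineq2[of "m *\<^sub>R w k" "LINT x:C k|\<mu>. \<sigma> x"] m(3) by (simp add: norm_minus_commute)
      moreover have "norm (LINT x:C k|\<mu>'. \<sigma>' x) \<le> m'"
      proof -
        have "norm (LINT x:C k|\<mu>'. \<sigma>' x) \<le> (LINT x:C k|\<mu>'. norm (\<sigma>' x))"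
          using fin'(2) by (rule set_integral_norm_bound)
        also have "\<dots> \<le> (LINT x:C k|\<mu>'. (1::real))"
          using AE(2) fin'(2) one by (intro set_integral_mono_AE set_integrable_norm) (auto elim: eventually_mono)
        finally show ?thesis by (simp add: one)
      qed
      moreover have "m * (1 - e) \<le> m * norm (w k)" using \<open>1 - e \<le> norm (w k)\<close> m by (intro mult_left_mono) auto
      \<comment> \<open>With V the common vector measure of the piece: m (1 - e) \<le> m |w k| \<le>
        |V| + e m \<le> m' + e m.\<close>
      ultimately have "(1 - 2 * e) * m \<le> m'"
        unfolding gauss_green_set_eq[OF G G' C bd] by (simp add: algebra_simps)
      then show ?thesis unfolding m using e m by (simp add: ennreal_mult'[symmetric] ennreal_leI)
    qed simp
    have "range C \<subseteq> sets \<mu>" "range C \<subseteq> sets \<mu>'" "disjoint_family C"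
      using C by (auto simp: sets C_def disjoint_family_disjointed)
    then have sum: "(\<Sum>k. emeasure \<mu> (C k)) = emeasure \<mu> A" "(\<Sum>k. emeasure \<mu>' (C k)) = emeasure \<mu>' A"
      unfolding \<open>(\<Union>k. C k) = A\<close>[symmetric] by (auto intro: suminf_emeasure)
    have "ennreal (1 - 2 * e) * emeasure \<mu> A = (\<Sum>k. ennreal (1 - 2 * e) * emeasure \<mu> (C k))"
      by (simp flip: sum(1))
    also have "\<dots> \<le> (\<Sum>k. emeasure \<mu>' (C k))" by (intro suminf_le piece) auto
    also have "\<dots> = emeasure \<mu>' A" by (rule sum)
    finally show ?thesis .
  qed
  define m m' where "m = measure \<mu> A" and "m' = measure \<mu>' A"
  have m: "emeasure \<mu> A = ennreal m" "emeasure \<mu>' A = ennreal m'" "0 \<le> m" "0 \<le> m'"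
    using gauss_green_bounded(1)[OF G A] gauss_green_bounded(1)[OF G' A]
    by (auto simp: m_def m'_def emeasure_eq_ennreal_measure)
  have "m \<le> m' + d" if d: "0 < d" for d
  proof -
    \<comment> \<open>The second entry makes 2 e m at most d; m + 1 instead of m keeps the quotient
      defined when m is zero.\<close>
    define e where "e = min (1/4) (d / (2 * (m + 1)))"
    have e: "0 < e" "e < 1/2" using d m by (auto simp: e_def)
    have "(1 - 2 * e) * m \<le> m'"
      using main[OF e] e m by (simp add: ennreal_mult'[symmetric])
    moreover have "2 * e * m \<le> d"
    proof -
      have "e \<le> d / (2 * (m + 1))" by (simp add: e_def)
      then have "e * (2 * (m + 1)) \<le> d" using m by (simp add: pos_le_divide_eq)
      then show ?thesis using e by (simp add: algebra_simps)
    qed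
    ultimately show ?thesis by (simp add: algebra_simps)
  qed
  then have "m \<le> m'" by (rule field_le_epsilon)
  then show ?thesis using m by (simp add: ennreal_leI)
qed

lemma gauss_green_measure_unique:
  assumes G: "gauss_green_measure E \<mu> \<sigma>" and G': "gauss_green_measure E \<mu>' \<sigma>'"
    and A: "A \<in> sets borel" "bounded A"
  shows "measure \<mu> A = measure \<mu>' A"
  using gauss_green_emeasure_le[OF G G' A] gauss_green_emeasure_le[OF G' G A]
  by (simp add: measure_def)

text \<open>Any known Gauss-Green pair may replace the existentially quantified one, since measures
  of balls and vector integrals over balls depend only on \<open>E\<close>.\<close>

lemma has_outer_normal_iff:
  assumes G: "gauss_green_measure E \<mu> \<sigma>"
  shows "has_outer_normal E x m \<longleftrightarrow>
    (\<forall>r>0. 0 < measure \<mu> (ball x r)) \<and>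
    ((\<lambda>r. (LINT y:ball x r|\<mu>. \<sigma> y) /\<^sub>R measure \<mu> (ball x r)) \<longlongrightarrow> m) (at_right 0) \<and> norm m = 1"
proof -
  let ?P = "\<lambda>\<mu> \<sigma>. (\<forall>r>0. 0 < measure \<mu> (ball x r)) \<and>
    ((\<lambda>r. (LINT y:ball x r|\<mu>. \<sigma> y) /\<^sub>R measure \<mu> (ball x r)) \<longlongrightarrow> m) (at_right 0) \<and> norm m = 1"
  have "?P \<mu>' \<sigma>' \<longleftrightarrow> ?P \<mu> \<sigma>" if G': "gauss_green_measure E \<mu>' \<sigma>'" for \<mu>' \<sigma>'
  proof -
    have "measure \<mu>' (ball x r) = measure \<mu> (ball x r)"
      "(LINT y:ball x r|\<mu>'. \<sigma>' y) = (LINT y:ball x r|\<mu>. \<sigma> y)" for r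
      using gauss_green_measure_unique[OF G' G, of "ball x r"] gauss_green_set_eq[OF G' G, of "ball x r"] by auto
    then show ?thesis by simp
  qed
  then show ?thesis unfolding has_outer_normal_def using G by blast
qed

section \<open>Facets, perimeter measure and the divergence theorem\<close>

locale facetted_polytope = polytope I n h E for I :: "'i set" and n h E +
  assumes witness: "\<And>i. i \<in> I \<Longrightarrow> \<exists>p. n i \<bullet> p = h i \<and> (\<forall>j\<in>I - {i}. n j \<bullet> p < h j)"
begin

lemma obtain_chart:
  assumes "i \<in> I"
  obtains R where "isometric_plane (plane_chart R (h i))" "range (plane_chart R (h i)) = {x. n i \<bullet> x = h i}"
  using orthogonal_matrix_exists_basis[OF norm_n[OF assms], of 3] plane_chart_isometric range_plane_chart by metis

lemma emeasure_plane_ball: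
  assumes i: "i \<in> I" and q: "n i \<bullet> q = h i" and s: "0 \<le> s"
  shows "emeasure hausdorff2 ({x. n i \<bullet> x = h i} \<inter> ball q s) = ennreal (pi * s\<^sup>2)"
proof -
  obtain R where R: "isometric_plane (plane_chart R (h i))" "range (plane_chart R (h i)) = {x. n i \<bullet> x = h i}"
    using obtain_chart[OF i] .
  interpret isometric_plane "plane_chart R (h i)" by (rule R(1))
  obtain y where y: "q = plane_chart R (h i) y" using R(2) q by blast
  have "plane_chart R (h i) -` ({x. n i \<bullet> x = h i} \<inter> ball q s) = ball y s"
  proof -
    have "n i \<bullet> plane_chart R (h i) p = h i" for p using R(2) by blast
    then show ?thesis by (auto simp: y)
  qed
  moreover have "emeasure lborel (ball y s) = ennreal (pi * s\<^sup>2)"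
    using s by (simp add: emeasure_ball unit_ball_vol_2 power2_eq_square)
  moreover have "{x. n i \<bullet> x = h i} \<inter> ball q s \<in> sets borel"
    by (intro sets.Int borel_closed closed_hyperplane borel_open) auto
  ultimately show ?thesis
    by (subst emeasure_hausdorff2_plane) (auto simp: R(2))
qed

text \<open>A ball of radius r that meets the face lies in the ball of radius 2 r about a common
  point, whose trace on the plane is a disc.\<close>

lemma emeasure_face_ball_le:
  assumes i: "i \<in> I" and r: "0 \<le> r"
  shows "emeasure hausdorff2 (face i \<inter> ball x r) \<le> ennreal (4 * pi * r\<^sup>2)"
proof (cases "face i \<inter> ball x r = {}")
  case False
  then obtain q where q: "q \<in> face i" "dist x q < r" by auto
  have "face i \<inter> ball x r \<subseteq> {x. n i \<bullet> x = h i} \<inter> ball q (2 * r)"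
  proof
    fix y assume y: "y \<in> face i \<inter> ball x r"
    then have "dist q y < 2 * r" using q dist_triangle3[of q y x] by simp
    then show "y \<in> {x. n i \<bullet> x = h i} \<inter> ball q (2 * r)" using y face_sub_plane by auto
  qed
  then have "emeasure hausdorff2 (face i \<inter> ball x r) \<le> emeasure hausdorff2 ({x. n i \<bullet> x = h i} \<inter> ball q (2 * r))"
    by (intro emeasure_mono) (auto intro!: sets.Int borel_closed closed_hyperplane)
  also have "\<dots> = ennreal (pi * (2 * r)\<^sup>2)"
    using q(1) face_sub_plane r by (intro emeasure_plane_ball[OF i]) auto
  finally show ?thesis by (simp add: power_mult_distrib mult.commute mult.left_commute)
qed simp

lemma emeasure_face_finite:
  assumes i: "i \<in> I"
  shows "emeasure hausdorff2 (face i) < \<infinity>"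
proof -
  obtain B where B: "0 < B" "\<And>y. y \<in> E \<Longrightarrow> norm y < B" using bounded_E bounded_pos_less by metis
  then have "face i \<inter> ball 0 B = face i" by (auto simp: face_def)
  then have "emeasure hausdorff2 (face i) \<le> ennreal (4 * pi * B\<^sup>2)"
    using emeasure_face_ball_le[OF i, of B 0] B by simp
  then show ?thesis by (rule le_less_trans) simp
qed

text \<open>In the chart of facet \<open>i\<close> the plane of facet \<open>j\<close> becomes a
  line or is empty. The remaining case, that it contains the whole plane of \<open>i\<close>, is
  excluded by the witness, a point of facet \<open>i\<close> strictly inside the half space of
  \<open>j\<close>.\<close>

lemma emeasure_face_Int:
  assumes ij: "i \<in> I" "j \<in> I" "i \<noteq> j"
  shows "emeasure hausdorff2 (face i \<inter> face j) = 0"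
proof -
  obtain R where R: "isometric_plane (plane_chart R (h i))" "range (plane_chart R (h i)) = {x. n i \<bullet> x = h i}"
    using obtain_chart[OF ij(1)] .
  interpret isometric_plane "plane_chart R (h i)" by (rule R(1))
  define a where "a = n j v* R"
  have lin: "n j \<bullet> plane_chart R (h i) y = (a $ 1, a $ 2) \<bullet> y + a $ 3 * h i" for y
  proof -
    have "n j \<bullet> plane_chart R (h i) y = a \<bullet> vector [fst y, snd y, h i]"
      unfolding plane_chart_def a_def dot_lmul_matrix ..
    then show ?thesis by (simp add: inner_vec_def sum_3 inner_prod_def)
  qed
  obtain p where p: "n i \<bullet> p = h i" "n j \<bullet> p < h j" using witness[OF ij(1)] ij by auto
  then obtain y0 where "p = plane_chart R (h i) y0" using R(2) by blast
  then have "(a $ 1, a $ 2) \<bullet> y0 + a $ 3 * h i < h j" using p lin by simp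
  then have nz: "(a $ 1, a $ 2) \<noteq> 0 \<or> h j - a $ 3 * h i \<noteq> 0" by (auto simp: inner_prod_def zero_prod_def)
  have "negligible {y. (a $ 1, a $ 2) \<bullet> y = h j - a $ 3 * h i}" by (rule negligible_hyperplane[OF nz])
  then have "emeasure lebesgue {y. (a $ 1, a $ 2) \<bullet> y = h j - a $ 3 * h i} = 0"
    by (simp add: negligible_iff_emeasure0)
  then have null: "emeasure lborel {y. (a $ 1, a $ 2) \<bullet> y = h j - a $ 3 * h i} = 0"
    using borel_closed[OF closed_hyperplane, of "(a $ 1, a $ 2)" "h j - a $ 3 * h i"] by simp
  have "emeasure hausdorff2 (face i \<inter> face j) = emeasure lborel (plane_chart R (h i) -` (face i \<inter> face j))"
    using face_sub_plane[of i] R(2) by (intro emeasure_hausdorff2_plane) auto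
  also have "\<dots> \<le> emeasure lborel {y. (a $ 1, a $ 2) \<bullet> y = h j - a $ 3 * h i}"
  proof (rule emeasure_mono)
    show "plane_chart R (h i) -` (face i \<inter> face j) \<subseteq> {y. (a $ 1, a $ 2) \<bullet> y = h j - a $ 3 * h i}"
      using face_sub_plane[of j] lin by fastforce
    show "{y. (a $ 1, a $ 2) \<bullet> y = h j - a $ 3 * h i} \<in> sets lborel"
      by (simp add: borel_closed[OF closed_hyperplane])
  qed
  finally show ?thesis using null by simp
qed

lemma AE_face_unique: "AE x in hausdorff2. \<forall>i\<in>I. \<forall>j\<in>I. x \<in> face i \<longrightarrow> x \<in> face j \<longrightarrow> i = j"
proof (intro AE_finite_allI[OF finite_I])
  fix i j assume ij: "i \<in> I" "j \<in> I"
  show "AE x in hausdorff2. x \<in> face i \<longrightarrow> x \<in> face j \<longrightarrow> i = j"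
  proof (cases "i = j")
    case False
    have "face i \<inter> face j \<in> null_sets hausdorff2"
      using emeasure_face_Int[OF ij False] by (auto simp: null_sets_def)
    then show ?thesis by (rule AE_I') auto
  qed simp
qed

definition area :: "'i \<Rightarrow> (real^3) set \<Rightarrow> real" where
  "area i A = measure hausdorff2 (face i \<inter> A)"

lemma area:
  assumes "i \<in> I" "A \<in> sets borel"
  shows "emeasure hausdorff2 (face i \<inter> A) = ennreal (area i A)" "0 \<le> area i A"
proof -
  have "emeasure hausdorff2 (face i \<inter> A) \<le> emeasure hausdorff2 (face i)"
    by (intro emeasure_mono) auto
  also note emeasure_face_finite[OF assms(1)]
  finally show "emeasure hausdorff2 (face i \<inter> A) = ennreal (area i A)"
    unfolding area_def by (intro emeasure_eq_ennreal_measure) simp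
qed (simp add: area_def)

definition perimeter_measure :: "(real^3) measure" where
  "perimeter_measure = density hausdorff2 (indicator (\<Union>i\<in>I. face i))"

text \<open>On the edges several normals are added, but only on a null set; the form as a finite sum
  turns integrals of the field into sums over the facets.\<close>

definition normal_field :: "real^3 \<Rightarrow> real^3" where
  "normal_field x = (\<Sum>i\<in>I. indicator (face i) x *\<^sub>R n i)"

lemma sets_boundary [measurable]: "(\<Union>i\<in>I. face i) \<in> sets borel"
  using finite_I by (intro sets.finite_UN) auto

lemma sets_perimeter [simp, measurable_cong]: "sets perimeter_measure = sets borel"
  by (simp add: perimeter_measure_def)

lemma normal_field_measurable [measurable]: "normal_field \<in> borel_measurable borel"
  unfolding normal_field_def[abs_def] by measurable

lemma emeasure_perimeter:
  assumes A: "A \<in> sets borel"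
  shows "emeasure perimeter_measure A = ennreal (\<Sum>i\<in>I. area i A)"
proof -
  have "emeasure perimeter_measure A = (\<integral>\<^sup>+x. indicator (\<Union>i\<in>I. face i) x * indicator A x \<partial>hausdorff2)"
    unfolding perimeter_measure_def using A by (subst emeasure_density) auto
  also have "\<dots> = (\<integral>\<^sup>+x. (\<Sum>i\<in>I. indicator (face i \<inter> A) x) \<partial>hausdorff2)"
  proof (rule nn_integral_cong_AE)
    show "AE x in hausdorff2. indicator (\<Union>i\<in>I. face i) x * indicator A x = (\<Sum>i\<in>I. indicator (face i \<inter> A) x :: ennreal)"
      using AE_face_unique
    proof eventually_elim
      case (elim x)
      show ?case
      proof (cases "x \<in> (\<Union>i\<in>I. face i) \<inter> A")
        case True
        then obtain i where i: "i \<in> I" "x \<in> face i" "x \<in> A" by auto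
        have "(\<Sum>j\<in>I. indicator (face j \<inter> A) x :: ennreal) = (\<Sum>j\<in>I. if j = i then 1 else 0)"
          using elim i by (intro sum.cong) (auto simp: indicator_def)
        then show ?thesis using i finite_I True by simp
      next
        case False
        then show ?thesis by (auto simp: indicator_def)
      qed
    qed
  qed
  also have "\<dots> = (\<Sum>i\<in>I. emeasure hausdorff2 (face i \<inter> A))"
    using A by (subst nn_integral_sum) auto
  also have "\<dots> = (\<Sum>i\<in>I. ennreal (area i A))"
    using A by (intro sum.cong refl area(1))
  also have "\<dots> = ennreal (\<Sum>i\<in>I. area i A)"
    using A by (intro sum_ennreal area(2))
  finally show ?thesis .
qed

lemma measure_perimeter: "A \<in> sets borel \<Longrightarrow> measure perimeter_measure A = (\<Sum>i\<in>I. area i A)"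
  using area(2) by (simp add: measure_def emeasure_perimeter sum_nonneg)

lemma integrable_face:
  fixes f :: "real^3 \<Rightarrow> 'b::euclidean_space"
  assumes "i \<in> I" "continuous_on UNIV f"
  shows "set_integrable hausdorff2 (face i) f"
proof -
  have "compact (f ` face i)"
    using compact_face assms(2) by (intro compact_continuous_image) (auto intro: continuous_on_subset)
  from compact_imp_bounded[OF this] obtain B where "\<And>x. x \<in> face i \<Longrightarrow> norm (f x) \<le> B"
    unfolding bounded_iff by auto
  moreover have "f \<in> borel_measurable hausdorff2"
    using borel_measurable_continuous_onI[OF assms(2)] by (simp cong: measurable_cong_sets)
  ultimately show ?thesis
    unfolding set_integrable_def using emeasure_face_finite[OF assms(1)]
    by (intro integrableI_bounded_set_indicator) auto
qed

lemma perimeter_integral: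
  fixes F :: "real^3 \<Rightarrow> real^3"
  assumes F: "continuous_on UNIV F"
  shows "(LINT x|perimeter_measure. F x \<bullet> normal_field x) = (\<Sum>i\<in>I. LINT x:face i|hausdorff2. F x \<bullet> n i)"
proof -
  have [measurable]: "F \<in> borel_measurable borel" using F by (rule borel_measurable_continuous_onI)
  have ind: "indicator (\<Union>i\<in>I. face i) x *\<^sub>R (F x \<bullet> normal_field x) = (\<Sum>i\<in>I. indicator (face i) x *\<^sub>R (F x \<bullet> n i))" for x
    by (cases "x \<in> (\<Union>i\<in>I. face i)") (auto simp: normal_field_def inner_sum_right indicator_def)
  have "perimeter_measure = density hausdorff2 (\<lambda>x. ennreal (indicator (\<Union>i\<in>I. face i) x))"
    by (simp add: perimeter_measure_def ennreal_indicator)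
  then have "(LINT x|perimeter_measure. F x \<bullet> normal_field x) =
      (LINT x|hausdorff2. indicator (\<Union>i\<in>I. face i) x *\<^sub>R (F x \<bullet> normal_field x))"
    by (simp add: integral_density)
  also have "\<dots> = (LINT x|hausdorff2. (\<Sum>i\<in>I. indicator (face i) x *\<^sub>R (F x \<bullet> n i)))"
    unfolding ind ..
  also have "\<dots> = (\<Sum>i\<in>I. LINT x:face i|hausdorff2. F x \<bullet> n i)"
    unfolding set_lebesgue_integral_def
    using F by (intro Bochner_Integration.integral_sum integrable_face[unfolded set_integrable_def] continuous_intros)
  finally show ?thesis .
qed

lemma perimeter_set_integral:
  assumes A: "A \<in> sets borel"
  shows "(LINT x:A|perimeter_measure. normal_field x) = (\<Sum>i\<in>I. area i A *\<^sub>R n i)"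
proof -
  note [measurable] = A
  have ind: "indicator (\<Union>i\<in>I. face i) x *\<^sub>R indicator A x *\<^sub>R normal_field x =
      (\<Sum>i\<in>I. indicator (face i \<inter> A) x *\<^sub>R n i)" for x
    by (cases "x \<in> (\<Union>i\<in>I. face i) \<inter> A") (auto simp: normal_field_def indicator_def intro!: sum.cong)
  have "perimeter_measure = density hausdorff2 (\<lambda>x. ennreal (indicator (\<Union>i\<in>I. face i) x))"
    by (simp add: perimeter_measure_def ennreal_indicator)
  then have "(LINT x:A|perimeter_measure. normal_field x) =
      (LINT x|hausdorff2. indicator (\<Union>i\<in>I. face i) x *\<^sub>R indicator A x *\<^sub>R normal_field x)"
    by (simp add: integral_density set_lebesgue_integral_def)
  also have "\<dots> = (LINT x|hausdorff2. (\<Sum>i\<in>I. indicator (face i \<inter> A) x *\<^sub>R n i))"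
    unfolding ind ..
  also have "\<dots> = (\<Sum>i\<in>I. LINT x|hausdorff2. indicator (face i \<inter> A) x *\<^sub>R n i)"
    using area(1)[OF _ A] by (intro Bochner_Integration.integral_sum) (auto intro!: integrable_scaleR_left integrable_real_indicator)
  also have "\<dots> = (\<Sum>i\<in>I. area i A *\<^sub>R n i)"
  proof (rule sum.cong[OF refl])
    fix i assume "i \<in> I"
    then have "integrable hausdorff2 (indicator (face i \<inter> A) :: _ \<Rightarrow> real)"
      using area(1)[OF _ A, of i] by (intro integrable_real_indicator) auto
    then have "(LINT x|hausdorff2. indicator (face i \<inter> A) x *\<^sub>R n i) =
        (LINT x|hausdorff2. indicator (face i \<inter> A) x :: real) *\<^sub>R n i"
      by (intro integral_scaleR_left) simp
    then show "(LINT x|hausdorff2. indicator (face i \<inter> A) x *\<^sub>R n i) = area i A *\<^sub>R n i"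
      by (simp add: area_def)
  qed
  finally show ?thesis .
qed

text \<open>The directional formula is applied to each coordinate function in its own direction and
  summed.\<close>

lemma divergence_theorem:
  fixes F :: "real^3 \<Rightarrow> real^3"
  assumes F: "C1_compact_support F"
  shows "(LINT x:E|lebesgue. divergence F x) = (\<Sum>i\<in>I. LINT x:face i|hausdorff2. F x \<bullet> n i)"
proof -
  let ?D = "\<lambda>x. frechet_derivative F (at x)"
  have der: "(F has_derivative ?D x) (at x)" for x
    using F by (simp add: C1_compact_support_def frechet_derivative_works)
  have cont: "continuous_on UNIV (\<lambda>x. ?D x v)" for v
    using F by (simp add: C1_compact_support_def)
  obtain K where K: "compact K" "\<And>x. x \<notin> K \<Longrightarrow> F x = 0" using F by (auto simp: C1_compact_support_def)
  have Fc: "continuous_on UNIV F"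
    using has_derivative_continuous[OF der] by (simp add: continuous_at_imp_continuous_on)
  have b: "(LINT x|lborel. indicator E x * (?D x b \<bullet> b)) = (\<Sum>i\<in>I. (n i \<bullet> b) * (LINT x:face i|hausdorff2. F x \<bullet> b))"
    if "b \<in> Basis" for b
  proof (rule integral_directional[where D = "\<lambda>x v. ?D x v \<bullet> b" and K = K])
    show "((\<lambda>x. F x \<bullet> b) has_derivative (\<lambda>v. ?D x v \<bullet> b)) (at x)" for x
      by (rule has_derivative_inner_left[OF der])
    show "continuous_on UNIV (\<lambda>x. ?D x b \<bullet> b)" by (intro continuous_intros cont)
  qed (use K that in auto)
  have "E \<in> sets borel" using closed_E by simp
  then have [measurable]: "E \<in> sets lborel" by simp
  have Dm [measurable]: "(\<lambda>x. ?D x v) \<in> borel_measurable borel" for v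
    by (rule borel_measurable_continuous_onI[OF cont])
  have Ec: "compact E" using closed_E bounded_E by (simp add: compact_eq_bounded_closed)
  have "(LINT x:E|lebesgue. divergence F x) = (LINT x|lborel. indicator E x *\<^sub>R divergence F x)"
    unfolding set_lebesgue_integral_def by (rule integral_completion) (simp add: divergence_def)
  also have "\<dots> = (LINT x|lborel. (\<Sum>b\<in>Basis. indicator E x *\<^sub>R (?D x b \<bullet> b)))"
    by (simp add: divergence_def sum_distrib_left)
  also have "\<dots> = (\<Sum>b\<in>Basis. LINT x|lborel. indicator E x *\<^sub>R (?D x b \<bullet> b))"
    using Ec by (intro Bochner_Integration.integral_sum borel_integrable_compact)
      (auto intro!: continuous_intros continuous_on_subset[OF cont])
  also have "\<dots> = (\<Sum>b\<in>Basis. \<Sum>i\<in>I. (n i \<bullet> b) * (LINT x:face i|hausdorff2. F x \<bullet> b))"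
    using b by simp
  also have "\<dots> = (\<Sum>i\<in>I. \<Sum>b\<in>Basis. (n i \<bullet> b) * (LINT x:face i|hausdorff2. F x \<bullet> b))"
    by (rule sum.swap)
  also have "\<dots> = (\<Sum>i\<in>I. LINT x:face i|hausdorff2. F x \<bullet> n i)"
  proof (rule sum.cong[OF refl])
    fix i assume i: "i \<in> I"
    have "(LINT x:face i|hausdorff2. F x \<bullet> n i) =
        (LINT x|hausdorff2. (\<Sum>b\<in>Basis. (n i \<bullet> b) * (indicator (face i) x *\<^sub>R (F x \<bullet> b))))"
      unfolding set_lebesgue_integral_def
      by (intro Bochner_Integration.integral_cong refl) (subst euclidean_inner, simp add: sum_distrib_left algebra_simps)
    also have "\<dots> = (\<Sum>b\<in>Basis. LINT x|hausdorff2. (n i \<bullet> b) * (indicator (face i) x *\<^sub>R (F x \<bullet> b)))"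
      by (intro Bochner_Integration.integral_sum integrable_mult_right integrable_face[OF i, unfolded set_integrable_def] continuous_intros Fc)
    also have "\<dots> = (\<Sum>b\<in>Basis. (n i \<bullet> b) * (LINT x:face i|hausdorff2. F x \<bullet> b))"
      by (simp add: set_lebesgue_integral_def)
    finally show "(\<Sum>b\<in>Basis. (n i \<bullet> b) * (LINT x:face i|hausdorff2. F x \<bullet> b)) = (LINT x:face i|hausdorff2. F x \<bullet> n i)" ..
  qed
  finally show ?thesis .
qed

lemma gauss_green_polytope: "gauss_green_measure E perimeter_measure normal_field"
  unfolding gauss_green_measure_def
proof (intro conjI allI impI)
  show "emeasure perimeter_measure K < \<infinity>" if "compact K" for K :: "(real^3) set"
    using that by (simp add: emeasure_perimeter borel_compact)
  have "AE x in hausdorff2. x \<in> (\<Union>i\<in>I. face i) \<longrightarrow> norm (normal_field x) = 1"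
    using AE_face_unique
  proof eventually_elim
    case (elim x)
    show ?case
    proof
      assume "x \<in> (\<Union>i\<in>I. face i)"
      then obtain i where i: "i \<in> I" "x \<in> face i" by auto
      have "normal_field x = (\<Sum>j\<in>I. if j = i then n i else 0)"
        unfolding normal_field_def using elim i by (intro sum.cong) (auto simp: indicator_def)
      then show "norm (normal_field x) = 1" using i finite_I norm_n by simp
    qed
  qed
  then show "AE x in perimeter_measure. norm (normal_field x) = 1"
    unfolding perimeter_measure_def by (subst AE_density) (auto simp: indicator_def elim: eventually_mono)
  fix F :: "real^3 \<Rightarrow> real^3" assume F: "C1_compact_support F"
  then have "\<forall>x. F differentiable (at x)" by (simp add: C1_compact_support_def)
  then have "continuous_on UNIV F"
    by (simp add: continuous_at_imp_continuous_on differentiable_imp_continuous_within)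
  then show "(LINT x:E|lebesgue. divergence F x) = (LINT x|perimeter_measure. F x \<bullet> normal_field x)"
    using divergence_theorem[OF F] perimeter_integral by simp
qed (auto simp: normal_field_measurable)

end

section \<open>Surface energy of Wulff polytopes\<close>

context facetted_polytope
begin

definition relint :: "'i \<Rightarrow> (real^3) set" where
  "relint i = {x. n i \<bullet> x = h i \<and> (\<forall>j\<in>I - {i}. n j \<bullet> x < h j)}"

lemma mem_E_iff: "x \<in> E \<longleftrightarrow> (\<forall>i\<in>I. n i \<bullet> x \<le> h i)"
  by (subst E_def) simp

lemma relint_sub_face: "i \<in> I \<Longrightarrow> relint i \<subseteq> face i"
  unfolding relint_def face_def mem_E_iff by (force simp: less_imp_le)

lemma relint_iff: "i \<in> I \<Longrightarrow> x \<in> relint i \<longleftrightarrow> x \<in> face i \<and> (\<forall>j\<in>I. x \<in> face j \<longrightarrow> j = i)"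
  unfolding relint_def face_def mem_Collect_eq mem_E_iff less_le by (metis DiffE DiffI insertCI order_refl singletonD)

lemma relint_neighbourhood:
  assumes i: "i \<in> I" and x: "x \<in> relint i"
  obtains r where "0 < r" "{y. n i \<bullet> y = h i} \<inter> ball x r \<subseteq> relint i"
proof -
  define U where "U = (\<Inter>j\<in>I - {i}. {y. n j \<bullet> y < h j})"
  have "open U" unfolding U_def using finite_I by (intro open_INT) (auto simp: open_halfspace_lt)
  moreover have "x \<in> U" using x by (auto simp: U_def relint_def)
  ultimately obtain r where "0 < r" "ball x r \<subseteq> U" using open_contains_ball by blast
  then have "{y. n i \<bullet> y = h i} \<inter> ball x r \<subseteq> relint i" by (auto simp: U_def relint_def)
  then show thesis using that \<open>0 < r\<close> by blast
qed

lemma sets_relint: "relint i \<in> sets borel"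
proof -
  have "relint i = {x. n i \<bullet> x = h i} \<inter> (\<Inter>j\<in>I - {i}. {y. n j \<bullet> y < h j})"
    by (auto simp: relint_def)
  also have "\<dots> \<in> sets borel"
    using finite_I by (intro sets.Int borel_closed closed_hyperplane borel_open open_INT) (auto simp: open_halfspace_lt)
  finally show ?thesis .
qed

lemma convex_E: "convex E"
proof -
  have "E = (\<Inter>i\<in>I. {x. n i \<bullet> x \<le> h i})" by (auto simp: E_def)
  then show ?thesis by (auto intro!: convex_INT convex_halfspace_le)
qed

text \<open>Contracting a disc in the face towards a boundary point of the face.\<close>

lemma area_ball_ge:
  assumes i: "i \<in> I" and x: "x \<in> face i"
  obtains \<kappa> r0 where "0 < \<kappa>" "0 < r0" "\<And>r. 0 < r \<Longrightarrow> r < r0 \<Longrightarrow> \<kappa> * r\<^sup>2 \<le> area i (ball x r)"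
proof -
  obtain p where p: "p \<in> relint i" using witness[OF i] by (auto simp: relint_def)
  obtain \<rho> where \<rho>: "0 < \<rho>" "{y. n i \<bullet> y = h i} \<inter> ball p \<rho> \<subseteq> relint i"
    using relint_neighbourhood[OF i p] .
  \<comment> \<open>The contraction towards \<open>x\<close> with ratio r / L takes the disc of
    radius \<rho> about \<open>p\<close> into the ball of radius r about \<open>x\<close>.\<close>
  define L where "L = dist x p + \<rho>"
  have L: "0 < L" using \<rho>(1) zero_le_dist[of x p] unfolding L_def by linarith
  have xp: "n i \<bullet> x = h i" "n i \<bullet> p = h i" using x p by (auto simp: face_def relint_def)
  have "pi * (\<rho> / L)\<^sup>2 * r\<^sup>2 \<le> area i (ball x r)" if r: "0 < r" "r < L" for r
  proof -
    define t where "t = r / L"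
    have t: "0 < t" "t \<le> 1" using r L by (auto simp: t_def)
    define q where "q = x + t *\<^sub>R (p - x)"
    have q: "n i \<bullet> q = h i" by (simp add: q_def inner_simps xp algebra_simps)
    have sub: "{y. n i \<bullet> y = h i} \<inter> ball q (t * \<rho>) \<subseteq> face i \<inter> ball x r"
    proof
      fix y assume "y \<in> {y. n i \<bullet> y = h i} \<inter> ball q (t * \<rho>)"
      then have y: "n i \<bullet> y = h i" "norm (y - q) < t * \<rho>" by (auto simp: dist_norm norm_minus_commute)
      define z where "z = p + (1 / t) *\<^sub>R (y - q)"
      have yz: "y = (1 - t) *\<^sub>R x + t *\<^sub>R z" using t by (simp add: z_def q_def algebra_simps)
      have "norm ((1 / t) *\<^sub>R (y - q)) < \<rho>" using y(2) t by (simp add: pos_divide_less_eq mult.commute)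
      then have "dist p z < \<rho>" by (simp add: z_def dist_norm norm_minus_commute)
      moreover have "n i \<bullet> z = h i" using y(1) q by (simp add: z_def inner_simps xp)
      ultimately have "z \<in> face i" using \<rho>(2) relint_sub_face[OF i] by auto
      then have "y \<in> E" using x t unfolding yz by (intro convexD[OF convex_E]) (auto simp: face_def)
      moreover have "dist x y < r"
      proof -
        have "norm (y - x) \<le> norm (y - q) + norm (q - x)"
          using norm_triangle_ineq[of "y - q" "q - x"] by simp
        also have "\<dots> < t * \<rho> + t * dist x p"
          using y(2) t by (simp add: q_def dist_norm norm_minus_commute)
        also have "\<dots> = t * L" by (simp add: L_def algebra_simps)
        also have "\<dots> = r" using L by (simp add: t_def)
        finally show ?thesis by (simp add: dist_norm norm_minus_commute)
      qed
      ultimately show "y \<in> face i \<inter> ball x r" using y(1) by (auto simp: face_def)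
    qed
    have "ennreal (pi * (t * \<rho>)\<^sup>2) = emeasure hausdorff2 ({y. n i \<bullet> y = h i} \<inter> ball q (t * \<rho>))"
      using t \<rho>(1) by (intro emeasure_plane_ball[OF i q, symmetric]) auto
    also have "\<dots> \<le> emeasure hausdorff2 (face i \<inter> ball x r)"
      by (intro emeasure_mono sub) auto
    also have "\<dots> = ennreal (area i (ball x r))" by (rule area[OF i]) auto
    finally have "pi * (t * \<rho>)\<^sup>2 \<le> area i (ball x r)" using area(2)[OF i] by simp
    then show ?thesis by (simp add: t_def power_divide power_mult_distrib ac_simps)
  qed
  then show thesis using that[of "pi * (\<rho> / L)\<^sup>2" L] \<rho>(1) L by (simp add: mult.assoc)
qed

lemma area_ball_le:
  assumes i: "i \<in> I" and r: "0 \<le> r"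
  shows "area i (ball x r) \<le> 4 * pi * r\<^sup>2"
  using emeasure_face_ball_le[OF i r, of x] area[OF i, of "ball x r"] r by simp

lemma inner_less_one:
  fixes u v :: "real^3"
  assumes "norm u = 1" "norm v = 1" "u \<noteq> v"
  shows "u \<bullet> v < 1"
proof -
  have "0 < (norm (u - v))\<^sup>2" using assms(3) by simp
  also have "(norm (u - v))\<^sup>2 = 2 - 2 * (u \<bullet> v)"
    using assms(1,2) by (simp add: power2_norm_eq_inner inner_diff inner_commute norm_eq_1)
  finally show ?thesis by simp
qed

text \<open>Near a relative interior point of a facet only that facet carries measure, so the
  averages are constant. Conversely, each facet through \<open>x\<close> has at least \<kappa> r^2
  of the at most C r^2 of area in the ball of radius r, hence a fixed share of the average. An
  average of unit vectors that tends to a unit vector forces every such facet to have that normal,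
  and distinct facets have distinct normals.\<close>

lemma has_outer_normal_polytope:
  "has_outer_normal E x m \<longleftrightarrow> (\<exists>i\<in>I. x \<in> relint i \<and> m = n i)"
proof -
  define T where "T r = (\<Sum>i\<in>I. area i (ball x r))" for r
  have T: "measure perimeter_measure (ball x r) = T r" for r by (simp add: measure_perimeter T_def)
  have V: "(LINT y:ball x r|perimeter_measure. normal_field y) = (\<Sum>i\<in>I. area i (ball x r) *\<^sub>R n i)" for r
    by (simp add: perimeter_set_integral)
  have pos: "0 \<le> area i (ball x r)" if "i \<in> I" for i r using area(2)[OF that] by simp
  note iff = has_outer_normal_iff[OF gauss_green_polytope, of x m, unfolded T V]
  have le_T: "area i (ball x r) \<le> T r" if "i \<in> I" for i r
    unfolding T_def using that finite_I pos by (intro member_le_sum) auto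
  show ?thesis
  proof
    assume "\<exists>i\<in>I. x \<in> relint i \<and> m = n i"
    then obtain i where i: "i \<in> I" "x \<in> relint i" "m = n i" by auto
    obtain \<kappa> r0 where \<kappa>: "0 < \<kappa>" "0 < r0" "\<And>r. 0 < r \<Longrightarrow> r < r0 \<Longrightarrow> \<kappa> * r\<^sup>2 \<le> area i (ball x r)"
      using area_ball_ge[OF i(1)] relint_sub_face[OF i(1)] i(2) by blast
    have Tpos: "0 < T r" if r: "0 < r" for r
    proof -
      define s where "s = min r (r0 / 2)"
      have s: "0 < s" "s < r0" "s \<le> r" using r \<kappa>(2) by (auto simp: s_def)
      have "0 < \<kappa> * s\<^sup>2" using s \<kappa> by simp
      also have "\<dots> \<le> area i (ball x s)" using s \<kappa>(3) by simp
      also have "\<dots> \<le> area i (ball x r)"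
        using area[OF i(1), of "ball x s"] area[OF i(1), of "ball x r"] s
          emeasure_mono[of "face i \<inter> ball x s" "face i \<inter> ball x r" hausdorff2]
        by (simp add: subset_ball inf.coboundedI2)
      finally show ?thesis using le_T[OF i(1)] by (rule less_le_trans)
    qed
    define U where "U = (\<Inter>j\<in>I - {i}. {y. n j \<bullet> y < h j})"
    have "open U" unfolding U_def using finite_I by (intro open_INT) (auto simp: open_halfspace_lt)
    moreover have "x \<in> U" using i(2) by (auto simp: U_def relint_def)
    ultimately obtain r1 where r1: "0 < r1" "ball x r1 \<subseteq> U" using open_contains_ball by blast
    have zero: "area j (ball x r) = 0" if "j \<in> I" "j \<noteq> i" "r < r1" for j r
    proof -
      have "ball x r \<subseteq> ball x r1" using that(3) by (simp add: subset_ball)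
      then have "face j \<inter> ball x r = {}" using r1 that(1,2) by (force simp: U_def face_def)
      then show ?thesis by (simp add: area_def)
    qed
    have "(\<Sum>j\<in>I. area j (ball x r) *\<^sub>R n j) /\<^sub>R T r = m" if r: "0 < r" "r < r1" for r
    proof -
      have "(\<Sum>j\<in>I. area j (ball x r) *\<^sub>R n j) = (\<Sum>j\<in>I. if j = i then area i (ball x r) *\<^sub>R n i else 0)"
        using zero r by (intro sum.cong) auto
      moreover have "T r = (\<Sum>j\<in>I. if j = i then area i (ball x r) else 0)"
        unfolding T_def using zero r by (intro sum.cong) auto
      ultimately show ?thesis using Tpos[OF r(1)] i finite_I by simp
    qed
    then have ev: "\<forall>\<^sub>F r in at_right 0. (\<Sum>j\<in>I. area j (ball x r) *\<^sub>R n j) /\<^sub>R T r = m"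
      using r1(1) by (intro eventually_at_rightI[of 0 r1]) auto
    have "((\<lambda>r. (\<Sum>j\<in>I. area j (ball x r) *\<^sub>R n j) /\<^sub>R T r) \<longlongrightarrow> m) (at_right 0)"
      using tendsto_eventually[OF ev] .
    then show "has_outer_normal E x m" unfolding iff using Tpos norm_n[OF i(1)] i(3) by blast
  next
    assume "has_outer_normal E x m"
    then have Tpos: "\<And>r. 0 < r \<Longrightarrow> 0 < T r"
      and lim: "((\<lambda>r. (\<Sum>j\<in>I. area j (ball x r) *\<^sub>R n j) /\<^sub>R T r) \<longlongrightarrow> m) (at_right 0)" and m: "norm m = 1"
      unfolding iff by auto
    have x_face: "x \<in> (\<Union>i\<in>I. face i)"
    proof (rule ccontr)
      assume "x \<notin> (\<Union>i\<in>I. face i)"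
      moreover have "closed (\<Union>i\<in>I. face i)"
        using finite_I compact_face compact_imp_closed by (intro closed_UN) auto
      ultimately obtain r where r: "0 < r" "ball x r \<subseteq> - (\<Union>i\<in>I. face i)"
        by (metis ComplI open_Compl open_contains_ball)
      then have "face i \<inter> ball x r = {}" if "i \<in> I" for i using that by auto
      then have "T r = 0" by (simp add: T_def area_def)
      then show False using Tpos[OF r(1)] by simp
    qed
    have lim1: "((\<lambda>r. 1 - ((\<Sum>j\<in>I. area j (ball x r) *\<^sub>R n j) /\<^sub>R T r) \<bullet> m) \<longlongrightarrow> 0) (at_right 0)"
      using tendsto_diff[OF tendsto_const[of 1] tendsto_inner[OF lim tendsto_const[of m]]] m
      by (simp add: norm_eq_1)
    \<comment> \<open>An average, weighted by area, of the nonnegative defects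
      \<open>1 - n j \<bullet> m\<close>.\<close>
    have eq: "1 - ((\<Sum>j\<in>I. area j (ball x r) *\<^sub>R n j) /\<^sub>R T r) \<bullet> m = (\<Sum>j\<in>I. area j (ball x r) * (1 - n j \<bullet> m)) / T r"
      if "0 < r" for r
    proof -
      have "((\<Sum>j\<in>I. area j (ball x r) *\<^sub>R n j) /\<^sub>R T r) \<bullet> m = (\<Sum>j\<in>I. area j (ball x r) * (n j \<bullet> m)) / T r"
        by (simp add: inner_sum_left divide_inverse mult.commute)
      moreover have "(\<Sum>j\<in>I. area j (ball x r) * (1 - n j \<bullet> m)) = T r - (\<Sum>j\<in>I. area j (ball x r) * (n j \<bullet> m))"
        by (simp add: T_def right_diff_distrib sum_subtractf)
      ultimately show ?thesis using Tpos[OF that] by (simp add: diff_divide_distrib)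
    qed
    have all_m: "n i = m" if i: "i \<in> I" "x \<in> face i" for i
    proof (rule ccontr)
      assume ne: "n i \<noteq> m"
      define c where "c = 1 - n i \<bullet> m"
      have c: "0 < c" using inner_less_one[OF norm_n[OF i(1)] m ne] by (simp add: c_def)
      obtain \<kappa> r0 where \<kappa>: "0 < \<kappa>" "0 < r0" "\<And>r. 0 < r \<Longrightarrow> r < r0 \<Longrightarrow> \<kappa> * r\<^sup>2 \<le> area i (ball x r)"
        using area_ball_ge[OF i] by blast
      define C where "C = real (card I) * (4 * pi)"
      have "0 < card I" using i(1) finite_I card_gt_0_iff by blast
      then have C: "0 < C" by (simp add: C_def)
      have "\<kappa> * c / C \<le> 1 - ((\<Sum>j\<in>I. area j (ball x r) *\<^sub>R n j) /\<^sub>R T r) \<bullet> m" if r: "0 < r" "r < r0" for r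
      proof -
        have "T r \<le> (\<Sum>j\<in>I. 4 * pi * r\<^sup>2)"
          unfolding T_def using r by (intro sum_mono area_ball_le) auto
        then have TC: "T r \<le> C * r\<^sup>2" by (simp add: C_def mult.assoc)
        have "\<kappa> * r\<^sup>2 * c \<le> area i (ball x r) * (1 - n i \<bullet> m)"
          using \<kappa>(3)[OF r] c by (simp add: c_def mult_right_mono)
        also have "\<dots> \<le> (\<Sum>j\<in>I. area j (ball x r) * (1 - n j \<bullet> m))"
        proof (rule member_le_sum[OF i(1) _ finite_I])
          fix j assume "j \<in> I - {i}"
          then have "n j \<bullet> m \<le> 1" using norm_cauchy_schwarz[of "n j" m] norm_n m by simp
          then show "0 \<le> area j (ball x r) * (1 - n j \<bullet> m)" using pos \<open>j \<in> I - {i}\<close> by simp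
        qed
        finally have "\<kappa> * r\<^sup>2 * c \<le> (\<Sum>j\<in>I. area j (ball x r) * (1 - n j \<bullet> m))" .
        then have "\<kappa> * r\<^sup>2 * c / (C * r\<^sup>2) \<le> (\<Sum>j\<in>I. area j (ball x r) * (1 - n j \<bullet> m)) / T r"
          using TC Tpos[OF r(1)] \<kappa>(1) c
            order_trans[of 0 "\<kappa> * r\<^sup>2 * c" "\<Sum>j\<in>I. area j (ball x r) * (1 - n j \<bullet> m)"]
          by (intro frac_le) auto
        also have "\<kappa> * r\<^sup>2 * c / (C * r\<^sup>2) = \<kappa> * c / C" using r by simp
        finally show ?thesis using eq[OF r(1)] by simp
      qed
      then have "\<forall>\<^sub>F r in at_right 0. \<kappa> * c / C \<le> 1 - ((\<Sum>j\<in>I. area j (ball x r) *\<^sub>R n j) /\<^sub>R T r) \<bullet> m"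
        using \<kappa>(2) by (intro eventually_at_rightI[of 0 r0]) auto
      then have "\<kappa> * c / C \<le> 0" by (intro tendsto_lowerbound[OF lim1]) auto
      then show False using \<kappa>(1) c C by (simp add: divide_le_0_iff mult_le_0_iff)
    qed
    obtain i where i: "i \<in> I" "x \<in> face i" using x_face by auto
    have "j = i" if "j \<in> I" "x \<in> face j" for j
      using all_m[OF that] all_m[OF i] inj_n that(1) i(1) by (auto dest: inj_onD)
    then have "x \<in> relint i" using i relint_iff[OF i(1), of x] by blast
    then show "\<exists>i\<in>I. x \<in> relint i \<and> m = n i" using i(1) all_m[OF i, symmetric] by blast
  qed
qed

lemma outer_normal_polytope:
  assumes "i \<in> I" "x \<in> relint i"
  shows "outer_normal E x = n i"
  unfolding outer_normal_def has_outer_normal_polytope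
proof (rule the_equality)
  show "\<exists>j\<in>I. x \<in> relint j \<and> n i = n j" using assms by auto
  fix m assume "\<exists>j\<in>I. x \<in> relint j \<and> m = n j"
  then obtain j where j: "j \<in> I" "x \<in> relint j" "m = n j" by auto
  then have "j = i" using assms relint_iff by blast
  then show "m = n i" using j by simp
qed

lemma reduced_boundary_polytope: "reduced_boundary E = (\<Union>i\<in>I. relint i)"
  by (auto simp: reduced_boundary_def has_outer_normal_polytope)

lemma measure_relint:
  assumes i: "i \<in> I"
  shows "measure hausdorff2 (relint i) = measure hausdorff2 (face i)"
proof -
  have "AE x in hausdorff2. x \<in> relint i \<longleftrightarrow> x \<in> face i"
    using AE_face_unique by eventually_elim (use i in \<open>auto simp: relint_iff\<close>)
  then show ?thesis by (intro measure_eq_AE) (auto simp: sets_relint)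
qed

lemma surface_energy_polytope: "surface_energy \<phi> E = (\<Sum>i\<in>I. \<phi> (n i) * measure hausdorff2 (face i))"
proof -
  have ind: "indicator (reduced_boundary E) x *\<^sub>R \<phi> (outer_normal E x) = (\<Sum>i\<in>I. indicator (relint i) x * \<phi> (n i))" for x
  proof (cases "x \<in> reduced_boundary E")
    case True
    then obtain i where i: "i \<in> I" "x \<in> relint i" by (auto simp: reduced_boundary_polytope)
    have "x \<in> relint j \<longleftrightarrow> j = i" if "j \<in> I" for j
      using i that relint_iff[of j x] relint_iff[of i x] by blast
    then have "(\<Sum>j\<in>I. indicator (relint j) x * \<phi> (n j)) = (\<Sum>j\<in>I. if j = i then \<phi> (n i) else 0)"
      by (intro sum.cong) (auto simp: indicator_def)
    then show ?thesis using True i finite_I by (simp add: outer_normal_polytope)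
  qed (auto simp: reduced_boundary_polytope indicator_def)
  have fin: "emeasure hausdorff2 (relint i) < \<infinity>" if "i \<in> I" for i
    using emeasure_mono[OF relint_sub_face[OF that], of hausdorff2] emeasure_face_finite[OF that]
    by (auto intro: le_less_trans)
  have "surface_energy \<phi> E = (LINT x|hausdorff2. (\<Sum>i\<in>I. indicator (relint i) x * \<phi> (n i)))"
    unfolding surface_energy_def set_lebesgue_integral_def ind ..
  also have "\<dots> = (\<Sum>i\<in>I. LINT x|hausdorff2. indicator (relint i) x * \<phi> (n i))"
    using fin by (intro Bochner_Integration.integral_sum integrable_mult_left integrable_real_indicator)
      (auto simp: sets_relint)
  also have "\<dots> = (\<Sum>i\<in>I. \<phi> (n i) * measure hausdorff2 (face i))"
    by (simp add: measure_relint mult.commute)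
  finally show ?thesis .
qed

text \<open>The divergence theorem for the identity field, cut off away from \<open>E\<close>.\<close>

lemma volume_polytope: "(\<Sum>i\<in>I. h i * measure hausdorff2 (face i)) = 3 * measure lebesgue E"
proof -
  obtain B where B: "0 < B" "\<And>y. y \<in> E \<Longrightarrow> norm y \<le> B" using bounded_E bounded_pos by metis
  \<comment> \<open>Equal to 1 on the ball of radius \<open>B\<close>, which contains
    \<open>E\<close>, equal to 0 once |x|^2 exceeds B^2 + 1, and continuously
    differentiable.\<close>
  define cut where "cut x = ramp2 (1 - ramp2 (x \<bullet> x - B\<^sup>2))" for x :: "real^3"
  define F where "F x = cut x *\<^sub>R x" for x
  define G where "G x v = (2 * max 0 (1 - ramp2 (x \<bullet> x - B\<^sup>2))) * (- ((2 * max 0 (x \<bullet> x - B\<^sup>2)) * (2 * (x \<bullet> v))))" for x v :: "real^3"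
  have r2: "(ramp2 has_derivative (*) (2 * max 0 t)) (at t)" for t
    using DERIV_ramp2[of t] by (simp add: has_field_derivative_def)
  have dercut: "(cut has_derivative G x) (at x)" for x
  proof -
    have 1: "((\<lambda>x. x \<bullet> x - B\<^sup>2) has_derivative (\<lambda>v. 2 * (x \<bullet> v))) (at x)"
      by (auto intro!: derivative_eq_intros simp: inner_commute)
    have 2: "((\<lambda>x. 1 - ramp2 (x \<bullet> x - B\<^sup>2)) has_derivative (\<lambda>v. - ((2 * max 0 (x \<bullet> x - B\<^sup>2)) * (2 * (x \<bullet> v))))) (at x)"
      using has_derivative_diff[OF has_derivative_const[of 1] has_derivative_compose[OF 1 r2]] by simp
    show ?thesis
      unfolding cut_def[abs_def] G_def[abs_def] using has_derivative_compose[OF 2 r2] .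
  qed
  have der: "(F has_derivative (\<lambda>v. cut x *\<^sub>R v + G x v *\<^sub>R x)) (at x)" for x
    unfolding F_def by (rule has_derivative_scaleR[OF dercut has_derivative_ident])
  have fd: "frechet_derivative F (at x) = (\<lambda>v. cut x *\<^sub>R v + G x v *\<^sub>R x)" for x
    using frechet_derivative_at[OF der] by simp
  have contcut: "continuous_on UNIV cut"
    using has_derivative_continuous[OF dercut] by (simp add: continuous_at_imp_continuous_on)
  have "continuous_on UNIV (\<lambda>x. cut x *\<^sub>R v + G x v *\<^sub>R x)" for v
    unfolding G_def
    by (intro continuous_intros contcut continuous_on_compose2[OF continuous_ramp2[of UNIV]]) auto
  moreover have "F x = 0" if "x \<notin> cball 0 (B + 1)" for x
  proof -
    have "B + 1 < norm x" using that by (simp add: dist_norm)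
    then have "(B + 1)\<^sup>2 \<le> x \<bullet> x" using B(1) by (metis dot_square_norm power_mono less_imp_le add_nonneg_nonneg zero_le_one)
    then have "1 \<le> x \<bullet> x - B\<^sup>2" using B(1) by (simp add: power2_sum)
    then have "1\<^sup>2 \<le> (max 0 (x \<bullet> x - B\<^sup>2))\<^sup>2" by (intro power_mono) auto
    then show ?thesis by (simp add: F_def cut_def ramp2_def)
  qed
  ultimately have "C1_compact_support F"
    unfolding C1_compact_support_def fd using der by (auto simp: differentiable_def intro!: exI[of _ "cball 0 (B + 1)"])
  note GG = divergence_theorem[OF this]
  have inE: "x \<bullet> x - B\<^sup>2 \<le> 0" if "x \<in> E" for x
    using power_mono[OF B(2)[OF that], of 2] by (simp add: dot_square_norm)
  have onE: "F x = x" "divergence F x = 3" if "x \<in> E" for x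
  proof -
    have *: "cut x = 1" "G x v = 0" for v using inE[OF that] by (auto simp: cut_def G_def ramp2_def)
    show "F x = x" by (simp add: F_def *)
    show "divergence F x = 3" by (simp add: divergence_def fd * Basis_real3 axis_eq_axis inner_axis_axis)
  qed
  have "3 * measure lebesgue E = (LINT x:E|lebesgue. divergence F x)"
  proof -
    have "E \<in> lmeasurable" using closed_E bounded_E by (simp add: lmeasurable_compact compact_eq_bounded_closed)
    then have "(LINT x:E|lebesgue. (3::real)) = 3 * measure lebesgue E"
      by (simp add: set_lebesgue_integral_def fmeasurable_def)
    moreover have "(LINT x:E|lebesgue. divergence F x) = (LINT x:E|lebesgue. 3)"
      unfolding set_lebesgue_integral_def using onE(2)
      by (intro Bochner_Integration.integral_cong refl) (auto simp: indicator_def)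
    ultimately show ?thesis by simp
  qed
  also have "\<dots> = (\<Sum>i\<in>I. h i * measure hausdorff2 (face i))"
    unfolding GG
  proof (rule sum.cong[OF refl])
    fix i assume i: "i \<in> I"
    have "(LINT x:face i|hausdorff2. F x \<bullet> n i) = (LINT x|hausdorff2. indicator (face i) x * h i)"
      unfolding set_lebesgue_integral_def using onE(1)
      by (intro Bochner_Integration.integral_cong refl) (auto simp: indicator_def face_def inner_commute)
    then show "(LINT x:face i|hausdorff2. F x \<bullet> n i) = h i * measure hausdorff2 (face i)"
      using emeasure_face_finite[OF i] by simp
  qed
  finally show ?thesis ..
qed

theorem surface_energy_wulff:
  assumes "\<And>i. i \<in> I \<Longrightarrow> \<phi> (n i) = h i"
  shows "surface_energy \<phi> E = 3 * measure lebesgue E"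
  using assms by (simp add: surface_energy_polytope flip: volume_polytope)

end

section \<open>The polar of the surface tension\<close>

definition hcp_tension :: "real^3 \<Rightarrow> real" where
  "hcp_tension \<nu> = sqrt 2 * (\<bar>e1 \<bullet> \<nu>\<bar> + \<bar>e2 \<bullet> \<nu>\<bar> + \<bar>(e1 - e2) \<bullet> \<nu>\<bar>)
            + 1 / sqrt 2 * \<bar>e3 \<bullet> \<nu>\<bar>
            + sqrt 2 * Max {\<bar>e1 \<bullet> \<nu>\<bar>, \<bar>e2 \<bullet> \<nu>\<bar>, \<bar>e3 \<bullet> \<nu>\<bar>, \<bar>(e1 - e2) \<bullet> \<nu>\<bar>}"

definition hcp_gauge :: "real^3 \<Rightarrow> real" where
  "hcp_gauge \<zeta> = Max {2 / (7 * sqrt 2) * (\<bar>\<zeta> $ 1\<bar> + 1 / sqrt 3 * \<bar>\<zeta> $ 2\<bar> + 3 / (2 * sqrt 6) * \<bar>\<zeta> $ 3\<bar>),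
                 1 / (2 * sqrt 3) * \<bar>\<zeta> $ 3\<bar>,
                 2 / (3 * sqrt 6) * \<bar>\<zeta> $ 2\<bar>,
                 4 / (7 * sqrt 6) * \<bar>\<zeta> $ 2\<bar> + 3 / (14 * sqrt 3) * \<bar>\<zeta> $ 3\<bar>,
                 1 / (3 * sqrt 2) * (\<bar>\<zeta> $ 1\<bar> + 1 / sqrt 3 * \<bar>\<zeta> $ 2\<bar>)}"

text \<open>Dual pairs of coordinates that make all coefficients rational.\<close>

definition covec :: "real \<Rightarrow> real \<Rightarrow> real \<Rightarrow> real^3" where
  "covec a b c = vector [a, b / sqrt 3, 3 / (2 * sqrt 6) * c]"

definition pvec :: "real \<Rightarrow> real \<Rightarrow> real \<Rightarrow> real^3" where
  "pvec x y z = vector [x, sqrt 3 * y, 2 / 3 * sqrt 6 * z]"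

lemma covec_pvec: "covec a b c \<bullet> pvec x y z = a * x + b * y + c * z"
  by (simp add: covec_def pvec_def inner_vec_def sum_3)

lemma pvec_cases: obtains x y z where "\<zeta> = pvec x y z"
  using that[of "\<zeta> $ 1" "\<zeta> $ 2 / sqrt 3" "3 / (2 * sqrt 6) * \<zeta> $ 3"]
  by (simp add: pvec_def vec_eq_iff forall_3)

lemma covec_cases: obtains a b c where "\<nu> = covec a b c"
  using that[of "\<nu> $ 1" "sqrt 3 * \<nu> $ 2" "2 / 3 * sqrt 6 * \<nu> $ 3"]
  by (simp add: covec_def vec_eq_iff forall_3)

lemma covec_eq_0_iff: "covec a b c = 0 \<longleftrightarrow> a = 0 \<and> b = 0 \<and> c = 0"
  by (simp add: covec_def vec_eq_iff forall_3)

lemma scaleR_covec: "t *\<^sub>R covec a b c = covec (t * a) (t * b) (t * c)"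
  by (simp add: covec_def vec_eq_iff forall_3)

text \<open>Here \<open>a\<close>, \<open>(a + b) / 2\<close> and \<open>(a - b) / 2\<close> are the
  inner products with \<open>e1\<close>, \<open>e2\<close> and \<open>e1 - e2\<close>. The
  identities |a + b| + |a - b| = 2 max |a| |b| and max |a + b| |a - b| = |a| + |b| leave an
  expression in absolute values of the coordinates.\<close>

definition tension_coord :: "real \<Rightarrow> real \<Rightarrow> real \<Rightarrow> real" where
  "tension_coord a b c = \<bar>a\<bar> + max \<bar>a\<bar> \<bar>b\<bar> + \<bar>c\<bar> / 2 + max (max \<bar>a\<bar> ((\<bar>a\<bar> + \<bar>b\<bar>) / 2)) \<bar>c\<bar>"

lemma e_covec:
  "e1 \<bullet> covec a b c = a" "e2 \<bullet> covec a b c = (a + b) / 2" "(e1 - e2) \<bullet> covec a b c = (a - b) / 2"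
  "e3 \<bullet> covec a b c = c"
  by (simp_all add: e1_def e2_def e3_def covec_def inner_vec_def sum_3 field_simps)

lemma hcp_tension_covec: "hcp_tension (covec a b c) = sqrt 2 * tension_coord a b c"
proof -
  have 1: "1 / sqrt 2 * \<bar>c\<bar> = sqrt 2 * (\<bar>c\<bar> / 2)"
    by (simp add: field_simps)
  have 2: "\<bar>(a + b) / 2\<bar> + \<bar>(a - b) / 2\<bar> = max \<bar>a\<bar> \<bar>b\<bar>"
  proof (cases "\<bar>a\<bar> \<le> \<bar>b\<bar>")
    case True
    then have "\<bar>(a + b) / 2\<bar> + \<bar>(a - b) / 2\<bar> = \<bar>b\<bar>" by (auto simp: abs_if field_simps split: if_splits)
    then show ?thesis using True by simp
  next
    case False
    then have "\<bar>(a + b) / 2\<bar> + \<bar>(a - b) / 2\<bar> = \<bar>a\<bar>" by (auto simp: abs_if field_simps split: if_splits)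
    then show ?thesis using False by simp
  qed
  have half: "(\<bar>a\<bar> + \<bar>b\<bar>) / 2 = max \<bar>(a + b) / 2\<bar> \<bar>(a - b) / 2\<bar>"
  proof (cases "\<bar>(a + b) / 2\<bar> \<le> \<bar>(a - b) / 2\<bar>")
    case True
    then have "(\<bar>a\<bar> + \<bar>b\<bar>) / 2 = \<bar>(a - b) / 2\<bar>" by (auto simp: abs_if field_simps split: if_splits)
    then show ?thesis using True by simp
  next
    case False
    then have "(\<bar>a\<bar> + \<bar>b\<bar>) / 2 = \<bar>(a + b) / 2\<bar>" by (auto simp: abs_if field_simps split: if_splits)
    then show ?thesis using False by simp
  qed
  have Max4: "Max {p, q, r, s} = max (max p (max q s)) r" for p q r s :: real
    by (simp add: ac_simps)
  have 3: "Max {\<bar>a\<bar>, \<bar>(a + b) / 2\<bar>, \<bar>c\<bar>, \<bar>(a - b) / 2\<bar>} = max (max \<bar>a\<bar> ((\<bar>a\<bar> + \<bar>b\<bar>) / 2)) \<bar>c\<bar>"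
    unfolding Max4 half ..
  show ?thesis
    unfolding hcp_tension_def e_covec 1 3 tension_coord_def
    by (simp only: 2[symmetric] distrib_left add.assoc)
qed

text \<open>The five terms are the orbits of facets under sign changes, with covectors (1,1,1),
  (0,0,1), (0,1,0), (0,2,1), (1,1,0); the denominators are twice their
  \<open>tension_coord\<close>.\<close>

definition gauge_coord :: "real \<Rightarrow> real \<Rightarrow> real \<Rightarrow> real" where
  "gauge_coord x y z = Max {(\<bar>x\<bar> + \<bar>y\<bar> + \<bar>z\<bar>) / 7, \<bar>z\<bar> / 3, \<bar>y\<bar> / 3, (2 * \<bar>y\<bar> + \<bar>z\<bar>) / 7, (\<bar>x\<bar> + \<bar>y\<bar>) / 6}"

lemma sqrt6: "sqrt 6 = sqrt 2 * sqrt 3" by (simp flip: real_sqrt_mult)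

lemma sqrt2_mult: "sqrt 2 * (sqrt 2 * c) = 2 * c"
  by (simp flip: mult.assoc)

lemma hcp_gauge_pvec: "hcp_gauge (pvec x y z) = sqrt 2 * gauge_coord x y z"
proof -
  have n: "pvec x y z $ 1 = x" "pvec x y z $ 2 = sqrt 3 * y" "pvec x y z $ 3 = 2 / 3 * sqrt 6 * z"
    by (simp_all add: pvec_def)
  have 1: "2 / (7 * sqrt 2) * (\<bar>x\<bar> + 1 / sqrt 3 * \<bar>sqrt 3 * y\<bar> + 3 / (2 * sqrt 6) * \<bar>2 / 3 * sqrt 6 * z\<bar>)
      = sqrt 2 * ((\<bar>x\<bar> + \<bar>y\<bar> + \<bar>z\<bar>) / 7)"
    by (simp add: abs_mult field_simps sqrt2_mult)
  have 2: "1 / (2 * sqrt 3) * \<bar>2 / 3 * sqrt 6 * z\<bar> = sqrt 2 * (\<bar>z\<bar> / 3)"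
    by (simp add: abs_mult sqrt6 field_simps sqrt2_mult)
  have 3: "2 / (3 * sqrt 6) * \<bar>sqrt 3 * y\<bar> = sqrt 2 * (\<bar>y\<bar> / 3)"
    by (simp add: abs_mult sqrt6 field_simps sqrt2_mult)
  have 4: "4 / (7 * sqrt 6) * \<bar>sqrt 3 * y\<bar> + 3 / (14 * sqrt 3) * \<bar>2 / 3 * sqrt 6 * z\<bar> = sqrt 2 * ((2 * \<bar>y\<bar> + \<bar>z\<bar>) / 7)"
    by (simp add: abs_mult sqrt6 field_simps sqrt2_mult)
  have 5: "1 / (3 * sqrt 2) * (\<bar>x\<bar> + 1 / sqrt 3 * \<bar>sqrt 3 * y\<bar>) = sqrt 2 * ((\<bar>x\<bar> + \<bar>y\<bar>) / 6)"
    by (simp add: abs_mult field_simps sqrt2_mult)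
  have M: "sqrt 2 * Max S = Max ((\<lambda>t. sqrt 2 * t) ` S)" if "finite S" "S \<noteq> {}" for S
    using that by (intro mono_Max_commute) (auto intro: monoI)
  show ?thesis
    unfolding hcp_gauge_def n 1 2 3 4 5 gauge_coord_def
    by (subst M) (simp_all only: image_insert image_empty finite.intros insert_not_empty not_False_eq_True)
qed

lemma gauge_coord_bounds:
  "\<bar>x\<bar> + \<bar>y\<bar> + \<bar>z\<bar> \<le> 7 * gauge_coord x y z" "\<bar>z\<bar> \<le> 3 * gauge_coord x y z" "\<bar>y\<bar> \<le> 3 * gauge_coord x y z"
  "2 * \<bar>y\<bar> + \<bar>z\<bar> \<le> 7 * gauge_coord x y z" "\<bar>x\<bar> + \<bar>y\<bar> \<le> 6 * gauge_coord x y z"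
proof -
  let ?g = "gauge_coord x y z"
  have "(\<bar>x\<bar> + \<bar>y\<bar> + \<bar>z\<bar>) / 7 \<le> ?g" "\<bar>z\<bar> / 3 \<le> ?g" "\<bar>y\<bar> / 3 \<le> ?g" "(2 * \<bar>y\<bar> + \<bar>z\<bar>) / 7 \<le> ?g" "(\<bar>x\<bar> + \<bar>y\<bar>) / 6 \<le> ?g"
    unfolding gauge_coord_def by (intro Max_ge; simp)+
  then show "\<bar>x\<bar> + \<bar>y\<bar> + \<bar>z\<bar> \<le> 7 * ?g" "\<bar>z\<bar> \<le> 3 * ?g" "\<bar>y\<bar> \<le> 3 * ?g"
    "2 * \<bar>y\<bar> + \<bar>z\<bar> \<le> 7 * ?g" "\<bar>x\<bar> + \<bar>y\<bar> \<le> 6 * ?g" by simp_all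
qed

text \<open>Every covector is a combination of facet normals of the Wulff shape on a common linearity cone of
  the tension.\<close>

lemma duality_nonneg:
  fixes a b c x y z g :: real
  assumes nn: "0 \<le> a" "0 \<le> b" "0 \<le> c" "0 \<le> y"
    and P: "x + y + z \<le> 7 * g" "z \<le> 3 * g" "y \<le> 3 * g" "2 * y + z \<le> 7 * g" "x + y \<le> 6 * g"
  shows "a * x + b * y + c * z \<le> 2 * (a + max a b + c / 2 + max (max a ((a + b) / 2)) c) * g"
proof -
  note m = mult_left_mono
  \<comment> \<open>The cones on which both maxima are linear. The multipliers in each case write
    (a, b, c) in terms of the facet covectors; when b \<le> a the combination has second entry a
    instead of b, and the excess is absorbed by 0 \<le> y.\<close>
  consider (1) "b \<le> a" "c \<le> a" | (2) "b \<le> a" "a < c" | (3) "a < b" "c \<le> a" | (4) "a < b" "a < c" "c \<le> (a + b) / 2"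
    | (5) "a < b" "(a + b) / 2 < c" by linarith
  then show ?thesis
  proof cases
    case 1
    then have "max (max a ((a + b) / 2)) c = a" "max a b = a" by auto
    then show ?thesis
      using m[OF P(1), of c] m[OF P(5), of "a - c"] m[OF nn(4), of "a - b"] nn 1 by (simp add: algebra_simps)
  next
    case 2
    then have "max (max a ((a + b) / 2)) c = c" "max a b = a" by auto
    then show ?thesis
      using m[OF P(1), of a] m[OF P(2), of "c - a"] m[OF nn(4), of "a - b"] nn 2 by (simp add: algebra_simps)
  next
    case 3
    then have "max (max a ((a + b) / 2)) c = (a + b) / 2" "max a b = b" by auto
    then show ?thesis
      using m[OF P(1), of c] m[OF P(5), of "a - c"] m[OF P(3), of "b - a"] nn 3 by (simp add: field_simps)
  next
    case 4
    then have "max (max a ((a + b) / 2)) c = (a + b) / 2" "max a b = b" by auto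
    then show ?thesis
      using m[OF P(1), of a] m[OF P(4), of "c - a"] m[OF P(3), of "b - 2 * c + a"] nn 4 by (simp add: field_simps)
  next
    case 5
    then have "max (max a ((a + b) / 2)) c = c" "max a b = b" by auto
    then show ?thesis
      using m[OF P(1), of a] m[OF P(4), of "(b - a) / 2"] m[OF P(2), of "c - (a + b) / 2"] nn 5
      by (simp add: field_simps)
  qed
qed

lemma duality: "\<nu> \<bullet> \<zeta> \<le> hcp_tension \<nu> * hcp_gauge \<zeta>"
proof -
  obtain a b c where \<nu>: "\<nu> = covec a b c" by (rule covec_cases)
  obtain x y z where \<zeta>: "\<zeta> = pvec x y z" by (rule pvec_cases)
  have "\<nu> \<bullet> \<zeta> \<le> \<bar>a\<bar> * \<bar>x\<bar> + \<bar>b\<bar> * \<bar>y\<bar> + \<bar>c\<bar> * \<bar>z\<bar>"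
    unfolding \<nu> \<zeta> covec_pvec abs_mult[symmetric] by linarith
  also have "\<dots> \<le> 2 * tension_coord a b c * gauge_coord x y z"
    unfolding tension_coord_def by (intro duality_nonneg gauge_coord_bounds) auto
  also have "\<dots> = hcp_tension \<nu> * hcp_gauge \<zeta>"
    by (simp add: \<nu> \<zeta> hcp_tension_covec hcp_gauge_pvec)
  finally show ?thesis .
qed

lemma tension_coord_nonneg: "0 \<le> tension_coord a b c" by (simp add: tension_coord_def)

lemma hcp_tension_pos: "\<nu> \<noteq> 0 \<Longrightarrow> 0 < hcp_tension \<nu>"
proof -
  assume nz: "\<nu> \<noteq> 0"
  obtain a b c where \<nu>: "\<nu> = covec a b c" by (rule covec_cases)
  have "0 < \<bar>a\<bar> + \<bar>b\<bar> + \<bar>c\<bar>" using nz unfolding \<nu> covec_eq_0_iff by linarith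
  moreover have "\<bar>b\<bar> \<le> max \<bar>a\<bar> \<bar>b\<bar>" "\<bar>c\<bar> \<le> max (max \<bar>a\<bar> ((\<bar>a\<bar> + \<bar>b\<bar>) / 2)) \<bar>c\<bar>" by auto
  ultimately have "0 < tension_coord a b c" unfolding tension_coord_def by linarith
  then show ?thesis by (simp add: \<nu> hcp_tension_covec)
qed

lemma hcp_tension_nonneg: "0 \<le> hcp_tension \<nu>"
proof -
  obtain a b c where "\<nu> = covec a b c" by (rule covec_cases)
  then show ?thesis by (simp add: hcp_tension_covec tension_coord_nonneg)
qed

lemma hcp_tension_scaleR: "0 \<le> t \<Longrightarrow> hcp_tension (t *\<^sub>R \<nu>) = t * hcp_tension \<nu>"
proof -
  assume t: "0 \<le> t"
  obtain a b c where \<nu>: "\<nu> = covec a b c" by (rule covec_cases)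
  have "tension_coord (t * a) (t * b) (t * c) = t * tension_coord a b c"
  proof -
    have mx: "max (t * p) (t * q) = t * max p q" for p q using t by (simp add: max_mult_distrib_left)
    have ab: "\<bar>t * p\<bar> = t * \<bar>p\<bar>" for p using t by (simp add: abs_mult)
    have half: "(t * p + t * q) / 2 = t * ((p + q) / 2)" for p q by (simp add: algebra_simps)
    show ?thesis unfolding tension_coord_def ab half mx by (simp add: algebra_simps)
  qed
  then show ?thesis by (simp add: \<nu> scaleR_covec hcp_tension_covec)
qed

lemma hcp_tension_convex: "convex_on UNIV hcp_tension"
proof -
  have ab: "convex_on UNIV (\<lambda>\<nu>::real^3. \<bar>u \<bullet> \<nu>\<bar>)" for u
  proof (rule convex_onI)
    fix t :: real and x y :: "real^3" assume t: "0 < t" "t < 1"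
    have "\<bar>u \<bullet> ((1 - t) *\<^sub>R x + t *\<^sub>R y)\<bar> \<le> \<bar>(1 - t) * (u \<bullet> x)\<bar> + \<bar>t * (u \<bullet> y)\<bar>"
      by (simp add: inner_simps)
    then show "\<bar>u \<bullet> ((1 - t) *\<^sub>R x + t *\<^sub>R y)\<bar> \<le> (1 - t) * \<bar>u \<bullet> x\<bar> + t * \<bar>u \<bullet> y\<bar>"
      using t by (simp add: abs_mult)
  qed simp
  have mx: "convex_on UNIV (\<lambda>\<nu>::real^3. max (f \<nu>) (g \<nu>))" if "convex_on UNIV f" "convex_on UNIV g" for f g :: "real^3 \<Rightarrow> real"
  proof (rule convex_onI)
    fix t :: real and x y :: "real^3" assume t: "0 < t" "t < 1"
    have "f ((1 - t) *\<^sub>R x + t *\<^sub>R y) \<le> (1 - t) * f x + t * f y" "g ((1 - t) *\<^sub>R x + t *\<^sub>R y) \<le> (1 - t) * g x + t * g y"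
      using that t by (auto intro: convex_onD)
    moreover have "(1 - t) * f x + t * f y \<le> (1 - t) * max (f x) (g x) + t * max (f y) (g y)"
      "(1 - t) * g x + t * g y \<le> (1 - t) * max (f x) (g x) + t * max (f y) (g y)"
      using t by (auto intro!: add_mono mult_left_mono)
    ultimately show "max (f ((1 - t) *\<^sub>R x + t *\<^sub>R y)) (g ((1 - t) *\<^sub>R x + t *\<^sub>R y)) \<le> (1 - t) * max (f x) (g x) + t * max (f y) (g y)"
      by linarith
  qed simp
  have eq: "hcp_tension = (\<lambda>\<nu>. sqrt 2 * (\<bar>e1 \<bullet> \<nu>\<bar> + \<bar>e2 \<bullet> \<nu>\<bar> + \<bar>(e1 - e2) \<bullet> \<nu>\<bar>)
            + 1 / sqrt 2 * \<bar>e3 \<bullet> \<nu>\<bar>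
            + sqrt 2 * max \<bar>e1 \<bullet> \<nu>\<bar> (max \<bar>e2 \<bullet> \<nu>\<bar> (max \<bar>e3 \<bullet> \<nu>\<bar> \<bar>(e1 - e2) \<bullet> \<nu>\<bar>)))"
    by (simp add: hcp_tension_def fun_eq_iff)
  show ?thesis unfolding eq by (intro convex_on_add convex_on_cmul ab mx) auto
qed

text \<open>The upper bound is \<open>duality\<close>. For the lower bound each of the five terms is
  the quotient at one facet covector with signs adapted to \<zeta>; by homogeneity the covector need
  not have length 1.\<close>

lemma polar_hcp: "polar hcp_tension \<zeta> = hcp_gauge \<zeta>"
proof -
  have le: "(\<nu> \<bullet> \<zeta>) / hcp_tension \<nu> \<le> hcp_gauge \<zeta>" if "\<nu> \<in> sphere 0 1" for \<nu>
  proof -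
    have "0 < hcp_tension \<nu>" using that by (intro hcp_tension_pos) auto
    then show ?thesis using duality[of \<nu> \<zeta>] by (simp add: pos_divide_le_eq mult.commute)
  qed
  have bdd: "bdd_above ((\<lambda>\<nu>. (\<nu> \<bullet> \<zeta>) / hcp_tension \<nu>) ` sphere 0 1)"
    using le by (intro bdd_aboveI2) auto
  obtain x y z where \<zeta>: "\<zeta> = pvec x y z" by (rule pvec_cases)
  have ge: "(a * x + b * y + c * z) / (sqrt 2 * tension_coord a b c) \<le> polar hcp_tension \<zeta>"
    if nz: "a \<noteq> 0 \<or> b \<noteq> 0 \<or> c \<noteq> 0" for a b c
  proof -
    define \<nu> where "\<nu> = covec a b c"
    have \<nu>: "\<nu> \<noteq> 0" using nz by (simp add: \<nu>_def covec_eq_0_iff)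
    have "(a * x + b * y + c * z) / (sqrt 2 * tension_coord a b c) = (\<nu> \<bullet> \<zeta>) / hcp_tension \<nu>"
      by (simp add: \<nu>_def \<zeta> covec_pvec hcp_tension_covec)
    also have "\<dots> = ((1 / norm \<nu>) *\<^sub>R \<nu> \<bullet> \<zeta>) / hcp_tension ((1 / norm \<nu>) *\<^sub>R \<nu>)"
      using \<nu> by (simp add: hcp_tension_scaleR)
    also have "\<dots> \<le> polar hcp_tension \<zeta>"
      unfolding polar_def using \<nu> by (intro cSUP_upper[OF _ bdd]) auto
    finally show ?thesis .
  qed
  have ge': "sqrt 2 * (a * x + b * y + c * z) / (2 * tension_coord a b c) \<le> polar hcp_tension \<zeta>"
    if nz: "a \<noteq> 0 \<or> b \<noteq> 0 \<or> c \<noteq> 0" for a b c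
  proof -
    have "sqrt 2 * (a * x + b * y + c * z) / (2 * tension_coord a b c) =
        (sqrt 2 / 2) * ((a * x + b * y + c * z) / tension_coord a b c)" by simp
    also have "sqrt 2 / 2 = 1 / sqrt 2" by (simp add: field_simps)
    finally show ?thesis using ge[OF nz] by simp
  qed
  \<comment> \<open>The sign takes the value 1 at 0, so that no test covector vanishes.\<close>
  define s where "s t = (if 0 \<le> t then 1 else - 1 :: real)" for t :: real
  have s: "s t * t = \<bar>t\<bar>" "\<bar>s t\<bar> = 1" "s t \<noteq> 0" for t by (auto simp: s_def)
  have t: "tension_coord (s x) (s y) (s z) = 7 / 2" "tension_coord 0 0 (s z) = 3 / 2" "tension_coord 0 (s y) 0 = 3 / 2"
    "tension_coord 0 (2 * s y) (s z) = 7 / 2" "tension_coord (s x) (s y) 0 = 3"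
    by (simp_all add: tension_coord_def s abs_mult)
  note g = ge'[of "s x" "s y" "s z"] ge'[of 0 0 "s z"] ge'[of 0 "s y" 0] ge'[of 0 "2 * s y" "s z"] ge'[of "s x" "s y" 0]
  have pieces: "sqrt 2 * ((\<bar>x\<bar> + \<bar>y\<bar> + \<bar>z\<bar>) / 7) \<le> polar hcp_tension \<zeta>"
    "sqrt 2 * (\<bar>z\<bar> / 3) \<le> polar hcp_tension \<zeta>" "sqrt 2 * (\<bar>y\<bar> / 3) \<le> polar hcp_tension \<zeta>"
    "sqrt 2 * ((2 * \<bar>y\<bar> + \<bar>z\<bar>) / 7) \<le> polar hcp_tension \<zeta>" "sqrt 2 * ((\<bar>x\<bar> + \<bar>y\<bar>) / 6) \<le> polar hcp_tension \<zeta>"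
    using g(1) apply (simp add: s t)
    using g(2) apply (simp add: s t)
    using g(3) apply (simp add: s t)
    using g(4) apply (simp add: s t mult.assoc)
    using g(5) apply (simp add: s t)
    done
  have "hcp_gauge \<zeta> \<le> polar hcp_tension \<zeta>"
  proof -
    have "gauge_coord x y z \<in> {(\<bar>x\<bar> + \<bar>y\<bar> + \<bar>z\<bar>) / 7, \<bar>z\<bar> / 3, \<bar>y\<bar> / 3, (2 * \<bar>y\<bar> + \<bar>z\<bar>) / 7, (\<bar>x\<bar> + \<bar>y\<bar>) / 6}"
      unfolding gauge_coord_def by (intro Max_in) auto
    then show ?thesis unfolding \<zeta> hcp_gauge_pvec using pieces[unfolded \<zeta>]
      by (elim insertE emptyE) (simp_all only:)
  qed
  moreover have "polar hcp_tension \<zeta> \<le> hcp_gauge \<zeta>"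
    unfolding polar_def using le by (intro cSUP_least) auto
  ultimately show ?thesis by simp
qed

lemma wulff_hcp: "wulff_set hcp_tension = {\<zeta>. hcp_gauge \<zeta> \<le> 1}"
proof (intro set_eqI iffI)
  fix \<zeta> assume \<zeta>: "\<zeta> \<in> wulff_set hcp_tension"
  have "(\<nu> \<bullet> \<zeta>) / hcp_tension \<nu> \<le> 1" if "\<nu> \<in> sphere 0 1" for \<nu>
  proof -
    have "0 < hcp_tension \<nu>" using that by (intro hcp_tension_pos) auto
    moreover have "\<zeta> \<bullet> \<nu> \<le> hcp_tension \<nu>" using \<zeta> that by (simp add: wulff_set_def)
    ultimately show ?thesis by (simp add: inner_commute pos_divide_le_eq)
  qed
  then have "polar hcp_tension \<zeta> \<le> 1" unfolding polar_def by (intro cSUP_least) auto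
  then show "\<zeta> \<in> {\<zeta>. hcp_gauge \<zeta> \<le> 1}" by (simp add: polar_hcp)
next
  fix \<zeta> assume "\<zeta> \<in> {\<zeta>. hcp_gauge \<zeta> \<le> 1}"
  then have "hcp_tension \<nu> * hcp_gauge \<zeta> \<le> hcp_tension \<nu> * 1" for \<nu>
    by (intro mult_left_mono hcp_tension_nonneg) auto
  then show "\<zeta> \<in> wulff_set hcp_tension"
    unfolding wulff_set_def using order_trans[OF duality] by (simp add: inner_commute)
qed

lemma pvec_mem_wulff: "pvec x y z \<in> wulff_set hcp_tension \<longleftrightarrow>
    \<bar>x\<bar> + \<bar>y\<bar> + \<bar>z\<bar> \<le> 7 / sqrt 2 \<and> \<bar>z\<bar> \<le> 3 / sqrt 2 \<and> \<bar>y\<bar> \<le> 3 / sqrt 2 \<and> 2 * \<bar>y\<bar> + \<bar>z\<bar> \<le> 7 / sqrt 2 \<and> \<bar>x\<bar> + \<bar>y\<bar> \<le> 6 / sqrt 2"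
proof -
  have "pvec x y z \<in> wulff_set hcp_tension \<longleftrightarrow> gauge_coord x y z \<le> 1 / sqrt 2"
    by (simp add: wulff_hcp hcp_gauge_pvec pos_le_divide_eq mult.commute)
  then show ?thesis by (auto simp: gauge_coord_def)
qed

section \<open>The Wulff shape\<close>

text \<open>Integer covectors of the 20 facets: 12 pyramid sides, namely eight with all entries
  nonzero and four of the form (0, \<plusminus>2, \<plusminus>1); two horizontal truncation faces;
  and six prism sides. The regular hexagon is split in this way because the coordinates single out
  the direction of \<open>e1\<close>.\<close>

definition facets :: "(int \<times> int \<times> int) set" where
  "facets = {-1, 1} \<times> {-1, 1} \<times> {-1, 1} \<union> {0} \<times> {0} \<times> {-1, 1} \<union> {0} \<times> {-1, 1} \<times> {0}
     \<union> {0} \<times> {-2, 2} \<times> {-1, 1} \<union> {-1, 1} \<times> {-1, 1} \<times> {0}"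

definition facet_covec :: "int \<times> int \<times> int \<Rightarrow> real^3" where
  "facet_covec = (\<lambda>(a, b, c). covec (of_int a) (of_int b) (of_int c))"

definition facet_normal :: "int \<times> int \<times> int \<Rightarrow> real^3" where
  "facet_normal i = (1 / norm (facet_covec i)) *\<^sub>R facet_covec i"

lemma facets_nonzero: "i \<in> facets \<Longrightarrow> facet_covec i \<noteq> 0"
  by (auto simp: facets_def facet_covec_def covec_eq_0_iff)

text \<open>Normalising the covector multiplies both sides by the same positive number, and points
  scaled by sqrt 2 cancel the factor sqrt 2 of the tension, so that rational inequalities
  remain.\<close>

lemma facet_le_iff:
  assumes "(a, b, c) \<in> facets"
  shows "facet_normal (a, b, c) \<bullet> pvec (sqrt 2 * x) (sqrt 2 * y) (sqrt 2 * z) \<le> hcp_tension (facet_normal (a, b, c)) \<longleftrightarrow>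
      of_int a * x + of_int b * y + of_int c * z \<le> tension_coord (of_int a) (of_int b) (of_int c)"
    and "facet_normal (a, b, c) \<bullet> pvec (sqrt 2 * x) (sqrt 2 * y) (sqrt 2 * z) < hcp_tension (facet_normal (a, b, c)) \<longleftrightarrow>
      of_int a * x + of_int b * y + of_int c * z < tension_coord (of_int a) (of_int b) (of_int c)"
    and "facet_normal (a, b, c) \<bullet> pvec (sqrt 2 * x) (sqrt 2 * y) (sqrt 2 * z) = hcp_tension (facet_normal (a, b, c)) \<longleftrightarrow>
      of_int a * x + of_int b * y + of_int c * z = tension_coord (of_int a) (of_int b) (of_int c)"
proof -
  define N where "N = norm (facet_covec (a, b, c))"
  have N: "0 < N" using facets_nonzero[OF assms] by (simp add: N_def)
  have l: "facet_normal (a, b, c) \<bullet> pvec (sqrt 2 * x) (sqrt 2 * y) (sqrt 2 * z) =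
      (sqrt 2 / N) * (of_int a * x + of_int b * y + of_int c * z)"
    unfolding facet_normal_def N_def[symmetric] by (simp add: facet_covec_def covec_pvec algebra_simps)
  have r: "hcp_tension (facet_normal (a, b, c)) = (sqrt 2 / N) * tension_coord (of_int a) (of_int b) (of_int c)"
    unfolding facet_normal_def N_def[symmetric] using N by (simp add: hcp_tension_scaleR facet_covec_def hcp_tension_covec)
  have "0 < sqrt 2 / N" using N by simp
  then show "facet_normal (a, b, c) \<bullet> pvec (sqrt 2 * x) (sqrt 2 * y) (sqrt 2 * z) \<le> hcp_tension (facet_normal (a, b, c)) \<longleftrightarrow>
      of_int a * x + of_int b * y + of_int c * z \<le> tension_coord (of_int a) (of_int b) (of_int c)"
    "facet_normal (a, b, c) \<bullet> pvec (sqrt 2 * x) (sqrt 2 * y) (sqrt 2 * z) < hcp_tension (facet_normal (a, b, c)) \<longleftrightarrow>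
      of_int a * x + of_int b * y + of_int c * z < tension_coord (of_int a) (of_int b) (of_int c)"
    "facet_normal (a, b, c) \<bullet> pvec (sqrt 2 * x) (sqrt 2 * y) (sqrt 2 * z) = hcp_tension (facet_normal (a, b, c)) \<longleftrightarrow>
      of_int a * x + of_int b * y + of_int c * z = tension_coord (of_int a) (of_int b) (of_int c)"
    unfolding l r by (simp_all only: mult_le_cancel_left_pos mult_less_cancel_left_pos mult_cancel_left) auto
qed

lemma tension_coord_values:
  "tension_coord (of_int a) (of_int b) (of_int c) =
    (if a = 0 \<and> \<bar>b\<bar> = 2 \<or> a \<noteq> 0 \<and> c \<noteq> 0 then 7 / 2 else if a = 0 then 3 / 2 else 3)"
  if "(a, b, c) \<in> facets"
  using that by (auto simp: facets_def tension_coord_def)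

lemma scaled_pvec_mem_wulff: "pvec (sqrt 2 * x) (sqrt 2 * y) (sqrt 2 * z) \<in> wulff_set hcp_tension \<longleftrightarrow>
    \<bar>x\<bar> + \<bar>y\<bar> + \<bar>z\<bar> \<le> 7 / 2 \<and> \<bar>z\<bar> \<le> 3 / 2 \<and> \<bar>y\<bar> \<le> 3 / 2 \<and> 2 * \<bar>y\<bar> + \<bar>z\<bar> \<le> 7 / 2 \<and> \<bar>x\<bar> + \<bar>y\<bar> \<le> 3"
proof -
  have s: "k / sqrt 2 = sqrt 2 * (k / 2)" for k by (simp add: field_simps)
  have c: "sqrt 2 * p \<le> sqrt 2 * q \<longleftrightarrow> p \<le> q" for p q by simp
  have ab: "\<bar>sqrt 2 * p\<bar> = sqrt 2 * \<bar>p\<bar>" for p by (simp add: abs_mult)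
  have two: "2 * (sqrt 2 * p) = sqrt 2 * (2 * p)" for p by simp
  show ?thesis
    unfolding pvec_mem_wulff s ab two distrib_left[symmetric] c by simp
qed

lemma scaled_pvec_cases: obtains x y z where "\<zeta> = pvec (sqrt 2 * x) (sqrt 2 * y) (sqrt 2 * z)"
proof -
  obtain x y z where "\<zeta> = pvec x y z" by (rule pvec_cases)
  then show thesis using that[of "x / sqrt 2" "y / sqrt 2" "z / sqrt 2"] by simp
qed

text \<open>Running through all signs in an orbit of facets reproduces one inequality between
  absolute values.\<close>

lemma wulff_eq_facets:
  "wulff_set hcp_tension = {x. \<forall>i\<in>facets. facet_normal i \<bullet> x \<le> hcp_tension (facet_normal i)}"
proof (intro set_eqI)
  fix \<zeta> :: "real^3"
  obtain x y z where \<zeta>: "\<zeta> = pvec (sqrt 2 * x) (sqrt 2 * y) (sqrt 2 * z)" by (rule scaled_pvec_cases)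
  have "(\<forall>i\<in>facets. facet_normal i \<bullet> \<zeta> \<le> hcp_tension (facet_normal i)) \<longleftrightarrow>
      (\<forall>(a, b, c)\<in>facets. of_int a * x + of_int b * y + of_int c * z \<le> tension_coord (of_int a) (of_int b) (of_int c))"
    unfolding \<zeta> by (auto simp: facet_le_iff)
  also have "\<dots> \<longleftrightarrow> (\<forall>(a, b, c)\<in>facets. of_int a * x + of_int b * y + of_int c * z \<le>
      (if a = 0 \<and> \<bar>b\<bar> = 2 \<or> a \<noteq> 0 \<and> c \<noteq> 0 then 7 / 2 else if a = 0 then 3 / 2 else (3::real)))"
  proof (rule ball_cong[OF refl])
    fix i assume "i \<in> facets"
    then show "(case i of (a, b, c) \<Rightarrow> of_int a * x + of_int b * y + of_int c * z \<le> tension_coord (of_int a) (of_int b) (of_int c)) \<longleftrightarrow>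
      (case i of (a, b, c) \<Rightarrow> of_int a * x + of_int b * y + of_int c * z \<le>
        (if a = 0 \<and> \<bar>b\<bar> = 2 \<or> a \<noteq> 0 \<and> c \<noteq> 0 then 7 / 2 else if a = 0 then 3 / 2 else (3::real)))"
      by (cases i) (simp only: prod.case tension_coord_values)
  qed
  also have "\<dots> \<longleftrightarrow> \<bar>x\<bar> + \<bar>y\<bar> + \<bar>z\<bar> \<le> 7 / 2 \<and> \<bar>z\<bar> \<le> 3 / 2 \<and> \<bar>y\<bar> \<le> 3 / 2 \<and> 2 * \<bar>y\<bar> + \<bar>z\<bar> \<le> 7 / 2 \<and> \<bar>x\<bar> + \<bar>y\<bar> \<le> 3"
    (is "?L \<longleftrightarrow> ?R")
  proof
    assume ?L
    then show ?R unfolding facets_def by (simp add: ball_Un) argo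
  next
    assume ?R
    then show ?L unfolding facets_def by (simp add: ball_Un) argo
  qed
  finally show "\<zeta> \<in> wulff_set hcp_tension \<longleftrightarrow> \<zeta> \<in> {x. \<forall>i\<in>facets. facet_normal i \<bullet> x \<le> hcp_tension (facet_normal i)}"
    by (simp add: \<zeta> scaled_pvec_mem_wulff)
qed

text \<open>One relative interior point per facet, showing that each facet inequality is
  irredundant. In the case (0, \<plusminus>2, \<plusminus>1) the entry \<open>5 / 8 * b\<close> is
  \<plusminus>5/4.\<close>

definition facet_coord :: "int \<times> int \<times> int \<Rightarrow> real \<times> real \<times> real" where
  "facet_coord = (\<lambda>(a, b, c). if a = 0 then if b = 0 then (0, 0, 3 / 2 * of_int c) else if c = 0 then (0, 3 / 2 * of_int b, 0)
       else (0, 5 / 8 * of_int b, of_int c)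
     else if c = 0 then (2 * of_int a, of_int b, 0) else (2 * of_int a, 1 / 2 * of_int b, of_int c))"

lemma facet_coord:
  assumes "i \<in> facets" "(a, b, c) \<in> facets" "facet_coord i = (x, y, z)"
  shows "if i = (a, b, c) then of_int a * x + of_int b * y + of_int c * z = tension_coord (of_int a) (of_int b) (of_int c)
    else of_int a * x + of_int b * y + of_int c * z < tension_coord (of_int a) (of_int b) (of_int c)"
proof -
  have *: "\<forall>i\<in>facets. \<forall>j\<in>facets. case facet_coord i of (x, y, z) \<Rightarrow> case j of (a, b, c) \<Rightarrow>
      (if i = (a, b, c) then of_int a * x + of_int b * y + of_int c * z = (if a = 0 \<and> \<bar>b\<bar> = 2 \<or> a \<noteq> 0 \<and> c \<noteq> 0 then 7 / 2 else if a = 0 then 3 / 2 else 3)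
       else of_int a * x + of_int b * y + of_int c * z < (if a = 0 \<and> \<bar>b\<bar> = 2 \<or> a \<noteq> 0 \<and> c \<noteq> 0 then 7 / 2 else if a = 0 then 3 / 2 else 3))"
    unfolding facets_def by (simp add: facet_coord_def ball_Un)
  show ?thesis
    using *[rule_format, OF assms(1,2)] unfolding assms(3) prod.case tension_coord_values[OF assms(2)] .
qed

definition facet_point :: "int \<times> int \<times> int \<Rightarrow> real^3" where
  "facet_point i = (case facet_coord i of (x, y, z) \<Rightarrow> pvec (sqrt 2 * x) (sqrt 2 * y) (sqrt 2 * z))"

lemma facet_point:
  assumes i: "i \<in> facets" and j: "j \<in> facets"
  shows "facet_normal i \<bullet> facet_point i = hcp_tension (facet_normal i)"
    "i \<noteq> j \<Longrightarrow> facet_normal j \<bullet> facet_point i < hcp_tension (facet_normal j)"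
proof -
  obtain x y z where x: "facet_coord i = (x, y, z)" by (cases "facet_coord i")
  obtain a b c a' b' c' where ij: "i = (a, b, c)" "j = (a', b', c')" by (cases i; cases j)
  show "facet_normal i \<bullet> facet_point i = hcp_tension (facet_normal i)"
    using facet_coord[OF i i[unfolded ij] x] facet_le_iff(3)[OF i[unfolded ij]]
    unfolding facet_point_def x prod.case by (simp add: ij)
  show "facet_normal j \<bullet> facet_point i < hcp_tension (facet_normal j)" if "i \<noteq> j"
    using facet_coord[OF i j[unfolded ij] x] facet_le_iff(2)[OF j[unfolded ij]] that
    unfolding facet_point_def x prod.case by (simp add: ij)
qed

lemma bounded_wulff: "bounded (wulff_set hcp_tension)"
proof -
  have "norm \<zeta> \<le> sqrt 2 * 3 + sqrt 3 * sqrt 2 * (3 / 2) + 2 / 3 * sqrt 6 * sqrt 2 * (3 / 2)" if "\<zeta> \<in> wulff_set hcp_tension" for \<zeta>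
  proof -
    obtain x y z where \<zeta>: "\<zeta> = pvec (sqrt 2 * x) (sqrt 2 * y) (sqrt 2 * z)" by (rule scaled_pvec_cases)
    have "\<bar>x\<bar> + \<bar>y\<bar> \<le> 3" "\<bar>y\<bar> \<le> 3 / 2" "\<bar>z\<bar> \<le> 3 / 2" using that unfolding \<zeta> scaled_pvec_mem_wulff by auto
    then have b: "\<bar>x\<bar> \<le> 3" "\<bar>y\<bar> \<le> 3 / 2" "\<bar>z\<bar> \<le> 3 / 2" using abs_ge_zero[of y] by linarith+
    have "norm \<zeta> \<le> (\<Sum>k\<in>UNIV. \<bar>\<zeta> $ k\<bar>)" by (rule norm_le_l1_cart)
    also have "\<dots> = sqrt 2 * \<bar>x\<bar> + sqrt 3 * sqrt 2 * \<bar>y\<bar> + 2 / 3 * sqrt 6 * sqrt 2 * \<bar>z\<bar>"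
      by (simp add: \<zeta> pvec_def sum_3 abs_mult)
    also have "\<dots> \<le> sqrt 2 * 3 + sqrt 3 * sqrt 2 * (3 / 2) + 2 / 3 * sqrt 6 * sqrt 2 * (3 / 2)"
      using b by (intro add_mono mult_left_mono) auto
    finally show ?thesis .
  qed
  then show ?thesis unfolding bounded_iff by blast
qed

lemma finite_facets: "finite facets" by (simp add: facets_def)

text \<open>The facet points also separate the normals: facets with equal normals would have equal
  tensions, but the point of one lies strictly inside the half space of the other.\<close>

interpretation wulff: facetted_polytope facets facet_normal "\<lambda>i. hcp_tension (facet_normal i)" "wulff_set hcp_tension"
proof
  show "inj_on facet_normal facets"
  proof (rule inj_onI, rule ccontr)
    fix i j assume "i \<in> facets" "j \<in> facets" "facet_normal i = facet_normal j" "i \<noteq> j"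
    then show False using facet_point[of i j] by simp
  qed
  show "\<exists>p. facet_normal i \<bullet> p = hcp_tension (facet_normal i) \<and>
      (\<forall>j\<in>facets - {i}. facet_normal j \<bullet> p < hcp_tension (facet_normal j))" if "i \<in> facets" for i
    using facet_point(1)[OF that that] facet_point(2)[OF that] by (intro exI[of _ "facet_point i"]) blast
  show "norm (facet_normal i) = 1" if "i \<in> facets" for i
    using facets_nonzero[OF that] by (simp add: facet_normal_def)
qed (rule finite_facets wulff_eq_facets bounded_wulff)+

lemma surface_energy_hcp:
  "surface_energy hcp_tension (wulff_set hcp_tension) = 3 * measure lebesgue (wulff_set hcp_tension)"
  by (rule wulff.surface_energy_wulff) simp

section \<open>Volume of the Wulff shape\<close>

lemma emeasure_plane_hexagon:
  fixes m :: real
  assumes m: "0 \<le> m"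
  shows "emeasure lborel {p :: real \<times> real. \<bar>fst p\<bar> + \<bar>snd p\<bar> \<le> m \<and> \<bar>snd p\<bar> \<le> m / 2} = ennreal (3 / 2 * m\<^sup>2)" (is "emeasure _ ?H = _")
proof -
  have "closed ?H" by (intro closed_Collect_conj closed_Collect_le continuous_intros)
  then have "?H \<in> sets (lborel \<Otimes>\<^sub>M lborel)" unfolding sets_lborel_pair by (rule borel_closed)
  then have "emeasure (lborel \<Otimes>\<^sub>M lborel) ?H = (\<integral>\<^sup>+y. emeasure lborel ((\<lambda>x. (x, y)) -` ?H) \<partial>lborel)"
    by (rule lborel_pair.emeasure_pair_measure_alt2)
  also have "\<dots> = (\<integral>\<^sup>+y. ennreal (2 * m - 2 * \<bar>y\<bar>) * indicator {- (m / 2)..m / 2} y \<partial>lborel)"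
  proof (intro nn_integral_cong)
    fix y :: real
    show "emeasure lborel ((\<lambda>x. (x, y)) -` ?H) = ennreal (2 * m - 2 * \<bar>y\<bar>) * indicator {- (m / 2)..m / 2} y"
    proof (cases "\<bar>y\<bar> \<le> m / 2")
      case True
      then have "(\<lambda>x. (x, y)) -` ?H = {- (m - \<bar>y\<bar>)..m - \<bar>y\<bar>}" by auto
      then show ?thesis using True m by (auto simp: indicator_def algebra_simps)
    next
      case False
      then have "(\<lambda>x. (x, y)) -` ?H = {}" by auto
      then show ?thesis using False by (auto simp: indicator_def)
    qed
  qed
  also have "\<dots> = ennreal ((2 * m * (m / 2) - (ramp2 (m / 2) - ramp2 (- (m / 2)))) - (2 * m * (- (m / 2)) - (ramp2 (- (m / 2)) - ramp2 (- (- (m / 2))))))"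
  \<comment> \<open>\<open>ramp2 y - ramp2 (- y)\<close> is y |y|, an antiderivative of 2 |y| that
    is differentiable at 0 as well.\<close>
  proof (rule nn_integral_FTC_Icc[where F = "\<lambda>y. 2 * m * y - (ramp2 y - ramp2 (- y))"])
    fix y assume "y \<in> {- (m / 2)..m / 2}"
    then show "0 \<le> 2 * m - 2 * \<bar>y\<bar>" using m by auto
    have "((\<lambda>y. 2 * m * y - (ramp2 y - ramp2 (- y))) has_real_derivative 2 * m - (2 * max 0 y - (2 * max 0 (- y)) * (- 1))) (at y)"
      by (auto intro!: derivative_eq_intros DERIV_ramp2 DERIV_chain2[OF DERIV_ramp2])
    then show "((\<lambda>y. 2 * m * y - (ramp2 y - ramp2 (- y))) has_real_derivative 2 * m - 2 * \<bar>y\<bar>) (at y)"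
      by (rule DERIV_cong) (auto simp: max_def)
  qed (use m in auto)
  also have "(2 * m * (m / 2) - (ramp2 (m / 2) - ramp2 (- (m / 2)))) - (2 * m * (- (m / 2)) - (ramp2 (- (m / 2)) - ramp2 (- (- (m / 2))))) = 3 / 2 * m\<^sup>2"
    using m by (simp add: ramp2_def power2_eq_square field_simps)
  finally show ?thesis by (simp only: lborel_prod)
qed

definition wulff_coord :: "(real^3) set" where
  "wulff_coord = {v. \<bar>v $ 1\<bar> + \<bar>v $ 2\<bar> + \<bar>v $ 3\<bar> \<le> 7 / 2 \<and> \<bar>v $ 3\<bar> \<le> 3 / 2 \<and> \<bar>v $ 2\<bar> \<le> 3 / 2
     \<and> 2 * \<bar>v $ 2\<bar> + \<bar>v $ 3\<bar> \<le> 7 / 2 \<and> \<bar>v $ 1\<bar> + \<bar>v $ 2\<bar> \<le> 3}"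

lemma closed_wulff_coord: "closed wulff_coord"
  unfolding wulff_coord_def by (intro closed_Collect_conj closed_Collect_le continuous_intros)

text \<open>The section at height z is a hexagon of size m = min 3 (7/2 - |z|) and area 3/2 m^2. The
  prism |z| \<le> 1/2 contributes 27/2 and the two frusta 19. The other constraints, |y| \<le> 3/2
  and 2 |y| + |z| \<le> 7/2, are the bound |y| \<le> m/2.\<close>

lemma emeasure_wulff_coord: "emeasure lborel wulff_coord = ennreal (65 / 2)"
proof -
  let ?T = "tri -` wulff_coord"
  \<comment> \<open>The excess of |z| over 1/2, written with positive parts so that
    \<open>?G\<close> is a single antiderivative across the three ranges of z.\<close>
  let ?r = "\<lambda>z::real. max 0 (z - 1 / 2) + max 0 (- z - 1 / 2)"
  let ?G = "\<lambda>z. 3 / 2 * (9 * z - 3 * (ramp2 (z - 1 / 2) - ramp2 (- z - 1 / 2))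
     + 1 / 3 * ((z - 1 / 2) * ramp2 (z - 1 / 2) - (- z - 1 / 2) * ramp2 (- z - 1 / 2)))"
  have W: "wulff_coord \<in> sets borel" by (rule borel_closed[OF closed_wulff_coord])
  have T: "?T \<in> sets borel" using measurable_sets[OF measurable_tri W] by simp
  have sp: "sets (lborel \<Otimes>\<^sub>M lborel) = sets (borel :: ((real \<times> real) \<times> real) measure)"
    by (subst lborel_prod) (rule sets_lborel)
  have "emeasure lborel wulff_coord = emeasure lborel ?T"
    by (subst lborel_tri) (use W in \<open>simp add: emeasure_distr\<close>)
  also have "\<dots> = emeasure (lborel \<Otimes>\<^sub>M lborel) ?T" by (simp only: lborel_prod)
  also have "\<dots> = (\<integral>\<^sup>+z. emeasure lborel ((\<lambda>p. (p, z)) -` ?T) \<partial>lborel)"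
    using T unfolding sp[symmetric] by (rule lborel_pair.emeasure_pair_measure_alt2)
  also have "\<dots> = (\<integral>\<^sup>+z. ennreal (3 / 2 * (3 - ?r z)\<^sup>2) * indicator {- (3 / 2)..3 / 2} z \<partial>lborel)"
  proof (intro nn_integral_cong)
    fix z :: real
    show "emeasure lborel ((\<lambda>p. (p, z)) -` ?T) = ennreal (3 / 2 * (3 - ?r z)\<^sup>2) * indicator {- (3 / 2)..3 / 2} z"
    proof (cases "\<bar>z\<bar> \<le> 3 / 2")
      case True
      have m: "3 - ?r z = min 3 (7 / 2 - \<bar>z\<bar>)" by (auto simp: max_def min_def)
      have "(\<lambda>p. (p, z)) -` ?T = {p. \<bar>fst p\<bar> + \<bar>snd p\<bar> \<le> 3 - ?r z \<and> \<bar>snd p\<bar> \<le> (3 - ?r z) / 2}"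
        unfolding m using True by (auto simp: wulff_coord_def)
      moreover have "emeasure lborel {p. \<bar>fst p\<bar> + \<bar>snd p\<bar> \<le> 3 - ?r z \<and> \<bar>snd p\<bar> \<le> (3 - ?r z) / 2} = ennreal (3 / 2 * (3 - ?r z)\<^sup>2)"
        by (rule emeasure_plane_hexagon) (use m True in auto)
      moreover have "z \<in> {- (3 / 2)..3 / 2}" using True by auto
      ultimately show ?thesis by (simp only: indicator_simps mult_1_right)
    next
      case False
      then have "(\<lambda>p. (p, z)) -` ?T = {}" by (auto simp: wulff_coord_def)
      then show ?thesis using False by (auto simp: indicator_def)
    qed
  qed
  also have "\<dots> = ennreal (?G (3 / 2) - ?G (- (3 / 2)))"
  proof (rule nn_integral_FTC_Icc[where F = ?G])
    fix z :: real
    have "(?G has_real_derivative 3 / 2 * (9 - 3 * (2 * max 0 (z - 1 / 2) - (2 * max 0 (- z - 1 / 2)) * (- 1))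
        + 1 / 3 * (3 * ramp2 (z - 1 / 2) - (3 * ramp2 (- z - 1 / 2)) * (- 1)))) (at z)"
      by (auto intro!: derivative_eq_intros DERIV_chain2[OF DERIV_ramp2])
        (auto simp: ramp2_def max_def power2_eq_square algebra_simps)
    then show "(?G has_real_derivative 3 / 2 * (3 - ?r z)\<^sup>2) (at z)"
      by (rule DERIV_cong) (auto simp: ramp2_def max_def power2_eq_square algebra_simps)
  qed auto
  also have "?G (3 / 2) - ?G (- (3 / 2)) = 65 / 2" by (simp add: ramp2_def)
  finally show ?thesis .
qed

definition wulff_map :: "real^3 \<Rightarrow> real^3" where
  "wulff_map v = pvec (sqrt 2 * v $ 1) (sqrt 2 * v $ 2) (sqrt 2 * v $ 3)"

lemma linear_wulff_map: "linear wulff_map"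
  by (auto simp: linear_iff wulff_map_def pvec_def vec_eq_iff forall_3 algebra_simps)

lemma det_wulff_map: "det (matrix wulff_map) = 8"
proof -
  have "det (matrix wulff_map) = sqrt 2 * (sqrt 3 * sqrt 2) * (2 / 3 * sqrt 6 * sqrt 2)"
    by (simp add: det_3 matrix_def wulff_map_def pvec_def axis_def)
  also have "\<dots> = (2 / 3) * (sqrt 2 * sqrt 2) * ((sqrt 2 * sqrt 3) * sqrt 6)" by (simp only: ac_simps)
  also have "sqrt 2 * sqrt 3 = sqrt 6" by (simp flip: real_sqrt_mult)
  also have "(2 / 3) * (sqrt 2 * sqrt 2) * (sqrt 6 * sqrt 6) = 8" by simp
  finally show ?thesis .
qed

lemma wulff_image: "wulff_set hcp_tension = wulff_map ` wulff_coord"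
proof (intro set_eqI iffI)
  fix \<zeta> assume "\<zeta> \<in> wulff_set hcp_tension"
  moreover obtain x y z where \<zeta>: "\<zeta> = pvec (sqrt 2 * x) (sqrt 2 * y) (sqrt 2 * z)" by (rule scaled_pvec_cases)
  ultimately have "vector [x, y, z] \<in> wulff_coord" "\<zeta> = wulff_map (vector [x, y, z])"
    by (auto simp: scaled_pvec_mem_wulff wulff_coord_def wulff_map_def)
  then show "\<zeta> \<in> wulff_map ` wulff_coord" by blast
qed (auto simp: wulff_map_def scaled_pvec_mem_wulff wulff_coord_def)

lemma measure_wulff: "measure lebesgue (wulff_set hcp_tension) = 260"
proof -
  have W: "wulff_coord \<in> sets borel" by (rule borel_closed[OF closed_wulff_coord])
  then have e: "emeasure lebesgue wulff_coord = ennreal (65 / 2)" using emeasure_wulff_coord by simp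
  have "wulff_coord \<in> lmeasurable" using W e by (intro fmeasurableI) auto
  then have "measure lebesgue (wulff_set hcp_tension) = 8 * measure lebesgue wulff_coord"
    unfolding wulff_image by (simp add: measure_linear_image[OF linear_wulff_map] det_wulff_map)
  then show ?thesis using e by (simp add: measure_def)
qed

text \<open>Energy 3 V divided by V^(2/3) is 3 V^(1/3), and V = 260 = 4 * 65.\<close>

lemma energy_per_volume:
  "measure lebesgue (wulff_set hcp_tension) powr (- 2 / 3) * surface_energy hcp_tension (wulff_set hcp_tension)
     = 3 * 2 powr (2 / 3) * 65 powr (1 / 3)"
proof -
  have "(260::real) powr (- 2 / 3) * (3 * 260) = 3 * (260 powr (- 2 / 3) * 260 powr 1)" by simp
  also have "260 powr (- 2 / 3) * 260 powr 1 = (260::real) powr (1 / 3)" by (subst powr_add[symmetric]) simp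
  also have "(260::real) = 2 powr 2 * 65" by simp
  also have "(2 powr 2 * 65 :: real) powr (1 / 3) = 2 powr (2 / 3) * 65 powr (1 / 3)"
  proof -
    have "(2 powr 2 :: real) powr (1 / 3) = 2 powr (2 / 3)" by (subst powr_powr) simp
    then show ?thesis by (subst powr_mult) simp_all
  qed
  finally show ?thesis by (simp add: surface_energy_hcp measure_wulff)
qed

section \<open>The Wulff shape as a truncated bipyramid\<close>

definition hexagon_coord :: "real \<Rightarrow> real \<Rightarrow> (real^3) set" where
  "hexagon_coord \<rho> z = {v. \<bar>v $ 1\<bar> + \<bar>v $ 2\<bar> \<le> \<rho> \<and> \<bar>v $ 2\<bar> \<le> \<rho> / 2 \<and> v $ 3 = z}"

lemma convex_hexagon_coord: "convex (hexagon_coord \<rho> z)"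
proof (rule convexI)
  fix x y :: "real^3" and u w :: real
  assume x: "x \<in> hexagon_coord \<rho> z" and y: "y \<in> hexagon_coord \<rho> z" and uw: "0 \<le> u" "0 \<le> w" "u + w = 1"
  have tri: "\<bar>u * a + w * b\<bar> \<le> u * \<bar>a\<bar> + w * \<bar>b\<bar>" for a b
    using abs_triangle_ineq[of "u * a" "w * b"] uw by (simp add: abs_mult)
  have comb: "u * a + w * b \<le> c" if "a \<le> c" "b \<le> c" for a b c
    using mult_left_mono[OF that(1) uw(1)] mult_left_mono[OF that(2) uw(2)] uw(3)
    by (metis add_mono distrib_right mult_1)
  have "\<bar>u * x $ 1 + w * y $ 1\<bar> + \<bar>u * x $ 2 + w * y $ 2\<bar> \<le> u * (\<bar>x $ 1\<bar> + \<bar>x $ 2\<bar>) + w * (\<bar>y $ 1\<bar> + \<bar>y $ 2\<bar>)"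
    using tri[of "x $ 1" "y $ 1"] tri[of "x $ 2" "y $ 2"] by (simp add: algebra_simps)
  also have "\<dots> \<le> \<rho>" using x y by (intro comb) (auto simp: hexagon_coord_def)
  finally have 1: "\<bar>u * x $ 1 + w * y $ 1\<bar> + \<bar>u * x $ 2 + w * y $ 2\<bar> \<le> \<rho>" .
  have 2: "\<bar>u * x $ 2 + w * y $ 2\<bar> \<le> \<rho> / 2"
    by (rule order_trans[OF tri comb]) (use x y in \<open>auto simp: hexagon_coord_def\<close>)
  have "u * z + w * z = z" using uw(3) by (metis distrib_right mult_1)
  then show "u *\<^sub>R x + w *\<^sub>R y \<in> hexagon_coord \<rho> z" using 1 2 x y by (simp add: hexagon_coord_def)
qed

definition hexagon_vertices :: "real \<Rightarrow> real \<Rightarrow> (real^3) set" where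
  "hexagon_vertices \<rho> z = {vector [\<rho>, 0, z], vector [\<rho> / 2, \<rho> / 2, z], vector [- (\<rho> / 2), \<rho> / 2, z],
     vector [- \<rho>, 0, z], vector [- (\<rho> / 2), - (\<rho> / 2), z], vector [\<rho> / 2, - (\<rho> / 2), z]}"

text \<open>Each point lies on a horizontal chord whose ends are on the two slanted edges in the
  same half; the ends are combinations of vertices with weight \<open>t\<close>, the point of the
  ends with weight \<open>r\<close>.\<close>

lemma hull_hexagon_vertices:
  assumes \<rho>: "0 < \<rho>"
  shows "convex hull (hexagon_vertices \<rho> z) = hexagon_coord \<rho> z"
proof
  show "convex hull (hexagon_vertices \<rho> z) \<subseteq> hexagon_coord \<rho> z"
    using \<rho> by (intro hull_minimal convex_hexagon_coord) (auto simp: hexagon_vertices_def hexagon_coord_def)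
  show "hexagon_coord \<rho> z \<subseteq> convex hull (hexagon_vertices \<rho> z)"
  proof
    fix v assume v: "v \<in> hexagon_coord \<rho> z"
    let ?H = "convex hull (hexagon_vertices \<rho> z)"
    have cvx: "(1 - t) *\<^sub>R p + t *\<^sub>R q \<in> ?H" if "p \<in> ?H" "q \<in> ?H" "0 \<le> t" "t \<le> 1" for p q t
      using convexD_alt[OF convex_convex_hull that] .
    define s :: real where "s = (if 0 \<le> v $ 2 then 1 else - 1)"
    have s: "s * \<bar>v $ 2\<bar> = v $ 2" by (simp add: s_def)
    define t where "t = 2 * \<bar>v $ 2\<bar> / \<rho>"
    have t: "0 \<le> t" "t \<le> 1" using v \<rho> by (auto simp: t_def hexagon_coord_def field_simps)
    have t\<rho>: "t * \<rho> = 2 * \<bar>v $ 2\<bar>" using \<rho> by (simp add: t_def)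
    have edge: "vector [e * (\<rho> - \<bar>v $ 2\<bar>), v $ 2, z] \<in> ?H" if "e = 1 \<or> e = - 1" for e
    proof -
      have "vector [e * \<rho>, 0, z] \<in> ?H" "vector [e * (\<rho> / 2), s * (\<rho> / 2), z] \<in> ?H"
        using that by (auto intro!: hull_inc simp: hexagon_vertices_def s_def)
      from cvx[OF this t]
      have "(1 - t) *\<^sub>R vector [e * \<rho>, 0, z] + t *\<^sub>R vector [e * (\<rho> / 2), s * (\<rho> / 2), z] \<in> ?H" .
      moreover have "(1 - t) *\<^sub>R vector [e * \<rho>, 0, z] + t *\<^sub>R vector [e * (\<rho> / 2), s * (\<rho> / 2), z] =
          (vector [e * (\<rho> - t * \<rho> / 2), s * (t * \<rho> / 2), z] :: real^3)"
        by (simp add: vec_eq_iff forall_3 algebra_simps)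
      ultimately show ?thesis by (simp add: t\<rho> s)
    qed
    show "v \<in> ?H"
    proof (cases "\<rho> - \<bar>v $ 2\<bar> = 0")
      case True
      then have "v $ 1 = 0" "v $ 3 = z" using v by (auto simp: hexagon_coord_def)
      then have "v = vector [1 * (\<rho> - \<bar>v $ 2\<bar>), v $ 2, z]" using True by (simp add: vec_eq_iff forall_3)
      then show ?thesis using edge[of 1] by simp
    next
      case False
      define L where "L = \<rho> - \<bar>v $ 2\<bar>"
      have L: "0 < L" "\<bar>v $ 1\<bar> \<le> L" using False v by (auto simp: L_def hexagon_coord_def)
      define r where "r = (1 + v $ 1 / L) / 2"
      have "- 1 \<le> v $ 1 / L" "v $ 1 / L \<le> 1" using L by (auto simp: abs_le_iff pos_le_divide_eq pos_divide_le_eq)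
      then have r: "0 \<le> r" "r \<le> 1" by (auto simp: r_def)
      have "(1 - r) *\<^sub>R vector [- 1 * L, v $ 2, z] + r *\<^sub>R vector [1 * L, v $ 2, z] \<in> ?H"
        using edge[of "- 1"] edge[of 1] r unfolding L_def by (intro cvx) auto
      moreover have "(1 - r) *\<^sub>R vector [- 1 * L, v $ 2, z] + r *\<^sub>R vector [1 * L, v $ 2, z] = v"
      proof -
        have "(2 * r - 1) * L = v $ 1" using L by (simp add: r_def field_simps)
        then show ?thesis using v by (simp add: vec_eq_iff forall_3 hexagon_coord_def algebra_simps)
      qed
      ultimately show ?thesis by simp
    qed
  qed
qed

lemma wulff_map_vector: "wulff_map (vector [x, y, z]) = pvec (sqrt 2 * x) (sqrt 2 * y) (sqrt 2 * z)"
  by (simp add: wulff_map_def)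

text \<open>\<open>wulff_map\<close> stretches the second coordinate by the additional factor sqrt
  3, which turns the coordinate vertices with entries \<rho>/2 into vertices at multiples of 60
  degrees.\<close>

lemma regular_hexagon_eq:
  assumes "0 < \<rho>"
  shows "regular_hexagon (wulff_map (vector [0, 0, z])) (axis 1 1) (axis 2 1) (sqrt 2 * \<rho>) = wulff_map ` hexagon_coord \<rho> z"
proof -
  have angles: "cos (2 * pi / 3) = - (1 / 2)" "sin (2 * pi / 3) = sqrt 3 / 2"
    "cos (4 * pi / 3) = - (1 / 2)" "sin (4 * pi / 3) = - (sqrt 3 / 2)"
    "cos (5 * pi / 3) = 1 / 2" "sin (5 * pi / 3) = - (sqrt 3 / 2)"
  proof -
    have "2 * pi / 3 = pi - pi / 3" "4 * pi / 3 = pi / 3 + pi" "5 * pi / 3 = 2 * pi - pi / 3" by simp_all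
    then show "cos (2 * pi / 3) = - (1 / 2)" "sin (2 * pi / 3) = sqrt 3 / 2"
      "cos (4 * pi / 3) = - (1 / 2)" "sin (4 * pi / 3) = - (sqrt 3 / 2)"
      "cos (5 * pi / 3) = 1 / 2" "sin (5 * pi / 3) = - (sqrt 3 / 2)"
      by (simp_all only: cos_pi_minus sin_pi_minus cos_periodic_pi sin_periodic_pi cos_2pi_minus sin_2pi_minus cos_60 sin_60)
  qed
  let ?v = "\<lambda>k. wulff_map (vector [0, 0, z]) + (sqrt 2 * \<rho>) *\<^sub>R (cos (real k * pi / 3) *\<^sub>R axis 1 1 + sin (real k * pi / 3) *\<^sub>R axis 2 1)"
  have "{?v k | k::nat. k < 6} = ?v ` {0, 1, 2, 3, 4, 5}"
  proof -
    have "{k::nat. k < 6} = {0, 1, 2, 3, 4, 5}" by auto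
    then show ?thesis by (simp only: setcompr_eq_image)
  qed
  also have "\<dots> = wulff_map ` hexagon_vertices \<rho> z"
    unfolding image_insert image_empty hexagon_vertices_def
    by (intro arg_cong2[where f = insert] refl)
      (simp_all add: angles cos_60 sin_60 wulff_map_vector pvec_def vec_eq_iff forall_3 axis_def)
  finally have "regular_hexagon (wulff_map (vector [0, 0, z])) (axis 1 1) (axis 2 1) (sqrt 2 * \<rho>) =
      convex hull (wulff_map ` hexagon_vertices \<rho> z)"
    unfolding regular_hexagon_def by simp
  also have "\<dots> = wulff_map ` hexagon_coord \<rho> z"
    using convex_hull_linear_image[OF linear_wulff_map] hull_hexagon_vertices[OF assms] by metis
  finally show ?thesis .
qed

text \<open>The section of a pyramid shrinks linearly with the weight \<open>w\<close> of the base.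
  The size 7/2 - |z| equals 3 at the base height 1/2 and vanishes at the apex height 7/2; \<sigma>
  selects the upper or the lower pyramid.\<close>

lemma hull_pyramid_coord:
  assumes \<sigma>: "\<sigma> = 1 \<or> \<sigma> = - 1"
  shows "convex hull (insert (vector [0, 0, \<sigma> * (7 / 2)]) (hexagon_coord 3 (\<sigma> * (1 / 2)))) =
    {v. 1 / 2 \<le> \<sigma> * v $ 3 \<and> \<sigma> * v $ 3 \<le> 7 / 2 \<and> \<bar>v $ 1\<bar> + \<bar>v $ 2\<bar> \<le> 7 / 2 - \<sigma> * v $ 3 \<and> \<bar>v $ 2\<bar> \<le> (7 / 2 - \<sigma> * v $ 3) / 2}"
    (is "convex hull (insert ?a ?H) = ?P")
proof -
  have ss: "\<sigma> * (\<sigma> * t) = t" for t using \<sigma> by auto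
  have "vector [0, 0, \<sigma> * (1 / 2)] \<in> ?H" by (simp add: hexagon_coord_def)
  then have ne: "?H \<noteq> {}" by blast
  have hull: "convex hull ?H = ?H" by (simp add: convex_hull_eq convex_hexagon_coord)
  have ins: "v \<in> convex hull (insert ?a ?H) \<longleftrightarrow> (\<exists>u\<ge>0. \<exists>w\<ge>0. \<exists>b. b \<in> ?H \<and> u + w = 1 \<and> v = u *\<^sub>R ?a + w *\<^sub>R b)" for v
    unfolding convex_hull_insert[OF ne] hull by blast
  show ?thesis
  proof (intro set_eqI iffI)
    fix v assume "v \<in> convex hull (insert ?a ?H)"
    then obtain u w b where uw: "0 \<le> u" "0 \<le> w" "b \<in> ?H" "u + w = 1" "v = u *\<^sub>R ?a + w *\<^sub>R b"
      unfolding ins by blast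
    have "\<sigma> * v $ 3 = u * (7 / 2) + w * (1 / 2)"
    proof -
      have "v $ 3 = u * (\<sigma> * (7 / 2)) + w * (\<sigma> * (1 / 2))" using uw(3,5) by (simp add: hexagon_coord_def)
      then have "\<sigma> * v $ 3 = (\<sigma> * \<sigma>) * (u * (7 / 2) + w * (1 / 2))" by (simp add: algebra_simps)
      moreover have "\<sigma> * \<sigma> = 1" using ss[of 1] by simp
      ultimately show ?thesis by (simp only: mult_1)
    qed
    then have z: "\<sigma> * v $ 3 = 7 / 2 - 3 * w" using uw(4) by simp
    have "w \<le> 1" using uw by simp
    have "\<bar>v $ 1\<bar> + \<bar>v $ 2\<bar> = w * (\<bar>b $ 1\<bar> + \<bar>b $ 2\<bar>)" "\<bar>v $ 2\<bar> = w * \<bar>b $ 2\<bar>"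
      using uw(2,5) by (simp_all add: abs_mult distrib_left)
    moreover have "w * (\<bar>b $ 1\<bar> + \<bar>b $ 2\<bar>) \<le> w * 3" "w * \<bar>b $ 2\<bar> \<le> w * (3 / 2)"
    proof -
      have "\<bar>b $ 1\<bar> + \<bar>b $ 2\<bar> \<le> 3" "\<bar>b $ 2\<bar> \<le> 3 / 2" using uw(3) by (simp_all add: hexagon_coord_def)
      then show "w * (\<bar>b $ 1\<bar> + \<bar>b $ 2\<bar>) \<le> w * 3" "w * \<bar>b $ 2\<bar> \<le> w * (3 / 2)"
        using uw(2) by (simp_all only: mult_left_mono)
    qed
    ultimately show "v \<in> ?P" unfolding mem_Collect_eq z using uw(2) \<open>w \<le> 1\<close> by simp
  next
    fix v assume v: "v \<in> ?P"
    define w where "w = (7 / 2 - \<sigma> * v $ 3) / 3"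
    have w: "0 \<le> w" "w \<le> 1" using v by (auto simp: w_def)
    have v3: "v $ 3 = (1 - w) * (\<sigma> * (7 / 2)) + w * (\<sigma> * (1 / 2))"
    proof -
      have "\<sigma> * v $ 3 = 7 / 2 - 3 * w" by (simp add: w_def field_simps)
      then have "v $ 3 = \<sigma> * (7 / 2 - 3 * w)" using ss by metis
      then show ?thesis by (simp add: field_simps)
    qed
    show "v \<in> convex hull (insert ?a ?H)"
    proof (cases "w = 0")
      case True
      then have "\<bar>v $ 1\<bar> + \<bar>v $ 2\<bar> \<le> 0" using v by (auto simp: w_def)
      then have "v $ 1 = 0" "v $ 2 = 0" by auto
      then have "v = 1 *\<^sub>R ?a + 0 *\<^sub>R vector [0, 0, \<sigma> * (1 / 2)]" using v3 True by (simp add: vec_eq_iff forall_3)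
      then show ?thesis unfolding ins using \<open>vector [0, 0, \<sigma> * (1 / 2)] \<in> ?H\<close>
        by (intro exI[of _ 1] exI[of _ 0] exI[of _ "vector [0, 0, \<sigma> * (1 / 2)]"] conjI) auto
    next
      case False
      then have wp: "0 < w" using w by simp
      define b :: "real^3" where "b = vector [v $ 1 / w, v $ 2 / w, \<sigma> * (1 / 2)]"
      have "\<bar>v $ 1\<bar> + \<bar>v $ 2\<bar> \<le> 3 * w" "\<bar>v $ 2\<bar> \<le> 3 / 2 * w" using v by (auto simp: w_def)
      then have "b \<in> ?H" using wp
        by (simp add: b_def hexagon_coord_def pos_divide_le_eq flip: add_divide_distrib)
      moreover have "v = (1 - w) *\<^sub>R ?a + w *\<^sub>R b" using wp v3 by (simp add: vec_eq_iff forall_3 b_def)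
      ultimately show ?thesis unfolding ins using w by (intro exI[of _ "1 - w"] exI[of _ w] exI[of _ b] conjI) auto
    qed
  qed
qed

lemma wulff_shape: "truncated_elongated_hexagonal_bipyramid (wulff_set hcp_tension)"
proof -
  define U :: real where "U = 2 / 3 * sqrt 6 * sqrt 2"
  have U: "0 < U" by (simp add: U_def)
  define n :: "real^3" where "n = axis 3 1"
  have zn: "(t * U) *\<^sub>R n = wulff_map (vector [0, 0, t])" for t
    by (simp add: n_def wulff_map_vector pvec_def U_def vec_eq_iff forall_3 axis_def)
  have add_n: "wulff_map v + t *\<^sub>R n = wulff_map (v + vector [0, 0, t / U])" for v t
  proof -
    have "t *\<^sub>R n = ((t / U) * U) *\<^sub>R n" using U by simp
    then show ?thesis unfolding zn by (simp add: linear_add[OF linear_wulff_map])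
  qed
  have dot_n: "wulff_map v \<bullet> n = U * v $ 3" for v
    by (simp add: n_def inner_axis wulff_map_def pvec_def U_def)
  \<comment> \<open>\<open>U\<close> is the vertical unit. In these units the prism ends at 1/2, the
    apexes are at 7/2 and the truncation is at 3/2, whence h = 1/2, k = 3 and t = 1.\<close>
  define h k t where "h = 1 / 2 * U" and "k = 3 * U" and "t = 1 * U"
  have hex: "regular_hexagon (\<sigma> *\<^sub>R h *\<^sub>R n) (axis 1 1) (axis 2 1) (sqrt 2 * 3) = wulff_map ` hexagon_coord 3 (\<sigma> * (1 / 2))" for \<sigma>
    using regular_hexagon_eq[of 3 "\<sigma> * (1 / 2)"] zn[of "\<sigma> * (1 / 2)"] by (simp add: h_def)
  have apex: "\<sigma> *\<^sub>R (h + k) *\<^sub>R n = wulff_map (vector [0, 0, \<sigma> * (7 / 2)])" for \<sigma>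
    using zn[of "\<sigma> * (7 / 2)"] by (simp add: h_def k_def algebra_simps)
  define P where "P \<sigma> = {v :: real^3. 1 / 2 \<le> \<sigma> * v $ 3 \<and> \<sigma> * v $ 3 \<le> 7 / 2 \<and> \<bar>v $ 1\<bar> + \<bar>v $ 2\<bar> \<le> 7 / 2 - \<sigma> * v $ 3 \<and> \<bar>v $ 2\<bar> \<le> (7 / 2 - \<sigma> * v $ 3) / 2}" for \<sigma>
  have pyr: "convex hull (insert (\<sigma> *\<^sub>R (h + k) *\<^sub>R n) (regular_hexagon (\<sigma> *\<^sub>R h *\<^sub>R n) (axis 1 1) (axis 2 1) (sqrt 2 * 3))) = wulff_map ` P \<sigma>"
    if "\<sigma> = 1 \<or> \<sigma> = - 1" for \<sigma>
    unfolding hex apex image_insert[symmetric] convex_hull_linear_image[OF linear_wulff_map, symmetric]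
      hull_pyramid_coord[OF that] P_def ..
  define Q where "Q = {v :: real^3. \<bar>v $ 1\<bar> + \<bar>v $ 2\<bar> \<le> 3 \<and> \<bar>v $ 2\<bar> \<le> 3 / 2 \<and> \<bar>v $ 3\<bar> \<le> 1 / 2}"
  have prism: "hexagonal_prism 0 (axis 1 1) (axis 2 1) n (sqrt 2 * 3) h = wulff_map ` Q"
  proof -
    have "hexagonal_prism 0 (axis 1 1) (axis 2 1) n (sqrt 2 * 3) h =
        {wulff_map v + s *\<^sub>R n | v s. v \<in> hexagon_coord 3 0 \<and> \<bar>s\<bar> \<le> h}"
      using hex[of 0] by (auto simp: hexagonal_prism_def)
    also have "\<dots> = wulff_map ` Q"
    proof (intro set_eqI iffI)
      fix x assume "x \<in> {wulff_map v + s *\<^sub>R n | v s. v \<in> hexagon_coord 3 0 \<and> \<bar>s\<bar> \<le> h}"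
      then obtain v s where v: "x = wulff_map v + s *\<^sub>R n" "v \<in> hexagon_coord 3 0" "\<bar>s\<bar> \<le> h" by auto
      have "\<bar>s / U\<bar> \<le> 1 / 2" using v(3) U by (simp add: h_def pos_divide_le_eq)
      then have "v + vector [0, 0, s / U] \<in> Q" using v(2) by (simp add: Q_def hexagon_coord_def)
      then show "x \<in> wulff_map ` Q" unfolding v(1) add_n by blast
    next
      fix x assume "x \<in> wulff_map ` Q"
      then obtain v where v: "x = wulff_map v" "v \<in> Q" by auto
      have "x = wulff_map (vector [v $ 1, v $ 2, 0]) + (v $ 3 * U) *\<^sub>R n"
      proof -
        have "vector [v $ 1, v $ 2, 0] + vector [0, 0, v $ 3 * U / U] = v"
          using U by (simp add: vec_eq_iff forall_3)
        then show ?thesis unfolding add_n v(1) by simp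
      qed
      moreover have "vector [v $ 1, v $ 2, 0] \<in> hexagon_coord 3 0" using v(2) by (simp add: Q_def hexagon_coord_def)
      moreover have "\<bar>v $ 3 * U\<bar> \<le> h" using v(2) U by (simp add: Q_def h_def abs_mult)
      ultimately show "x \<in> {wulff_map v + s *\<^sub>R n | v s. v \<in> hexagon_coord 3 0 \<and> \<bar>s\<bar> \<le> h}" by blast
    qed
    finally show ?thesis .
  qed
  have "elongated_hexagonal_bipyramid 0 (axis 1 1) (axis 2 1) n (sqrt 2 * 3) h k = wulff_map ` (Q \<union> P 1 \<union> P (- 1))"
    unfolding elongated_hexagonal_bipyramid_def prism image_Un
    using pyr[of 1] pyr[of "- 1"]
    by (simp only: scaleR_minus1_left scaleR_one diff_0 add_0_left simp_thms)
  moreover have "{x. \<bar>(x - 0) \<bullet> n\<bar> \<le> h + t} \<inter> wulff_map ` S = wulff_map ` (S \<inter> {v. \<bar>v $ 3\<bar> \<le> 3 / 2})" for S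
  proof -
    have "\<bar>(wulff_map v - 0) \<bullet> n\<bar> \<le> h + t \<longleftrightarrow> \<bar>v $ 3\<bar> \<le> 3 / 2" for v
    proof -
      have "\<bar>(wulff_map v - 0) \<bullet> n\<bar> = U * \<bar>v $ 3\<bar>" using U by (simp add: dot_n abs_mult)
      moreover have "h + t = U * (3 / 2)" by (simp add: h_def t_def)
      ultimately show ?thesis using U by (simp only: mult_le_cancel_left_pos)
    qed
    then show ?thesis by auto
  qed
  moreover have "(Q \<union> P 1 \<union> P (- 1)) \<inter> {v. \<bar>v $ 3\<bar> \<le> 3 / 2} = wulff_coord"
  proof (intro set_eqI iffI)
    fix v :: "real^3" assume "v \<in> (Q \<union> P 1 \<union> P (- 1)) \<inter> {v. \<bar>v $ 3\<bar> \<le> 3 / 2}"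
    then show "v \<in> wulff_coord" by (auto simp: Q_def P_def wulff_coord_def abs_if split: if_splits)
  next
    fix v :: "real^3" assume v: "v \<in> wulff_coord"
    consider "\<bar>v $ 3\<bar> \<le> 1 / 2" | "1 / 2 \<le> v $ 3" | "1 / 2 \<le> - v $ 3" by linarith
    then show "v \<in> (Q \<union> P 1 \<union> P (- 1)) \<inter> {v. \<bar>v $ 3\<bar> \<le> 3 / 2}"
      using v by cases (auto simp: Q_def P_def wulff_coord_def)
  qed
  ultimately have W: "wulff_set hcp_tension =
      elongated_hexagonal_bipyramid 0 (axis 1 1) (axis 2 1) n (sqrt 2 * 3) h k \<inter> {x. \<bar>(x - 0) \<bullet> n\<bar> \<le> h + t}"
    by (metis wulff_image inf_commute)
  have "0 < sqrt 2 * 3" "0 < h" "0 < t" "t < k" using U by (auto simp: h_def t_def k_def)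
  moreover have "norm (axis 1 1 :: real^3) = 1" "norm (axis 2 1 :: real^3) = 1" "norm n = 1"
    "axis 1 1 \<bullet> (axis 2 1 :: real^3) = 0" "axis 1 1 \<bullet> n = 0" "axis 2 1 \<bullet> n = 0"
    by (simp_all add: n_def inner_axis_axis)
  ultimately show ?thesis using W unfolding truncated_elongated_hexagonal_bipyramid_def by blast
qed

section \<open>Bonds of the hexagonal close-packed lattice\<close>

definition lat :: "int \<times> int \<times> int \<Rightarrow> real^3" where
  "lat = (\<lambda>(a, b, c). of_int a *\<^sub>R e1 + of_int b *\<^sub>R e2 + of_int c *\<^sub>R e3)"

lemma lat_nth:
  "lat (a, b, c) $ 1 = of_int a + of_int b / 2" "lat (a, b, c) $ 2 = sqrt 3 / 2 * of_int b"
  "lat (a, b, c) $ 3 = 2 / 3 * sqrt 6 * of_int c"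
  by (simp_all add: lat_def e1_def e2_def e3_def)

lemma v1_nth: "v1 $ 1 = 1 / 2" "v1 $ 2 = sqrt 3 / 6" "v1 $ 3 = sqrt 6 / 3"
  by (simp_all add: v1_def e1_def e2_def e3_def)

lemma lat_add: "lat (l + m) = lat l + lat m"
  by (cases l; cases m) (simp add: lat_def algebra_simps)

lemma lat_minus: "lat (- l) = - lat l"
  by (cases l) (simp add: lat_def algebra_simps)

lemma lat_diff: "lat (l - m) = lat l - lat m"
  using lat_add[of l "- m"] lat_minus[of m] by simp

text \<open>The sublattice \<open>span_Z\<close> and its translate by \<open>v1\<close> are distinguished by a Boolean.\<close>

definition site :: "bool \<Rightarrow> int \<times> int \<times> int \<Rightarrow> real^3" where
  "site s l = (if s then v1 else 0) + lat l"

lemma site_add: "site s (l + m) = site s l + lat m"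
  by (simp add: site_def lat_add add.assoc)

lemma HCP_eq: "HCP = (\<Union>s. range (site s))"
proof -
  have "span_Z = range lat"
    unfolding span_Z_def lat_def by (auto simp: image_iff) (metis case_prod_conv)
  show ?thesis unfolding HCP_def \<open>span_Z = range lat\<close> site_def by (auto simp: UNIV_bool)
qed

lemma site_in_HCP [simp]: "site s l \<in> HCP" by (auto simp: HCP_eq)

text \<open>In units of sqrt 6 / 3 the third coordinate is an integer whose parity tells the two
  sublattices apart.\<close>

lemma inj_site: "inj (\<lambda>(s, l). site s l)"
proof (rule injI)
  fix p q :: "bool \<times> int \<times> int \<times> int"
  assume pq: "(case p of (s, l) \<Rightarrow> site s l) = (case q of (s, l) \<Rightarrow> site s l)"
  obtain s a b c where p: "p = (s, a, b, c)" by (cases p)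
  obtain t a' b' c' where q: "q = (t, a', b', c')" by (cases q)
  have eq: "site s (a, b, c) = site t (a', b', c')" using pq by (simp add: p q)
  have 3: "(if s then 1 else 0) + 2 * c = (if t then 1 else 0) + 2 * c'"
  proof -
    have "sqrt 6 / 3 * of_int ((if s then 1 else 0) + 2 * c) = sqrt 6 / 3 * of_int ((if t then 1 else 0) + 2 * c')"
      using arg_cong[OF eq, of "\<lambda>x. x $ 3"] by (auto simp: site_def lat_nth v1_nth algebra_simps split: if_splits)
    then show ?thesis by (simp only: mult_cancel_left of_int_eq_iff) simp
  qed
  then have st: "s = t" "c = c'" by (auto split: if_splits) presburger+
  then have "lat (a, b, c) = lat (a', b', c')" using eq by (simp add: site_def)
  from arg_cong[OF this, of "\<lambda>x. x $ 1"] arg_cong[OF this, of "\<lambda>x. x $ 2"]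
  have "b = b'" "a = a'" by (auto simp: lat_nth)
  then show "p = q" using st by (simp add: p q)
qed

definition in_plane :: "(int \<times> int \<times> int) set" where
  "in_plane = {(1, 0, 0), (-1, 0, 0), (0, 1, 0), (0, -1, 0), (1, -1, 0), (-1, 1, 0)}"

text \<open>The labels \<open>d\<close> for which \<open>v1 + lat d\<close> has length 1: three
  bonds to the layer above (third entry 0) and three to the layer below (third entry -1).\<close>

definition inter_layer :: "(int \<times> int \<times> int) set" where
  "inter_layer = {(0, 0, 0), (-1, 0, 0), (0, -1, 0), (0, 0, -1), (-1, 0, -1), (0, -1, -1)}"

text \<open>Pairs of a sublattice and a difference of labels. A bond from the unshifted sublattice
  adds \<open>d\<close>; the same bond seen from its other end subtracts it.\<close>

definition nbrs :: "bool \<Rightarrow> (bool \<times> int \<times> int \<times> int) set" where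
  "nbrs s = (\<lambda>d. (s, d)) ` in_plane \<union> (\<lambda>d. (\<not> s, if s then - d else d)) ` inter_layer"

lemma norm3: "(norm (x :: real^3))\<^sup>2 = (x $ 1)\<^sup>2 + (x $ 2)\<^sup>2 + (x $ 3)\<^sup>2"
  unfolding power2_norm_eq_inner by (simp add: inner_vec_def sum_3 power2_eq_square)

lemma norm_eq_1_iff: "norm (x :: real^3) = 1 \<longleftrightarrow> (norm x)\<^sup>2 = 1"
  by (simp add: power2_eq_1_iff) (metis norm_ge_zero not_one_le_zero neg_0_le_iff_le order_trans zero_le_one)

text \<open>Three times the squared norm is the integral form 3 (a^2 + a b + b^2) + 8 c^2.
  Completing the square in either variable bounds \<open>a\<close>, \<open>b\<close> and
  \<open>c\<close>, so finitely many candidates remain.\<close>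

lemma norm_lat: "norm (lat l) = 1 \<longleftrightarrow> l \<in> in_plane"
proof -
  obtain a b c where l: "l = (a, b, c)" by (cases l)
  have "3 * (norm (lat l))\<^sup>2 = of_int (3 * (a * a + a * b + b * b) + 8 * (c * c))"
    unfolding norm3 l lat_nth by (simp add: power2_eq_square algebra_simps)
  then have "norm (lat l) = 1 \<longleftrightarrow> (of_int (3 * (a * a + a * b + b * b) + 8 * (c * c)) :: real) = 3"
    unfolding norm_eq_1_iff by linarith
  also have "\<dots> \<longleftrightarrow> 3 * (a * a + a * b + b * b) + 8 * (c * c) = 3" by linarith
  also have "\<dots> \<longleftrightarrow> l \<in> in_plane"
  proof
    assume eq: "3 * (a * a + a * b + b * b) + 8 * (c * c) = 3"
    define q S1 S2 where "q = a * a + a * b + b * b" and "S1 = (2 * a + b) * (2 * a + b)" and "S2 = (2 * b + a) * (2 * b + a)"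
    have sq: "4 * q = S1 + 3 * (b * b)" "4 * q = S2 + 3 * (a * a)" by (simp_all add: q_def S1_def S2_def algebra_simps)
    have nn: "0 \<le> S1" "0 \<le> S2" "0 \<le> b * b" "0 \<le> a * a" "0 \<le> c * c" by (simp_all add: S1_def S2_def)
    have eq: "3 * q + 8 * (c * c) = 3" using eq by (simp add: q_def)
    have "c * c = 0" using eq sq(1) nn by linarith
    then have c: "c = 0" by simp
    have "3 * (b * b) \<le> 4" "3 * (a * a) \<le> 4" using eq sq nn by linarith+
    then have "b * b \<le> 1" "a * a \<le> 1" by linarith+
    then have "\<bar>b\<bar> \<le> 1" "\<bar>a\<bar> \<le> 1" by (simp_all add: abs_square_le_1[unfolded power2_eq_square])
    then have "a \<in> {-1, 0, 1}" "b \<in> {-1, 0, 1}" by auto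
    then show "l \<in> in_plane" using eq c l by (auto simp: in_plane_def q_def)
  qed (auto simp: in_plane_def l)
  finally show ?thesis .
qed

text \<open>The same completion of squares. For integers c^2 + c is nonnegative, so the planar part
  is nonpositive, which leaves only the values 0 and -1 for \<open>a\<close> and
  \<open>b\<close>.\<close>

lemma norm_v1_lat: "norm (v1 + lat l) = 1 \<longleftrightarrow> l \<in> inter_layer"
proof -
  obtain a b c where l: "l = (a, b, c)" by (cases l)
  have "3 * (norm (v1 + lat l))\<^sup>2 = of_int (3 * (a * a + a * b + b * b + a + b) + 8 * (c * c + c) + 3)"
    unfolding norm3 l vector_add_component lat_nth v1_nth
    by (simp add: power2_eq_square algebra_simps)
  then have "norm (v1 + lat l) = 1 \<longleftrightarrow> (of_int (3 * (a * a + a * b + b * b + a + b) + 8 * (c * c + c) + 3) :: real) = 3"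
    unfolding norm_eq_1_iff by linarith
  also have "\<dots> \<longleftrightarrow> 3 * (a * a + a * b + b * b + a + b) + 8 * (c * c + c) = 0" by linarith
  also have "\<dots> \<longleftrightarrow> l \<in> inter_layer"
  proof
    assume eq: "3 * (a * a + a * b + b * b + a + b) + 8 * (c * c + c) = 0"
    define q S1 S2 where "q = a * a + a * b + b * b + a + b" and "S1 = (2 * a + b + 1) * (2 * a + b + 1)"
      and "S2 = (2 * b + a + 1) * (2 * b + a + 1)"
    have sq: "4 * q = S1 + 3 * (b * b) + 2 * b - 1" "4 * q = S2 + 3 * (a * a) + 2 * a - 1"
      by (simp_all add: q_def S1_def S2_def algebra_simps)
    have nn: "0 \<le> S1" "0 \<le> S2" by (simp_all add: S1_def S2_def)
    have eq: "3 * q + 8 * (c * c + c) = 0" using eq by (simp add: q_def)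
    have cc: "0 \<le> c * c + c"
    proof (cases "0 \<le> c")
      case False
      then have "0 \<le> (- c) * (- c - 1)" by (intro mult_nonneg_nonneg) auto
      then show ?thesis by (simp add: algebra_simps)
    qed simp
    have quad: "t = 0 \<or> t = - 1" if "3 * (t * t) + 2 * t \<le> 1" for t :: int
    proof -
      have "t < 1"
      proof (rule ccontr)
        assume "\<not> t < 1"
        then have "1 * 1 \<le> t * t" by (intro mult_mono) auto
        then show False using that \<open>\<not> t < 1\<close> by linarith
      qed
      moreover have "- 2 < t"
      proof (rule ccontr)
        assume "\<not> - 2 < t"
        then have "2 * - t \<le> (- t) * (- t)" by (intro mult_right_mono) auto
        then show False using that \<open>\<not> - 2 < t\<close> by simp
      qed
      ultimately show ?thesis by auto
    qed
    define C where "C = c * c + c"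
    have "q \<le> 0" using eq cc unfolding C_def[symmetric] by linarith
    then have "3 * (b * b) + 2 * b \<le> 1" "3 * (a * a) + 2 * a \<le> 1" using sq nn by linarith+
    then have "b = 0 \<or> b = - 1" "a = 0 \<or> a = - 1" using quad by blast+
    moreover from this have "0 \<le> q" by (auto simp: q_def)
    then have "C = 0" "q = 0" using eq cc unfolding C_def[symmetric] by linarith+
    then have "c * c + c = 0" "q = 0" by (simp_all add: C_def)
    moreover from this have "c * (c + 1) = 0" by (simp add: algebra_simps)
    then have "c = 0 \<or> c = - 1" by auto
    ultimately show "l \<in> inter_layer" using l by (auto simp: inter_layer_def q_def)
  qed (auto simp: inter_layer_def l)
  finally show ?thesis .
qed

lemma dist_site: "dist (site s l) (site t m) = 1 \<longleftrightarrow> (t, m - l) \<in> nbrs s"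
proof -
  have "dist (site s l) (site t m) = (if s = t then norm (lat (m - l)) else if s then norm (v1 + lat (l - m)) else norm (v1 + lat (m - l)))"
    by (auto simp: dist_norm site_def lat_diff norm_minus_commute algebra_simps)
  moreover have "l - m \<in> inter_layer \<longleftrightarrow> m - l \<in> uminus ` inter_layer"
  proof -
    have neg: "m - l = - x \<longleftrightarrow> l - m = x" for x
      using minus_diff_eq[of l m] neg_equal_iff_equal[of "l - m" x] by metis
    show ?thesis unfolding image_iff neg by blast
  qed
  ultimately show ?thesis
    by (auto simp: norm_lat norm_v1_lat nbrs_def image_iff)
qed

lemma neighbours_site: "neighbours (site s l) = (\<lambda>(t, d). site t (l + d)) ` nbrs s"
proof (intro set_eqI iffI)
  fix y assume "y \<in> neighbours (site s l)"
  then obtain t m where y: "y = site t m" "dist (site s l) (site t m) = 1"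
    by (auto simp: neighbours_def HCP_eq)
  then have "(t, m - l) \<in> nbrs s" by (simp add: dist_site)
  moreover have "y = site t (l + (m - l))" by (simp add: y)
  ultimately show "y \<in> (\<lambda>(t, d). site t (l + d)) ` nbrs s" by force
next
  fix y assume "y \<in> (\<lambda>(t, d). site t (l + d)) ` nbrs s"
  then obtain t d where y: "y = site t (l + d)" "(t, d) \<in> nbrs s" by auto
  then show "y \<in> neighbours (site s l)"
    using dist_site[of s l t "l + d"] by (simp add: neighbours_def)
qed

lemma finite_nbrs [simp]: "finite (nbrs s)" by (simp add: nbrs_def in_plane_def inter_layer_def)

lemma inj_nbrs: "inj_on (\<lambda>(t, d). site t (l + d)) (nbrs s)"
proof (rule inj_onI)
  fix p q assume "(case p of (t, d) \<Rightarrow> site t (l + d)) = (case q of (t, d) \<Rightarrow> site t (l + d))"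
  then have "(fst p, l + snd p) = (fst q, l + snd q)"
    using injD[OF inj_site, of "(fst p, l + snd p)" "(fst q, l + snd q)"] by (simp only: case_prod_beta fst_conv snd_conv)
  then have "fst p = fst q" "snd p = snd q" by (simp_all only: prod.inject add_left_cancel)
  then show "p = q" by (rule prod_eqI)
qed

lemma sum_nbrs: "(\<Sum>(t, d)\<in>nbrs s. f t d) = (\<Sum>d\<in>in_plane. f s d) + (\<Sum>d\<in>inter_layer. f (\<not> s) (if s then - d else d))"
proof -
  have "(\<Sum>(t, d)\<in>nbrs s. f t d) = (\<Sum>(t, d)\<in>(\<lambda>d. (s, d)) ` in_plane. f t d) +
      (\<Sum>(t, d)\<in>(\<lambda>d. (\<not> s, if s then - d else d)) ` inter_layer. f t d)"
    unfolding nbrs_def by (intro sum.union_disjoint) (auto simp: in_plane_def inter_layer_def)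
  also have "\<dots> = (\<Sum>d\<in>in_plane. f s d) + (\<Sum>d\<in>inter_layer. f (\<not> s) (if s then - d else d))"
    by (intro arg_cong2[where f = "(+)"]; subst sum.reindex) (auto simp: inj_on_def)
  finally show ?thesis .
qed

lemma card_nbrs: "card (nbrs s) = 12"
proof -
  have "card (nbrs s) = (\<Sum>(t, d)\<in>nbrs s. 1)" by (simp add: case_prod_beta)
  also have "\<dots> = card in_plane + card inter_layer" unfolding sum_nbrs by simp
  also have "\<dots> = 12" by (simp add: in_plane_def inter_layer_def)
  finally show ?thesis .
qed

section \<open>The edge energy as a count of missing bonds\<close>

lemma finite_site_bounded:
  assumes "bounded A"
  shows "finite {l. site s l \<in> A}"
proof -
  obtain B where B: "\<And>x. x \<in> A \<Longrightarrow> norm x \<le> B" using assms bounded_iff by blast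
  define C where "C = B + norm v1"
  have "{l. site s l \<in> A} \<subseteq> {- \<lceil>2 * C\<rceil>..\<lceil>2 * C\<rceil>} \<times> {- \<lceil>2 * C\<rceil>..\<lceil>2 * C\<rceil>} \<times> {- \<lceil>2 * C\<rceil>..\<lceil>2 * C\<rceil>}"
  proof
    fix l assume l: "l \<in> {l. site s l \<in> A}"
    obtain a b c where abc: "l = (a, b, c)" by (cases l)
    have "norm (lat l) \<le> norm (site s l) + norm v1"
      using norm_triangle_ineq4[of "site s l" v1] norm_ge_zero[of v1] by (auto simp: site_def)
    then have n: "norm (lat l) \<le> C" using B[of "site s l"] l by (simp add: C_def)
    have nth: "\<bar>lat l $ k\<bar> \<le> C" for k using component_le_norm_cart[of "lat l" k] n by linarith
    have C: "0 \<le> C" using n norm_ge_zero order_trans by blast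
    have "3 / 2 \<le> sqrt 3" by (rule real_le_rsqrt) (simp add: power2_eq_square)
    have "2 \<le> sqrt 6" by (rule real_le_rsqrt) simp
    have b: "\<bar>of_int b\<bar> \<le> 4 / 3 * C"
    proof -
      have "3 / 2 / 2 * \<bar>of_int b\<bar> \<le> sqrt 3 / 2 * \<bar>of_int b :: real\<bar>"
        using \<open>3 / 2 \<le> sqrt 3\<close> by (intro mult_right_mono divide_right_mono) auto
      also have "\<dots> \<le> C" using nth[of 2] by (simp add: abc lat_nth abs_mult)
      finally show ?thesis by simp
    qed
    have c: "\<bar>of_int c\<bar> \<le> C"
    proof -
      have "1 * \<bar>of_int c\<bar> \<le> 2 / 3 * sqrt 6 * \<bar>of_int c :: real\<bar>"
        using \<open>2 \<le> sqrt 6\<close> by (intro mult_right_mono) auto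
      also have "\<dots> \<le> C" using nth[of 3] by (simp add: abc lat_nth abs_mult)
      finally show ?thesis by simp
    qed
    have "\<bar>of_int a + of_int b / 2\<bar> \<le> C" using nth[of 1] by (simp add: abc lat_nth)
    then have a: "\<bar>of_int a\<bar> \<le> 2 * C" using b C by linarith
    have "\<bar>t\<bar> \<le> \<lceil>2 * C\<rceil>" if "\<bar>of_int t\<bar> \<le> 2 * C" for t :: int
    proof -
      have "(of_int \<bar>t\<bar> :: real) \<le> 2 * C" using that by simp
      also have "\<dots> \<le> of_int \<lceil>2 * C\<rceil>" by (rule le_of_int_ceiling)
      finally show ?thesis by (simp only: of_int_le_iff)
    qed
    moreover have "\<bar>of_int b\<bar> \<le> 2 * C" "\<bar>of_int c\<bar> \<le> 2 * C" using b c C by linarith+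
    ultimately have "\<bar>a\<bar> \<le> \<lceil>2 * C\<rceil>" "\<bar>b\<bar> \<le> \<lceil>2 * C\<rceil>" "\<bar>c\<bar> \<le> \<lceil>2 * C\<rceil>" using a by blast+
    then show "l \<in> {- \<lceil>2 * C\<rceil>..\<lceil>2 * C\<rceil>} \<times> {- \<lceil>2 * C\<rceil>..\<lceil>2 * C\<rceil>} \<times> {- \<lceil>2 * C\<rceil>..\<lceil>2 * C\<rceil>}"
      by (auto simp: abc abs_le_iff)
  qed
  then show ?thesis by (rule finite_subset) simp
qed

text \<open>Oriented missing bonds of one type, recorded by the label of the end inside
  \<open>X\<close>; only this end has to lie in \<open>A\<close>, as in the energy.\<close>

definition cut :: "(real^3) set \<Rightarrow> (real^3) set \<Rightarrow> bool \<Rightarrow> int \<times> int \<times> int \<Rightarrow> bool \<Rightarrow> (int \<times> int \<times> int) set" where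
  "cut X A s d t = {l. site s l \<in> X \<inter> A \<and> site t (l + d) \<notin> X}"

text \<open>The deficit of a site is the number of its 12 neighbouring sites outside
  \<open>X\<close>; exchanging sums sorts the missing bonds by type.\<close>

lemma edge_energy_eq:
  assumes X: "X \<subseteq> HCP" and A: "bounded A"
  shows "edge_energy X A = (\<Sum>s\<in>UNIV. \<Sum>(t, d)\<in>nbrs s. real (card (cut X A s d t)))"
proof -
  define L where "L s = {l. site s l \<in> X \<inter> A}" for s
  have finL: "finite (L s)" for s
    by (rule finite_subset[OF _ finite_site_bounded[OF A, of s]]) (auto simp: L_def)
  have XA: "X \<inter> A = (\<lambda>(s, l). site s l) ` (SIGMA s:UNIV. L s)"
    using X by (force simp: L_def HCP_eq image_iff)
  have deg: "12 - real (card (neighbours (site s l) \<inter> X)) = (\<Sum>(t, d)\<in>nbrs s. of_bool (site t (l + d) \<notin> X))" for s l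
  proof -
    have "neighbours (site s l) \<inter> X = (\<lambda>(t, d). site t (l + d)) ` {p \<in> nbrs s. site (fst p) (l + snd p) \<in> X}"
      unfolding neighbours_site by force
    moreover have "card ((\<lambda>(t, d). site t (l + d)) ` {p \<in> nbrs s. site (fst p) (l + snd p) \<in> X}) =
        card {p \<in> nbrs s. site (fst p) (l + snd p) \<in> X}"
      by (rule card_image[OF inj_on_subset[OF inj_nbrs]]) auto
    ultimately have "card (neighbours (site s l) \<inter> X) = card {p \<in> nbrs s. site (fst p) (l + snd p) \<in> X}"
      by (simp only:)
    also have "{p \<in> nbrs s. site (fst p) (l + snd p) \<in> X} = nbrs s \<inter> {p. site (fst p) (l + snd p) \<in> X}" by auto
    also have "real (card \<dots>) = (\<Sum>(t, d)\<in>nbrs s. of_bool (site t (l + d) \<in> X))"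
      unfolding case_prod_beta by (subst sum_of_bool_eq) simp_all
    finally have "real (card (neighbours (site s l) \<inter> X)) = (\<Sum>(t, d)\<in>nbrs s. of_bool (site t (l + d) \<in> X))" .
    moreover have "(12 :: real) = (\<Sum>(t, d)\<in>nbrs s. 1)" using card_nbrs[of s] by (simp add: case_prod_beta)
    ultimately have "12 - real (card (neighbours (site s l) \<inter> X)) = (\<Sum>(t, d)\<in>nbrs s. 1 - of_bool (site t (l + d) \<in> X))"
      by (simp add: case_prod_beta sum_subtractf)
    then show ?thesis by (simp only: of_bool_not_iff)
  qed
  have "edge_energy X A = (\<Sum>(s, l)\<in>(SIGMA s:UNIV. L s). 12 - real (card (neighbours (site s l) \<inter> X)))"
    unfolding edge_energy_def XA
    by (subst sum.reindex[OF inj_on_subset[OF inj_site]]) (auto simp: case_prod_beta intro!: sum.cong)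
  also have "\<dots> = (\<Sum>s\<in>UNIV. \<Sum>l\<in>L s. \<Sum>(t, d)\<in>nbrs s. of_bool (site t (l + d) \<notin> X))"
    unfolding deg by (rule sum.Sigma[symmetric]) (use finL in auto)
  also have "\<dots> = (\<Sum>s\<in>UNIV. \<Sum>(t, d)\<in>nbrs s. \<Sum>l\<in>L s. of_bool (site t (l + d) \<notin> X))"
    unfolding case_prod_beta by (intro sum.cong refl sum.swap)
  also have "\<dots> = (\<Sum>s\<in>UNIV. \<Sum>(t, d)\<in>nbrs s. real (card (cut X A s d t)))"
  proof (intro sum.cong refl, clarify)
    fix s t a b c
    have "(\<Sum>l\<in>L s. of_bool (site t (l + (a, b, c)) \<notin> X) :: real) = real (card {l \<in> L s. site t (l + (a, b, c)) \<notin> X})"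
      by (subst sum_of_bool_eq) (simp_all add: finL Collect_conj_eq)
    also have "{l \<in> L s. site t (l + (a, b, c)) \<notin> X} = cut X A s (a, b, c) t"
      by (auto simp: L_def cut_def)
    finally show "(\<Sum>l\<in>L s. of_bool (site t (l + (a, b, c)) \<notin> X) :: real) = real (card (cut X A s (a, b, c) t))" .
  qed
  finally show ?thesis .
qed

section \<open>Lattice points in slabs\<close>

text \<open>Its fibres are the half-open unit cubes of coordinate space, so that counting labels
  becomes measuring a union of cubes.\<close>

definition floor3 :: "real^3 \<Rightarrow> int \<times> int \<times> int" where
  "floor3 v = (\<lfloor>v $ 1\<rfloor>, \<lfloor>v $ 2\<rfloor>, \<lfloor>v $ 3\<rfloor>)"

lemma
  shows sets_floor3: "floor3 -` {l} \<in> sets borel" and emeasure_floor3: "emeasure lborel (floor3 -` {l}) = 1"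
proof -
  obtain a b c where l: "l = (a, b, c)" by (cases l)
  have eq: "floor3 -` {l} = {v \<in> space borel. \<lfloor>v $ 1\<rfloor> = a \<and> \<lfloor>v $ 2\<rfloor> = b \<and> \<lfloor>v $ 3\<rfloor> = c}"
    by (auto simp: floor3_def l)
  have [measurable]: "(\<lambda>v::real^3. v $ k) \<in> borel_measurable borel" for k
    by (intro borel_measurable_continuous_onI continuous_intros)
  show S: "floor3 -` {l} \<in> sets borel" unfolding eq by measurable
  have fl: "\<lfloor>x\<rfloor> = k \<longleftrightarrow> x \<in> {of_int k..<of_int k + 1}" for x :: real and k
    by (auto simp: floor_eq_iff)
  have pre: "tri -` floor3 -` {l} = ({of_int a..<of_int a + 1} \<times> {of_int b..<of_int b + 1}) \<times> {of_int c..<of_int c + 1}"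
    by (auto simp: floor3_def l fl)
  have "emeasure lborel (floor3 -` {l}) = emeasure lborel (tri -` floor3 -` {l})"
    by (subst lborel_tri) (use S in \<open>simp add: emeasure_distr\<close>)
  also have "\<dots> = emeasure (lborel \<Otimes>\<^sub>M lborel) (({of_int a..<of_int a + 1 :: real} \<times> {of_int b..<of_int b + 1 :: real}) \<times> {of_int c..<of_int c + 1 :: real})"
    unfolding pre by (simp only: lborel_prod)
  also have "\<dots> = emeasure lborel ({of_int a..<of_int a + 1 :: real} \<times> {of_int b..<of_int b + 1 :: real}) * emeasure lborel {of_int c..<of_int c + 1 :: real}"
    by (rule lborel.emeasure_pair_measure_Times) (auto intro: borel_Times)
  also have "emeasure lborel ({of_int a..<of_int a + 1 :: real} \<times> {of_int b..<of_int b + 1 :: real}) =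
      emeasure (lborel \<Otimes>\<^sub>M lborel) ({of_int a..<of_int a + 1 :: real} \<times> {of_int b..<of_int b + 1 :: real})"
    by (simp only: lborel_prod)
  also have "\<dots> = emeasure lborel {of_int a..<of_int a + 1 :: real} * emeasure lborel {of_int b..<of_int b + 1 :: real}"
    by (rule lborel.emeasure_pair_measure_Times) auto
  finally show "emeasure lborel (floor3 -` {l}) = 1" by simp
qed

lemma emeasure_cubes:
  assumes "finite S"
  shows "emeasure lborel (\<Union>l\<in>S. floor3 -` {l}) = of_nat (card S)"
proof -
  have "emeasure lborel (\<Union>l\<in>S. floor3 -` {l}) = (\<Sum>l\<in>S. emeasure lborel (floor3 -` {l}))"
    using assms sets_floor3 by (intro sum_emeasure[symmetric]) (auto simp: disjoint_family_on_def)
  then show ?thesis by (simp add: emeasure_floor3)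
qed

definition lat_matrix :: "real^3^3" where
  "lat_matrix = vector [vector [1, 1 / 2, 0], vector [0, sqrt 3 / 2, 0], vector [0, 0, 2 / 3 * sqrt 6]]"

text \<open>The volume of a cell of one sublattice, the origin of all factors
  \<open>1 / sqrt 2\<close> in the tension.\<close>

lemma det_lat_matrix: "det lat_matrix = sqrt 2"
proof -
  have "det lat_matrix = (sqrt 3 * sqrt 3) / 3 * sqrt 2"
    by (simp add: lat_matrix_def det_3 sqrt6)
  then show ?thesis by simp
qed

lemma lat_matrix_mult: "lat_matrix *v v = v $ 1 *\<^sub>R e1 + v $ 2 *\<^sub>R e2 + v $ 3 *\<^sub>R e3"
  by (simp add: vec_eq_iff forall_3 lat_matrix_def matrix_vector_mult_def sum_3 e1_def e2_def e3_def)

lemma norm_e: "norm e1 = 1" "norm e2 = 1" "norm e3 \<le> 2"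
proof -
  have "(norm e1)\<^sup>2 = 1" "(norm e2)\<^sup>2 = 1" "(norm e3)\<^sup>2 \<le> 2\<^sup>2"
    unfolding norm3 by (simp_all add: e1_def e2_def e3_def power_mult_distrib power_divide)
  then show "norm e1 = 1" "norm e2 = 1" "norm e3 \<le> 2"
    by (simp_all only: norm_eq_1_iff) (metis power2_le_imp_le zero_le_numeral)
qed

lemma lat_floor3: "norm (lat_matrix *v v - lat (floor3 v)) \<le> 4"
proof -
  have "lat_matrix *v v - lat (floor3 v) = frac (v $ 1) *\<^sub>R e1 + frac (v $ 2) *\<^sub>R e2 + frac (v $ 3) *\<^sub>R e3"
    by (simp add: lat_matrix_mult lat_def floor3_def frac_def algebra_simps)
  also have "norm \<dots> \<le> frac (v $ 1) * norm e1 + frac (v $ 2) * norm e2 + frac (v $ 3) * norm e3"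
    by (intro norm_triangle_mono order.refl) (simp_all add: frac_ge_0)
  also have "\<dots> \<le> 1 * 1 + 1 * 1 + 1 * 2"
    using norm_e by (intro add_mono mult_mono) (auto simp: less_imp_le frac_lt_1)
  finally show ?thesis by simp
qed

lemma le_of_multiples:
  fixes a b c :: real
  assumes "\<And>K::nat. K0 \<le> K \<Longrightarrow> real K * a \<le> real K * b + c"
  shows "a \<le> b"
proof (rule ccontr)
  assume "\<not> a \<le> b"
  then have ab: "0 < a - b" by simp
  obtain K1 :: nat where "c / (a - b) < real K1" using reals_Archimedean2 by blast
  then have "c / (a - b) < real (max K0 K1)" by simp
  then have "c < real (max K0 K1) * (a - b)" using ab by (simp add: pos_divide_less_eq)
  then show False using assms[of "max K0 K1"] by (simp add: algebra_simps)
qed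

section \<open>Coordinates of the cube and slabs of lattice points\<close>

locale frame =
  fixes \<nu> :: "real^3" and R :: "real^3^3"
  assumes frame: "cube_frame \<nu> R"
begin

lemma R: "orthogonal_matrix R" "R *v axis 3 1 = \<nu>" using frame by (auto simp: cube_frame_def)

definition crd :: "real^3 \<Rightarrow> real^3" where "crd x = transpose R *v x"

lemma crd_linear: "crd (x + y) = crd x + crd y" "crd (x - y) = crd x - crd y" "crd (t *\<^sub>R x) = t *\<^sub>R crd x"
  by (simp_all add: crd_def matrix_vector_right_distrib matrix_vector_mult_diff_distrib matrix_vector_mult_scaleR del: transpose_matrix_vector)

lemma R_crd: "R *v crd x = x" "crd (R *v x) = x"
  using R(1) unfolding crd_def orthogonal_matrix_def
  by (simp_all add: matrix_vector_mul_assoc del: transpose_matrix_vector)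

lemma crd_3: "crd x $ 3 = \<nu> \<bullet> x"
  using orthogonal_inner_third[OF R, of "crd x"] by (simp add: R_crd)

lemma norm_crd: "norm (crd x) = norm x"
  using orthogonal_transformation_norm[OF orthogonal_transformation_mult_vec[OF R(1)], of "crd x"] by (simp add: R_crd)

lemma crd_le_norm: "\<bar>crd x $ i\<bar> \<le> norm x"
  using component_le_norm_cart[of "crd x" i] by (simp add: norm_crd)

lemma nu_le_norm: "\<bar>\<nu> \<bullet> x\<bar> \<le> norm x"
  using crd_le_norm[of x 3] by (simp add: crd_3)

lemma mem_cube: "x \<in> cube R T \<longleftrightarrow> (\<forall>i. \<bar>crd x $ i\<bar> < T / 2)"
  proof
  assume "x \<in> cube R T"
  then show "\<forall>i. \<bar>crd x $ i\<bar> < T / 2" by (auto simp: cube_def R_crd)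
next
  assume "\<forall>i. \<bar>crd x $ i\<bar> < T / 2"
  then have "R *v crd x \<in> cube R T" unfolding cube_def by blast
  then show "x \<in> cube R T" by (simp only: R_crd)
qed

lemma bounded_cube: "bounded (cube R T)"
proof -
  have "norm x \<le> T / 2 + T / 2 + T / 2" if "x \<in> cube R T" for x
  proof -
    have "norm x \<le> (\<Sum>i\<in>UNIV. \<bar>crd x $ i\<bar>)" using norm_le_l1_cart[of "crd x"] by (simp add: norm_crd)
    also have "\<dots> = \<bar>crd x $ 1\<bar> + \<bar>crd x $ 2\<bar> + \<bar>crd x $ 3\<bar>" by (simp add: sum_3)
    finally show ?thesis using that[unfolded mem_cube, rule_format, of 1] that[unfolded mem_cube, rule_format, of 2]
      that[unfolded mem_cube, rule_format, of 3] by linarith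
  qed
  then show ?thesis unfolding bounded_iff by blast
qed

text \<open>\<open>slope\<close> and \<open>obl\<close>: the first two coordinates of the projection along \<open>lat w\<close> onto the plane orthogonal
  to \<open>\<nu>\<close>.\<close>

definition slope :: "int \<times> int \<times> int \<Rightarrow> 3 \<Rightarrow> real" where "slope w i = crd (lat w) $ i / (\<nu> \<bullet> lat w)"

definition obl :: "int \<times> int \<times> int \<Rightarrow> real^3 \<Rightarrow> 3 \<Rightarrow> real" where "obl w x i = crd x $ i - slope w i * (\<nu> \<bullet> x)"

lemma obl_add: "obl w (x + y) i = obl w x i + obl w y i"
  by (simp add: obl_def crd_linear inner_simps algebra_simps)

lemma obl_scaleR: "obl w (t *\<^sub>R x) i = t * obl w x i"
  by (simp add: obl_def crd_linear algebra_simps)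

lemma obl_period: "\<nu> \<bullet> lat w \<noteq> 0 \<Longrightarrow> obl w (lat w) i = 0"
  by (simp add: obl_def slope_def)

lemma obl_le: "\<bar>obl w x i\<bar> \<le> (1 + \<bar>slope w i\<bar>) * norm x"
proof -
  have "\<bar>obl w x i\<bar> \<le> \<bar>crd x $ i\<bar> + \<bar>slope w i * (\<nu> \<bullet> x)\<bar>" unfolding obl_def by (rule abs_triangle_ineq4)
  also have "\<dots> \<le> norm x + \<bar>slope w i\<bar> * norm x"
    unfolding abs_mult by (intro add_mono mult_left_mono crd_le_norm nu_le_norm) simp
  finally show ?thesis by (simp add: algebra_simps)
qed

text \<open>The thickness is \<open>K\<close> periods of \<open>w\<close>, and the cross-section is
  measured along \<open>w\<close>. Since \<open>obl\<close> is constant along \<open>w\<close>,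
  translation by \<open>w\<close> stacks slabs exactly.\<close>

definition slab :: "int \<times> int \<times> int \<Rightarrow> nat \<Rightarrow> real \<Rightarrow> (int \<times> int \<times> int) set" where
  "slab w K T = {l. 0 \<le> \<nu> \<bullet> lat l \<and> \<nu> \<bullet> lat l < real K * (\<nu> \<bullet> lat w) \<and> \<bar>obl w (lat l) 1\<bar> < T / 2 \<and> \<bar>obl w (lat l) 2\<bar> < T / 2}"

lemma finite_slab: "finite (slab w K T)"
proof -
  define A where "A = {x. 0 \<le> \<nu> \<bullet> x \<and> \<nu> \<bullet> x < real K * (\<nu> \<bullet> lat w) \<and> \<bar>obl w x 1\<bar> < T / 2 \<and> \<bar>obl w x 2\<bar> < T / 2}"
  define P where "P = real K * (\<nu> \<bullet> lat w)"
  have "norm x \<le> (T / 2 + \<bar>slope w 1\<bar> * P) + (T / 2 + \<bar>slope w 2\<bar> * P) + P" if x: "x \<in> A" for x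
  proof -
    have \<nu>: "\<bar>\<nu> \<bullet> x\<bar> \<le> P" using x by (auto simp: A_def P_def)
    have i: "\<bar>crd x $ i\<bar> \<le> T / 2 + \<bar>slope w i\<bar> * P" if "\<bar>obl w x i\<bar> < T / 2" for i
    proof -
      have "\<bar>crd x $ i\<bar> \<le> \<bar>obl w x i\<bar> + \<bar>slope w i\<bar> * \<bar>\<nu> \<bullet> x\<bar>"
        unfolding obl_def abs_mult[symmetric] by linarith
      also have "\<dots> \<le> T / 2 + \<bar>slope w i\<bar> * P" using that \<nu> by (intro add_mono mult_left_mono) auto
      finally show ?thesis .
    qed
    have "norm x \<le> (\<Sum>i\<in>UNIV. \<bar>crd x $ i\<bar>)" using norm_le_l1_cart[of "crd x"] by (simp add: norm_crd)
    also have "\<dots> = \<bar>crd x $ 1\<bar> + \<bar>crd x $ 2\<bar> + \<bar>\<nu> \<bullet> x\<bar>" by (simp add: sum_3 crd_3)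
    also have "\<dots> \<le> (T / 2 + \<bar>slope w 1\<bar> * P) + (T / 2 + \<bar>slope w 2\<bar> * P) + P"
      using x \<nu> by (intro add_mono i) (auto simp: A_def)
    finally show ?thesis .
  qed
  then have "bounded A" unfolding bounded_iff by blast
  then have "finite {l. site False l \<in> A}" by (rule finite_site_bounded)
  then show ?thesis
    by (rule finite_subset[rotated]) (auto simp: slab_def A_def site_def)
qed

text \<open>The layer beyond the first \<open>K\<close> periods is the first layer translated by K
  w.\<close>

lemma card_slab:
  assumes p: "0 < \<nu> \<bullet> lat w"
  shows "card (slab w K T) = K * card (slab w 1 T)"
proof (induction K)
  case 0
  have "slab w 0 T = {}" by (auto simp: slab_def)
  then show ?case by simp
next
  case (Suc K)
  define kw where "kw = (case w of (a, b, c) \<Rightarrow> (int K * a, int K * b, int K * c))"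
  have kw: "lat kw = real K *\<^sub>R lat w" by (cases w) (simp add: kw_def lat_def algebra_simps)
  have o: "obl w (lat (l + kw)) i = obl w (lat l) i" for l i
    using p by (simp add: lat_add kw obl_add obl_scaleR obl_period)
  have v: "\<nu> \<bullet> lat (l + kw) = \<nu> \<bullet> lat l + real K * (\<nu> \<bullet> lat w)" for l
    by (simp add: lat_add kw inner_simps)
  have "slab w (Suc K) T = slab w K T \<union> (\<lambda>l. l + kw) ` slab w 1 T"
  proof (intro set_eqI iffI)
    fix l assume l: "l \<in> slab w (Suc K) T"
    show "l \<in> slab w K T \<union> (\<lambda>l. l + kw) ` slab w 1 T"
    proof (cases "\<nu> \<bullet> lat l < real K * (\<nu> \<bullet> lat w)")
      case True then show ?thesis using l by (simp add: slab_def)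
    next
      case False
      then have "l - kw \<in> slab w 1 T" using l v[of "l - kw"] o[of "l - kw"] by (simp add: slab_def algebra_simps)
      then show ?thesis by (intro UnI2 image_eqI[of _ _ "l - kw"]) simp_all
    qed
  next
    fix l assume "l \<in> slab w K T \<union> (\<lambda>l. l + kw) ` slab w 1 T"
    then show "l \<in> slab w (Suc K) T"
    proof
      assume "l \<in> slab w K T"
      then show ?thesis using p by (auto simp: slab_def algebra_simps)
    next
      assume "l \<in> (\<lambda>l. l + kw) ` slab w 1 T"
      then obtain m where m: "l = m + kw" "m \<in> slab w 1 T" by auto
      then show ?thesis using p unfolding m(1) slab_def mem_Collect_eq v o by (simp add: distrib_right)
    qed
  qed
  moreover have "slab w K T \<inter> (\<lambda>l. l + kw) ` slab w 1 T = {}"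
  proof -
    have "m + kw \<notin> slab w K T" if "m \<in> slab w 1 T" for m
      using that by (simp add: slab_def v)
    then show ?thesis by auto
  qed
  ultimately have "card (slab w (Suc K) T) = card (slab w K T) + card ((\<lambda>l. l + kw) ` slab w 1 T)"
    using finite_slab by (simp add: card_Un_disjoint)
  also have "card ((\<lambda>l. l + kw) ` slab w 1 T) = card (slab w 1 T)" by (intro card_image inj_onI) simp
  finally show ?case using Suc by simp
qed

definition obl_map :: "int \<times> int \<times> int \<Rightarrow> real^3 \<Rightarrow> real^3" where
  "obl_map w v = vector [obl w (lat_matrix *v v) 1, obl w (lat_matrix *v v) 2, \<nu> \<bullet> (lat_matrix *v v)]"

text \<open>\<open>obl_map\<close> is a shear after a rotation or reflection after
  \<open>lat_matrix\<close>, and only the last changes volume.\<close>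

lemma
  shows linear_obl_map: "linear (obl_map w)" and det_obl_map: "\<bar>det (matrix (obl_map w))\<bar> = sqrt 2"
proof -
  define S :: "real^3^3" where "S = vector [vector [1, 0, - slope w 1], vector [0, 1, - slope w 2], vector [0, 0, 1]]"
  have eq: "obl_map w = (*v) (S ** (transpose R ** lat_matrix))"
  proof
    fix v
    define x where "x = lat_matrix *v v"
    have "(S ** (transpose R ** lat_matrix)) *v v = S *v crd x"
      by (simp add: x_def crd_def matrix_vector_mul_assoc del: transpose_matrix_vector)
    moreover have "S *v crd x = vector [obl w x 1, obl w x 2, \<nu> \<bullet> x]"
      by (simp add: vec_eq_iff forall_3 S_def matrix_vector_mult_def sum_3 obl_def crd_3)
    ultimately show "obl_map w v = (S ** (transpose R ** lat_matrix)) *v v"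
      by (simp add: obl_map_def x_def)
  qed
  show "linear (obl_map w)" unfolding eq by simp
  have "det S = 1" by (simp add: S_def det_3)
  moreover have "\<bar>det R\<bar> = 1" using det_orthogonal_matrix[OF R(1)] by auto
  ultimately show "\<bar>det (matrix (obl_map w))\<bar> = sqrt 2"
    unfolding eq by (simp add: det_mul det_transpose det_lat_matrix abs_mult)
qed

lemma emeasure_obl_map:
  assumes A: "A \<in> sets borel"
  shows "emeasure lborel A = ennreal (sqrt 2) * emeasure lborel (obl_map w -` A)" "obl_map w -` A \<in> sets borel"
proof -
  have m [measurable]: "obl_map w \<in> borel_measurable borel"
    using linear_obl_map by (intro borel_measurable_continuous_onI linear_continuous_on) (simp add: linear_conv_bounded_linear)
  show B: "obl_map w -` A \<in> sets borel" using measurable_sets[OF m A] by simp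
  have L: "(lborel :: (real^3) measure) = distr (density lborel (\<lambda>_. ennreal (sqrt 2))) borel (obl_map w)"
    using lborel_distr_linear[OF linear_obl_map, of w] det_obl_map[of w] by fastforce
  have "emeasure lborel A = emeasure (distr (density lborel (\<lambda>_. ennreal (sqrt 2))) borel (obl_map w)) A"
    using L by simp
  also have "\<dots> = ennreal (sqrt 2) * emeasure lborel (obl_map w -` A)"
    using A B by (simp add: emeasure_distr emeasure_density nn_integral_cmult)
  finally show "emeasure lborel A = ennreal (sqrt 2) * emeasure lborel (obl_map w -` A)" .
qed

lemma emeasure_box3:
  assumes "0 \<le> s" "\<alpha> \<le> \<beta>"
  shows "emeasure lborel (box (vector [- s, - s, \<alpha>]) (vector [s, s, \<beta>] :: real^3)) = ennreal ((2 * s)\<^sup>2 * (\<beta> - \<alpha>))"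
    "emeasure lborel (cbox (vector [- s, - s, \<alpha>]) (vector [s, s, \<beta>] :: real^3)) = ennreal ((2 * s)\<^sup>2 * (\<beta> - \<alpha>))"
proof -
  have *: "(\<Prod>b\<in>Basis. (vector [s, s, \<beta>] - vector [- s, - s, \<alpha>] :: real^3) \<bullet> b) = (2 * s)\<^sup>2 * (\<beta> - \<alpha>)"
    by (simp add: Basis_real3 inner_axis axis_eq_axis power2_eq_square)
  have le: "vector [- s, - s, \<alpha>] \<bullet> b \<le> (vector [s, s, \<beta>] :: real^3) \<bullet> b" if "b \<in> Basis" for b
    using that assms by (auto simp: Basis_real3 inner_axis)
  show "emeasure lborel (box (vector [- s, - s, \<alpha>]) (vector [s, s, \<beta>] :: real^3)) = ennreal ((2 * s)\<^sup>2 * (\<beta> - \<alpha>))"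
    "emeasure lborel (cbox (vector [- s, - s, \<alpha>]) (vector [s, s, \<beta>] :: real^3)) = ennreal ((2 * s)\<^sup>2 * (\<beta> - \<alpha>))"
    using emeasure_lborel_box[OF le] emeasure_lborel_cbox[OF le] unfolding * by auto
qed

text \<open>Stacking \<open>K\<close> slabs and letting \<open>K\<close> tend to infinity removes the boundary error in the direction
  of \<open>lat w\<close>.\<close>

lemma slab_count:
  assumes p: "0 < \<nu> \<bullet> lat w"
  obtains C where "0 < C" "\<And>T. C < T \<Longrightarrow> sqrt 2 * card (slab w 1 T) \<le> (T + C)\<^sup>2 * (\<nu> \<bullet> lat w)"
    "\<And>T. C < T \<Longrightarrow> (T - C)\<^sup>2 * (\<nu> \<bullet> lat w) \<le> sqrt 2 * card (slab w 1 T)"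
proof -
  \<comment> \<open>A label differs from any point of its cube by at most 4 in space;
    \<open>D\<close> bounds the resulting change of the height and of both oblique
    coordinates.\<close>
  define D where "D = 4 * (1 + \<bar>slope w 1\<bar> + \<bar>slope w 2\<bar>)"
  have D: "0 < D" by (simp add: D_def add_pos_nonneg)
  have near: "\<bar>\<nu> \<bullet> (lat_matrix *v v) - \<nu> \<bullet> lat (floor3 v)\<bar> \<le> D"
    "\<bar>obl w (lat_matrix *v v) 1 - obl w (lat (floor3 v)) 1\<bar> \<le> D"
    "\<bar>obl w (lat_matrix *v v) 2 - obl w (lat (floor3 v)) 2\<bar> \<le> D" for v
  proof -
    define z where "z = lat_matrix *v v - lat (floor3 v)"
    have z: "norm z \<le> 4" unfolding z_def by (rule lat_floor3)
    have eq: "lat_matrix *v v = lat (floor3 v) + z" by (simp add: z_def)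
    have "\<bar>\<nu> \<bullet> z\<bar> \<le> 4" using nu_le_norm[of z] z by linarith
    then show "\<bar>\<nu> \<bullet> (lat_matrix *v v) - \<nu> \<bullet> lat (floor3 v)\<bar> \<le> D"
      unfolding eq by (simp add: inner_simps D_def)
    have "\<bar>obl w z i\<bar> \<le> (1 + \<bar>slope w i\<bar>) * 4" for i
      using obl_le[of w z i] z mult_left_mono[OF z, of "1 + \<bar>slope w i\<bar>"] by simp
    from this[of 1] this[of 2] show "\<bar>obl w (lat_matrix *v v) 1 - obl w (lat (floor3 v)) 1\<bar> \<le> D"
      "\<bar>obl w (lat_matrix *v v) 2 - obl w (lat (floor3 v)) 2\<bar> \<le> D"
      unfolding eq obl_add by (simp_all add: D_def)
  qed
  have mem: "obl_map w v \<in> cbox (vector [- s, - s, \<alpha>]) (vector [s, s, \<beta>]) \<longleftrightarrow>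
      \<bar>obl w (lat_matrix *v v) 1\<bar> \<le> s \<and> \<bar>obl w (lat_matrix *v v) 2\<bar> \<le> s \<and> \<alpha> \<le> \<nu> \<bullet> (lat_matrix *v v) \<and> \<nu> \<bullet> (lat_matrix *v v) \<le> \<beta>"
    "obl_map w v \<in> box (vector [- s, - s, \<alpha>]) (vector [s, s, \<beta>]) \<longleftrightarrow>
      \<bar>obl w (lat_matrix *v v) 1\<bar> < s \<and> \<bar>obl w (lat_matrix *v v) 2\<bar> < s \<and> \<alpha> < \<nu> \<bullet> (lat_matrix *v v) \<and> \<nu> \<bullet> (lat_matrix *v v) < \<beta>"
    for v s \<alpha> \<beta>
    by (auto simp: mem_box Basis_real3 inner_axis obl_map_def)
  have stack: "ennreal (sqrt 2 * (real K * card (slab w 1 T))) = ennreal (sqrt 2) * of_nat (card (slab w K T))" for K T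
    using card_slab[OF p, of K T] by (simp only: ennreal_of_nat_eq_real_of_nat of_nat_mult) (simp add: ennreal_mult')
  have up: "sqrt 2 * card (slab w 1 T) \<le> (T + 2 * D)\<^sup>2 * (\<nu> \<bullet> lat w)" if T: "2 * D < T" for T
  proof (rule le_of_multiples[of 0 _ _ "(T + 2 * D)\<^sup>2 * (2 * D)"])
    fix K :: nat
    let ?B = "cbox (vector [- (T / 2 + D), - (T / 2 + D), - D]) (vector [T / 2 + D, T / 2 + D, real K * (\<nu> \<bullet> lat w) + D]) :: (real^3) set"
    have sub: "(\<Union>l\<in>slab w K T. floor3 -` {l}) \<subseteq> obl_map w -` ?B"
    proof
      fix v assume "v \<in> (\<Union>l\<in>slab w K T. floor3 -` {l})"
      then have "floor3 v \<in> slab w K T" by auto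
      then show "v \<in> obl_map w -` ?B"
        unfolding vimage_eq mem slab_def using near[of v] by auto
    qed
    have "ennreal (sqrt 2 * (real K * card (slab w 1 T))) = ennreal (sqrt 2) * of_nat (card (slab w K T))" by (rule stack)
    also have "\<dots> = ennreal (sqrt 2) * emeasure lborel (\<Union>l\<in>slab w K T. floor3 -` {l})"
      by (simp add: emeasure_cubes finite_slab)
    also have "\<dots> \<le> ennreal (sqrt 2) * emeasure lborel (obl_map w -` ?B)"
      using emeasure_obl_map(2)[of ?B w] by (intro mult_left_mono emeasure_mono sub) auto
    also have "\<dots> = emeasure lborel ?B" by (rule emeasure_obl_map(1)[symmetric]) simp
    also have "\<dots> = ennreal ((2 * (T / 2 + D))\<^sup>2 * (real K * (\<nu> \<bullet> lat w) + D - (- D)))"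
      using T D p by (intro emeasure_box3) (auto intro: order_trans[of _ 0])
    finally have "sqrt 2 * (real K * card (slab w 1 T)) \<le> (2 * (T / 2 + D))\<^sup>2 * (real K * (\<nu> \<bullet> lat w) + D - (- D))"
      using D p by (subst (asm) ennreal_le_iff) auto
    moreover have "2 * (T / 2 + D) = T + 2 * D" by simp
    ultimately show "real K * (sqrt 2 * card (slab w 1 T)) \<le> real K * ((T + 2 * D)\<^sup>2 * (\<nu> \<bullet> lat w)) + (T + 2 * D)\<^sup>2 * (2 * D)"
      by (simp add: algebra_simps)
  qed
  have low: "(T - 2 * D)\<^sup>2 * (\<nu> \<bullet> lat w) \<le> sqrt 2 * card (slab w 1 T)" if T: "2 * D < T" for T
  proof -
    \<comment> \<open>From \<open>K0\<close> on the stack is thicker than 2 D, so that the box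
      shrunk by \<open>D\<close> on each side is nonempty.\<close>
    obtain K0 :: nat where "2 * D / (\<nu> \<bullet> lat w) < real K0" using reals_Archimedean2 by blast
    then have K0: "2 * D < real K0 * (\<nu> \<bullet> lat w)" using p by (simp add: pos_divide_less_eq)
    show ?thesis
    proof (rule le_of_multiples[of K0 _ _ "(T - 2 * D)\<^sup>2 * (2 * D)"])
      fix K :: nat assume "K0 \<le> K"
      then have "real K0 * (\<nu> \<bullet> lat w) \<le> real K * (\<nu> \<bullet> lat w)" using p by simp
      then have K: "2 * D < real K * (\<nu> \<bullet> lat w)" using K0 by linarith
      let ?B = "box (vector [- (T / 2 - D), - (T / 2 - D), D]) (vector [T / 2 - D, T / 2 - D, real K * (\<nu> \<bullet> lat w) - D]) :: (real^3) set"
      have sub: "obl_map w -` ?B \<subseteq> (\<Union>l\<in>slab w K T. floor3 -` {l})"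
      proof
        fix v assume "v \<in> obl_map w -` ?B"
        then have "floor3 v \<in> slab w K T"
          unfolding vimage_eq mem slab_def using near[of v] by auto
        then show "v \<in> (\<Union>l\<in>slab w K T. floor3 -` {l})" by auto
      qed
      have "ennreal ((2 * (T / 2 - D))\<^sup>2 * (real K * (\<nu> \<bullet> lat w) - D - D)) = emeasure lborel ?B"
        using T K by (intro emeasure_box3[symmetric]) auto
      also have "\<dots> = ennreal (sqrt 2) * emeasure lborel (obl_map w -` ?B)"
        by (rule emeasure_obl_map(1)) simp
      also have "\<dots> \<le> ennreal (sqrt 2) * emeasure lborel (\<Union>l\<in>slab w K T. floor3 -` {l})"
        using finite_slab sets_floor3 by (intro mult_left_mono emeasure_mono sub) auto
      also have "\<dots> = ennreal (sqrt 2 * (real K * card (slab w 1 T)))"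
        unfolding stack by (simp add: emeasure_cubes finite_slab)
      finally have "(2 * (T / 2 - D))\<^sup>2 * (real K * (\<nu> \<bullet> lat w) - D - D) \<le> sqrt 2 * (real K * card (slab w 1 T))"
        by (subst (asm) ennreal_le_iff) auto
      moreover have "2 * (T / 2 - D) = T - 2 * D" by simp
      ultimately show "real K * ((T - 2 * D)\<^sup>2 * (\<nu> \<bullet> lat w)) \<le> real K * (sqrt 2 * card (slab w 1 T)) + (T - 2 * D)\<^sup>2 * (2 * D)"
        by (simp add: algebra_simps)
    qed
  qed
  show thesis using that[of "2 * D"] D up low by simp
qed

end

section \<open>Lower bound for the cell energy\<close>

definition zmult :: "int \<Rightarrow> int \<times> int \<times> int \<Rightarrow> int \<times> int \<times> int" where
  "zmult k = (\<lambda>(a, b, c). (k * a, k * b, k * c))"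

lemma lat_zmult: "lat (zmult k w) = of_int k *\<^sub>R lat w"
  by (cases w) (simp add: zmult_def lat_def algebra_simps)

lemma zmult_add_one: "zmult (k + 1) w = zmult k w + w"
  by (cases w) (simp add: zmult_def algebra_simps)

lemma finite_lat_bounded:
  assumes "bounded A" shows "finite {l. z + lat l \<in> A}"
proof -
  have "finite {l. site False l \<in> (\<lambda>x. x - z) ` A}"
    by (intro finite_site_bounded bounded_translation_minus assms)
  moreover have "{l. z + lat l \<in> A} \<subseteq> {l. site False l \<in> (\<lambda>x. x - z) ` A}"
    by (auto simp: site_def image_iff algebra_simps intro!: bexI)
  ultimately show ?thesis by (rule finite_subset[rotated])
qed

lemma card_shift: "card {l. P (l + w)} = card {l :: int \<times> int \<times> int. P l}"
proof -
  have "{l. P l} = (\<lambda>l. l + w) ` {l. P (l + w)}"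
  proof (intro set_eqI iffI)
    fix l assume "l \<in> {l. P l}"
    then show "l \<in> (\<lambda>l. l + w) ` {l. P (l + w)}" by (intro image_eqI[of _ _ "l - w"]) simp_all
  qed auto
  then show ?thesis by (simp add: card_image inj_on_def)
qed

text \<open>The gap 3/2 between the faces of the two cubes exceeds the bond length 1.\<close>

lemma abs_less_shift:
  fixes a b :: real
  assumes "\<bar>a\<bar> < (T - 3) / 2" "\<bar>b - a\<bar> \<le> 1"
  shows "\<bar>b\<bar> < T / 2"
proof -
  have "\<bar>b\<bar> \<le> \<bar>a\<bar> + \<bar>b - a\<bar>" using abs_triangle_ineq[of a "b - a"] by simp
  also have "\<dots> < (T - 3) / 2 + 1" using assms by (rule add_less_le_mono)
  also have "\<dots> < T / 2" by (simp add: field_simps)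
  finally show ?thesis .
qed

lemma int_crossing:
  assumes "\<not> P (a::int)" "P b" "a < b"
  shows "\<exists>k. \<not> P k \<and> P (k + 1)"
proof (rule ccontr)
  assume "\<nexists>k. \<not> P k \<and> P (k + 1)"
  then have step: "\<not> P k \<Longrightarrow> \<not> P (k + 1)" for k by blast
  have "\<not> P b" by (rule int_gr_induct[OF \<open>a < b\<close>]) (use step assms(1) in auto)
  then show False using \<open>P b\<close> by simp
qed

context frame
begin

lemma obl_shift: "\<nu> \<bullet> lat w \<noteq> 0 \<Longrightarrow> obl w (z + lat (l + zmult k w)) i = obl w z i + obl w (lat l) i"
  by (simp add: lat_add lat_zmult obl_add obl_scaleR obl_period)

lemma nu_shift: "\<nu> \<bullet> lat (l + zmult k w) = \<nu> \<bullet> lat l + of_int k * (\<nu> \<bullet> lat w)"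
  by (simp add: lat_add lat_zmult inner_simps)

lemma admissible_outside:
  assumes "X \<in> admissible \<nu> R T" "x \<in> HCP" "x \<notin> cube R (T - 3)"
  shows "x \<in> X \<longleftrightarrow> 0 \<le> \<nu> \<bullet> x"
  using assms by (auto simp: admissible_def half_space_fun_def indicator_def inner_commute split: if_splits)

text \<open>A bond entering \<open>X\<close> is counted only if its inner end lies in the cube. If
  an end lies in the smaller cube, the gap between the cubes suffices. Otherwise both ends obey the
  half-space condition, so the bond crosses the plane through the origin; the inner end has height
  at most 1 and its lateral position is controlled by \<open>obl\<close>.\<close>

lemma crossing_edge_in_cube:
  assumes X: "X \<in> admissible \<nu> R T" and T: "2 < T" and H: "y \<in> HCP" "y' \<in> HCP" and y: "y' \<in> X" "y \<notin> X"
    and n: "norm (y' - y) \<le> 1" and o: "\<And>i. i \<noteq> 3 \<Longrightarrow> \<bar>obl w y' i\<bar> + \<bar>slope w i\<bar> < T / 2"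
  shows "y' \<in> cube R T"
proof (cases "y' \<in> cube R (T - 3) \<or> y \<in> cube R (T - 3)")
  case True
  then have "\<bar>crd y' $ i\<bar> < T / 2" for i
  proof
    assume "y \<in> cube R (T - 3)"
    then have "\<bar>crd y $ i\<bar> < (T - 3) / 2" by (simp add: mem_cube)
    moreover have "\<bar>crd y' $ i - crd y $ i\<bar> \<le> 1" using crd_le_norm[of "y' - y" i] n by (simp add: crd_linear)
    ultimately show ?thesis by (rule abs_less_shift)
  next
    assume "y' \<in> cube R (T - 3)"
    then have "\<bar>crd y' $ i\<bar> < (T - 3) / 2" by (simp add: mem_cube)
    then show ?thesis by simp
  qed
  then show ?thesis by (simp add: mem_cube)
next
  case False
  then have "0 \<le> \<nu> \<bullet> y'" "\<nu> \<bullet> y < 0" using admissible_outside[OF X] H y by auto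
  moreover have "\<bar>\<nu> \<bullet> y' - \<nu> \<bullet> y\<bar> \<le> 1" using nu_le_norm[of "y' - y"] n by (simp add: inner_diff_right)
  ultimately have \<nu>: "\<bar>\<nu> \<bullet> y'\<bar> \<le> 1" by linarith
  have "\<bar>crd y' $ i\<bar> < T / 2" for i
  proof (cases "i = 3")
    case True then show ?thesis using \<nu> T by (simp add: crd_3)
  next
    case False
    have "\<bar>slope w i * (\<nu> \<bullet> y')\<bar> \<le> \<bar>slope w i\<bar> * 1" unfolding abs_mult using \<nu> by (intro mult_left_mono) auto
    then have "\<bar>crd y' $ i\<bar> \<le> \<bar>obl w y' i\<bar> + \<bar>slope w i\<bar>" unfolding obl_def by linarith
    then show ?thesis using o[OF False] by simp
  qed
  then show ?thesis by (simp add: mem_cube)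
qed

text \<open>Heights within one period of \<open>w\<close> determine the multiple of \<open>w\<close>
  that was added.\<close>

lemma inj_slab_shift:
  assumes p: "0 < \<nu> \<bullet> lat w" and l: "l \<in> slab w 1 T" "l' \<in> slab w 1 T" and eq: "l + zmult k w = l' + zmult k' w"
  shows "l = l'"
proof -
  let ?P = "\<nu> \<bullet> lat w"
  have "\<nu> \<bullet> lat l + of_int k * ?P = \<nu> \<bullet> lat l' + of_int k' * ?P"
    using arg_cong[OF eq, of "\<lambda>x. \<nu> \<bullet> lat x"] by (simp only: nu_shift)
  moreover have "0 \<le> \<nu> \<bullet> lat l" "\<nu> \<bullet> lat l < ?P" "0 \<le> \<nu> \<bullet> lat l'" "\<nu> \<bullet> lat l' < ?P" using l by (auto simp: slab_def)
  moreover have "of_int (k - k') * ?P = of_int k * ?P - of_int k' * ?P" by (simp add: left_diff_distrib)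
  ultimately have "of_int (k - k') * ?P < 1 * ?P" "- 1 * ?P < of_int (k - k') * ?P" by simp_all
  then have "of_int (k - k') < (1 :: real)" "- 1 < (of_int (k - k') :: real)" using p by (simp_all only: mult_less_cancel_right)
  then have "k = k'" by linarith
  then show "l = l'" using eq by simp
qed

text \<open>Every line in direction \<open>lat w\<close>, refined to a zigzag through the intermediate sites \<open>oq + lat l\<close>, enters \<open>X\<close> at
  least once; \<open>slab w 1\<close> selects one representative of each line.\<close>

lemma crossing:
  assumes HCP: "\<And>l. op + lat l \<in> HCP" "\<And>l. oq + lat l \<in> HCP"
    and n: "norm (oq - op) \<le> 1" "norm (op + lat w - oq) \<le> 1" and p: "0 < \<nu> \<bullet> lat w"
  obtains C where "0 < C" "\<And>T X. C < T \<Longrightarrow> X \<in> admissible \<nu> R T \<Longrightarrow> card (slab w 1 (T - C)) \<le>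
    card {l. oq + lat l \<in> X \<inter> cube R T \<and> op + lat l \<notin> X} + card {l. op + lat (l + w) \<in> X \<inter> cube R T \<and> oq + lat l \<notin> X}"
proof -
  let ?P = "\<nu> \<bullet> lat w"
  define S where "S = 1 + \<bar>slope w 1\<bar> + \<bar>slope w 2\<bar>"
  define N where "N = 1 + norm op + norm oq"
  \<comment> \<open>Half of it exceeds \<open>S * (N - 1)\<close>, the oblique coordinate of the
    offsets \<open>op\<close> and \<open>oq\<close>, plus the slope.\<close>
  define C where "C = 2 * S * N + 2"
  have SN: "1 \<le> S" "1 \<le> N" by (simp_all add: S_def N_def)
  then have "0 \<le> 2 * S * N" by simp
  then have C: "2 \<le> C" by (simp add: C_def)
  have 3: "i = 1 \<or> i = 2" if "i \<noteq> 3" for i :: 3 using exhaust_3[of i] that by auto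
  have main: "card (slab w 1 (T - C)) \<le> card {l. oq + lat l \<in> X \<inter> cube R T \<and> op + lat l \<notin> X} +
      card {l. op + lat (l + w) \<in> X \<inter> cube R T \<and> oq + lat l \<notin> X}" (is "_ \<le> card ?A + card ?B")
    if T: "C < T" and X: "X \<in> admissible \<nu> R T" for T X
  proof -
    have small: "\<bar>obl w (z + lat (l + zmult k w)) i\<bar> + \<bar>slope w i\<bar> < T / 2"
      if z: "norm z \<le> N - 1" and l: "l \<in> slab w 1 (T - C)" and i: "i \<noteq> 3" for z l k i
    proof -
      have "\<bar>obl w z i\<bar> \<le> (1 + \<bar>slope w i\<bar>) * norm z" by (rule obl_le)
      also have "\<dots> \<le> S * (N - 1)" using z SN 3[OF i] by (intro mult_mono) (auto simp: S_def)
      finally have 1: "\<bar>obl w z i\<bar> \<le> S * (N - 1)" .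
      have 2: "\<bar>obl w (lat l) i\<bar> < (T - C) / 2" using l 3[OF i] by (auto simp: slab_def)
      have 4: "\<bar>slope w i\<bar> \<le> S" using 3[OF i] by (auto simp: S_def)
      have 5: "S * (N - 1) = S * N - S" by (simp add: algebra_simps)
      have "(T - C) / 2 = T / 2 - S * N - 1" by (simp add: C_def field_simps)
      then have "\<bar>obl w z i + obl w (lat l) i\<bar> + \<bar>slope w i\<bar> < T / 2" using 1 2 4 5 by linarith
      then show ?thesis using p by (simp add: obl_shift)
    qed
    have far: "x \<notin> cube R (T - 3)" if "T \<le> \<bar>\<nu> \<bullet> x\<bar>" for x
    proof
      assume "x \<in> cube R (T - 3)"
      then have "\<bar>crd x $ 3\<bar> < (T - 3) / 2" by (simp add: mem_cube)
      then show False using that T C by (simp add: crd_3)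
    qed
    have ex: "\<exists>k. l + zmult k w \<in> ?A \<union> ?B" if l: "l \<in> slab w 1 (T - C)" for l
    proof -
      define P where "P k \<longleftrightarrow> op + lat (l + zmult k w) \<in> X" for k
      define u where "u = \<nu> \<bullet> op + \<nu> \<bullet> lat l"
      have \<nu>: "\<nu> \<bullet> (op + lat (l + zmult k w)) = u + of_int k * ?P" for k
        by (simp add: u_def inner_add_right nu_shift)
      \<comment> \<open>After \<open>m\<close> periods in either direction the line has left the
        smaller cube, so the boundary condition puts it in \<open>X\<close> at the upper end and
        outside \<open>X\<close> at the lower end.\<close>
      obtain m :: nat where "(T + \<bar>u\<bar>) / ?P < real m" using reals_Archimedean2 by blast
      then have m: "T + \<bar>u\<bar> < real m * ?P" using p by (simp add: pos_divide_less_eq)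
      have "P (int m)"
      proof -
        have ge: "T \<le> u + of_int (int m) * ?P" using m by simp
        then have "op + lat (l + zmult (int m) w) \<notin> cube R (T - 3)" by (intro far) (simp only: \<nu>)
        then show ?thesis using admissible_outside[OF X HCP(1)] ge T C by (simp add: P_def \<nu>)
      qed
      moreover have "\<not> P (- int m)"
      proof -
        have le: "u + of_int (- int m) * ?P \<le> - T" using m by simp
        then have "op + lat (l + zmult (- int m) w) \<notin> cube R (T - 3)" by (intro far) (simp only: \<nu>)
        then have "P (- int m) \<longleftrightarrow> 0 \<le> u + of_int (- int m) * ?P"
          using admissible_outside[OF X HCP(1)[of "l + zmult (- int m) w"]] unfolding P_def \<nu> by blast
        then show ?thesis using le T C by linarith
      qed
      moreover have "- int m < int m"
      proof -
        have "0 < real m * ?P" using m T C by linarith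
        then have "0 < real m" using p by (simp add: zero_less_mult_iff)
        then show ?thesis by simp
      qed
      ultimately obtain k where k: "\<not> P k" "P (k + 1)" using int_crossing by blast
      define j where "j = l + zmult k w"
      have k: "op + lat j \<notin> X" "op + lat (j + w) \<in> X"
        using k by (simp_all add: P_def j_def zmult_add_one add.assoc)
      have "j \<in> ?A \<union> ?B"
      \<comment> \<open>Between \<open>op + lat j\<close> outside and
        \<open>op + lat (j + w)\<close> inside, the intermediate site decides which half of the
        zigzag step enters \<open>X\<close>.\<close>
      proof (cases "oq + lat j \<in> X")
        case True
        have "oq + lat j \<in> cube R T"
          by (rule crossing_edge_in_cube[OF X _ HCP(1)[of j] HCP(2) True k(1)])
            (use T C n(1) small[of oq, OF _ l] in \<open>auto simp: j_def N_def\<close>)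
        then show ?thesis using True k(1) by simp
      next
        case False
        have "op + lat (l + zmult (k + 1) w) = op + lat (j + w)" by (simp add: j_def zmult_add_one add.assoc)
        moreover have "norm op \<le> N - 1" by (simp add: N_def)
        ultimately have "\<bar>obl w (op + lat (j + w)) i\<bar> + \<bar>slope w i\<bar> < T / 2" if "i \<noteq> 3" for i
          using small[of op l i "k + 1", OF _ l that] by simp
        moreover have "norm (op + lat (j + w) - (oq + lat j)) \<le> 1" using n(2) by (simp add: lat_add algebra_simps)
        ultimately have "op + lat (j + w) \<in> cube R T"
          using T C by (intro crossing_edge_in_cube[OF X _ HCP(2)[of j] HCP(1) k(2) False]) auto
        then show ?thesis using False k(2) by simp
      qed
      then show ?thesis unfolding j_def by blast
    qed
    define kk where "kk l = (SOME k. l + zmult k w \<in> ?A \<union> ?B)" for l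
    have kk: "l + zmult (kk l) w \<in> ?A \<union> ?B" if "l \<in> slab w 1 (T - C)" for l
      unfolding kk_def by (rule someI_ex[OF ex[OF that]])
    have inj: "inj_on (\<lambda>l. l + zmult (kk l) w) (slab w 1 (T - C))"
      using inj_slab_shift[OF p] by (intro inj_onI) blast
    have fin: "finite ?A" "finite ?B"
    proof -
      have "finite {l. oq + lat l \<in> cube R T}" by (rule finite_lat_bounded[OF bounded_cube])
      then show "finite ?A" by (rule finite_subset[rotated]) auto
      have "finite {l. (op + lat w) + lat l \<in> cube R T}" by (rule finite_lat_bounded[OF bounded_cube])
      then show "finite ?B" by (rule finite_subset[rotated]) (auto simp: lat_add algebra_simps)
    qed
    have "card (slab w 1 (T - C)) = card ((\<lambda>l. l + zmult (kk l) w) ` slab w 1 (T - C))" by (rule card_image[OF inj, symmetric])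
    also have "\<dots> \<le> card (?A \<union> ?B)" by (intro card_mono finite_UnI fin image_subsetI kk)
    also have "\<dots> \<le> card ?A + card ?B" by (rule card_Un_le)
    finally show ?thesis .
  qed
  show thesis using that[of C] C main by auto
qed

text \<open>A lower bound of order \<open>b * T^2\<close>, uniform over all competitors. The shift
  by \<open>C\<close> absorbs errors of lower order, so that such bounds can be added.\<close>

definition lower :: "real \<Rightarrow> (real \<Rightarrow> (real^3) set \<Rightarrow> real) \<Rightarrow> bool" where
  "lower b F \<longleftrightarrow> (\<exists>C. \<forall>T>C. \<forall>X\<in>admissible \<nu> R T. (T - C)\<^sup>2 * b \<le> F T X)"

lemma lower_nonpos: "b \<le> 0 \<Longrightarrow> (\<And>T X. 0 \<le> F T X) \<Longrightarrow> lower b F"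
  unfolding lower_def by (meson mult_nonneg_nonpos order_trans zero_le_power2)

lemma lower_add:
  assumes "lower a F" "lower b G" "0 \<le> a" "0 \<le> b"
  shows "lower (a + b) (\<lambda>T X. F T X + G T X)"
proof -
  obtain C D where F: "\<And>T X. C < T \<Longrightarrow> X \<in> admissible \<nu> R T \<Longrightarrow> (T - C)\<^sup>2 * a \<le> F T X"
    and G: "\<And>T X. D < T \<Longrightarrow> X \<in> admissible \<nu> R T \<Longrightarrow> (T - D)\<^sup>2 * b \<le> G T X"
    using assms(1, 2) unfolding lower_def by blast
  have "(T - max C D)\<^sup>2 * (a + b) \<le> F T X + G T X" if T: "max C D < T" and X: "X \<in> admissible \<nu> R T" for T X
  proof -
    have "(T - max C D)\<^sup>2 * a \<le> (T - C)\<^sup>2 * a" "(T - max C D)\<^sup>2 * b \<le> (T - D)\<^sup>2 * b"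
      using T assms(3, 4) by (intro mult_right_mono power_mono; simp)+
    moreover have "(T - C)\<^sup>2 * a \<le> F T X" "(T - D)\<^sup>2 * b \<le> G T X" using F G T X by auto
    ultimately show ?thesis unfolding distrib_left by linarith
  qed
  then show ?thesis unfolding lower_def by blast
qed

lemma lower_sum:
  assumes "finite I" "\<And>i. i \<in> I \<Longrightarrow> lower (b i) (F i)" "\<And>i. i \<in> I \<Longrightarrow> 0 \<le> b i"
  shows "lower (\<Sum>i\<in>I. b i) (\<lambda>T X. \<Sum>i\<in>I. F i T X)"
  using assms
proof (induction I rule: finite_induct)
  case empty then show ?case by (simp add: lower_nonpos)
next
  case (insert i I) then show ?case by (simp add: lower_add sum_nonneg)
qed

lemma lower_crossing:
  assumes HCP: "\<And>l. op + lat l \<in> HCP" "\<And>l. oq + lat l \<in> HCP"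
    and n: "norm (oq - op) \<le> 1" "norm (op + lat w - oq) \<le> 1" and p: "0 < \<nu> \<bullet> lat w"
  shows "lower ((\<nu> \<bullet> lat w) / sqrt 2) (\<lambda>T X. real (card {l. oq + lat l \<in> X \<inter> cube R T \<and> op + lat l \<notin> X}) +
    real (card {l. op + lat (l + w) \<in> X \<inter> cube R T \<and> oq + lat l \<notin> X}))"
proof -
  obtain C where C: "0 < C" "\<And>T X. C < T \<Longrightarrow> X \<in> admissible \<nu> R T \<Longrightarrow> card (slab w 1 (T - C)) \<le>
    card {l. oq + lat l \<in> X \<inter> cube R T \<and> op + lat l \<notin> X} + card {l. op + lat (l + w) \<in> X \<inter> cube R T \<and> oq + lat l \<notin> X}"
    by (rule crossing[OF HCP n p]) (rule that; assumption)
  obtain D where D: "0 < D" "\<And>T. D < T \<Longrightarrow> sqrt 2 * card (slab w 1 T) \<le> (T + D)\<^sup>2 * (\<nu> \<bullet> lat w)"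
    "\<And>T. D < T \<Longrightarrow> (T - D)\<^sup>2 * (\<nu> \<bullet> lat w) \<le> sqrt 2 * card (slab w 1 T)"
    by (rule slab_count[OF p]) (rule that; assumption)
  have "(T - (C + D))\<^sup>2 * ((\<nu> \<bullet> lat w) / sqrt 2) \<le> real (card {l. oq + lat l \<in> X \<inter> cube R T \<and> op + lat l \<notin> X}) +
    real (card {l. op + lat (l + w) \<in> X \<inter> cube R T \<and> oq + lat l \<notin> X})" (is "_ \<le> ?r")
    if "C + D < T" "X \<in> admissible \<nu> R T" for T X
  proof -
    have "(T - C - D)\<^sup>2 * (\<nu> \<bullet> lat w) \<le> sqrt 2 * real (card (slab w 1 (T - C)))" using that D(1) by (intro D(3)) simp
    also have "\<dots> \<le> sqrt 2 * ?r" using C(2)[of T X] that D(1) by (intro mult_left_mono) simp_all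
    finally show ?thesis by (simp add: diff_diff_eq pos_divide_le_eq mult.commute)
  qed
  then show ?thesis unfolding lower_def by blast
qed

end

context frame
begin

lemma nu_lat: "\<nu> \<bullet> lat (a, b, c) = of_int a * (e1 \<bullet> \<nu>) + of_int b * (e2 \<bullet> \<nu>) + of_int c * (e3 \<bullet> \<nu>)"
  by (simp add: lat_def inner_add_right inner_commute)

lemma nu_lat_0: "\<nu> \<bullet> lat (a, 0) = of_int a * (e1 \<bullet> \<nu>)" "\<nu> \<bullet> lat 0 = 0"
  by (simp_all add: zero_prod_def nu_lat)

lemma lower_mono:
  assumes "lower b F" "\<And>T X. X \<in> admissible \<nu> R T \<Longrightarrow> F T X \<le> G T X"
  shows "lower b G"
  using assms unfolding lower_def by (meson order_trans)

lemma site_0_add: "site s 0 + lat l = site s l"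
  using site_add[of s 0 l] by simp

text \<open>A straight line is the zigzag with both starting points equal, whose first half step is
  void. It is followed in direction \<open>- d\<close>, because a missing bond in direction
  \<open>d\<close> leaves \<open>X\<close>.\<close>

lemma lower_in_plane:
  assumes d: "d \<in> in_plane"
  shows "lower (max 0 (- (\<nu> \<bullet> lat d)) / sqrt 2) (\<lambda>T X. real (card (cut X (cube R T) s d s)))"
proof (cases "0 < \<nu> \<bullet> lat (- d)")
  case True
  have "norm (lat (- d)) = 1" using d by (simp add: norm_lat lat_minus)
  then have n: "norm (site s 0 + lat (- d) - site s 0) \<le> 1" by simp
  have "lower ((\<nu> \<bullet> lat (- d)) / sqrt 2) (\<lambda>T X.
      real (card {l. site s 0 + lat l \<in> X \<inter> cube R T \<and> site s 0 + lat l \<notin> X}) +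
      real (card {l. site s 0 + lat (l + - d) \<in> X \<inter> cube R T \<and> site s 0 + lat l \<notin> X}))"
    by (intro lower_crossing True n) (simp_all add: site_0_add)
  moreover have "card {l. site s 0 + lat (l + - d) \<in> X \<inter> A \<and> site s 0 + lat l \<notin> X} = card (cut X A s d s)" for X A
    using card_shift[of "\<lambda>l. site s l \<in> X \<inter> A \<and> site s (l + d) \<notin> X" "- d"]
    unfolding site_0_add cut_def by simp
  moreover have "card {l. site s 0 + lat l \<in> X \<inter> A \<and> site s 0 + lat l \<notin> X} = 0" for X A
  proof -
    have "{l. site s 0 + lat l \<in> X \<inter> A \<and> site s 0 + lat l \<notin> X} = {}" by blast
    then show ?thesis by (simp only: card.empty)
  qed
  moreover have "max 0 (- (\<nu> \<bullet> lat d)) = \<nu> \<bullet> lat (- d)" using True by (simp add: lat_minus)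
  ultimately show ?thesis by (simp only: of_nat_0 add_0)
next
  case False
  then show ?thesis by (intro lower_nonpos) (auto simp: lat_minus)
qed

text \<open>Each step goes from the unshifted site 0 to the shifted site \<open>d\<close> and on to
  the unshifted site \<open>d - d'\<close>. Entering \<open>X\<close> on the first half is a missing
  bond of difference \<open>- d\<close>, on the second half one of difference
  \<open>d'\<close>.\<close>

lemma lower_zigzag:
  assumes d: "d \<in> inter_layer" "d' \<in> inter_layer" and p: "0 < \<nu> \<bullet> lat (d - d')"
  shows "lower ((\<nu> \<bullet> lat (d - d')) / sqrt 2)
    (\<lambda>T X. real (card (cut X (cube R T) True (- d) False)) + real (card (cut X (cube R T) False d' True)))"
proof -
  have "norm (site True d - site False 0) = 1"
    using d(1) site_0_add[of False 0] by (simp add: site_def norm_v1_lat lat_diff[of 0 0, simplified])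
  moreover have "norm (site False 0 + lat (d - d') - site True d) = 1"
  proof -
    have "site False 0 + lat (d - d') - site True d = - (v1 + lat d')"
      unfolding site_0_add by (simp add: site_def lat_diff)
    then show ?thesis using d(2) by (simp only: norm_minus_cancel norm_v1_lat)
  qed
  ultimately have "lower ((\<nu> \<bullet> lat (d - d')) / sqrt 2) (\<lambda>T X.
      real (card {l. site True d + lat l \<in> X \<inter> cube R T \<and> site False 0 + lat l \<notin> X}) +
      real (card {l. site False 0 + lat (l + (d - d')) \<in> X \<inter> cube R T \<and> site True d + lat l \<notin> X}))"
    by (intro lower_crossing p) (simp_all add: site_add[symmetric])
  moreover have "card {l. site True d + lat l \<in> X \<inter> A \<and> site False 0 + lat l \<notin> X} = card (cut X A True (- d) False)" for X A
    using card_shift[of "\<lambda>l. site True l \<in> X \<inter> A \<and> site False (l + - d) \<notin> X" d]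
    unfolding cut_def site_add[symmetric] by (simp add: add.commute)
  moreover have "card {l. site False 0 + lat (l + (d - d')) \<in> X \<inter> A \<and> site True d + lat l \<notin> X} =
      card (cut X A False d' True)" for X A
    using card_shift[of "\<lambda>l. site False l \<in> X \<inter> A \<and> site True (l + d') \<notin> X" "d - d'"]
    unfolding cut_def site_add[symmetric] by (simp add: add.commute)
  ultimately show ?thesis by simp
qed

definition inter_cut :: "real \<Rightarrow> (real^3) set \<Rightarrow> int \<times> int \<times> int \<Rightarrow> real" where
  "inter_cut T X d = real (card (cut X (cube R T) True (- d) False)) + real (card (cut X (cube R T) False d True))"

text \<open>The zigzag is followed upwards, which fixes one orientation for each of the two bond
  directions; the opposite orientations only add nonnegative terms.\<close>

lemma lower_pair:
  assumes "d \<in> inter_layer" "d' \<in> inter_layer"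
  shows "lower (\<bar>\<nu> \<bullet> lat (d - d')\<bar> / sqrt 2) (\<lambda>T X. inter_cut T X d + inter_cut T X d')"
proof -
  have *: "lower (\<bar>\<nu> \<bullet> lat (d - d')\<bar> / sqrt 2) (\<lambda>T X. inter_cut T X d + inter_cut T X d')"
    if "d \<in> inter_layer" "d' \<in> inter_layer" "0 < \<nu> \<bullet> lat (d - d')" for d d'
    using lower_zigzag[OF that] that(3) by (auto intro: lower_mono simp: inter_cut_def)
  show ?thesis
  proof (cases rule: linorder_cases[of "\<nu> \<bullet> lat d'" "\<nu> \<bullet> lat d"])
    case less then show ?thesis using assms by (intro *) (simp_all add: lat_diff inner_diff_right)
  next
    case greater
    have "\<bar>\<nu> \<bullet> lat (d' - d)\<bar> = \<bar>\<nu> \<bullet> lat (d - d')\<bar>" by (simp add: lat_diff inner_diff_right abs_minus_commute)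
    then show ?thesis using *[of d' d] greater assms by (simp add: add.commute lat_diff inner_diff_right)
  next
    case equal then show ?thesis by (intro lower_nonpos) (simp_all add: inter_cut_def lat_diff inner_diff_right)
  qed
qed

lemma lower_pairing:
  assumes S: "set [a, a', b, b', c, c'] = inter_layer" and D: "distinct [a, a', b, b', c, c']"
  shows "lower ((\<bar>\<nu> \<bullet> lat (a - a')\<bar> + \<bar>\<nu> \<bullet> lat (b - b')\<bar> + \<bar>\<nu> \<bullet> lat (c - c')\<bar>) / sqrt 2)
    (\<lambda>T X. \<Sum>d\<in>inter_layer. inter_cut T X d)"
proof -
  have sum: "(\<Sum>d\<in>inter_layer. f d) = (f a + f a') + (f b + f b') + (f c + f c')" for f :: "_ \<Rightarrow> real"
    using sum_list_distinct_conv_sum_set[OF D, of f] unfolding S by (simp add: add.assoc)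
  have i: "a \<in> inter_layer" "a' \<in> inter_layer" "b \<in> inter_layer" "b' \<in> inter_layer" "c \<in> inter_layer" "c' \<in> inter_layer"
    using S by auto
  show ?thesis unfolding sum add_divide_distrib by (intro lower_add lower_pair i) (simp_all add: add_nonneg_nonneg)
qed

text \<open>For each candidate \<open>m\<close>, a pairing in which two pairs differ by the
  corresponding lattice vector and the third by \<open>e3\<close>; for \<open>e3\<close> itself all
  three differ by \<open>e3\<close>.\<close>

lemma lower_inter:
  assumes "m \<in> {\<bar>e1 \<bullet> \<nu>\<bar>, \<bar>e2 \<bullet> \<nu>\<bar>, \<bar>e3 \<bullet> \<nu>\<bar>, \<bar>(e1 - e2) \<bullet> \<nu>\<bar>}"
  shows "lower ((\<bar>e3 \<bullet> \<nu>\<bar> + 2 * m) / sqrt 2) (\<lambda>T X. \<Sum>d\<in>inter_layer. inter_cut T X d)"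
proof -
  note pq = inner_diff_left
  consider "m = \<bar>e1 \<bullet> \<nu>\<bar>" | "m = \<bar>e2 \<bullet> \<nu>\<bar>" | "m = \<bar>e3 \<bullet> \<nu>\<bar>" | "m = \<bar>(e1 - e2) \<bullet> \<nu>\<bar>" using assms by blast
  then show ?thesis
  proof cases
    case 1
    have "lower ((\<bar>\<nu> \<bullet> lat ((0, 0, 0) - (-1, 0, 0))\<bar> + \<bar>\<nu> \<bullet> lat ((0, 0, -1) - (-1, 0, -1))\<bar> +
        \<bar>\<nu> \<bullet> lat ((0, -1, 0) - (0, -1, -1))\<bar>) / sqrt 2) (\<lambda>T X. \<Sum>d\<in>inter_layer. inter_cut T X d)"
      by (rule lower_pairing) (auto simp: inter_layer_def)
    then show ?thesis by (simp add: 1 nu_lat nu_lat_0 add.commute)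
  next
    case 2
    have "lower ((\<bar>\<nu> \<bullet> lat ((0, 0, 0) - (0, -1, 0))\<bar> + \<bar>\<nu> \<bullet> lat ((0, 0, -1) - (0, -1, -1))\<bar> +
        \<bar>\<nu> \<bullet> lat ((-1, 0, 0) - (-1, 0, -1))\<bar>) / sqrt 2) (\<lambda>T X. \<Sum>d\<in>inter_layer. inter_cut T X d)"
      by (rule lower_pairing) (auto simp: inter_layer_def)
    then show ?thesis by (simp add: 2 nu_lat nu_lat_0 add.commute)
  next
    case 3
    have "lower ((\<bar>\<nu> \<bullet> lat ((0, 0, 0) - (0, 0, -1))\<bar> + \<bar>\<nu> \<bullet> lat ((-1, 0, 0) - (-1, 0, -1))\<bar> +
        \<bar>\<nu> \<bullet> lat ((0, -1, 0) - (0, -1, -1))\<bar>) / sqrt 2) (\<lambda>T X. \<Sum>d\<in>inter_layer. inter_cut T X d)"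
      by (rule lower_pairing) (auto simp: inter_layer_def)
    then show ?thesis by (simp add: 3 nu_lat nu_lat_0 add.commute)
  next
    case 4
    have "lower ((\<bar>\<nu> \<bullet> lat ((0, -1, 0) - (-1, 0, 0))\<bar> + \<bar>\<nu> \<bullet> lat ((0, -1, -1) - (-1, 0, -1))\<bar> +
        \<bar>\<nu> \<bullet> lat ((0, 0, 0) - (0, 0, -1))\<bar>) / sqrt 2) (\<lambda>T X. \<Sum>d\<in>inter_layer. inter_cut T X d)"
      by (rule lower_pairing) (auto simp: inter_layer_def)
    then show ?thesis by (simp add: 4 nu_lat nu_lat_0 pq add.commute)
  qed
qed

lemma sum_in_plane:
  "(\<Sum>d\<in>in_plane. max 0 (- (\<nu> \<bullet> lat d))) = \<bar>e1 \<bullet> \<nu>\<bar> + \<bar>e2 \<bullet> \<nu>\<bar> + \<bar>(e1 - e2) \<bullet> \<nu>\<bar>"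
proof -
  have m: "max 0 (- t) + max 0 t = \<bar>t\<bar>" for t :: real by (simp add: max_def)
  show ?thesis unfolding in_plane_def
    by (simp add: nu_lat nu_lat_0 inner_diff_left m[symmetric])
qed

lemma sum_bool: "(\<Sum>s\<in>UNIV. f s) = f False + f True"
  by (simp add: UNIV_bool)

text \<open>The tension regrouped by origin of its terms: in-plane lines, once for each sublattice,
  and the interlayer zigzags with the best pairing \<open>m\<close>.\<close>

lemma hcp_tension_eq:
  obtains m where "m \<in> {\<bar>e1 \<bullet> \<nu>\<bar>, \<bar>e2 \<bullet> \<nu>\<bar>, \<bar>e3 \<bullet> \<nu>\<bar>, \<bar>(e1 - e2) \<bullet> \<nu>\<bar>}"
    "\<bar>e1 \<bullet> \<nu>\<bar> \<le> m" "\<bar>e2 \<bullet> \<nu>\<bar> \<le> m" "\<bar>e3 \<bullet> \<nu>\<bar> \<le> m" "\<bar>(e1 - e2) \<bullet> \<nu>\<bar> \<le> m"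
    "hcp_tension \<nu> = 2 * ((\<bar>e1 \<bullet> \<nu>\<bar> + \<bar>e2 \<bullet> \<nu>\<bar> + \<bar>(e1 - e2) \<bullet> \<nu>\<bar>) / sqrt 2) + (\<bar>e3 \<bullet> \<nu>\<bar> + 2 * m) / sqrt 2"
proof -
  define A where "A = {\<bar>e1 \<bullet> \<nu>\<bar>, \<bar>e2 \<bullet> \<nu>\<bar>, \<bar>e3 \<bullet> \<nu>\<bar>, \<bar>(e1 - e2) \<bullet> \<nu>\<bar>}"
  have A: "finite A" "A \<noteq> {}" by (simp_all add: A_def)
  show thesis
  proof (rule that[of "Max A"])
    show "Max A \<in> {\<bar>e1 \<bullet> \<nu>\<bar>, \<bar>e2 \<bullet> \<nu>\<bar>, \<bar>e3 \<bullet> \<nu>\<bar>, \<bar>(e1 - e2) \<bullet> \<nu>\<bar>}" using Max_in[OF A] unfolding A_def .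
    show "\<bar>e1 \<bullet> \<nu>\<bar> \<le> Max A" "\<bar>e2 \<bullet> \<nu>\<bar> \<le> Max A" "\<bar>e3 \<bullet> \<nu>\<bar> \<le> Max A" "\<bar>(e1 - e2) \<bullet> \<nu>\<bar> \<le> Max A"
      by (rule Max_ge[OF A(1)], simp add: A_def)+
    have "sqrt 2 * S + 1 / sqrt 2 * h + sqrt 2 * m = 2 * (S / sqrt 2) + (h + 2 * m) / sqrt 2" for S h m :: real
      by (simp add: field_simps)
    then show "hcp_tension \<nu> = 2 * ((\<bar>e1 \<bullet> \<nu>\<bar> + \<bar>e2 \<bullet> \<nu>\<bar> + \<bar>(e1 - e2) \<bullet> \<nu>\<bar>) / sqrt 2) + (\<bar>e3 \<bullet> \<nu>\<bar> + 2 * Max A) / sqrt 2"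
      unfolding hcp_tension_def A_def by blast
  qed
qed

lemma edge_energy_split:
  assumes "X \<subseteq> HCP"
  shows "edge_energy X (cube R T) =
    (\<Sum>s\<in>UNIV. \<Sum>d\<in>in_plane. real (card (cut X (cube R T) s d s))) + (\<Sum>d\<in>inter_layer. inter_cut T X d)"
  unfolding edge_energy_eq[OF assms bounded_cube] sum_nbrs sum_bool inter_cut_def sum.distrib by simp

lemma lower_energy: "lower (hcp_tension \<nu>) (\<lambda>T X. edge_energy X (cube R T))"
proof -
  obtain m where m: "m \<in> {\<bar>e1 \<bullet> \<nu>\<bar>, \<bar>e2 \<bullet> \<nu>\<bar>, \<bar>e3 \<bullet> \<nu>\<bar>, \<bar>(e1 - e2) \<bullet> \<nu>\<bar>}"
    "hcp_tension \<nu> = 2 * ((\<bar>e1 \<bullet> \<nu>\<bar> + \<bar>e2 \<bullet> \<nu>\<bar> + \<bar>(e1 - e2) \<bullet> \<nu>\<bar>) / sqrt 2) + (\<bar>e3 \<bullet> \<nu>\<bar> + 2 * m) / sqrt 2"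
    by (rule hcp_tension_eq) (rule that; assumption)
  have fin: "finite in_plane" by (simp add: in_plane_def)
  have m0: "0 \<le> m" using m(1) by auto
  have "lower (\<Sum>s\<in>(UNIV::bool set). \<Sum>d\<in>in_plane. max 0 (- (\<nu> \<bullet> lat d)) / sqrt 2)
      (\<lambda>T X. \<Sum>s\<in>UNIV. \<Sum>d\<in>in_plane. real (card (cut X (cube R T) s d s)))"
    by (intro lower_sum lower_in_plane fin) (simp_all add: sum_nonneg)
  then have "lower (2 * ((\<bar>e1 \<bullet> \<nu>\<bar> + \<bar>e2 \<bullet> \<nu>\<bar> + \<bar>(e1 - e2) \<bullet> \<nu>\<bar>) / sqrt 2))
      (\<lambda>T X. \<Sum>s\<in>UNIV. \<Sum>d\<in>in_plane. real (card (cut X (cube R T) s d s)))"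
    unfolding sum_divide_distrib[symmetric] sum_in_plane by (simp only: sum_bool mult_2 add_divide_distrib)
  then have "lower (hcp_tension \<nu>) (\<lambda>T X. (\<Sum>s\<in>UNIV. \<Sum>d\<in>in_plane. real (card (cut X (cube R T) s d s))) +
      (\<Sum>d\<in>inter_layer. inter_cut T X d))"
    unfolding m(2) using m0 by (intro lower_add lower_inter m(1)) simp_all
  then show ?thesis
    by (rule lower_mono) (simp add: edge_energy_split admissible_def)
qed

end

section \<open>Upper bound for the cell energy\<close>

text \<open>At a median the sum of deviations is the sum of the three largest values minus that of
  the three smallest. It is 3 h if the spread of the u's is at most h, and h + 2 (u1 - u3)
  otherwise; the cases locate the median among the two sorted triples.\<close>

lemma median_sorted:
  fixes u1 u2 u3 h m :: real
  assumes s: "u2 \<le> u1" "u3 \<le> u2" and h: "0 \<le> h" and m: "h \<le> m" "u1 - u3 \<le> m"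
  shows "\<exists>x\<in>{u1, u2, u3, u1 - h, u2 - h, u3 - h}.
    (\<bar>u1 - x\<bar> + \<bar>u2 - x\<bar> + \<bar>u3 - x\<bar>) + (\<bar>u1 - h - x\<bar> + \<bar>u2 - h - x\<bar> + \<bar>u3 - h - x\<bar>) \<le> h + 2 * m"
proof -
  have *: "\<bar>t\<bar> = t" if "0 \<le> t" for t :: real using that by simp
  have **: "\<bar>t\<bar> = - t" if "t \<le> 0" for t :: real using that by simp
  consider "u1 - u3 \<le> h" | "h \<le> u1 - u3" "u2 \<le> u1 - h" | "h \<le> u1 - u3" "u1 - h \<le> u2"
    using linear[of "u1 - u3" h] linear[of u2 "u1 - h"] by blast
  then show ?thesis
  proof cases
    case 1
    have "\<bar>u1 - u3\<bar> = u1 - u3" "\<bar>u2 - u3\<bar> = u2 - u3" "\<bar>u3 - u3\<bar> = 0"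
      "\<bar>u1 - h - u3\<bar> = - (u1 - h - u3)" "\<bar>u2 - h - u3\<bar> = - (u2 - h - u3)" "\<bar>u3 - h - u3\<bar> = - (u3 - h - u3)"
      by (rule * ** abs_zero; use s h m 1 in linarith | simp)+
    then show ?thesis using s h m 1 by (intro bexI[of _ u3]) (simp, simp)
  next
    case 2
    have "\<bar>u1 - u2\<bar> = u1 - u2" "\<bar>u2 - u2\<bar> = 0" "\<bar>u3 - u2\<bar> = - (u3 - u2)"
      "\<bar>u1 - h - u2\<bar> = u1 - h - u2" "\<bar>u2 - h - u2\<bar> = - (u2 - h - u2)" "\<bar>u3 - h - u2\<bar> = - (u3 - h - u2)"
      by (rule * ** abs_zero; use s h m 2 in linarith | simp)+
    then show ?thesis using s h m 2 by (intro bexI[of _ u2]) (simp, simp)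
  next
    case 3
    have "\<bar>u1 - (u1 - h)\<bar> = h" using h by simp
    moreover have "\<bar>u2 - (u1 - h)\<bar> = u2 - (u1 - h)" "\<bar>u3 - (u1 - h)\<bar> = - (u3 - (u1 - h))" "\<bar>u1 - h - (u1 - h)\<bar> = 0"
      "\<bar>u2 - h - (u1 - h)\<bar> = - (u2 - h - (u1 - h))" "\<bar>u3 - h - (u1 - h)\<bar> = - (u3 - h - (u1 - h))"
      by (rule * ** abs_zero; use s h m 3 in linarith | simp)+
    ultimately show ?thesis using s h m 3 by (intro bexI[of _ "u1 - h"]) (simp, simp)
  qed
qed

lemma median:
  fixes u1 u2 u3 h m :: real
  assumes h: "0 \<le> h" and m: "h \<le> m" "\<bar>u1 - u2\<bar> \<le> m" "\<bar>u1 - u3\<bar> \<le> m" "\<bar>u2 - u3\<bar> \<le> m"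
  shows "\<exists>x\<in>{u1, u2, u3, u1 - h, u2 - h, u3 - h}.
    (\<bar>u1 - x\<bar> + \<bar>u2 - x\<bar> + \<bar>u3 - x\<bar>) + (\<bar>u1 - h - x\<bar> + \<bar>u2 - h - x\<bar> + \<bar>u3 - h - x\<bar>) \<le> h + 2 * m"
proof -
  have m: "h \<le> m" "u1 - u2 \<le> m" "u2 - u1 \<le> m" "u1 - u3 \<le> m" "u3 - u1 \<le> m" "u2 - u3 \<le> m" "u3 - u2 \<le> m"
    using m by (simp_all add: abs_le_iff)
  have perm: "\<exists>x\<in>B. g x \<le> c" if "\<exists>x\<in>A. f x \<le> c" "A \<subseteq> B" "\<And>x. f x = g x" for A B :: "real set" and f g :: "real \<Rightarrow> real" and c
    using that by auto
  consider "u2 \<le> u1" "u3 \<le> u2" | "u3 \<le> u1" "u2 \<le> u3" | "u1 \<le> u2" "u3 \<le> u1" | "u3 \<le> u2" "u1 \<le> u3"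
    | "u1 \<le> u3" "u2 \<le> u1" | "u2 \<le> u3" "u1 \<le> u2"
    using linear[of u1 u2] linear[of u1 u3] linear[of u2 u3] by blast
  then show ?thesis
  proof cases
    case 1 show ?thesis using median_sorted[OF 1 h m(1) m(4)] .
  next
    case 2
    from median_sorted[OF 2 h m(1) m(2)] show ?thesis by (rule perm) (blast, simp only: add.commute add.left_commute)
  next
    case 3
    from median_sorted[OF 3 h m(1) m(6)] show ?thesis by (rule perm) (blast, simp only: add.commute add.left_commute)
  next
    case 4
    from median_sorted[OF 4 h m(1) m(3)] show ?thesis by (rule perm) (blast, simp only: add.commute add.left_commute)
  next
    case 5
    from median_sorted[OF 5 h m(1) m(7)] show ?thesis by (rule perm) (blast, simp only: add.commute add.left_commute)
  next
    case 6
    from median_sorted[OF 6 h m(1) m(5)] show ?thesis by (rule perm) (blast, simp only: add.commute add.left_commute)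
  qed
qed

context frame
begin

text \<open>The six heights \<open>d \<bullet> \<nu>\<close> are two translates of one triple, at
  distance \<open>e3 \<bullet> \<nu>\<close>. If this distance is negative, the two layers exchange
  roles.\<close>

lemma exists_median:
  assumes m: "\<bar>e1 \<bullet> \<nu>\<bar> \<le> m" "\<bar>e2 \<bullet> \<nu>\<bar> \<le> m" "\<bar>e3 \<bullet> \<nu>\<bar> \<le> m" "\<bar>(e1 - e2) \<bullet> \<nu>\<bar> \<le> m"
  shows "\<exists>d0\<in>inter_layer. (\<Sum>d\<in>inter_layer. \<bar>\<nu> \<bullet> lat (d - d0)\<bar>) \<le> \<bar>e3 \<bullet> \<nu>\<bar> + 2 * m"
proof -
  define p q h where "p = e1 \<bullet> \<nu>" and "q = e2 \<bullet> \<nu>" and "h = e3 \<bullet> \<nu>"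
  have m: "\<bar>p\<bar> \<le> m" "\<bar>q\<bar> \<le> m" "\<bar>h\<bar> \<le> m" "\<bar>p - q\<bar> \<le> m" "\<bar>q - p\<bar> \<le> m"
    using m by (simp_all add: p_def q_def h_def inner_diff_left abs_minus_commute)
  have sum: "(\<Sum>d\<in>inter_layer. \<bar>\<nu> \<bullet> lat (d - d0)\<bar>) =
      (\<bar>0 - x\<bar> + \<bar>- p - x\<bar> + \<bar>- q - x\<bar>) + (\<bar>- h - x\<bar> + \<bar>- p - h - x\<bar> + \<bar>- q - h - x\<bar>)"
    if "x = \<nu> \<bullet> lat d0" for d0 x
  proof -
    have S: "(\<Sum>d\<in>inter_layer. f d) =
        (f (0, 0, 0) + f (-1, 0, 0) + f (0, -1, 0)) + (f (0, 0, -1) + f (-1, 0, -1) + f (0, -1, -1))" for f :: "_ \<Rightarrow> real"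
      by (simp add: inter_layer_def add.assoc)
    have "\<nu> \<bullet> lat (0, 0, 0) = 0" "\<nu> \<bullet> lat (-1, 0, 0) = - p" "\<nu> \<bullet> lat (0, -1, 0) = - q"
      "\<nu> \<bullet> lat (0, 0, -1) = - h" "\<nu> \<bullet> lat (-1, 0, -1) = - p - h" "\<nu> \<bullet> lat (0, -1, -1) = - q - h"
      by (simp_all add: nu_lat nu_lat_0 p_def q_def h_def)
    then show ?thesis unfolding S lat_diff inner_diff_right that by (simp only:)
  qed
  have "\<exists>x\<in>{0, - p, - q, - h, - p - h, - q - h}.
      (\<bar>0 - x\<bar> + \<bar>- p - x\<bar> + \<bar>- q - x\<bar>) + (\<bar>- h - x\<bar> + \<bar>- p - h - x\<bar> + \<bar>- q - h - x\<bar>) \<le> \<bar>h\<bar> + 2 * m"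
  proof (cases "0 \<le> h")
    case True
    then have "\<bar>h\<bar> = h" by simp
    moreover have A: "h \<le> m" "\<bar>0 - - p\<bar> \<le> m" "\<bar>0 - - q\<bar> \<le> m" "\<bar>- p - - q\<bar> \<le> m"
    proof -
      have "0 - - p = p" "0 - - q = q" "- p - - q = q - p" by simp_all
      then show "\<bar>0 - - p\<bar> \<le> m" "\<bar>0 - - q\<bar> \<le> m" "\<bar>- p - - q\<bar> \<le> m" using m by (simp_all only:)
      show "h \<le> m" using m(3) by (rule abs_le_D1)
    qed
    ultimately show ?thesis using median[OF True A] by (simp only: diff_0)
  next
    case False
    then have "0 \<le> - h" by simp
    then have "\<exists>x\<in>{- h, - p - h, - q - h, - h - - h, - p - h - - h, - q - h - - h}.
      (\<bar>- h - x\<bar> + \<bar>- p - h - x\<bar> + \<bar>- q - h - x\<bar>) + (\<bar>- h - - h - x\<bar> + \<bar>- p - h - - h - x\<bar> + \<bar>- q - h - - h - x\<bar>) \<le> - h + 2 * m"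
    proof (rule median)
      have "- h - (- p - h) = p" "- h - (- q - h) = q" "- p - h - (- q - h) = q - p" by simp_all
      then show "\<bar>- h - (- p - h)\<bar> \<le> m" "\<bar>- h - (- q - h)\<bar> \<le> m" "\<bar>- p - h - (- q - h)\<bar> \<le> m"
        using m by (simp_all only:)
      show "- h \<le> m" using m(3) by (rule abs_le_D2)
    qed
    moreover have "- h - - h = 0" "- p - h - - h = - p" "- q - h - - h = - q" "\<bar>h\<bar> = - h" using False by simp_all
    ultimately obtain x where "x \<in> {- h, - p - h, - q - h, 0, - p, - q}"
      "(\<bar>- h - x\<bar> + \<bar>- p - h - x\<bar> + \<bar>- q - h - x\<bar>) + (\<bar>0 - x\<bar> + \<bar>- p - x\<bar> + \<bar>- q - x\<bar>) \<le> \<bar>h\<bar> + 2 * m"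
      by (simp only:) (rule bexE)
    then show ?thesis by (intro bexI[of _ x]) (simp only: add.commute, blast)
  qed
  then obtain x where x: "x \<in> {0, - p, - q, - h, - p - h, - q - h}"
    "(\<bar>0 - x\<bar> + \<bar>- p - x\<bar> + \<bar>- q - x\<bar>) + (\<bar>- h - x\<bar> + \<bar>- p - h - x\<bar> + \<bar>- q - h - x\<bar>) \<le> \<bar>h\<bar> + 2 * m" by (rule bexE)
  have "(\<lambda>d. \<nu> \<bullet> lat d) ` inter_layer = {0, - p, - q, - h, - p - h, - q - h}"
    by (simp add: inter_layer_def nu_lat nu_lat_0 p_def q_def h_def)
  then obtain d0 where "d0 \<in> inter_layer" "x = \<nu> \<bullet> lat d0" using x(1) by (metis imageE)
  moreover from this(2) have "(\<Sum>d\<in>inter_layer. \<bar>\<nu> \<bullet> lat (d - d0)\<bar>) \<le> \<bar>h\<bar> + 2 * m"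
    unfolding sum[OF \<open>x = \<nu> \<bullet> lat d0\<close>] by (intro x(2))
  ultimately show ?thesis unfolding h_def by blast
qed

text \<open>In the competitor the \<open>v1\<close>-sites near the origin are cut by a half space shifted so that their median neighbour
  lies on its boundary.\<close>

definition comp :: "int \<times> int \<times> int \<Rightarrow> real \<Rightarrow> (real^3) set" where
  "comp d0 T = {site s l | s l. if s \<and> site s l \<in> cube R (T - 3) then 0 \<le> \<nu> \<bullet> lat (l - d0) else 0 \<le> \<nu> \<bullet> site s l}"

lemma site_in_comp:
  "site s l \<in> comp d0 T \<longleftrightarrow> (if s \<and> site s l \<in> cube R (T - 3) then 0 \<le> \<nu> \<bullet> lat (l - d0) else 0 \<le> \<nu> \<bullet> site s l)"
proof
  assume "site s l \<in> comp d0 T"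
  then obtain t m where t: "site s l = site t m"
    "if t \<and> site t m \<in> cube R (T - 3) then 0 \<le> \<nu> \<bullet> lat (m - d0) else 0 \<le> \<nu> \<bullet> site t m" by (auto simp only: comp_def mem_Collect_eq)
  then have st: "s = t" "l = m" using injD[OF inj_site, of "(s, l)" "(t, m)"] by simp_all
  show "if s \<and> site s l \<in> cube R (T - 3) then 0 \<le> \<nu> \<bullet> lat (l - d0) else 0 \<le> \<nu> \<bullet> site s l"
    unfolding st by (rule t(2))
qed (auto simp only: comp_def)

lemma comp_admissible: "comp d0 T \<in> admissible \<nu> R T"
proof -
  have "site s l \<in> comp d0 T \<longleftrightarrow> 0 \<le> site s l \<bullet> \<nu>" if "site s l \<notin> cube R (T - 3)" for s l
    using that by (simp add: site_in_comp inner_commute)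
  then have "indicator (comp d0 T) x = half_space_fun \<nu> x" if "x \<in> HCP" "x \<notin> cube R (T - 3)" for x
    using that by (auto simp: HCP_eq half_space_fun_def indicator_def)
  moreover have "comp d0 T \<subseteq> HCP" unfolding comp_def by auto
  ultimately show ?thesis by (auto simp: admissible_def)
qed

text \<open>After this relabelling both sublattices of the competitor are cut, in the interior, by
  the same condition \<open>0 \<le> \<nu> \<bullet> lat _\<close>.\<close>

definition shift :: "int \<times> int \<times> int \<Rightarrow> bool \<Rightarrow> int \<times> int \<times> int" where
  "shift d0 s = (if s then - d0 else 0)"

text \<open>The shifted sublattice near the cutting plane in the collar between the cubes, enlarged
  so as to contain the neighbours of all sites of the cube.\<close>

definition bad :: "real \<Rightarrow> (int \<times> int \<times> int) set" where
  "bad T = {l. site True l \<in> cube R (T + 2) \<and> site True l \<notin> cube R (T - 3) \<and> \<bar>\<nu> \<bullet> site True l\<bar> \<le> 1}"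

text \<open>In the collar the competitor uses the original half space. The two cutting heights
  differ by the inner product of \<nu> with the unit vector \<open>v1 + lat d0\<close>, so they
  agree on sites of height above 1 in absolute value.\<close>

lemma comp_shift:
  assumes d0: "d0 \<in> inter_layer" and l: "site s l \<in> cube R (T + 2)" "l \<notin> bad T"
  shows "site s l \<in> comp d0 T \<longleftrightarrow> 0 \<le> \<nu> \<bullet> lat (l + shift d0 s)"
proof (cases "s \<and> site s l \<notin> cube R (T - 3)")
  case True
  then have 1: "1 < \<bar>\<nu> \<bullet> site True l\<bar>" using l by (auto simp: bad_def)
  have "norm (v1 + lat d0) = 1" using d0 by (simp add: norm_v1_lat)
  then have "\<bar>\<nu> \<bullet> (v1 + lat d0)\<bar> \<le> 1" using nu_le_norm[of "v1 + lat d0"] by simp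
  moreover have "\<nu> \<bullet> lat (l + shift d0 True) = \<nu> \<bullet> site True l - \<nu> \<bullet> (v1 + lat d0)"
    by (simp add: shift_def site_def lat_diff inner_add_right inner_diff_right)
  ultimately have "0 \<le> \<nu> \<bullet> lat (l + shift d0 True) \<longleftrightarrow> 0 \<le> \<nu> \<bullet> site True l" using 1 by linarith
  then show ?thesis using True by (cases s) (simp_all add: site_in_comp)
next
  case False
  then show ?thesis by (cases s) (simp_all add: site_in_comp shift_def, simp add: site_def)
qed

lemma near_in_cube:
  assumes "x \<in> cube R T" "norm (x - y) \<le> 1" shows "y \<in> cube R (T + 2)"
  unfolding mem_cube
proof
  fix i
  have "\<bar>crd y $ i\<bar> \<le> \<bar>crd x $ i\<bar> + \<bar>crd (x - y) $ i\<bar>" by (simp add: crd_linear)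
  also have "\<dots> < T / 2 + 1" using assms crd_le_norm[of "x - y" i] by (intro add_less_le_mono) (auto simp: mem_cube)
  finally show "\<bar>crd y $ i\<bar> < (T + 2) / 2" by (simp add: field_simps)
qed

lemma cube_mono: "T \<le> T' \<Longrightarrow> x \<in> cube R T \<Longrightarrow> x \<in> cube R T'"
  unfolding mem_cube by (meson divide_right_mono less_le_trans zero_le_numeral)

lemma finite_bad: "finite (bad T)"
  by (rule finite_subset[OF _ finite_site_bounded[OF bounded_cube, of True "T + 2"]]) (auto simp: bad_def)

text \<open>A missing bond is one of the ideal pair of shifted half spaces unless one of its two
  ends is bad.\<close>

lemma card_cut_comp:
  assumes d0: "d0 \<in> inter_layer" and d: "(t, d) \<in> nbrs s"
  shows "card (cut (comp d0 T) (cube R T) s d t) \<le>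
    card {l. site s l \<in> cube R T \<and> 0 \<le> \<nu> \<bullet> lat (l + shift d0 s) \<and> \<nu> \<bullet> lat (l + d + shift d0 t) < 0} + 2 * card (bad T)"
    (is "_ \<le> card ?I + _")
proof -
  have sub: "cut (comp d0 T) (cube R T) s d t \<subseteq> ?I \<union> (bad T \<union> {l. l + d \<in> bad T})"
  proof
    fix l assume l: "l \<in> cut (comp d0 T) (cube R T) s d t"
    have "dist (site s l) (site t (l + d)) = 1" using d by (simp add: dist_site)
    then have 2: "site t (l + d) \<in> cube R (T + 2)"
      using l by (intro near_in_cube[of "site s l"]) (auto simp: cut_def dist_norm)
    have 1: "site s l \<in> cube R (T + 2)" using l by (auto simp: cut_def intro: cube_mono[of T])
    show "l \<in> ?I \<union> (bad T \<union> {l. l + d \<in> bad T})"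
    proof (cases "l \<in> bad T \<or> l + d \<in> bad T")
      case False
      then have "0 \<le> \<nu> \<bullet> lat (l + shift d0 s)" "\<not> 0 \<le> \<nu> \<bullet> lat (l + d + shift d0 t)"
        using comp_shift[OF d0 1] comp_shift[OF d0 2] l unfolding cut_def by blast+
      then show ?thesis using l unfolding cut_def not_le by blast
    qed blast
  qed
  have fin: "finite ?I"
    by (rule finite_subset[OF _ finite_site_bounded[OF bounded_cube, of s T]]) auto
  have sh: "card {l. l + d \<in> bad T} = card (bad T)" using card_shift[of "\<lambda>l. l \<in> bad T" d] by simp
  have fin2: "finite {l. l + d \<in> bad T}"
    using finite_bad[of T] finite_vimageI[of "bad T" "\<lambda>l. l + d"] by (simp add: vimage_def inj_on_def)
  have "card (cut (comp d0 T) (cube R T) s d t) \<le> card (?I \<union> (bad T \<union> {l. l + d \<in> bad T}))"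
    by (intro card_mono sub finite_UnI fin fin2 finite_bad)
  also have "\<dots> \<le> card ?I + (card (bad T) + card {l. l + d \<in> bad T})"
    by (meson add_left_mono card_Un_le order_trans)
  finally show ?thesis by (simp add: sh)
qed


end

text \<open>In addition to the shift of \<open>T\<close>, a linear error is allowed: it is the order
  of the number of bad sites, which enter with leading coefficient 0.\<close>

definition upper :: "real \<Rightarrow> (real \<Rightarrow> real) \<Rightarrow> bool" where
  "upper b F \<longleftrightarrow> (\<exists>C>0. \<forall>T>C. F T \<le> (T + C)\<^sup>2 * b + C * T)"

lemma upper_add:
  assumes "upper a F" "upper b G" "0 \<le> a" "0 \<le> b"
  shows "upper (a + b) (\<lambda>T. F T + G T)"
proof -
  obtain C D where C: "0 < C" "\<And>T. C < T \<Longrightarrow> F T \<le> (T + C)\<^sup>2 * a + C * T"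
    and D: "0 < D" "\<And>T. D < T \<Longrightarrow> G T \<le> (T + D)\<^sup>2 * b + D * T"
    using assms(1, 2) unfolding upper_def by blast
  have "F T + G T \<le> (T + (C + D))\<^sup>2 * (a + b) + (C + D) * T" if T: "C + D < T" for T
  proof -
    have "(T + C)\<^sup>2 * a \<le> (T + (C + D))\<^sup>2 * a" "(T + D)\<^sup>2 * b \<le> (T + (C + D))\<^sup>2 * b"
      using T C(1) D(1) assms(3, 4) by (intro mult_right_mono power_mono; simp)+
    moreover have "F T \<le> (T + C)\<^sup>2 * a + C * T" "G T \<le> (T + D)\<^sup>2 * b + D * T" using C D T by auto
    ultimately show ?thesis unfolding distrib_left distrib_right by linarith
  qed
  then show ?thesis using C(1) D(1) unfolding upper_def by (intro exI[of _ "C + D"]) simp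
qed

lemma upper_mono: "upper b F \<Longrightarrow> (\<And>T. G T \<le> F T) \<Longrightarrow> upper b G"
  unfolding upper_def by (meson order_trans)

lemma upper_zero: "upper 0 (\<lambda>T. 0)"
  unfolding upper_def by (intro exI[of _ 1]) simp

lemma upper_sum:
  assumes "finite I" "\<And>i. i \<in> I \<Longrightarrow> upper (b i) (F i)" "\<And>i. i \<in> I \<Longrightarrow> 0 \<le> b i"
  shows "upper (\<Sum>i\<in>I. b i) (\<lambda>T. \<Sum>i\<in>I. F i T)"
  using assms
proof (induction I rule: finite_induct)
  case empty then show ?case by (simp add: upper_zero)
next
  case (insert i I) then show ?case by (simp add: upper_add sum_nonneg)
qed

context frame
begin

lemma norm_nu: "norm \<nu> = 1"
  using norm_crd[of \<nu>] R_crd(2)[of "axis 3 1"] R(2) by simp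

lemma ascending_direction: obtains w where "0 < \<nu> \<bullet> lat w"
proof -
  have "\<exists>w. \<nu> \<bullet> lat w \<noteq> 0"
  proof (rule ccontr)
    assume "\<nexists>w. \<nu> \<bullet> lat w \<noteq> 0"
    then have 0: "\<nu> \<bullet> lat w = 0" for w by blast
    have "e1 \<bullet> \<nu> = 0" "e2 \<bullet> \<nu> = 0" "e3 \<bullet> \<nu> = 0"
      using 0[of "(1, 0, 0)"] 0[of "(0, 1, 0)"] 0[of "(0, 0, 1)"] by (simp_all add: nu_lat nu_lat_0)
    then have "hcp_tension \<nu> = 0" by (simp add: hcp_tension_def inner_diff_left)
    then show False using hcp_tension_pos[of \<nu>] norm_nu by force
  qed
  then obtain w where "\<nu> \<bullet> lat w \<noteq> 0" by blast
  then have "0 < \<nu> \<bullet> lat w \<or> 0 < \<nu> \<bullet> lat (- w)" by (auto simp: lat_minus)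
  then show thesis using that by blast
qed

lemma obl_less:
  assumes "\<bar>crd x $ i\<bar> < a" "\<bar>\<nu> \<bullet> x\<bar> \<le> b"
  shows "\<bar>obl w x i\<bar> < a + \<bar>slope w i\<bar> * b"
proof -
  have "\<bar>obl w x i\<bar> \<le> \<bar>crd x $ i\<bar> + \<bar>slope w i * (\<nu> \<bullet> x)\<bar>" unfolding obl_def by (rule abs_triangle_ineq4)
  also have "\<dots> < a + \<bar>slope w i\<bar> * b"
    unfolding abs_mult using assms by (intro add_less_le_mono mult_left_mono) auto
  finally show ?thesis .
qed

lemma crd_site_lat: "\<bar>crd (lat l) $ i\<bar> \<le> \<bar>crd (z + lat l) $ i\<bar> + norm z"
proof -
  have "crd (lat l) $ i = crd (z + lat l) $ i - crd z $ i" by (simp add: crd_linear)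
  then have "\<bar>crd (lat l) $ i\<bar> \<le> \<bar>crd (z + lat l) $ i\<bar> + \<bar>crd z $ i\<bar>" by (simp only: abs_triangle_ineq4)
  then show ?thesis using crd_le_norm[of z i] by linarith
qed

text \<open>\<open>f l\<close> and \<open>g l\<close> are the relabelled ends of the bond. If the
  inner end is at nonnegative height and the outer one, a step \<open>w\<close> below, at negative
  height, then \<open>f l\<close> lies within one period, so the bonds inject into a slightly wider
  slab. If \<open>w\<close> does not ascend there are none.\<close>

lemma upper_ideal:
  assumes w: "\<And>l. z + lat (f l) = site s l" "\<And>l. lat (g l) + lat w = lat (f l)" "inj f"
  shows "upper (max 0 (\<nu> \<bullet> lat w) / sqrt 2)
    (\<lambda>T. card {l. site s l \<in> cube R T \<and> 0 \<le> \<nu> \<bullet> lat (f l) \<and> \<nu> \<bullet> lat (g l) < 0})"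
proof (cases "0 < \<nu> \<bullet> lat w")
  case False
  have "\<nu> \<bullet> lat (g l) + \<nu> \<bullet> lat w = \<nu> \<bullet> lat (f l)" for l by (simp only: w(2)[symmetric] inner_add_right)
  then have "\<not> (0 \<le> \<nu> \<bullet> lat (f l) \<and> \<nu> \<bullet> lat (g l) < 0)" for l using False by (smt (verit))
  then have "{l. site s l \<in> cube R T \<and> 0 \<le> \<nu> \<bullet> lat (f l) \<and> \<nu> \<bullet> lat (g l) < 0} = {}" for T by blast
  then show ?thesis using False upper_zero by (simp only: card.empty of_nat_0) simp
next
  case True
  let ?P = "\<nu> \<bullet> lat w"
  obtain C where C: "0 < C" "\<And>T. C < T \<Longrightarrow> sqrt 2 * card (slab w 1 T) \<le> (T + C)\<^sup>2 * ?P"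
    "\<And>T. C < T \<Longrightarrow> (T - C)\<^sup>2 * ?P \<le> sqrt 2 * card (slab w 1 T)"
    by (rule slab_count[OF True]) (rule that; assumption)
  define D where "D = 2 * (norm z + \<bar>slope w 1\<bar> * ?P + \<bar>slope w 2\<bar> * ?P)"
  have D: "0 \<le> D" using True by (simp add: D_def)
  have "real (card {l. site s l \<in> cube R T \<and> 0 \<le> \<nu> \<bullet> lat (f l) \<and> \<nu> \<bullet> lat (g l) < 0}) \<le>
      (T + (C + D))\<^sup>2 * (max 0 ?P / sqrt 2) + (C + D) * T" (is "real (card ?I) \<le> _") if T: "C + D < T" for T
  proof -
    have "f l \<in> slab w 1 (T + D)" if l: "l \<in> ?I" for l
    proof -
      have gw: "\<nu> \<bullet> lat (g l) + ?P = \<nu> \<bullet> lat (f l)" by (simp only: w(2)[symmetric] inner_add_right)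
      then have P: "0 \<le> \<nu> \<bullet> lat (f l)" "\<nu> \<bullet> lat (f l) < ?P" using l by auto
      have ob: "\<bar>obl w (lat (f l)) i\<bar> < T / 2 + norm z + \<bar>slope w i\<bar> * ?P" for i
      proof (rule obl_less)
        have "\<bar>crd (lat (f l)) $ i\<bar> \<le> \<bar>crd (site s l) $ i\<bar> + norm z"
          using crd_site_lat[of "f l" i z] by (simp only: w(1))
        moreover have "\<bar>crd (site s l) $ i\<bar> < T / 2" using l by (simp add: mem_cube)
        ultimately show "\<bar>crd (lat (f l)) $ i\<bar> < T / 2 + norm z" by linarith
        show "\<bar>\<nu> \<bullet> lat (f l)\<bar> \<le> ?P" using P by simp
      qed
      have "0 \<le> \<bar>slope w 1\<bar> * ?P" "0 \<le> \<bar>slope w 2\<bar> * ?P" using True by simp_all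
      moreover have "(T + D) / 2 = T / 2 + norm z + \<bar>slope w 1\<bar> * ?P + \<bar>slope w 2\<bar> * ?P" by (simp add: D_def add_divide_distrib)
      ultimately have "\<bar>obl w (lat (f l)) 1\<bar> < (T + D) / 2" "\<bar>obl w (lat (f l)) 2\<bar> < (T + D) / 2"
        using ob[of 1] ob[of 2] by linarith+
      then show ?thesis using P by (simp add: slab_def)
    qed
    then have "card (f ` ?I) \<le> card (slab w 1 (T + D))" by (intro card_mono finite_slab image_subsetI)
    then have "card ?I \<le> card (slab w 1 (T + D))" using inj_on_subset[OF w(3) subset_UNIV] by (simp only: card_image)
    then have "sqrt 2 * card ?I \<le> sqrt 2 * card (slab w 1 (T + D))" by simp
    also have "\<dots> \<le> (T + D + C)\<^sup>2 * ?P" using T C(1) D by (intro C(2)) simp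
    finally have "real (card ?I) \<le> (T + (C + D))\<^sup>2 * (?P / sqrt 2)"
      by (simp add: pos_le_divide_eq mult.commute add.assoc add.commute[of C])
    moreover have "0 \<le> (C + D) * T" using C(1) D T by simp
    ultimately show ?thesis using True by (simp add: max_def)
  qed
  then show ?thesis unfolding upper_def using C(1) D by (intro exI[of _ "C + D"]) simp
qed

lemma slab_mono: "T \<le> T' \<Longrightarrow> slab w K T \<subseteq> slab w K T'"
proof
  fix l assume "T \<le> T'" "l \<in> slab w K T"
  moreover from this have "T / 2 \<le> T' / 2" by simp
  ultimately show "l \<in> slab w K T'" unfolding slab_def mem_Collect_eq using less_le_trans by blast
qed

text \<open>The sites where the shifted and the unshifted half space disagree lie in a slab of bounded thickness close to
  the lateral boundary of the cube, so that their number is of lower order.\<close>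

lemma upper_bad: "upper 0 (\<lambda>T. real (card (bad T)))"
proof -
  obtain w where p: "0 < \<nu> \<bullet> lat w" by (rule ascending_direction)
  let ?P = "\<nu> \<bullet> lat w"
  obtain C where C: "0 < C" "\<And>T. C < T \<Longrightarrow> sqrt 2 * card (slab w 1 T) \<le> (T + C)\<^sup>2 * ?P"
    "\<And>T. C < T \<Longrightarrow> (T - C)\<^sup>2 * ?P \<le> sqrt 2 * card (slab w 1 T)"
    by (rule slab_count[OF p]) (rule that; assumption)
  define c where "c = 1 + norm v1"
  have c: "0 \<le> c" by (simp add: c_def)
  \<comment> \<open>Translation by k w moves the heights, which lie between -c and c, into a stack
    of 2 k + 1 periods starting at 0.\<close>
  obtain k :: nat where "c / ?P < real k" using reals_Archimedean2 by blast
  then have k: "c < real k * ?P" using p by (simp add: pos_divide_less_eq)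
  define K where "K = 2 * k + 1"
  define E where "E = norm v1 + \<bar>slope w 1\<bar> * c + \<bar>slope w 2\<bar> * c"
  define D where "D = 3 + 2 * E"
  have E: "\<bar>slope w 1\<bar> * c \<le> E - norm v1" "\<bar>slope w 2\<bar> * c \<le> E - norm v1" "0 \<le> E"
    using c by (simp_all add: E_def)
  then have D: "3 \<le> D" by (simp add: D_def)
  define B where "B = real K * ?P * (4 * (C + D))"
  have B: "0 \<le> B" using p C(1) D by (simp add: B_def)
  have "real (card (bad T)) \<le> (T + (C + D + 5 + B))\<^sup>2 * 0 + (C + D + 5 + B) * T" if T: "C + D + 5 + B < T" for T
  proof -
    have T5: "C + D + 5 < T" using T B by linarith
    have in_slab: "l + zmult (int k) w \<in> slab w K (T + D) - slab w K (T - D)" if l: "l \<in> bad T" for l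
    proof -
      have s: "site True l = v1 + lat l" by (simp add: site_def)
      have "\<nu> \<bullet> site True l = \<nu> \<bullet> v1 + \<nu> \<bullet> lat l" by (simp add: s inner_add_right)
      then have \<nu>l: "\<bar>\<nu> \<bullet> lat l\<bar> \<le> c"
        using l nu_le_norm[of v1] unfolding bad_def c_def mem_Collect_eq by linarith
      have v: "\<nu> \<bullet> lat (l + zmult (int k) w) = \<nu> \<bullet> lat l + real k * ?P" by (simp add: nu_shift)
      have o: "obl w (lat (l + zmult (int k) w)) i = obl w (lat l) i" for i
        using obl_shift[of w 0 l "int k" i] obl_scaleR[of w 0 0 i] p by simp
      have up: "\<bar>obl w (lat l) i\<bar> < (T + D) / 2" if i: "i = 1 \<or> i = 2" for i
      proof -
        have "\<bar>crd (site True l) $ i\<bar> < (T + 2) / 2" using l by (auto simp: bad_def mem_cube)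
        then have "\<bar>crd (lat l) $ i\<bar> < (T + 2) / 2 + norm v1" using crd_site_lat[of l i v1] unfolding s by linarith
        then have "\<bar>obl w (lat l) i\<bar> < (T + 2) / 2 + norm v1 + \<bar>slope w i\<bar> * c" using \<nu>l by (rule obl_less)
        moreover have "\<bar>slope w i\<bar> * c \<le> E - norm v1" using i E by auto
        ultimately show ?thesis unfolding D_def by (simp add: field_simps)
      qed
      have "\<exists>i. (T - 3) / 2 \<le> \<bar>crd (site True l) $ i\<bar>" using l by (auto simp: bad_def mem_cube not_less)
      then obtain i where i: "(T - 3) / 2 \<le> \<bar>crd (site True l) $ i\<bar>" by blast
      have "i \<noteq> 3"
      proof
        assume "i = 3"
        then have "(T - 3) / 2 \<le> 1" using i l by (simp add: crd_3 bad_def)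
        then show False using T5 C(1) D by simp
      qed
      then have i12: "i = 1 \<or> i = 2" using exhaust_3[of i] by auto
      have low: "(T - D) / 2 \<le> \<bar>obl w (lat l) i\<bar>"
      proof -
        have "crd (site True l) $ i = crd v1 $ i + obl w (lat l) i + slope w i * (\<nu> \<bullet> lat l)"
          by (simp add: s crd_linear obl_def)
        then have "\<bar>crd (site True l) $ i\<bar> \<le> \<bar>crd v1 $ i\<bar> + \<bar>obl w (lat l) i\<bar> + \<bar>slope w i * (\<nu> \<bullet> lat l)\<bar>"
          by (simp only:)
        moreover have "\<bar>slope w i * (\<nu> \<bullet> lat l)\<bar> \<le> \<bar>slope w i\<bar> * c" unfolding abs_mult using \<nu>l by (intro mult_left_mono) auto
        moreover have "\<bar>slope w i\<bar> * c \<le> E - norm v1" using i12 E by auto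
        moreover have "\<bar>crd v1 $ i\<bar> \<le> norm v1" by (rule crd_le_norm)
        moreover have "a \<le> o' + E" if "x \<le> y + o' + z" "z \<le> z'" "z' \<le> E - n" "y \<le> n" "a \<le> x" for a x y z z' o' n :: real
          using that by linarith
        ultimately have "(T - 3) / 2 \<le> \<bar>obl w (lat l) i\<bar> + E" using i by blast
        then show ?thesis unfolding D_def by (simp add: field_simps)
      qed
      have "real K * ?P = 2 * (real k * ?P) + ?P" by (simp add: K_def distrib_right)
      then have "0 \<le> \<nu> \<bullet> lat l + real k * ?P" "\<nu> \<bullet> lat l + real k * ?P < real K * ?P"
        using \<nu>l k p unfolding abs_le_iff by linarith+
      then have "l + zmult (int k) w \<in> slab w K (T + D)" unfolding slab_def mem_Collect_eq v o using up by blast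
      moreover have "l + zmult (int k) w \<notin> slab w K (T - D)" unfolding slab_def mem_Collect_eq v o using low i12 by (auto simp: not_less)
      ultimately show ?thesis by blast
    qed
    have "card (bad T) = card ((\<lambda>l. l + zmult (int k) w) ` bad T)" by (simp add: card_image inj_on_def)
    also have "\<dots> \<le> card (slab w K (T + D) - slab w K (T - D))"
      using finite_slab by (intro card_mono finite_Diff image_subsetI in_slab)
    also have "\<dots> = card (slab w K (T + D)) - card (slab w K (T - D))"
      using D by (intro card_Diff_subset finite_slab slab_mono) simp
    finally have "real (card (bad T)) \<le> real (card (slab w K (T + D))) - real (card (slab w K (T - D)))"
      using card_mono[OF finite_slab slab_mono, of "T - D" "T + D" w K] D by linarith
    also have "\<dots> = real K * (real (card (slab w 1 (T + D))) - real (card (slab w 1 (T - D))))"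
      unfolding card_slab[OF p, of K "T + D"] card_slab[OF p, of K "T - D"] by (simp add: right_diff_distrib)
    also have "\<dots> \<le> real K * (sqrt 2 * (real (card (slab w 1 (T + D))) - real (card (slab w 1 (T - D)))))"
    proof (intro mult_left_mono)
      have "0 \<le> real (card (slab w 1 (T + D))) - real (card (slab w 1 (T - D)))"
        using card_mono[OF finite_slab slab_mono, of "T - D" "T + D" w 1] D by simp
      then have "1 * (real (card (slab w 1 (T + D))) - real (card (slab w 1 (T - D)))) \<le>
          sqrt 2 * (real (card (slab w 1 (T + D))) - real (card (slab w 1 (T - D))))"
        by (intro mult_right_mono) simp_all
      then show "real (card (slab w 1 (T + D))) - real (card (slab w 1 (T - D))) \<le>
          sqrt 2 * (real (card (slab w 1 (T + D))) - real (card (slab w 1 (T - D))))" by simp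
    qed simp
    also have "\<dots> \<le> real K * ((T + D + C)\<^sup>2 * ?P - (T - D - C)\<^sup>2 * ?P)"
    proof (intro mult_left_mono)
      have "sqrt 2 * card (slab w 1 (T + D)) \<le> (T + D + C)\<^sup>2 * ?P" using T5 D by (intro C(2)) simp
      moreover have "(T - D - C)\<^sup>2 * ?P \<le> sqrt 2 * card (slab w 1 (T - D))" using T5 by (intro C(3)) simp
      ultimately show "sqrt 2 * (real (card (slab w 1 (T + D))) - real (card (slab w 1 (T - D)))) \<le>
          (T + D + C)\<^sup>2 * ?P - (T - D - C)\<^sup>2 * ?P" unfolding right_diff_distrib by linarith
    qed simp
    \<comment> \<open>The difference of the squares of T + (C + D) and T - (C + D) is 4 (C + D) T;
      the quadratic terms cancel.\<close>
    also have "\<dots> = B * T" unfolding B_def by (simp add: power2_eq_square algebra_simps)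
    also have "\<dots> \<le> (T + (C + D + 5 + B))\<^sup>2 * 0 + (C + D + 5 + B) * T"
      using T5 C(1) D B by simp
    finally show ?thesis .
  qed
  then show ?thesis unfolding upper_def using C(1) D B by (intro exI[of _ "C + D + 5 + B"]) simp
qed

end

section \<open>Identification of the surface tension\<close>

context frame
begin

lemma lat_shift_diff:
  "lat (l + d + shift d0 t) + lat (shift d0 s - d - shift d0 t) = lat (l + shift d0 s)"
  by (simp add: lat_add[symmetric])

lemma upper_cut:
  assumes d0: "d0 \<in> inter_layer" and d: "(t, d) \<in> nbrs s"
  shows "upper (max 0 (\<nu> \<bullet> lat (shift d0 s - d - shift d0 t)) / sqrt 2) (\<lambda>T. card (cut (comp d0 T) (cube R T) s d t))"
proof -
  have z: "site s 0 - lat (shift d0 s) + lat (l + shift d0 s) = site s l" for l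
    by (simp add: lat_add site_0_add[symmetric, of s l])
  have I: "upper (max 0 (\<nu> \<bullet> lat (shift d0 s - d - shift d0 t)) / sqrt 2)
      (\<lambda>T. card {l. site s l \<in> cube R T \<and> 0 \<le> \<nu> \<bullet> lat (l + shift d0 s) \<and> \<nu> \<bullet> lat (l + d + shift d0 t) < 0})"
    by (rule upper_ideal[OF z lat_shift_diff]) (simp add: inj_on_def)
  have "upper (max 0 (\<nu> \<bullet> lat (shift d0 s - d - shift d0 t)) / sqrt 2 + (0 + 0))
      (\<lambda>T. card {l. site s l \<in> cube R T \<and> 0 \<le> \<nu> \<bullet> lat (l + shift d0 s) \<and> \<nu> \<bullet> lat (l + d + shift d0 t) < 0} +
        (real (card (bad T)) + real (card (bad T))))"
    by (intro upper_add I upper_bad) simp_all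
  then have "upper (max 0 (\<nu> \<bullet> lat (shift d0 s - d - shift d0 t)) / sqrt 2)
      (\<lambda>T. card {l. site s l \<in> cube R T \<and> 0 \<le> \<nu> \<bullet> lat (l + shift d0 s) \<and> \<nu> \<bullet> lat (l + d + shift d0 t) < 0} +
        (real (card (bad T)) + real (card (bad T))))"
    by (simp only: add_0_right)
  then show ?thesis
  proof (rule upper_mono)
    fix T
    show "real (card (cut (comp d0 T) (cube R T) s d t)) \<le>
      card {l. site s l \<in> cube R T \<and> 0 \<le> \<nu> \<bullet> lat (l + shift d0 s) \<and> \<nu> \<bullet> lat (l + d + shift d0 t) < 0} +
        (real (card (bad T)) + real (card (bad T)))"
      using card_cut_comp[OF d0 d, of T] by linarith
  qed
qed

text \<open>With the relabelling by \<open>d0\<close>, the two orientations of an interlayer bond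
  \<open>d\<close> contribute the positive parts of \<open>\<nu> \<bullet> lat (d0 - d)\<close> and
  of its negative, together the deviation of \<open>d\<close> from \<open>d0\<close>; the median
  makes their sum minimal.\<close>

lemma upper_energy: "\<exists>X. (\<forall>T. X T \<in> admissible \<nu> R T) \<and> upper (hcp_tension \<nu>) (\<lambda>T. edge_energy (X T) (cube R T))"
proof -
  obtain m where m: "m \<in> {\<bar>e1 \<bullet> \<nu>\<bar>, \<bar>e2 \<bullet> \<nu>\<bar>, \<bar>e3 \<bullet> \<nu>\<bar>, \<bar>(e1 - e2) \<bullet> \<nu>\<bar>}"
    "\<bar>e1 \<bullet> \<nu>\<bar> \<le> m" "\<bar>e2 \<bullet> \<nu>\<bar> \<le> m" "\<bar>e3 \<bullet> \<nu>\<bar> \<le> m" "\<bar>(e1 - e2) \<bullet> \<nu>\<bar> \<le> m"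
    "hcp_tension \<nu> = 2 * ((\<bar>e1 \<bullet> \<nu>\<bar> + \<bar>e2 \<bullet> \<nu>\<bar> + \<bar>(e1 - e2) \<bullet> \<nu>\<bar>) / sqrt 2) + (\<bar>e3 \<bullet> \<nu>\<bar> + 2 * m) / sqrt 2"
    by (rule hcp_tension_eq)
  obtain d0 where d0: "d0 \<in> inter_layer" "(\<Sum>d\<in>inter_layer. \<bar>\<nu> \<bullet> lat (d - d0)\<bar>) \<le> \<bar>e3 \<bullet> \<nu>\<bar> + 2 * m"
    using exists_median[OF m(2-5)] by blast
  define b where "b = (\<Sum>s\<in>UNIV. \<Sum>(t, d)\<in>nbrs s. max 0 (\<nu> \<bullet> lat (shift d0 s - d - shift d0 t)) / sqrt 2)"
  have "upper b (\<lambda>T. \<Sum>s\<in>UNIV. \<Sum>(t, d)\<in>nbrs s. real (card (cut (comp d0 T) (cube R T) s d t)))"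
    unfolding b_def case_prod_beta
    by (intro upper_sum upper_cut d0(1) finite_nbrs finite) (simp_all add: sum_nonneg)
  moreover have "comp d0 T \<subseteq> HCP" for T using comp_admissible[of d0 T] by (simp add: admissible_def)
  ultimately have up: "upper b (\<lambda>T. edge_energy (comp d0 T) (cube R T))"
    by (simp only: edge_energy_eq bounded_cube)
  have b: "b \<le> hcp_tension \<nu>"
  proof -
    have pl: "max 0 (- t) + max 0 t = \<bar>t\<bar>" for t :: real by (simp add: max_def)
    have c: "max 0 (\<nu> \<bullet> lat (d0 - d)) + max 0 (\<nu> \<bullet> lat (d - d0)) = \<bar>\<nu> \<bullet> lat (d - d0)\<bar>" for d
      using pl[of "\<nu> \<bullet> lat (d - d0)"] by (simp add: lat_diff inner_diff_right)
    have "b * sqrt 2 = (\<Sum>s\<in>UNIV. \<Sum>(t, d)\<in>nbrs s. max 0 (\<nu> \<bullet> lat (shift d0 s - d - shift d0 t)))"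
      unfolding b_def case_prod_beta sum_divide_distrib[symmetric] by simp
    also have "\<dots> = (\<Sum>s\<in>UNIV. (\<Sum>d\<in>in_plane. max 0 (- (\<nu> \<bullet> lat d))) +
        (\<Sum>d\<in>inter_layer. max 0 (\<nu> \<bullet> lat (shift d0 s - (if s then - d else d) - shift d0 (\<not> s)))))"
      unfolding sum_nbrs by (simp add: lat_minus)
    also have "\<dots> = 2 * (\<Sum>d\<in>in_plane. max 0 (- (\<nu> \<bullet> lat d))) +
        (\<Sum>d\<in>inter_layer. max 0 (\<nu> \<bullet> lat (d0 - d)) + max 0 (\<nu> \<bullet> lat (d - d0)))"
    proof -
      have sh: "shift d0 False - d - shift d0 True = d0 - d" "shift d0 True + d - shift d0 False = d - d0" for d
        by (simp_all add: shift_def)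
      show ?thesis
        by (simp only: sum_bool sum.distrib if_True if_False not_True_eq_False not_False_eq_True diff_minus_eq_add sh)
    qed
    also have "\<dots> \<le> 2 * (\<bar>e1 \<bullet> \<nu>\<bar> + \<bar>e2 \<bullet> \<nu>\<bar> + \<bar>(e1 - e2) \<bullet> \<nu>\<bar>) + (\<bar>e3 \<bullet> \<nu>\<bar> + 2 * m)"
      unfolding c sum_in_plane by (intro add_left_mono d0(2))
    also have "\<dots> = hcp_tension \<nu> * sqrt 2"
    proof -
      have "2 * S + U = (2 * (S / sqrt 2) + U / sqrt 2) * sqrt 2" for S U :: real by (simp add: distrib_right)
      then show ?thesis unfolding m(6) by blast
    qed
    finally show ?thesis by simp
  qed
  obtain C where C: "0 < C" "\<And>T. C < T \<Longrightarrow> edge_energy (comp d0 T) (cube R T) \<le> (T + C)\<^sup>2 * b + C * T"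
    using up unfolding upper_def by blast
  have "edge_energy (comp d0 T) (cube R T) \<le> (T + C)\<^sup>2 * hcp_tension \<nu> + C * T" if "C < T" for T
  proof -
    have "edge_energy (comp d0 T) (cube R T) \<le> (T + C)\<^sup>2 * b + C * T" by (rule C(2)[OF that])
    also have "\<dots> \<le> (T + C)\<^sup>2 * hcp_tension \<nu> + C * T" using b by (intro add_right_mono mult_left_mono) simp_all
    finally show ?thesis .
  qed
  then show ?thesis using C(1) comp_admissible unfolding upper_def by (intro exI[of _ "comp d0"]) auto
qed

lemma cell_energy_tendsto: "((\<lambda>T. 1 / T\<^sup>2 * cell_energy \<nu> R T) \<longlongrightarrow> hcp_tension \<nu>) at_top"
proof -
  let ?\<Phi> = "hcp_tension \<nu>"
  obtain C where C: "\<And>T X. C < T \<Longrightarrow> X \<in> admissible \<nu> R T \<Longrightarrow> (T - C)\<^sup>2 * ?\<Phi> \<le> edge_energy X (cube R T)"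
    using lower_energy unfolding lower_def by blast
  obtain X D where X: "\<And>T. X T \<in> admissible \<nu> R T"
    and D: "0 < D" "\<And>T. D < T \<Longrightarrow> edge_energy (X T) (cube R T) \<le> (T + D)\<^sup>2 * ?\<Phi> + D * T"
    using upper_energy unfolding upper_def by blast
  have low: "(T - C)\<^sup>2 * ?\<Phi> \<le> cell_energy \<nu> R T" if "C < T" for T
    unfolding cell_energy_def using X[of T] C[OF that] by (intro cINF_greatest) auto
  have up: "cell_energy \<nu> R T \<le> (T + D)\<^sup>2 * ?\<Phi> + D * T" if "max C D < T" for T
  proof -
    \<comment> \<open>The infimum is taken over reals, so it lies below the competitor's energy once
      the energies are bounded below; the uniform lower estimate supplies this.\<close>
    have "bdd_below ((\<lambda>X. edge_energy X (cube R T)) ` admissible \<nu> R T)"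
      using C[of T] that by (intro bdd_belowI2[of _ "(T - C)\<^sup>2 * ?\<Phi>"]) auto
    then have "cell_energy \<nu> R T \<le> edge_energy (X T) (cube R T)"
      unfolding cell_energy_def by (rule cINF_lower[OF _ X])
    also have "\<dots> \<le> (T + D)\<^sup>2 * ?\<Phi> + D * T" using that by (intro D(2)) simp
    finally show ?thesis .
  qed
  have lim: "((\<lambda>T::real. c / T) \<longlongrightarrow> 0) at_top" for c :: real
    by (intro tendsto_divide_0[OF tendsto_const] filterlim_at_top_imp_at_infinity filterlim_ident)
  have "((\<lambda>T. (1 - C / T)\<^sup>2 * ?\<Phi>) \<longlongrightarrow> (1 - 0)\<^sup>2 * ?\<Phi>) at_top" by (intro tendsto_intros lim)
  then have L: "((\<lambda>T. (1 - C / T)\<^sup>2 * ?\<Phi>) \<longlongrightarrow> ?\<Phi>) at_top" by simp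
  have "((\<lambda>T. (1 + D / T)\<^sup>2 * ?\<Phi> + D / T) \<longlongrightarrow> (1 + 0)\<^sup>2 * ?\<Phi> + 0) at_top" by (intro tendsto_intros lim)
  then have U: "((\<lambda>T. (1 + D / T)\<^sup>2 * ?\<Phi> + D / T) \<longlongrightarrow> ?\<Phi>) at_top" by simp
  have ev: "eventually (\<lambda>T. max C D < T) at_top" by (rule eventually_gt_at_top)
  show ?thesis
  proof (rule tendsto_sandwich[OF _ _ L U])
    show "\<forall>\<^sub>F T in at_top. (1 - C / T)\<^sup>2 * ?\<Phi> \<le> 1 / T\<^sup>2 * cell_energy \<nu> R T"
      using ev
    proof eventually_elim
      case (elim T)
      then have T: "0 < T" using D(1) by simp
      have "(1 - C / T)\<^sup>2 * ?\<Phi> = 1 / T\<^sup>2 * ((T - C)\<^sup>2 * ?\<Phi>)"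
        using T by (simp add: diff_divide_eq_iff power_divide)
      also have "\<dots> \<le> 1 / T\<^sup>2 * cell_energy \<nu> R T" using elim by (intro mult_left_mono low) simp_all
      finally show ?case .
    qed
    show "\<forall>\<^sub>F T in at_top. 1 / T\<^sup>2 * cell_energy \<nu> R T \<le> (1 + D / T)\<^sup>2 * ?\<Phi> + D / T"
      using ev
    proof eventually_elim
      case (elim T)
      then have T: "0 < T" using D(1) by simp
      have "1 + D / T = (T + D) / T" using T by (simp add: field_simps)
      then have "(1 + D / T)\<^sup>2 = (T + D)\<^sup>2 / T\<^sup>2" by (simp only: power_divide)
      moreover have "1 / T\<^sup>2 * (D * T) = D / T" using T by (simp add: power2_eq_square)
      moreover have "1 / T\<^sup>2 * cell_energy \<nu> R T \<le> 1 / T\<^sup>2 * ((T + D)\<^sup>2 * ?\<Phi> + D * T)"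
        using elim by (intro mult_left_mono up) simp_all
      ultimately show ?case by (simp add: distrib_left)
    qed
  qed
qed

end

lemma surface_tension_hcp: "is_surface_tension hcp_tension"
  unfolding is_surface_tension_def
proof (intro conjI allI ballI impI)
  fix \<nu> R assume "cube_frame \<nu> R"
  then interpret frame \<nu> R by unfold_locales
  show "((\<lambda>T. 1 / T\<^sup>2 * cell_energy \<nu> R T) \<longlongrightarrow> hcp_tension \<nu>) at_top" by (rule cell_energy_tendsto)
qed (simp_all add: hcp_tension_nonneg hcp_tension_convex hcp_tension_scaleR)

lemma exists_cube_frame:
  assumes "norm \<nu> = 1" shows "\<exists>R. cube_frame \<nu> R"
proof -
  obtain A where A: "orthogonal_matrix A" "A *v axis 3 1 = \<nu>"
    by (rule orthogonal_matrix_exists_basis[OF assms])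
  then show ?thesis by (auto simp: cube_frame_def)
qed

text \<open>Every unit vector has a cube frame, so uniqueness of limits fixes the values on the
  sphere. Homogeneity extends this to nonzero vectors, and the value t at the origin satisfies t = 2
  t. This is what makes the definite description of \<open>phi_HCP\<close> meaningful.\<close>

lemma surface_tension_unique:
  assumes "is_surface_tension \<phi>" "is_surface_tension \<psi>" shows "\<phi> = \<psi>"
proof
  fix \<nu> :: "real^3"
  have hom: "c > 0 \<Longrightarrow> \<phi> (c *\<^sub>R x) = c * \<phi> x" "c > 0 \<Longrightarrow> \<psi> (c *\<^sub>R x) = c * \<psi> x" for c x
    using assms unfolding is_surface_tension_def by blast+
  have sph: "\<phi> x = \<psi> x" if x: "norm x = 1" for x
  proof -
    obtain R where R: "cube_frame x R" using exists_cube_frame[OF x] by blast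
    have "((\<lambda>T. 1 / T\<^sup>2 * cell_energy x R T) \<longlongrightarrow> \<phi> x) at_top" "((\<lambda>T. 1 / T\<^sup>2 * cell_energy x R T) \<longlongrightarrow> \<psi> x) at_top"
      using assms x R unfolding is_surface_tension_def by auto
    then show ?thesis by (rule tendsto_unique[OF trivial_limit_at_top_linorder])
  qed
  show "\<phi> \<nu> = \<psi> \<nu>"
  proof (cases "\<nu> = 0")
    case True
    then show ?thesis using hom[of 2 0] by simp
  next
    case False
    then have "norm (\<nu> /\<^sub>R norm \<nu>) = 1" by simp
    then show ?thesis using sph hom[of "norm \<nu>" "\<nu> /\<^sub>R norm \<nu>"] False by simp
  qed
qed

lemma phi_HCP_eq: "phi_HCP = hcp_tension"
  unfolding phi_HCP_def
  by (rule the_equality[where P = is_surface_tension, OF surface_tension_hcp]) (rule surface_tension_unique[OF _ surface_tension_hcp])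

theorem proposition2p5:
  shows "(\<forall>\<nu> :: real^3. phi_HCP \<nu> =
            sqrt 2 * (\<bar>e1 \<bullet> \<nu>\<bar> + \<bar>e2 \<bullet> \<nu>\<bar> + \<bar>(e1 - e2) \<bullet> \<nu>\<bar>)
            + 1 / sqrt 2 * \<bar>e3 \<bullet> \<nu>\<bar>
            + sqrt 2 * Max {\<bar>e1 \<bullet> \<nu>\<bar>, \<bar>e2 \<bullet> \<nu>\<bar>, \<bar>e3 \<bullet> \<nu>\<bar>, \<bar>(e1 - e2) \<bullet> \<nu>\<bar>})
       \<and> (\<forall>\<zeta> :: real^3. polar phi_HCP \<zeta> =
            Max {2 / (7 * sqrt 2) * (\<bar>\<zeta> $ 1\<bar> + 1 / sqrt 3 * \<bar>\<zeta> $ 2\<bar> + 3 / (2 * sqrt 6) * \<bar>\<zeta> $ 3\<bar>),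
                 1 / (2 * sqrt 3) * \<bar>\<zeta> $ 3\<bar>,
                 2 / (3 * sqrt 6) * \<bar>\<zeta> $ 2\<bar>,
                 4 / (7 * sqrt 6) * \<bar>\<zeta> $ 2\<bar> + 3 / (14 * sqrt 3) * \<bar>\<zeta> $ 3\<bar>,
                 1 / (3 * sqrt 2) * (\<bar>\<zeta> $ 1\<bar> + 1 / sqrt 3 * \<bar>\<zeta> $ 2\<bar>)})
       \<and> truncated_elongated_hexagonal_bipyramid W_HCP
       \<and> measure lebesgue W_HCP powr (- 2 / 3) * surface_energy phi_HCP W_HCP
           = 3 * 2 powr (2 / 3) * 65 powr (1 / 3)"
  unfolding W_HCP_def phi_HCP_eq polar_hcp
  by (intro conjI allI hcp_tension_def hcp_gauge_def wulff_shape energy_per_volume)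

end
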